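(* Let $\mathcal{Z}$ be an arc diagram, $\mathcal{A}=\mathcal{A}(\mathcal{Z})$ its strand algebra and $\mathcal{H}=H(\mathcal{A})$. Let $\mathcal{CY}$ be a cycle choice function for $\mathcal{Z}$ and $\mathcal{CR}$ a creation choice function. Then there is an $A_\infty$ structure $X$ on $\mathcal{H}$ (operations $X_n:\mathcal{H}^{\otimes n}\to\mathcal{H}$) extending its DGA structure (so $X_1=0$, $X_2$ is multiplication), and a morphism of $A_\infty$ algebras $f:\mathcal{H}\to\mathcal{A}$ (maps $f_n:\mathcal{H}^{\otimes n}\to\mathcal{A}$) extending the cycle selection map $f_1=f^{\mathcal{CY}}$, such that for all tensor products $M=M_1\otimes\cdots\otimes M_n$ of nonzero homology classes of diagrams: (1) if $M$ is not viable, then $\overline{f}_n(M)=0$ and $X_n(M)=0$; and if $M$ has an idempotent mismatch then $f_n(M)=0$; (2) the maps $X_n$ and $f_n$ all preserve H-data; $X_n$ has Maslov degree $n-2$ and $f_n$ has Maslov degree $n-1$; (3) each $f_n$ ($n\ge2$) is balanced: if $(f_1X_n-U_n)(M)=0$ then $f_n(M)=0$; (4) for $n\ge2$, on each twisted H-summand $f_n=A^*_{\mathcal{CR}}\circ(f_1X_n-U_n)$ (i.e. this holds on every viable $M$ with twisted H-data), where $$U_n(a_1\otimes\cdots\otimes a_n)=\sum_{j=1}^{n-1}f_j(a_1\otimes\cdots\otimes a_j)\,f_{n-j}(a_{j+1}\otimes\cdots\otimes a_n)+\sum_{\substack{2\le j\le n-1\\ 0\le k\le n-j}}f_{n-j+1}\big(a_1\otimes\cdots\otimes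 a_k\otimes X_j(a_{k+1}\otimes\cdots\otimes a_{k+j})\otimes\cdots\otimes a_n\big)$$ and $X_n=[U_n]$ (homology class). The operations $X_n$ satisfying these conditions are unique, and the maps $f_n$ are uniquely defined modulo $\mathcal{F}$.
   Context: All algebra is over $\mathbb{Z}_2$. An arc diagram $\mathcal{Z}=(\mathbf{Z},\mathbf{a},r)$ consists of oriented intervals $\mathbf{Z}=\{Z_1,\dots,Z_l\}$, distinct points $\mathbf{a}=(a_1,\dots,a_{2k})$ (places) in the interiors of the intervals, ordered along them, and a 2-to-1 map $r:\mathbf{a}\to\{1,\dots,k\}$ such that oriented surgery on $\mathbf{Z}$ at all $0$-spheres $r^{-1}(i)$ yields a 1-manifold with no circle components. The fibres $P=\{p,q\}$ of $r$ are the matched pairs, identified with $1,\dots,k$. Let $-\infty_i,+\infty_i$ be the start and end of $Z_i$ and $\mathbf{a}_{\pm\infty}=\mathbf{a}\cup\{\pm\infty_i\}$, partially ordered along the intervals; the places cut the intervals into steps. A strand diagram is a triple $(S,T,\phi)$ with $S,T\subseteq\mathbf{a}_{\pm\infty}$ and $\phi:S\to T$ a bijection with $\phi(x)\ge x$; it is drawn as strands in $[0,1]\times\mathbf{Z}$ from $\{0\}\times S$ to $\{1\}\times T$, meeting efficiently; crossings are inversions ($x<y$ with $\phi(x)>\phi(y)$), counted by $\mathrm{inv}$. The product of $(S,T,\phi)$ and $(U,V,\psi)$ is $(S,V,\psi\phi)$ if $T=U$ and $\mathrm{inv}(\psi\phi)=\mathrm{inv}(\phi)+\mathrm{inv}(\psi)$,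 and $0$ otherwise; $\partial$ is the sum of all resolutions of one crossing which lower the number of crossings by exactly $1$. $I(S)$ is the identity diagram on $S$. For a set $s$ of matched pairs let $I(s)=\sum_S I(S)$, over all $S\subseteq \mathbf{a}_{\pm\infty}$ consisting of exactly one place of each pair in $s$, no other places, and any subset of $\{\pm\infty_i\}$. For $\mu=(S,T,\phi)$ without horizontal strands (fixed points) let $a(\mu)=\sum_U(S\cup U,T\cup U,\phi_U)$ over $U\subseteq\mathbf{a}_{\pm\infty}\setminus(S\cup T)$, $\phi_U$ extending $\phi$ by the identity. A diagram from $s$ to $t$ is a nonzero element $I(s)a(\mu)I(t)$; it is drawn as one picture with dotted horizontal strands at both places $p,q$ of every matched pair carrying a horizontal strand. The (augmented) strand algebra $\mathcal{A}=\mathcal{A}(\mathcal{Z})$ is the DGA with basis the diagrams; $\mathcal{H}=H(\mathcal{A})$, a DGA with zero differential. H-data is a triple $(h,s,t)$ with $h\in H_1(\mathbf{Z},\mathbf{a}_{\pm\infty})$ and $s,t$ sets of matched pairs. A diagram from $s$ to $t$ has H-data $(h,s,t)$, $h=\sum_x[x,\phi(x)]$; $\mathcal{A}(h,s,t)$ is the span of diagrams with this H-data and $\mathcal{H}(h,s,t)$ its homology, so $\mathcal{A}=\bigoplus\mathcal{A}(h,s,t)$, $\mathcal{H}=\bigoplus\mathcal{H}(h,s,t)$. The Maslov grading is $\iota(D)=\mathrm{inv}(\mu)-m(h,S)$ for any term $\mu=(S,T,\phi)$ of $D$, where $m(h,S)$ is the sum over places $a\in S\cap\mathbf{a}$ of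 the average multiplicity of $h$ on the two steps at $a$ (and $m$ is extended linearly to $0$-chains, ignoring $\pm\infty_i$). $h$ (and any H-data or diagram with H-grading $h$) is viable if $h$ has multiplicity $0$ or $1$ on every step. In a viable diagram every crossing involves a horizontal strand, hence lies at a matched pair. A viable diagram is tight if it has no crossings and is nonzero in homology, twisted if it has no crossings and is zero in homology, crossed if it has crossings. Viable H-data is tight (resp. twisted) if some tight (resp. twisted) diagram has that H-data, and singular otherwise. Each $\mathcal{H}(h,s,t)$ is $0$ or $\mathbb{Z}_2$, nonzero exactly for tight $(h,s,t)$, with generator $M_{h,s,t}$ represented by any tight diagram with H-data $(h,s,t)$. A pair $P$ is 11 if $P\in s$ and $P\in t$; it is once occupied at $p$ by $h$ if $h$ covers both steps at $p$ and neither step at the twin $q$; doubly occupied if $h$ covers all four steps at $p,q$. $\mathcal{F}\subset\mathcal{A}$ is the two-sided ideal spanned by diagrams that are non-viable or have a crossing at some doubly occupied pair. $\overline{f}$ denotes the composition of a map $f$ into $\mathcal{A}$ with $\mathcal{A}\to\mathcal{A}/\mathcal{F}$. For classes $M_i$ with H-data $(h_i,s_i,t_i)$, $M=M_1\otimes\cdots\otimes M_n$ has an idempotent mismatch if some $t_i\neq s_{i+1}$; $M$ is viable if it has no mismatch and $\sum h_i$ is viable. Its H-data is $(\sum h_i,s_1,t_n)$ and its Maslov grading is $\sum\iota(M_i)+\sum_{j<k}m(h_k,\partial h_j)$. A map preserves H-data if it sends such $M$ into the $(\sum h_i,s_1,t_n)$ summand. A cycle choice function $\mathcal{CY}$ assigns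 to each tight $(h,s,t)$ and each 11 doubly occupied pair $P$ of $(h,s,t)$ one of the two places of $P$. The linear map $f^{\mathcal{CY}}:\mathcal{H}\to\mathcal{A}$ sends $M_{h,s,t}$, for each tight $(h,s,t)$, to the unique tight diagram with H-data $(h,s,t)$ in which strands begin and end at the chosen place of each 11 doubly occupied pair. A creation choice function $\mathcal{CR}$ assigns to each twisted $(h,s,t)$ one of its 11 once occupied pairs (at least one exists). The operator $A^*_{\mathcal{CR}}$ on $\bigoplus_{(h,s,t)\text{ twisted}}\mathcal{A}(h,s,t)$ acts on a diagram $D\in\mathcal{A}(h,s,t)$ as follows: with $P=\{p,q\}=\mathcal{CR}(h,s,t)$, $p$ the occupied place, $A^*_{\mathcal{CR}}D=0$ if $D$ has a crossing at $P$; otherwise one strand of $D$ ends at $p$ and another begins at $p$, and $A^*_{\mathcal{CR}}D$ is obtained by joining these into a single strand running past $p$ and adding dotted horizontal strands at $p$ and $q$. $A_\infty$ conventions: $\sum_{i+j+k=n}X_{i+1+k}(1^{\otimes i}\otimes X_j\otimes 1^{\otimes k})=0$; $\mathcal{A}$ is an $A_\infty$ algebra with trivial $n$-ary operations for $n\ge3$; $f$ is a morphism if $\sum_{i+j+k=n}f_{i+1+k}(1^{\otimes i}\otimes X_j\otimes1^{\otimes k})=\partial f_n+\sum_{i=1}^{n-1}f_i\cdot f_{n-i}$ for all $n\ge1$. *)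

theory Defs
  imports Complex_Main "HOL-Algebra.QuotRing" "HOL-Library.Poly_Mapping" "HOL-Library.Z2"
begin

section \<open>Arc diagrams\<close>

text \<open>
  An arc diagram is recorded by the number of places on each interval, the number of matched pairs,
  and the map sending a place to (the number of) its matched pair.  The point \<open>(i, j)\<close> is the
  \<open>j\<close>-th point of the interval \<open>i\<close>, where \<open>(i, 0)\<close> is the start of the interval (minus infinity),
  \<open>(i, 1), \<dots>, (i, sizes ! i)\<close> are its places in order, and \<open>(i, sizes ! i + 1)\<close> is its end
  (plus infinity).  The step \<open>(i, j)\<close> is the one from the point \<open>(i, j)\<close> to the point \<open>(i, j + 1)\<close>.
\<close>

type_synonym point = "nat \<times> nat"
type_synonym step = "nat \<times> nat"

record arc_data =
  sizes :: "nat list"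
  npairs :: nat
  pair_of :: "point \<Rightarrow> nat"

definition points :: "arc_data \<Rightarrow> point set" where
  "points Z = {(i, j). i < length (sizes Z) \<and> j \<le> sizes Z ! i + 1}"

definition places :: "arc_data \<Rightarrow> point set" where
  "places Z = {(i, j). i < length (sizes Z) \<and> 1 \<le> j \<and> j \<le> sizes Z ! i}"

definition steps :: "arc_data \<Rightarrow> step set" where
  "steps Z = {(i, j). i < length (sizes Z) \<and> j \<le> sizes Z ! i}"

definition step_before :: "point \<Rightarrow> step" where
  "step_before p = (fst p, snd p - 1)"

definition step_after :: "point \<Rightarrow> step" where
  "step_after p = p"

definition pt_less :: "point \<Rightarrow> point \<Rightarrow> bool" (infix "\<prec>" 50) where
  "x \<prec> y \<longleftrightarrow> fst x = fst y \<and> snd x < snd y"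

definition pairs :: "arc_data \<Rightarrow> nat set" where
  "pairs Z = {1..npairs Z}"

definition fibre :: "arc_data \<Rightarrow> nat \<Rightarrow> point set" where
  "fibre Z P = {p \<in> places Z. pair_of Z p = P}"

text \<open>
  Oriented surgery at \<open>{p, q}\<close> joins the step arriving at \<open>p\<close> to the step leaving \<open>q\<close>, and the
  step arriving at \<open>q\<close> to the step leaving \<open>p\<close>.  Each step thus has at most one successor and one
  predecessor, and the circle components of the surgered manifold are the cycles of this relation.
\<close>

definition surgery :: "arc_data \<Rightarrow> (step \<times> step) set" where
  "surgery Z = {(step_before p, step_after q) | p q.
     p \<in> places Z \<and> q \<in> places Z \<and> p \<noteq> q \<and> pair_of Z p = pair_of Z q}"

definition arc_diagram :: "arc_data \<Rightarrow> bool" where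
  "arc_diagram Z \<longleftrightarrow>
     pair_of Z ` places Z \<subseteq> pairs Z \<and> (\<forall>P\<in>pairs Z. card (fibre Z P) = 2) \<and> acyclic (surgery Z)"


section \<open>Strand diagrams\<close>

text \<open>
  A triple \<open>(S, T, \<phi>)\<close> is encoded by the graph of \<open>\<phi>\<close>; then \<open>S\<close> is its domain and \<open>T\<close> its range.
\<close>

type_synonym strands = "(point \<times> point) set"

definition strand_diagram :: "arc_data \<Rightarrow> strands \<Rightarrow> bool" where
  "strand_diagram Z \<mu> \<longleftrightarrow> \<mu> \<subseteq> points Z \<times> points Z \<and> single_valued \<mu> \<and> single_valued (\<mu>\<inverse>) \<and>
     (\<forall>(x, y)\<in>\<mu>. x = y \<or> x \<prec> y)"

definition inversions :: "strands \<Rightarrow> ((point \<times> point) \<times> (point \<times> point)) set" where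
  "inversions \<mu> = {(a, b). a \<in> \<mu> \<and> b \<in> \<mu> \<and> fst a \<prec> fst b \<and> snd b \<prec> snd a}"

definition ninv :: "strands \<Rightarrow> nat" where
  "ninv \<mu> = card (inversions \<mu>)"

definition resolve :: "strands \<Rightarrow> point \<times> point \<Rightarrow> point \<times> point \<Rightarrow> strands" where
  "resolve \<mu> a b = (\<mu> - {a, b}) \<union> {(fst a, snd b), (fst b, snd a)}"

text \<open>
  A vector over \<open>\<int>\<^sub>2\<close> is a finitely supported function to \<^typ>\<open>bit\<close>; it is the sum of
  the basis elements in its set of keys.
\<close>

type_synonym vec = "strands \<Rightarrow>\<^sub>0 bit"

definition basis :: "strands \<Rightarrow> vec" where
  "basis \<mu> = Poly_Mapping.single \<mu> 1"

definition z2_span :: "vec set \<Rightarrow> vec set" where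
  "z2_span B = {\<Sum>D\<in>F. D | F. finite F \<and> F \<subseteq> B}"

definition strand_mult :: "strands \<Rightarrow> strands \<Rightarrow> vec" where
  "strand_mult \<mu> \<nu> =
     (if Range \<mu> = Domain \<nu> \<and> ninv (\<mu> O \<nu>) = ninv \<mu> + ninv \<nu> then basis (\<mu> O \<nu>) else 0)"

definition vec_mult :: "vec \<Rightarrow> vec \<Rightarrow> vec" where
  "vec_mult x y = (\<Sum>\<mu>\<in>Poly_Mapping.keys x. \<Sum>\<nu>\<in>Poly_Mapping.keys y. strand_mult \<mu> \<nu>)"

definition strand_diff :: "strands \<Rightarrow> vec" where
  "strand_diff \<mu> =
     (\<Sum>(a, b)\<in>{(a, b)\<in>inversions \<mu>. ninv (resolve \<mu> a b) + 1 = ninv \<mu>}. basis (resolve \<mu> a b))"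

definition vec_diff :: "vec \<Rightarrow> vec" where
  "vec_diff x = (\<Sum>\<mu>\<in>Poly_Mapping.keys x. strand_diff \<mu>)"


section \<open>The strand algebra and its homology\<close>

definition idem :: "arc_data \<Rightarrow> nat set \<Rightarrow> vec" where
  "idem Z s = (\<Sum>S\<in>{S. S \<subseteq> points Z \<and>
       (\<forall>P\<in>pairs Z. card (S \<inter> fibre Z P) = (if P \<in> s then 1 else 0))}. basis (Id_on S))"

definition add_horizontals :: "arc_data \<Rightarrow> strands \<Rightarrow> vec" where
  "add_horizontals Z \<mu> = (\<Sum>U\<in>Pow (points Z - (Domain \<mu> \<union> Range \<mu>)). basis (\<mu> \<union> Id_on U))"

definition dgm :: "arc_data \<Rightarrow> nat set \<Rightarrow> strands \<Rightarrow> nat set \<Rightarrow> vec" where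
  "dgm Z s \<mu> t = vec_mult (vec_mult (idem Z s) (add_horizontals Z \<mu>)) (idem Z t)"

text \<open>
  The group \<open>H\<^sub>1\<close> of the intervals relative to all points is free on the steps; a class is given by
  its multiplicities on the steps.
\<close>

type_synonym h1 = "step \<Rightarrow> int"
type_synonym hdata = "h1 \<times> nat set \<times> nat set"

definition h_grading :: "strands \<Rightarrow> h1" where
  "h_grading \<mu> = (\<lambda>(i, j). int (card {(x, y)\<in>\<mu>. fst x = i \<and> snd x \<le> j \<and> j < snd y}))"

definition diagrams_with :: "arc_data \<Rightarrow> hdata \<Rightarrow> vec set" where
  "diagrams_with Z = (\<lambda>(h, s, t). {dgm Z s \<mu> t | \<mu>.
     strand_diagram Z \<mu> \<and> (\<forall>(x, y)\<in>\<mu>. x \<noteq> y) \<and> s \<subseteq> pairs Z \<and> t \<subseteq> pairs Z \<and>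
     h_grading \<mu> = h \<and> dgm Z s \<mu> t \<noteq> 0})"

definition diagrams :: "arc_data \<Rightarrow> vec set" where
  "diagrams Z = (\<Union>d. diagrams_with Z d)"

definition strand_alg :: "arc_data \<Rightarrow> vec ring" where
  "strand_alg Z = \<lparr>carrier = z2_span (diagrams Z), mult = vec_mult,
     one = (\<Sum>s\<in>Pow (pairs Z). idem Z s), zero = 0, add = (+)\<rparr>"

definition cycle_ring :: "arc_data \<Rightarrow> vec ring" where
  "cycle_ring Z = (strand_alg Z)\<lparr>carrier := {x \<in> carrier (strand_alg Z). vec_diff x = 0}\<rparr>"

definition boundaries :: "arc_data \<Rightarrow> vec set" where
  "boundaries Z = vec_diff ` carrier (strand_alg Z)"

definition homology :: "arc_data \<Rightarrow> vec set ring" where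
  "homology Z = cycle_ring Z Quot boundaries Z"

definition hclass :: "arc_data \<Rightarrow> vec \<Rightarrow> vec set" where
  "hclass Z x = boundaries Z +>\<^bsub>cycle_ring Z\<^esub> x"

definition alg_summand :: "arc_data \<Rightarrow> hdata \<Rightarrow> vec set" where
  "alg_summand Z d = z2_span (diagrams_with Z d)"

definition hom_summand :: "arc_data \<Rightarrow> hdata \<Rightarrow> vec set set" where
  "hom_summand Z d = hclass Z ` {x \<in> alg_summand Z d. vec_diff x = 0}"


section \<open>Maslov grading\<close>

definition avg_mult :: "arc_data \<Rightarrow> h1 \<Rightarrow> (point \<Rightarrow> int) \<Rightarrow> rat" where
  "avg_mult Z h c =
     (\<Sum>a\<in>places Z. of_int (c a) * (of_int (h (step_before a) + h (step_after a)) / 2))"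

definition h_boundary :: "h1 \<Rightarrow> point \<Rightarrow> int" where
  "h_boundary h p = (if snd p = 0 then 0 else h (step_before p)) - h (step_after p)"

definition maslov_term :: "arc_data \<Rightarrow> strands \<Rightarrow> rat" where
  "maslov_term Z \<mu> =
     of_nat (ninv \<mu>) - avg_mult Z (h_grading \<mu>) (\<lambda>a. of_bool (a \<in> Domain \<mu>))"

definition maslov_homogeneous :: "arc_data \<Rightarrow> rat \<Rightarrow> vec \<Rightarrow> bool" where
  "maslov_homogeneous Z g x \<longleftrightarrow> (\<forall>\<mu>\<in>Poly_Mapping.keys x. maslov_term Z \<mu> = g)"

definition maslov_homogeneous_class :: "arc_data \<Rightarrow> rat \<Rightarrow> vec set \<Rightarrow> bool" where
  "maslov_homogeneous_class Z g c \<longleftrightarrow>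
     (\<exists>x\<in>carrier (cycle_ring Z). maslov_homogeneous Z g x \<and> c = hclass Z x)"


section \<open>Tight and twisted diagrams\<close>

definition viable :: "arc_data \<Rightarrow> h1 \<Rightarrow> bool" where
  "viable Z h \<longleftrightarrow> (\<forall>e\<in>steps Z. h e = 0 \<or> h e = 1)"

text \<open>
  A crossing in the picture of a diagram, with its dotted strands, is a crossing in at least one of
  the strand diagrams which are its terms; it need not be present in all of them.
\<close>

definition has_crossing :: "vec \<Rightarrow> bool" where
  "has_crossing D \<longleftrightarrow> (\<exists>\<mu>\<in>Poly_Mapping.keys D. inversions \<mu> \<noteq> {})"

definition crossing_at :: "arc_data \<Rightarrow> vec \<Rightarrow> nat \<Rightarrow> bool" where
  "crossing_at Z D P \<longleftrightarrow>
     (\<exists>\<mu>\<in>Poly_Mapping.keys D. \<exists>(a, b)\<in>inversions \<mu>. \<exists>p\<in>fibre Z P. a = (p, p) \<or> b = (p, p))"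

definition tight :: "arc_data \<Rightarrow> hdata \<Rightarrow> vec \<Rightarrow> bool" where
  "tight Z d D \<longleftrightarrow> D \<in> diagrams_with Z d \<and> viable Z (fst d) \<and> \<not> has_crossing D \<and>
     D \<in> carrier (cycle_ring Z) \<and> hclass Z D \<noteq> \<zero>\<^bsub>homology Z\<^esub>"

definition twisted :: "arc_data \<Rightarrow> hdata \<Rightarrow> vec \<Rightarrow> bool" where
  "twisted Z d D \<longleftrightarrow> D \<in> diagrams_with Z d \<and> viable Z (fst d) \<and> \<not> has_crossing D \<and>
     D \<in> carrier (cycle_ring Z) \<and> hclass Z D = \<zero>\<^bsub>homology Z\<^esub>"

definition tight_hdata :: "arc_data \<Rightarrow> hdata \<Rightarrow> bool" where
  "tight_hdata Z d \<longleftrightarrow> (\<exists>D. tight Z d D)"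

definition twisted_hdata :: "arc_data \<Rightarrow> hdata \<Rightarrow> bool" where
  "twisted_hdata Z d \<longleftrightarrow> (\<exists>D. twisted Z d D)"

definition once_occupied_at :: "arc_data \<Rightarrow> h1 \<Rightarrow> nat \<Rightarrow> point \<Rightarrow> bool" where
  "once_occupied_at Z h P p \<longleftrightarrow> p \<in> fibre Z P \<and> h (step_before p) \<noteq> 0 \<and> h (step_after p) \<noteq> 0 \<and>
     (\<forall>q\<in>fibre Z P - {p}. h (step_before q) = 0 \<and> h (step_after q) = 0)"

definition doubly_occupied :: "arc_data \<Rightarrow> h1 \<Rightarrow> nat \<Rightarrow> bool" where
  "doubly_occupied Z h P \<longleftrightarrow> (\<forall>p\<in>fibre Z P. h (step_before p) \<noteq> 0 \<and> h (step_after p) \<noteq> 0)"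

definition ideal_F :: "arc_data \<Rightarrow> vec set" where
  "ideal_F Z = z2_span {D. \<exists>h s t. D \<in> diagrams_with Z (h, s, t) \<and>
     (\<not> viable Z h \<or> (\<exists>P\<in>pairs Z. doubly_occupied Z h P \<and> crossing_at Z D P))}"

text \<open>The non-horizontal strands of a diagram are common to all of its terms.\<close>

definition moving_strands :: "vec \<Rightarrow> strands" where
  "moving_strands D = {(x, y)\<in>\<Union>(Poly_Mapping.keys D). x \<noteq> y}"


section \<open>Cycle choice and creation choice functions\<close>

definition cycle_choice :: "arc_data \<Rightarrow> (hdata \<Rightarrow> nat \<Rightarrow> point) \<Rightarrow> bool" where
  "cycle_choice Z CY \<longleftrightarrow> (\<forall>h s t. tight_hdata Z (h, s, t) \<longrightarrow>
     (\<forall>P\<in>s \<inter> t. doubly_occupied Z h P \<longrightarrow> CY (h, s, t) P \<in> fibre Z P))"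

definition creation_choice :: "arc_data \<Rightarrow> (hdata \<Rightarrow> nat) \<Rightarrow> bool" where
  "creation_choice Z CR \<longleftrightarrow> (\<forall>h s t. twisted_hdata Z (h, s, t) \<longrightarrow>
     CR (h, s, t) \<in> s \<inter> t \<and> (\<exists>p. once_occupied_at Z h (CR (h, s, t)) p))"

definition hom_generator :: "arc_data \<Rightarrow> hdata \<Rightarrow> vec set" where
  "hom_generator Z d = (THE M. \<exists>D. tight Z d D \<and> M = hclass Z D)"

definition chosen_diagram :: "arc_data \<Rightarrow> (hdata \<Rightarrow> nat \<Rightarrow> point) \<Rightarrow> hdata \<Rightarrow> vec" where
  "chosen_diagram Z CY = (\<lambda>(h, s, t). THE D. tight Z (h, s, t) D \<and>
     (\<forall>P\<in>s \<inter> t. doubly_occupied Z h P \<longrightarrow>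
        CY (h, s, t) P \<in> Domain (moving_strands D) \<inter> Range (moving_strands D)))"

text \<open>
  A diagram is recovered from its moving strands and idempotents.  Distinct diagrams have disjoint
  sets of terms, so the basis diagrams occurring in an element \<open>x\<close> of the algebra are those all
  of whose terms occur in \<open>x\<close>.
\<close>

definition create_diagram :: "arc_data \<Rightarrow> (hdata \<Rightarrow> nat) \<Rightarrow> hdata \<Rightarrow> vec \<Rightarrow> vec" where
  "create_diagram Z CR = (\<lambda>(h, s, t) D.
     (let P = CR (h, s, t); p = (THE p. once_occupied_at Z h P p); \<mu> = moving_strands D
      in if crossing_at Z D P then 0
         else dgm Z s ({(x, y)\<in>\<mu>. x \<noteq> p \<and> y \<noteq> p} \<union> {(x, y). (x, p) \<in> \<mu> \<and> (p, y) \<in> \<mu>}) t))"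

definition creation_op :: "arc_data \<Rightarrow> (hdata \<Rightarrow> nat) \<Rightarrow> hdata \<Rightarrow> vec \<Rightarrow> vec" where
  "creation_op Z CR d x =
     (\<Sum>D\<in>{D \<in> diagrams_with Z d. Poly_Mapping.keys D \<subseteq> Poly_Mapping.keys x}. create_diagram Z CR d D)"


section \<open>A-infinity structures over \<open>\<int>\<^sub>2\<close>\<close>

text \<open>
  A linear map on an \<open>n\<close>-fold tensor power is given as a multilinear function of lists of length \<open>n\<close>.
  Over \<open>\<int>\<^sub>2\<close> additive maps are linear.
\<close>

definition multilinear ::
    "nat \<Rightarrow> ('a, 'm) ring_scheme \<Rightarrow> ('b, 'k) ring_scheme \<Rightarrow> ('a list \<Rightarrow> 'b) \<Rightarrow> bool" where
  "multilinear n G B F \<longleftrightarrow> (\<forall>as. length as = n \<and> set as \<subseteq> carrier G \<longrightarrow>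
     F as \<in> carrier B \<and>
     (\<forall>i<n. \<forall>b\<in>carrier G. F (as[i := as ! i \<oplus>\<^bsub>G\<^esub> b]) = F as \<oplus>\<^bsub>B\<^esub> F (as[i := b])))"

definition insert_op :: "(nat \<Rightarrow> 'a list \<Rightarrow> 'a) \<Rightarrow> nat \<Rightarrow> nat \<Rightarrow> 'a list \<Rightarrow> 'a list" where
  "insert_op X i j as = take i as @ [X j (take j (drop i as))] @ drop (i + j) as"

definition A_inf_algebra :: "('a, 'm) ring_scheme \<Rightarrow> (nat \<Rightarrow> 'a list \<Rightarrow> 'a) \<Rightarrow> bool" where
  "A_inf_algebra G X \<longleftrightarrow> (\<forall>n\<ge>1. multilinear n G G (X n) \<and>
     (\<forall>as. length as = n \<and> set as \<subseteq> carrier G \<longrightarrow>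
        finsum G (\<lambda>(i, j, k). X (i + 1 + k) (insert_op X i j as))
          {(i, j, k). i + j + k = n \<and> 1 \<le> j} = \<zero>\<^bsub>G\<^esub>))"

text \<open>A morphism from an A-infinity algebra \<open>(G, X)\<close> to a DGA \<open>B\<close> with differential \<open>d\<close>.\<close>

definition A_inf_morphism :: "('a, 'm) ring_scheme \<Rightarrow> (nat \<Rightarrow> 'a list \<Rightarrow> 'a) \<Rightarrow>
    ('b, 'k) ring_scheme \<Rightarrow> ('b \<Rightarrow> 'b) \<Rightarrow> (nat \<Rightarrow> 'a list \<Rightarrow> 'b) \<Rightarrow> bool" where
  "A_inf_morphism G X B d f \<longleftrightarrow> (\<forall>n\<ge>1. multilinear n G B (f n) \<and>
     (\<forall>as. length as = n \<and> set as \<subseteq> carrier G \<longrightarrow>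
        finsum B (\<lambda>(i, j, k). f (i + 1 + k) (insert_op X i j as))
          {(i, j, k). i + j + k = n \<and> 1 \<le> j} =
        d (f n as) \<oplus>\<^bsub>B\<^esub> finsum B (\<lambda>i. f i (take i as) \<otimes>\<^bsub>B\<^esub> f (n - i) (drop i as)) {1..n - 1}))"

definition U_op :: "('b, 'k) ring_scheme \<Rightarrow> (nat \<Rightarrow> 'a list \<Rightarrow> 'a) \<Rightarrow> (nat \<Rightarrow> 'a list \<Rightarrow> 'b) \<Rightarrow>
    nat \<Rightarrow> 'a list \<Rightarrow> 'b" where
  "U_op B X f n as =
     finsum B (\<lambda>j. f j (take j as) \<otimes>\<^bsub>B\<^esub> f (n - j) (drop j as)) {1..n - 1} \<oplus>\<^bsub>B\<^esub>
     finsum B (\<lambda>(j, k). f (n - j + 1) (insert_op X k j as))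
       {(j, k). 2 \<le> j \<and> j \<le> n - 1 \<and> k \<le> n - j}"

text \<open>The cycle selection map, as the linear map with the prescribed values on generators.\<close>

definition cycle_selection_map ::
    "arc_data \<Rightarrow> (hdata \<Rightarrow> nat \<Rightarrow> point) \<Rightarrow> (vec set \<Rightarrow> vec) \<Rightarrow> bool" where
  "cycle_selection_map Z CY F \<longleftrightarrow>
     (\<forall>a\<in>carrier (homology Z). F a \<in> carrier (strand_alg Z)) \<and>
     (\<forall>a\<in>carrier (homology Z). \<forall>b\<in>carrier (homology Z). F (a \<oplus>\<^bsub>homology Z\<^esub> b) = F a + F b) \<and>
     (\<forall>d. tight_hdata Z d \<longrightarrow> F (hom_generator Z d) = chosen_diagram Z CY d)"


section \<open>Tensor products of homology classes of diagrams\<close>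

definition class_with_hdata :: "arc_data \<Rightarrow> hdata \<Rightarrow> vec set \<Rightarrow> bool" where
  "class_with_hdata Z d M \<longleftrightarrow> M \<noteq> \<zero>\<^bsub>homology Z\<^esub> \<and>
     (\<exists>D\<in>diagrams_with Z d \<inter> carrier (cycle_ring Z). M = hclass Z D)"

definition diagram_classes :: "arc_data \<Rightarrow> vec set set" where
  "diagram_classes Z = {M. \<exists>d. class_with_hdata Z d M}"

text \<open>
  A nonzero class is represented by diagrams with one and the same H-data and Maslov grading, so the
  descriptions below are definite.
\<close>

definition class_hdata :: "arc_data \<Rightarrow> vec set \<Rightarrow> hdata" where
  "class_hdata Z M = (THE d. class_with_hdata Z d M)"

definition class_maslov :: "arc_data \<Rightarrow> vec set \<Rightarrow> rat" where
  "class_maslov Z M = (THE g. \<exists>D\<in>diagrams Z \<inter> carrier (cycle_ring Z).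
     M = hclass Z D \<and> maslov_homogeneous Z g D)"

definition h_of :: "arc_data \<Rightarrow> vec set \<Rightarrow> h1" where
  "h_of Z M = fst (class_hdata Z M)"

definition source_of :: "arc_data \<Rightarrow> vec set \<Rightarrow> nat set" where
  "source_of Z M = fst (snd (class_hdata Z M))"

definition target_of :: "arc_data \<Rightarrow> vec set \<Rightarrow> nat set" where
  "target_of Z M = snd (snd (class_hdata Z M))"

definition tensor_h :: "arc_data \<Rightarrow> vec set list \<Rightarrow> h1" where
  "tensor_h Z Ms = (\<lambda>e. \<Sum>M\<leftarrow>Ms. h_of Z M e)"

definition tensor_hdata :: "arc_data \<Rightarrow> vec set list \<Rightarrow> hdata" where
  "tensor_hdata Z Ms = (tensor_h Z Ms, source_of Z (hd Ms), target_of Z (last Ms))"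

definition idempotent_mismatch :: "arc_data \<Rightarrow> vec set list \<Rightarrow> bool" where
  "idempotent_mismatch Z Ms \<longleftrightarrow>
     (\<exists>i. i + 1 < length Ms \<and> target_of Z (Ms ! i) \<noteq> source_of Z (Ms ! (i + 1)))"

definition tensor_viable :: "arc_data \<Rightarrow> vec set list \<Rightarrow> bool" where
  "tensor_viable Z Ms \<longleftrightarrow> \<not> idempotent_mismatch Z Ms \<and> viable Z (tensor_h Z Ms)"

definition tensor_maslov :: "arc_data \<Rightarrow> vec set list \<Rightarrow> rat" where
  "tensor_maslov Z Ms = (\<Sum>M\<leftarrow>Ms. class_maslov Z M) +
     (\<Sum>k<length Ms. \<Sum>j<k. avg_mult Z (h_of Z (Ms ! k)) (h_boundary (h_of Z (Ms ! j))))"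


section \<open>The conditions on \<open>X\<close> and \<open>f\<close>\<close>

definition vanishing_condition where
  "vanishing_condition Z X f \<longleftrightarrow> (\<forall>n\<ge>1. \<forall>Ms. length Ms = n \<and> set Ms \<subseteq> diagram_classes Z \<longrightarrow>
     (\<not> tensor_viable Z Ms \<longrightarrow> f n Ms \<in> ideal_F Z \<and> X n Ms = \<zero>\<^bsub>homology Z\<^esub>) \<and>
     (idempotent_mismatch Z Ms \<longrightarrow> f n Ms = \<zero>\<^bsub>strand_alg Z\<^esub>))"

definition grading_condition where
  "grading_condition Z X f \<longleftrightarrow> (\<forall>n\<ge>1. \<forall>Ms. length Ms = n \<and> set Ms \<subseteq> diagram_classes Z \<longrightarrow>
     X n Ms \<in> hom_summand Z (tensor_hdata Z Ms) \<and>
     f n Ms \<in> alg_summand Z (tensor_hdata Z Ms) \<and>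
     maslov_homogeneous_class Z (tensor_maslov Z Ms + of_nat n - 2) (X n Ms) \<and>
     maslov_homogeneous Z (tensor_maslov Z Ms + of_nat n - 1) (f n Ms))"

definition balanced_condition where
  "balanced_condition Z X f \<longleftrightarrow> (\<forall>n\<ge>2. \<forall>Ms. length Ms = n \<and> set Ms \<subseteq> diagram_classes Z \<longrightarrow>
     f 1 [X n Ms] \<ominus>\<^bsub>strand_alg Z\<^esub> U_op (strand_alg Z) X f n Ms = \<zero>\<^bsub>strand_alg Z\<^esub> \<longrightarrow>
     f n Ms = \<zero>\<^bsub>strand_alg Z\<^esub>)"

definition creation_condition where
  "creation_condition Z CR X f \<longleftrightarrow>
     (\<forall>n\<ge>2. \<forall>Ms. length Ms = n \<and> set Ms \<subseteq> diagram_classes Z \<longrightarrow>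
       tensor_viable Z Ms \<longrightarrow> twisted_hdata Z (tensor_hdata Z Ms) \<longrightarrow>
       f n Ms = creation_op Z CR (tensor_hdata Z Ms)
         (f 1 [X n Ms] \<ominus>\<^bsub>strand_alg Z\<^esub> U_op (strand_alg Z) X f n Ms)) \<and>
     (\<forall>n\<ge>2. \<forall>as. length as = n \<and> set as \<subseteq> carrier (homology Z) \<longrightarrow>
       U_op (strand_alg Z) X f n as \<in> carrier (cycle_ring Z) \<and>
       X n as = hclass Z (U_op (strand_alg Z) X f n as))"

definition choice_structure :: "arc_data \<Rightarrow> (hdata \<Rightarrow> nat \<Rightarrow> point) \<Rightarrow> (hdata \<Rightarrow> nat) \<Rightarrow>
    (nat \<Rightarrow> vec set list \<Rightarrow> vec set) \<Rightarrow> (nat \<Rightarrow> vec set list \<Rightarrow> vec) \<Rightarrow> bool" where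
  "choice_structure Z CY CR X f \<longleftrightarrow>
     A_inf_algebra (homology Z) X \<and>
     (\<forall>a\<in>carrier (homology Z). X 1 [a] = \<zero>\<^bsub>homology Z\<^esub>) \<and>
     (\<forall>a\<in>carrier (homology Z). \<forall>b\<in>carrier (homology Z). X 2 [a, b] = a \<otimes>\<^bsub>homology Z\<^esub> b) \<and>
     A_inf_morphism (homology Z) X (strand_alg Z) vec_diff f \<and>
     cycle_selection_map Z CY (\<lambda>a. f 1 [a]) \<and>
     vanishing_condition Z X f \<and>
     grading_condition Z X f \<and>
     balanced_condition Z X f \<and>
     creation_condition Z CR X f"

end

(*
  In a summand that is not viable, exchanging the ends of two strands near the first step of
  multiplicity at least two is a contracting homotopy. In a viable summand, a diagram is determined
  by the places at which its strands are broken, and the differential breaks one more strand. If some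
  pair is once occupied, joining the strands there is a contracting homotopy (the creation operator);
  otherwise the homology has one generator, the class of any diagram broken at every doubly occupied
  pair.

  X_n and f_n are built by recursion on n. The relations for fewer factors give d U_n = f_1 R_n,
  where R_n is the sum of the A-infinity relation. Since f_1 is a section of the map to homology,
  R_n = 0 and U_n is a cycle. Then X_n = [U_n], and f_n sends a product of generators to a homogeneous
  element with differential f_1 X_n - U_n.

  For uniqueness, U_n is determined modulo F by the operations with fewer factors, and in a viable
  summand every cycle in F is a boundary, which determines X_n. In a tight summand, a homogeneous
  element outside F is a cycle, so balancedness forces f_n into F there.
*)

theory Submission
 imports Defs
begin

text \<open>Over Z_2 a vector is its support. A diagram is the sum of all placements of its dotted
  strands, so an element of the algebra is a set of strand diagrams closed under such moves. Closure
  properties thus become bijections between the ways of producing two terms of one diagram. The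
  difficulty is that a horizontal strand can be moved in a product only if nothing stops at its new
  point in the middle. The condition on inversion numbers makes product and differential awkward. It
  is dropped at first: the sum of all resolutions satisfies exact identities modulo 2, and the
  actual operations are recovered by projecting to the largest inversion number that can occur. In a
  viable summand everything depends on whether a breakable pair has one or two breakable places. One
  place gives a contraction. Two places are homologous choices, and a full choice survives because
  full sets occur in boundaries only in twos. Operations are prescribed on tuples of generators and
  extended multilinearly, so identities and congruences between multilinear maps need checking on
  generators only.\<close>

abbreviation (input) "keys \<equiv> Poly_Mapping.keys"
abbreviation (input) "single \<equiv> Poly_Mapping.single"

section \<open>Vectors over \<open>\<int>\<^sub>2\<close>\<close>

class char2 = ab_group_add +
 assumes add_self [simp]: "x + x = 0"
begin

lemma add_self_left [simp]: "x + (x + y) = y"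
 by (simp add: add.assoc [symmetric])

end

instance bit :: char2
 by standard (metis bit_2_eq_0 mult_2 mult_zero_left)

instance poly_mapping :: (type, char2) char2
 by standard (rule poly_mapping_eqI, simp add: lookup_add)

lemma keys_add_bit:
 fixes x y :: "'k \<Rightarrow>\<^sub>0 bit"
 shows "keys (x + y) =
  (keys x - keys y) Un (keys y - keys x)"
proof -
 have *: "(a + b ~= 0) \<longleftrightarrow> ((a ~= 0) ~= (b ~= 0))" for a b :: bit
  by (cases a; cases b) simp_all
 show ?thesis
  unfolding set_eq_iff in_keys_iff lookup_add Un_iff Diff_iff
  using * by blast
qed

text \<open>The linear extension of \<open>g\<close>. Every nonzero coefficient is 1, so the
  codomain carries no scalars; additivity in the vector comes from characteristic 2.\<close>

definition lin :: "('k => 'b::comm_monoid_add) => ('k \<Rightarrow>\<^sub>0 bit) => 'b" where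
 "lin g x = (\<Sum>k\<in>keys x. g k)"

lemma lin_zero [simp]: "lin g 0 = 0"
 by (simp add: lin_def)

lemma lin_single [simp]: "lin g (single k 1) = g k"
 by (simp add: lin_def)

lemma lin_add:
 fixes g :: "'k => 'b::char2"
 shows "lin g (x + y) = lin g x + lin g y"
proof -
 let ?X = "keys x" and ?Y = "keys y"
 have f: "finite ?X" "finite ?Y" by auto
 have "lin g (x + y) = sum g (?X - ?Y) + sum g (?Y - ?X)"
  unfolding lin_def keys_add_bit using f by (intro sum.union_disjoint) auto
 \<comment> \<open>The sum over the common support is inserted twice, which changes nothing in
   characteristic 2 and completes both supports.\<close>
 also have "... = (sum g (?X - ?Y) + sum g (?X Int ?Y)) + (sum g (?X Int ?Y) + sum g (?Y - ?X))"
  by (simp add: add.assoc)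
 also have "sum g (?X - ?Y) + sum g (?X Int ?Y) = sum g ?X"
  using f by (metis add.commute sum.Int_Diff)
 also have "sum g (?X Int ?Y) + sum g (?Y - ?X) = sum g ?Y"
  using f by (metis Int_commute sum.Int_Diff)
 finally show ?thesis by (simp add: lin_def)
qed

lemma lin_sum:
 fixes g :: "'k => 'b::char2"
 shows "lin g (sum f I) = (\<Sum>i\<in>I. lin g (f i))"
 by (induction I rule: infinite_finite_induct) (auto simp: lin_add)

lemma vec_eq_sum: "(x :: 'k \<Rightarrow>\<^sub>0 bit) = lin (%k. single k 1) x"
proof (rule poly_mapping_eqI)
 fix k
 have "Poly_Mapping.lookup (lin (%k. single k 1) x) k = (\<Sum>j\<in>keys x. (1 when j = k))"
  by (simp add: lin_def lookup_sum lookup_single)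
 also have "... = (if k \<in> keys x then 1 else 0)"
  by (simp add: when_def)
 also have "... = Poly_Mapping.lookup x k"
  by (auto simp: in_keys_iff)
 finally show "Poly_Mapping.lookup x k = Poly_Mapping.lookup (lin (%k. single k 1) x) k" by simp
qed

lemma lin_cong: "(!!k. k \<in> keys x ==> g k = g' k) ==> lin g x = lin g' x"
 by (simp add: lin_def)

lemma lin_fun_add: "lin (%k. g k + g' k) x = lin g x + lin g' x"
 by (simp add: lin_def sum.distrib)

lemma lin_fun_zero [simp]: "lin (%k. 0) x = 0"
 by (simp add: lin_def)

lemma lin_lin:
 fixes g :: "'j => 'b::char2" and f :: "'k => 'j \<Rightarrow>\<^sub>0 bit"
 shows "lin g (lin f x) = lin (%k. lin g (f k)) x"
 unfolding lin_def[of f x] lin_sum unfolding lin_def by simp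

lemma additive_lin:
 fixes T :: "('j \<Rightarrow>\<^sub>0 bit) => 'b::char2"
 assumes "!!x y. T (x + y) = T x + T y"
 shows "T (lin g x) = lin (%k. T (g k)) x"
proof -
 have "T 0 = 0" using assms[of 0 0] by simp
 then have "T (sum g K) = (\<Sum>k\<in>K. T (g k))" for K
  by (induction K rule: infinite_finite_induct) (auto simp: assms)
 then show ?thesis by (simp add: lin_def)
qed

lemma lin_swap: "lin (%k. lin (%j. g k j) y) x = lin (%j. lin (%k. g k j) x) y"
 unfolding lin_def by (rule sum.swap)

text \<open>Vectors over Z_2 correspond to finite sets, and \<open>vecof\<close> is the inverse of
  \<open>keys\<close>. Equality of vectors is mostly proved as equality of supports.\<close>

definition vecof :: "'k set => ('k \<Rightarrow>\<^sub>0 bit)" where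
 "vecof K = (\<Sum>k\<in>K. single k 1)"

lemma lookup_vecof: "finite K ==> Poly_Mapping.lookup (vecof K) k = of_bool (k \<in> K)"
 by (simp add: vecof_def lookup_sum lookup_single when_def)

lemma keys_vecof [simp]: "finite K ==> keys (vecof K) = K"
 by (auto simp: in_keys_iff lookup_vecof)

lemma vecof_keys [simp]: "vecof (keys x) = (x :: 'k \<Rightarrow>\<^sub>0 bit)"
 using vec_eq_sum[of x] by (simp add: vecof_def lin_def)

lemma vec_eqI: "keys x = keys y ==> x = (y :: 'k \<Rightarrow>\<^sub>0 bit)"
 by (metis vecof_keys)

lemma lin_vecof: "finite K ==> lin g (vecof K) = sum g K"
 by (simp add: lin_def)

text \<open>Coordinate projection; it cuts out the part with a given inversion number, idempotent,
  H-data or Maslov degree.\<close>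

definition restr :: "('k => bool) => ('k \<Rightarrow>\<^sub>0 bit) => ('k \<Rightarrow>\<^sub>0 bit)" where
 "restr P x = lin (%k. if P k then single k 1 else 0) x"

lemma restr_add: "restr P (x + y) = restr P x + restr P y"
 by (simp add: restr_def lin_add)

lemma restr_zero [simp]: "restr P 0 = 0"
 by (simp add: restr_def)

lemma restr_sum: "restr P (sum f I) = (\<Sum>i\<in>I. restr P (f i))"
 by (simp add: restr_def lin_sum)

lemma restr_single: "restr P (single k 1) = (if P k then single k 1 else 0)"
 by (simp add: restr_def)

lemma keys_restr [simp]: "keys (restr P x) = {k \<in> keys x. P k}"
proof -
 have "restr P x = vecof {k \<in> keys x. P k}"
  unfolding restr_def lin_def vecof_def by (simp add: sum.inter_filter)
 then show ?thesis by simp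
qed

lemma restr_id: "(!!k. k \<in> keys x ==> P k) ==> restr P x = x"
 by (rule vec_eqI) auto

lemma restr_none: "(!!k. k \<in> keys x ==> \<not> P k) ==> restr P x = 0"
 by (rule vec_eqI) auto

lemma keys_lin_subset:
 fixes f :: "'k => ('j \<Rightarrow>\<^sub>0 bit)"
 shows "keys (lin f x) \<subseteq> (\<Union>k\<in>keys x. keys (f k))"
 unfolding lin_def by (metis keys_sum)

lemma keys_sum_subset:
 fixes f :: "'i => ('j \<Rightarrow>\<^sub>0 bit)"
 shows "keys (sum f I) \<subseteq> (\<Union>i\<in>I. keys (f i))"
 by (rule keys_sum)

section \<open>Inversions of compositions\<close>

lemma vec_mult_lin: "vec_mult x y = lin (%mu. lin (%nu. strand_mult mu nu) y) x"
 by (simp add: vec_mult_def lin_def)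

lemma vec_diff_lin: "vec_diff = lin strand_diff"
 by (simp add: vec_diff_def lin_def fun_eq_iff)

lemma vec_diff_add: "vec_diff (x + y) = vec_diff x + vec_diff y"
 by (simp add: vec_diff_lin lin_add)

lemma vec_diff_zero [simp]: "vec_diff 0 = 0"
 by (simp add: vec_diff_lin)

lemma vec_diff_sum: "vec_diff (sum f I) = (\<Sum>i\<in>I. vec_diff (f i))"
 by (simp add: vec_diff_lin lin_sum)

lemma vec_diff_basis [simp]: "vec_diff (basis mu) = strand_diff mu"
 by (simp add: vec_diff_lin basis_def)

lemma vec_mult_add_left: "vec_mult (x + x') y = vec_mult x y + vec_mult x' y"
 by (simp add: vec_mult_lin lin_add)

lemma vec_mult_add_right: "vec_mult x (y + y') = vec_mult x y + vec_mult x y'"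
 by (simp add: vec_mult_lin lin_add lin_fun_add)

lemma vec_mult_zero [simp]: "vec_mult 0 y = 0" "vec_mult x 0 = 0"
 by (simp_all add: vec_mult_lin)

lemma vec_mult_sum_left: "vec_mult (sum f I) y = (\<Sum>i\<in>I. vec_mult (f i) y)"
 by (induction I rule: infinite_finite_induct) (auto simp: vec_mult_add_left)

lemma vec_mult_sum_right: "vec_mult x (sum f I) = (\<Sum>i\<in>I. vec_mult x (f i))"
 by (induction I rule: infinite_finite_induct) (auto simp: vec_mult_add_right)

lemma vec_mult_basis [simp]: "vec_mult (basis mu) (basis nu) = strand_mult mu nu"
 by (simp add: vec_mult_lin basis_def)

text \<open>Diagrams whose strands may also move down. Allowing them makes every diagram with a crossing
 factor through an adjacent transposition.\<close>

definition braid :: "strands => bool" where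
 "braid mu \<longleftrightarrow> finite mu & single_valued mu & single_valued (mu^-1) & (\<forall>(x, y)\<in>mu. fst x = fst y)"

text \<open>Strands are indexed by an auxiliary set carrying the labellings \<open>a\<close> of
  starts and \<open>b\<close> of ends. Composition, inversions and resolutions become statements
  about labellings; for a composition the index set consists of the points where the factors
  meet.\<close>

definition gr :: "'i set => ('i => point) => ('i => point) => strands" where
 "gr I a b = (%u. (a u, b u)) ` I"

lemma Domain_gr [simp]: "Domain (gr I a b) = a ` I" and Range_gr [simp]: "Range (gr I a b) = b ` I"
 by (auto simp: gr_def)

lemma in_gr: "(x, y) \<in> gr I a b \<longleftrightarrow> (\<exists>u\<in>I. x = a u & y = b u)"
 by (auto simp: gr_def)

lemma converse_gr: "(gr I a b)^-1 = gr I b a"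
 by (intro subset_antisym subrelI) (auto simp only: in_gr converse_iff)

lemma gr_cong: "(!!u. u \<in> I ==> a u = a' u) ==> (!!u. u \<in> I ==> b u = b' u) ==> gr I a b = gr I a' b'"
 by (simp add: gr_def)

lemma gr_comp:
 assumes "inj_on b I"
 shows "gr I a b O gr I b c = gr I a c"
proof (intro subset_antisym subsetI)
 fix z assume "z \<in> gr I a b O gr I b c"
 then obtain u v where "u \<in> I" "v \<in> I" "b u = b v" "z = (a u, c v)" by (auto simp: gr_def)
 then show "z \<in> gr I a c" using assms by (auto simp: gr_def inj_on_def)
next
 fix z assume "z \<in> gr I a c"
 then obtain u where "u \<in> I" "z = (a u, c u)" by (auto simp: gr_def)
 then show "z \<in> gr I a b O gr I b c" unfolding gr_def by blast
qed

lemma braid_gr: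
 assumes "finite I" "inj_on a I" "inj_on b I" "!!u. u \<in> I ==> fst (a u) = fst (b u)"
 shows "braid (gr I a b)"
proof -
 have *: "a u = a v \<longleftrightarrow> u = v" "b u = b v \<longleftrightarrow> u = v" if "u \<in> I" "v \<in> I" for u v
  using assms(2,3) that by (auto dest: inj_onD)
 show ?thesis
  unfolding braid_def
 proof (intro conjI)
  show "finite (gr I a b)" using assms(1) by (simp add: gr_def)
  show "single_valued (gr I a b)" unfolding single_valued_def in_gr using * by metis
  show "single_valued ((gr I a b)^-1)" unfolding single_valued_def converse_iff in_gr using * by metis
  show "\<forall>(x, y)\<in>gr I a b. fst x = fst y" using assms(4) by (auto simp only: gr_def)
 qed
qed

lemma braid_start:
 assumes "braid mu"
 obtains b where "mu = gr (Domain mu) id b" "inj_on b (Domain mu)" "finite (Domain mu)"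
  "!!u. u \<in> Domain mu ==> fst (b u) = fst u" "b ` Domain mu = Range mu"
proof -
 define b where "b = (%x. THE y. (x, y) \<in> mu)"
 have b: "b x = y" if "(x, y) \<in> mu" for x y
  unfolding b_def using that assms unfolding braid_def single_valued_def by (intro the_equality) blast+
 have bD: "(u, b u) \<in> mu" if "u \<in> Domain mu" for u using that b by blast
 have "(x, y) \<in> mu \<longleftrightarrow> (x, y) \<in> gr (Domain mu) id b" for x y
  using b bD unfolding in_gr id_def by blast
 then have "mu = gr (Domain mu) id b" by (intro subset_antisym subrelI) blast+
 moreover have "inj_on b (Domain mu)"
 proof (rule inj_onI)
  fix u v assume "u \<in> Domain mu" "v \<in> Domain mu" "b u = b v"
  then show "u = v"
   using bD[of u] bD[of v] assms unfolding braid_def single_valued_def converse_iff by metis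
 qed
 moreover have "finite (Domain mu)" using assms by (simp add: braid_def finite_Domain)
 moreover have "fst (b u) = fst u" if "u \<in> Domain mu" for u
  using bD[OF that] assms unfolding braid_def by fastforce
 moreover have "b ` Domain mu = Range mu" using b bD by blast
 ultimately show ?thesis using that by blast
qed

lemma braid_converse: "braid mu ==> braid (mu^-1)"
 by (auto simp: braid_def)

lemma braid_end:
 assumes "braid mu"
 obtains a where "mu = gr (Range mu) a id" "inj_on a (Range mu)" "finite (Range mu)"
  "!!u. u \<in> Range mu ==> fst (a u) = fst u" "a ` Range mu = Domain mu"
proof -
 obtain a where *: "mu^-1 = gr (Domain (mu^-1)) id a" "inj_on a (Domain (mu^-1))" "finite (Domain (mu^-1))"
  "!!u. u \<in> Domain (mu^-1) ==> fst (a u) = fst u" "a ` Domain (mu^-1) = Range (mu^-1)"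
  using braid_start[OF braid_converse[OF assms]] by blast
 have "mu = (gr (Range mu) id a)^-1" using *(1) by (metis Domain_converse converse_converse)
 then have "mu = gr (Range mu) a id" by (metis converse_gr)
 moreover have "a ` Range mu = Domain mu" using *(5) by simp
 ultimately show ?thesis using that * by simp
qed

text \<open>Both factors are indexed by the points at which they are joined.\<close>

lemma braid_comp_index:
 assumes "braid al" "braid be" "Range al = Domain be"
 obtains I a b where "al = gr I a id" "be = gr I id b" "al O be = gr I a b" "finite I"
  "inj_on a I" "inj_on b I" "!!u. u \<in> I ==> fst (a u) = fst u" "!!u. u \<in> I ==> fst (b u) = fst u"
  "I = Range al"
proof -
 obtain a where a: "al = gr (Range al) a id" "inj_on a (Range al)" "finite (Range al)"
  "!!u. u \<in> Range al ==> fst (a u) = fst u" using braid_end[OF assms(1)] by metis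
 obtain b where b: "be = gr (Range al) id b" "inj_on b (Range al)"
  "!!u. u \<in> Range al ==> fst (b u) = fst u" using braid_start[OF assms(2)] assms(3) by metis
 have "al O be = gr (Range al) a b" using gr_comp[of id "Range al" a b] a(1) b(1) by simp
 then show ?thesis using that a b by blast
qed

lemma braid_comp:
 assumes "braid al" "braid be" "Range al = Domain be"
 shows "braid (al O be)"
 using braid_comp_index[OF assms] by (metis braid_gr)

lemma pt_less_trans [trans]: "x \<prec> y ==> y \<prec> z ==> x \<prec> z" by (auto simp: pt_less_def)
lemma pt_less_irrefl [simp]: "\<not> x \<prec> x" by (auto simp: pt_less_def)
lemma pt_less_asym: "x \<prec> y ==> \<not> y \<prec> x" by (auto simp: pt_less_def)
lemma pt_less_total: "fst x = fst y ==> x ~= y ==> x \<prec> y \<or> y \<prec> x"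
 by (auto simp: pt_less_def prod_eq_iff)

definition disagree :: "'i set => ('i => point) => ('i => point) => ('i \<times> 'i) set" where
 "disagree I a b = {(u, v). u \<in> I & v \<in> I & a u \<prec> a v & b v \<prec> b u}"

lemma inversions_gr: "inversions (gr I a b) = (%(u, v). ((a u, b u), (a v, b v))) ` disagree I a b"
proof (intro subset_antisym subsetI)
 fix z assume "z \<in> inversions (gr I a b)"
 then obtain u v where "u \<in> I" "v \<in> I" "z = ((a u, b u), (a v, b v))" "a u \<prec> a v" "b v \<prec> b u"
  unfolding inversions_def gr_def by fastforce
 then show "z \<in> (%(u, v). ((a u, b u), (a v, b v))) ` disagree I a b"
  unfolding disagree_def by (intro image_eqI[of _ _ "(u, v)"]) auto
next
 fix z assume "z \<in> (%(u, v). ((a u, b u), (a v, b v))) ` disagree I a b"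
 then obtain w where w: "w \<in> disagree I a b" "z = (%(u, v). ((a u, b u), (a v, b v))) w"
  by (rule imageE)
 obtain u v where "w = (u, v)" by (rule prod.exhaust)
 then have "u \<in> I" "v \<in> I" "z = ((a u, b u), (a v, b v))" "a u \<prec> a v" "b v \<prec> b u"
  using w by (auto simp only: disagree_def mem_Collect_eq case_prod_conv)
 then show "z \<in> inversions (gr I a b)"
  unfolding inversions_def gr_def by simp
qed

lemma inj_on_inversions: 
 "inj_on a I ==> inj_on (%(u, v). ((a u, b u), (a v, b v))) (disagree I a b)"
 by (auto simp: inj_on_def disagree_def)

lemma ninv_gr: "inj_on a I ==> ninv (gr I a b) = card (disagree I a b)"
 unfolding ninv_def inversions_gr by (simp add: card_image inj_on_inversions)

text \<open>Precomposition with a transposition. Resolving the crossing of the strands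
  \<open>u\<close> and \<open>v\<close> does exactly this to the labelling of the ends
  (\<open>resolve_gr\<close>).\<close>

definition swapf :: "'i => 'i => ('i => 'b) => 'i => 'b" where
 "swapf u v b = b(u := b v, v := b u)"

lemma swapf_commute: "swapf u v b = swapf v u b"
 by (auto simp: swapf_def fun_eq_iff)

lemma swapf_apply: "swapf u v b w = (if w = v then b u else if w = u then b v else b w)"
 by (simp add: swapf_def)

lemma swapf_swapf [simp]: "swapf u v (swapf u v b) = b"
 by (auto simp: swapf_def fun_eq_iff)

lemma swapf_image: "u \<in> I ==> v \<in> I ==> swapf u v b ` I = b ` I"
 by (auto simp: swapf_apply image_iff)

lemma inj_on_swapf: "inj_on b I ==> u \<in> I ==> v \<in> I ==> inj_on (swapf u v b) I"
 by (auto simp: inj_on_def swapf_apply)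

lemma gr_split:
 assumes "u \<in> I" "v \<in> I"
 shows "gr I a b = gr (I - {u, v}) a b Un {(a u, b u), (a v, b v)}"
 using assms unfolding gr_def by blast

lemma gr_swap_left:
 assumes "u \<in> I" "v \<in> I"
 shows "gr I (swapf u v a) b = gr I a (swapf u v b)"
 unfolding gr_split[OF assms] by (auto simp: gr_def swapf_apply)

lemma resolve_gr:
 assumes "inj_on a I" "u \<in> I" "v \<in> I" "u ~= v"
 shows "resolve (gr I a b) (a u, b u) (a v, b v) = gr I a (swapf u v b)"
proof -
 have "gr I a b - {(a u, b u), (a v, b v)} = gr (I - {u, v}) a b"
  unfolding gr_split[OF assms(2,3)] using inj_onD[OF assms(1)] assms(2,3)
  by (auto simp only: gr_def)
 also have "... = gr (I - {u, v}) a (swapf u v b)"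
  by (rule gr_cong) (auto simp: swapf_apply)
 finally have *: "gr I a b - {(a u, b u), (a v, b v)} = gr (I - {u, v}) a (swapf u v b)" .
 have "swapf u v b u = b v" "swapf u v b v = b u" using assms(4) by (auto simp: swapf_apply)
 then show ?thesis
  unfolding resolve_def * gr_split[OF assms(2,3), of a "swapf u v b"] by simp
qed

section \<open>The strand algebra is a differential algebra\<close>

text \<open>The sum of the resolutions of all crossings. Forgetting how far a resolution or a composition
 lowers the number of inversions turns the Leibniz rule into an identity of formal sums.\<close>

definition all_resolutions :: "strands => vec" where
 "all_resolutions mu = (\<Sum>(a, b)\<in>inversions mu. basis (resolve mu a b))"

text \<open>Each unordered pair of strands occurs once, ordered by the index points rather than by
  the starts as in \<open>disagree\<close>. The condition is then symmetric in \<open>a\<close> and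
  \<open>b\<close>, so crossings of a composition can be compared with those of its factors.\<close>

definition crossing_pairs :: "point set => (point => point) => (point => point) => (point \<times> point) set" where
 "crossing_pairs I a b = {(u, v). u \<in> I & v \<in> I & u \<prec> v & (a u \<prec> a v) ~= (b u \<prec> b v)}"

definition line_map :: "point set => (point => point) => bool" where
 "line_map I a \<longleftrightarrow> inj_on a I & (\<forall>u\<in>I. fst (a u) = fst u)"

lemma line_map_less_iff:
 assumes "line_map I a" "u \<in> I" "v \<in> I" "fst u = fst v" "u ~= v"
 shows "\<not> a u \<prec> a v \<longleftrightarrow> a v \<prec> a u"
proof -
 have "fst (a u) = fst (a v)" "a u ~= a v"
  using assms by (auto simp: line_map_def dest: inj_onD)
 then show ?thesis using pt_less_total pt_less_asym by blast
qed

lemma line_map_less_fst: "line_map I a ==> u \<in> I ==> v \<in> I ==> a u \<prec> a v ==> fst u = fst v"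
 by (simp add: line_map_def pt_less_def)

lemma line_map_id [simp]: "line_map I id" by (simp add: line_map_def)

lemma line_map_swapf:
 "line_map I b ==> u \<in> I ==> v \<in> I ==> fst u = fst v ==> line_map I (swapf u v b)"
 unfolding line_map_def by (auto simp: inj_on_swapf) (auto simp: swapf_apply)

text \<open>\<open>disagree\<close> and \<open>crossing_pairs\<close> differ only in which of the
  two crossing strands is named first.\<close>

lemma disagree_bij:
 assumes "line_map I a" "line_map I b"
 shows "bij_betw (%(u, v). if u \<prec> v then (u, v) else (v, u)) (disagree I a b) (crossing_pairs I a b)"
proof (rule bij_betw_byWitness[where f' = "%(u, v). if a u \<prec> a v then (u, v) else (v, u)"])
 note l = line_map_less_iff[OF assms(1)] line_map_less_iff[OF assms(2)]
  line_map_less_fst[OF assms(1)] pt_less_total pt_less_asym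
 have d: "u \<in> I" "v \<in> I" "fst u = fst v" "u ~= v" "a u \<prec> a v" "\<not> a v \<prec> a u" "b v \<prec> b u" "\<not> b u \<prec> b v"
  "(u \<prec> v & \<not> v \<prec> u) \<or> (v \<prec> u & \<not> u \<prec> v)"
  if "(u, v) \<in> disagree I a b" for u v
  using that l unfolding disagree_def by auto (metis pt_less_asym l)+
 have c: "u \<in> I" "v \<in> I" "fst u = fst v" "u ~= v" "u \<prec> v" "\<not> v \<prec> u"
  "(a u \<prec> a v & \<not> a v \<prec> a u & b v \<prec> b u) \<or> (a v \<prec> a u & \<not> a u \<prec> a v & b u \<prec> b v)"
  if "(u, v) \<in> crossing_pairs I a b" for u v
 proof -
  show *: "u \<in> I" "v \<in> I" "u \<prec> v" using that by (auto simp: crossing_pairs_def)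
  then show **: "fst u = fst v" "u ~= v" "\<not> v \<prec> u" by (auto simp: pt_less_def)
  then show "(a u \<prec> a v & \<not> a v \<prec> a u & b v \<prec> b u) \<or> (a v \<prec> a u & \<not> a u \<prec> a v & b u \<prec> b v)"
   using that * l(1,2)[of u v] unfolding crossing_pairs_def by (auto dest: pt_less_asym)
 qed
 show "\<forall>w\<in>disagree I a b. (case case w of (u, v) => if u \<prec> v then (u, v) else (v, u) of
   (u, v) => if a u \<prec> a v then (u, v) else (v, u)) = w"
  using d by (auto split: prod.splits)
 show "\<forall>w\<in>crossing_pairs I a b. (case case w of (u, v) => if a u \<prec> a v then (u, v) else (v, u) of
   (u, v) => if u \<prec> v then (u, v) else (v, u)) = w"
  using c by (auto split: prod.splits)
 show "(%(u, v). if u \<prec> v then (u, v) else (v, u)) ` disagree I a b \<subseteq> crossing_pairs I a b"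
 proof (clarify, goal_cases)
  case (1 _ _ u1 u2 v1 v2)
  then show ?case using d[OF 1(2)] by (auto simp: crossing_pairs_def split: if_splits)
 qed
 show "(%(u, v). if a u \<prec> a v then (u, v) else (v, u)) ` crossing_pairs I a b \<subseteq> disagree I a b"
 proof (clarify, goal_cases)
  case (1 _ _ u1 u2 v1 v2)
  then show ?case using c[OF 1(2)] by (auto simp: disagree_def split: if_splits)
 qed
qed

lemma finite_crossing_pairs [simp]: "finite I ==> finite (crossing_pairs I a b)"
 by (rule finite_subset[of _ "I \<times> I"]) (auto simp: crossing_pairs_def)

lemma ninv_line_map:
 "line_map I a ==> line_map I b ==> ninv (gr I a b) = card (crossing_pairs I a b)"
 using bij_betw_same_card[OF disagree_bij] by (simp add: ninv_gr line_map_def)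

lemma all_resolutions_gr:
 assumes "line_map I a" "line_map I b"
 shows "all_resolutions (gr I a b) = (\<Sum>(u, v)\<in>crossing_pairs I a b. basis (gr I a (swapf u v b)))"
proof -
 have inj: "inj_on a I" using assms by (simp add: line_map_def)
 have "all_resolutions (gr I a b) =
   (\<Sum>(u, v)\<in>disagree I a b. basis (resolve (gr I a b) (a u, b u) (a v, b v)))"
  unfolding all_resolutions_def inversions_gr
  by (subst sum.reindex[OF inj_on_inversions[OF inj]]) (auto simp: case_prod_beta intro: sum.cong)
 also have "... = (\<Sum>(u, v)\<in>disagree I a b. basis (gr I a (swapf u v b)))"
 proof (rule sum.cong[OF refl], clarify, goal_cases)
  case (1 u1 u2 v1 v2)
  then have "(u1, u2) \<in> I" "(v1, v2) \<in> I" "(u1, u2) ~= (v1, v2)" by (auto simp: disagree_def)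
  then show ?case using resolve_gr[OF inj] by simp
 qed
 also have "... = (\<Sum>(u, v)\<in>crossing_pairs I a b. basis (gr I a (swapf u v b)))"
  by (subst sum.reindex_bij_betw[OF disagree_bij[OF assms], symmetric])
   (auto simp: swapf_commute case_prod_beta intro: sum.cong)
 finally show ?thesis .
qed

lemma braid_comp_line_map:
 assumes "braid al" "braid be" "Range al = Domain be"
 obtains I a b where "al = gr I a id" "be = gr I id b" "al O be = gr I a b" "finite I"
  "line_map I a" "line_map I b"
 using braid_comp_index[OF assms] unfolding line_map_def by metis

lemma braid_line_map:
 assumes "braid mu"
 obtains b where "mu = gr (Domain mu) id b" "finite (Domain mu)" "line_map (Domain mu) b"
 using braid_start[OF assms] unfolding line_map_def by metis

text \<open>Two strands that cross in both factors are back in their original order after the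
  composition. So crossings add modulo 2, which yields both the subadditivity of \<open>ninv\<close>
  and the Leibniz rule.\<close>

lemma crossing_pairs_sym_diff:
 "crossing_pairs I a b = (crossing_pairs I a id - crossing_pairs I id b) Un (crossing_pairs I id b - crossing_pairs I a id)"
 by (auto simp: crossing_pairs_def)

lemma ninv_comp_le:
 assumes "braid al" "braid be" "Range al = Domain be"
 shows "ninv (al O be) <= ninv al + ninv be"
proof -
 obtain I a b where *: "al = gr I a id" "be = gr I id b" "al O be = gr I a b" "finite I"
  "line_map I a" "line_map I b" using braid_comp_line_map[OF assms] by metis
 have "card (crossing_pairs I a b) <= card (crossing_pairs I a id Un crossing_pairs I id b)"
  using *(4) crossing_pairs_sym_diff[of I a b] by (intro card_mono) auto
 also have "... <= card (crossing_pairs I a id) + card (crossing_pairs I id b)" by (rule card_Un_le)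
 finally show ?thesis using * by (simp add: ninv_line_map)
qed

definition compose :: "strands => strands => vec" where
 "compose mu nu = (if Range mu = Domain nu then basis (mu O nu) else 0)"

text \<open>Resolving a crossing in either factor and then composing gives the composition with two
  ends exchanged. Strands that cross in both factors contribute the same diagram twice; the
  remaining pairs are the crossings of the composition.\<close>

lemma all_resolutions_comp:
 assumes "braid al" "braid be" "Range al = Domain be"
 shows "all_resolutions (al O be) =
  lin (%mu. basis (mu O be)) (all_resolutions al) + lin (%nu. basis (al O nu)) (all_resolutions be)"
proof -
 obtain I a b where *: "al = gr I a id" "be = gr I id b" "al O be = gr I a b" "finite I"
  "line_map I a" "line_map I b" using braid_comp_line_map[OF assms] by metis
 define F where "F = (%(u, v). basis (gr I a (swapf u v b)))"
 have inj: "inj_on b I" "inj_on a I" using * by (auto simp: line_map_def)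
 have "lin (%mu. basis (mu O be)) (all_resolutions al) = (\<Sum>(u, v)\<in>crossing_pairs I a id. basis (gr I a (swapf u v id) O be))"
  unfolding *(1) all_resolutions_gr[OF *(5) line_map_id] lin_sum basis_def by (simp add: case_prod_beta)
 also have "... = sum F (crossing_pairs I a id)"
  unfolding F_def
 proof (rule sum.cong[OF refl], clarify, goal_cases)
  case (1 u1 u2 v1 v2)
  then have I: "(u1, u2) \<in> I" "(v1, v2) \<in> I" by (auto simp: crossing_pairs_def)
  have "gr I a (swapf (u1, u2) (v1, v2) id) O be = gr I (swapf (u1, u2) (v1, v2) a) id O gr I id b"
   unfolding gr_swap_left[OF I] *(2) ..
  also have "... = gr I (swapf (u1, u2) (v1, v2) a) b"
   by (rule gr_comp) simp
  also have "... = gr I a (swapf (u1, u2) (v1, v2) b)"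
   by (rule gr_swap_left[OF I])
  finally show ?case by simp
 qed
 finally have 1: "lin (%mu. basis (mu O be)) (all_resolutions al) = sum F (crossing_pairs I a id)" .
 have "lin (%nu. basis (al O nu)) (all_resolutions be) = (\<Sum>(u, v)\<in>crossing_pairs I id b. basis (al O gr I id (swapf u v b)))"
  unfolding *(2) all_resolutions_gr[OF line_map_id *(6)] lin_sum basis_def by (simp add: case_prod_beta)
 also have "... = sum F (crossing_pairs I id b)"
  unfolding F_def *(1) by (simp add: gr_comp)
 finally have 2: "lin (%nu. basis (al O nu)) (all_resolutions be) = sum F (crossing_pairs I id b)" .
 have "all_resolutions (al O be) = sum F (crossing_pairs I a b)"
  unfolding *(3) F_def by (rule all_resolutions_gr[OF *(5,6)])
 also have "... = sum F (crossing_pairs I a id) + sum F (crossing_pairs I id b)"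
  unfolding crossing_pairs_sym_diff[of I a b]
  using lin_add[of F "vecof (crossing_pairs I a id)" "vecof (crossing_pairs I id b)"] *(4)
  by (simp add: lin_def keys_add_bit)
 finally show ?thesis unfolding 1 2 .
qed

text \<open>The strands crossing both strands of an inversion; they are uncrossed twice by its resolution.\<close>

definition between :: "strands => point \<times> point => point \<times> point => (point \<times> point) set" where
 "between mu a b = {c \<in> mu. fst a \<prec> fst c & fst c \<prec> fst b & snd b \<prec> snd c & snd c \<prec> snd a}"

text \<open>Separates the ordered pairs involving two distinguished strands from the rest, which an
  exchange of these strands leaves unchanged.\<close>

lemma card_pairs_split:
 assumes "finite I" "u \<in> I" "v \<in> I" "u ~= v"
 shows "card {(x, y). x \<in> I & y \<in> I & R x y} =
  card {(x, y). x \<in> I - {u, v} & y \<in> I - {u, v} & R x y} +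
  (\<Sum>w\<in>I - {u, v}. of_bool (R w u) + of_bool (R u w) + of_bool (R w v) + of_bool (R v w)) +
  of_bool (R u u) + of_bool (R v v) + of_bool (R u v) + of_bool (R v u)"
proof -
 have *: "card {(x, y). x \<in> I & y \<in> I & R x y} = (\<Sum>x\<in>I. \<Sum>y\<in>I. of_bool (R x y))" if "finite I" for I
 proof -
  have "{(x, y). x \<in> I & y \<in> I & R x y} = {p \<in> I \<times> I. R (fst p) (snd p)}" by auto
  also have "card ... = (\<Sum>p\<in>I \<times> I. of_bool (R (fst p) (snd p)))"
   using that unfolding card_eq_sum of_bool_def by (intro sum.inter_filter) auto
  finally show ?thesis by (simp add: sum.cartesian_product case_prod_beta)
 qed
 let ?J = "I - {u, v}"
 have I: "I = insert u (insert v ?J)" and J: "u \<notin> insert v ?J" "v \<notin> ?J" "finite ?J"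
  using assms by auto
 have s: "sum g I = g u + (g v + sum g ?J)" for g :: "_ => nat"
  using J by (subst I) simp
 show ?thesis
  unfolding *[OF assms(1)] *[OF J(3)] s
  by (simp add: sum.distrib)
qed

text \<open>A third strand crosses the exchanged strands as often before as after, unless it lies
  between them both at its start and at its end. Such a strand crosses both before and neither
  after, whence the factor 2.\<close>

lemma ninv_swapf:
 assumes "line_map I b" "finite I" "u \<in> I" "v \<in> I" "u \<prec> v" "b v \<prec> b u"
 shows "ninv (gr I id b) = ninv (gr I id (swapf u v b)) + 1 +
  2 * card {w \<in> I. u \<prec> w & w \<prec> v & b v \<prec> b w & b w \<prec> b u}"
proof -
 define R where "R = (%b x y. x \<prec> y & b y \<prec> (b x :: point))"
 have uv: "u ~= v" using assms(5) by auto
 have n: "ninv (gr I id b) = card {(x, y). x \<in> I & y \<in> I & R b x y}" for b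
  by (simp add: ninv_gr disagree_def R_def)
 let ?J = "I - {u, v}" and ?b = "swapf u v b"
 have b: "?b u = b v" "?b v = b u" "?b w = b w" if "w \<in> ?J" for w
  using uv that by (auto simp: swapf_apply)
 have 1: "{(x, y). x \<in> ?J & y \<in> ?J & R b x y} = {(x, y). x \<in> ?J & y \<in> ?J & R ?b x y}"
  by (auto simp: R_def swapf_apply)
 define M where "M = {w \<in> I. u \<prec> w & w \<prec> v & b v \<prec> b w & b w \<prec> b u}"
 have 2: "of_bool (R b w u) + of_bool (R b u w) + of_bool (R b w v) + of_bool (R b v w) =
  of_bool (R ?b w u) + of_bool (R ?b u w) + of_bool (R ?b w v) + of_bool (R ?b v w) + 2 * (of_bool (w \<in> M) :: nat)"
  if w: "w \<in> ?J" for w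
 proof -
  have s: "?b u = b v" "?b v = b u" "?b w = b w" using uv w by (auto simp: swapf_apply)
  have lin: "fst (b w) = fst w" "fst (b u) = fst u" "fst (b v) = fst v" "fst u = fst v"
   "snd (b w) ~= snd (b u)" "snd (b w) ~= snd (b v)" if "fst w = fst u"
   using assms w that unfolding line_map_def pt_less_def
   by (auto simp: inj_on_def) (metis prod_eq_iff)+
  have ne: "snd w ~= snd u" "snd w ~= snd v" if "fst w = fst u"
   using w assms(5) that by (auto simp: prod_eq_iff pt_less_def)
  have uv2: "snd u < snd v" "snd (b v) < snd (b u)" "fst u = fst v"
   using assms(5,6) by (auto simp: pt_less_def)
  show ?thesis
  proof (cases "fst w = fst u")
   case True
   have l: "w \<prec> u \<longleftrightarrow> snd w < snd u" "u \<prec> w \<longleftrightarrow> \<not> snd w < snd u" "w \<prec> v \<longleftrightarrow> snd w < snd v" "v \<prec> w \<longleftrightarrow> \<not> snd w < snd v"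
    "b w \<prec> b u \<longleftrightarrow> snd (b w) < snd (b u)" "b u \<prec> b w \<longleftrightarrow> \<not> snd (b w) < snd (b u)"
    "b w \<prec> b v \<longleftrightarrow> snd (b w) < snd (b v)" "b v \<prec> b w \<longleftrightarrow> \<not> snd (b w) < snd (b v)"
    using lin[OF True] ne[OF True] True by (auto simp: pt_less_def)
   \<comment> \<open>The cases are the positions of the start and of the end of \<open>w\<close>
     relative to those of the two exchanged strands.\<close>
   show ?thesis
    using w uv2 unfolding R_def M_def s mem_Collect_eq l
    by (cases "snd w < snd u"; cases "snd w < snd v"; cases "snd (b w) < snd (b u)"; cases "snd (b w) < snd (b v)")
     simp_all
  next
   case False
   then show ?thesis using uv2 by (auto simp: R_def M_def pt_less_def)
  qed
 qed
 have M: "M \<subseteq> ?J" by (auto simp: M_def)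
 have 3: "(\<Sum>w\<in>?J. 2 * (of_bool (w \<in> M) :: nat)) = 2 * card M"
  using M assms(2) by (simp add: sum_distrib_left [symmetric] of_bool_def sum.If_cases Int_absorb1)
 have 4: "\<not> R b u u" "\<not> R b v v" "R b u v" "\<not> R b v u" "\<not> R ?b u u" "\<not> R ?b v v" "\<not> R ?b u v" "\<not> R ?b v u"
  using assms(5,6) uv by (auto simp: R_def swapf_apply dest: pt_less_asym)
 have S: "(\<Sum>w\<in>?J. of_bool (R b w u) + of_bool (R b u w) + of_bool (R b w v) + of_bool (R b v w)) =
  (\<Sum>w\<in>?J. of_bool (R ?b w u) + of_bool (R ?b u w) + of_bool (R ?b w v) + of_bool (R ?b v w)) + 2 * card M"
  unfolding 3[symmetric] sum.distrib[symmetric] by (rule sum.cong[OF refl 2])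
 show ?thesis
  unfolding n card_pairs_split[OF assms(2,3,4) uv] 1 S M_def[symmetric] using 4 by simp
qed

lemma inversion_line_map:
 assumes "braid mu" "(a, b) \<in> inversions mu"
 obtains I f u v where "mu = gr I id f" "finite I" "line_map I f" "u \<in> I" "v \<in> I"
  "a = (u, f u)" "b = (v, f v)" "u \<prec> v" "f v \<prec> f u" "resolve mu a b = gr I id (swapf u v f)"
proof -
 obtain f where f: "mu = gr (Domain mu) id f" "finite (Domain mu)" "line_map (Domain mu) f"
  using braid_line_map[OF assms(1)] by metis
 define I where "I = Domain mu"
 note f = f[folded I_def]
 obtain u v where uv: "u \<in> I" "v \<in> I" "a = (u, f u)" "b = (v, f v)" "u \<prec> v" "f v \<prec> f u"
  using assms(2) f(1) inversions_gr[of I id f] by (auto simp: disagree_def)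
 have "resolve mu a b = gr I id (swapf u v f)"
  using resolve_gr[of id I u v f] uv f(1) pt_less_irrefl[of u] by (metis id_apply inj_on_id)
 then show ?thesis using that f uv by metis
qed

text \<open>The bridge between the counting condition in \<open>strand_diff\<close> and a geometric
  one: a resolution loses exactly one crossing iff no strand lies between the two resolved
  ones.\<close>

lemma ninv_resolve:
 assumes "braid mu" "(a, b) \<in> inversions mu"
 shows "ninv mu = ninv (resolve mu a b) + 1 + 2 * card (between mu a b)"
proof -
 obtain I f u v where f: "mu = gr I id f" "finite I" "line_map I f" and uv: "u \<in> I" "v \<in> I"
  "a = (u, f u)" "b = (v, f v)" "u \<prec> v" "f v \<prec> f u" and 1: "resolve mu a b = gr I id (swapf u v f)"
  using inversion_line_map[OF assms] .
 have 2: "between mu a b = (%w. (w, f w)) ` {w \<in> I. u \<prec> w & w \<prec> v & f v \<prec> f w & f w \<prec> f u}"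
  unfolding between_def uv(3,4) f(1) by (auto simp: gr_def)
 have 3: "card (between mu a b) = card {w \<in> I. u \<prec> w & w \<prec> v & f v \<prec> f w & f w \<prec> f u}"
  unfolding 2 by (rule card_image) (auto simp: inj_on_def)
 show ?thesis
  using ninv_swapf[OF f(3,2) uv(1,2,5,6)] unfolding 1 3 f(1)[symmetric] .
qed

lemma resolve_Domain [simp]: "(a, b) \<in> inversions mu ==> Domain (resolve mu a b) = Domain mu"
 and resolve_Range [simp]: "(a, b) \<in> inversions mu ==> Range (resolve mu a b) = Range mu"
 unfolding resolve_def inversions_def by (cases a; cases b; auto)+

lemma braid_resolve:
 assumes "braid mu" "(a, b) \<in> inversions mu"
 shows "braid (resolve mu a b)"
proof -
 obtain I f u v where f: "finite I" "line_map I f" "u \<in> I" "v \<in> I" "u \<prec> v"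
  and *: "resolve mu a b = gr I id (swapf u v f)" using inversion_line_map[OF assms] .
 then have "line_map I (swapf u v f)" using line_map_swapf[of I f u v] by (simp add: pt_less_def)
 then show ?thesis unfolding * using f(1) by (intro braid_gr) (auto simp: line_map_def)
qed

lemma finite_inversions [simp]: "finite mu ==> finite (inversions mu)"
 by (rule finite_subset[of _ "mu \<times> mu"]) (auto simp: inversions_def)

lemma keys_all_resolutions:
 assumes "braid mu" "nu \<in> keys (all_resolutions mu)"
 obtains a b where "(a, b) \<in> inversions mu" "nu = resolve mu a b"
proof -
 obtain p where p: "p \<in> inversions mu" "nu \<in> keys (case p of (a, b) => basis (resolve mu a b))"
  using subsetD[OF keys_sum_subset assms(2)[unfolded all_resolutions_def]] by (rule UN_E)
 obtain a b where "p = (a, b)" by (rule prod.exhaust)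
 then show ?thesis using p that by (simp add: basis_def)
qed

lemma all_resolutions_props:
 assumes "braid mu" "nu \<in> keys (all_resolutions mu)"
 shows "braid nu" "Domain nu = Domain mu" "Range nu = Range mu" "ninv nu < ninv mu"
proof -
 obtain a b where *: "(a, b) \<in> inversions mu" "nu = resolve mu a b" using keys_all_resolutions[OF assms] .
 show "braid nu" "Domain nu = Domain mu" "Range nu = Range mu" "ninv nu < ninv mu"
  using * braid_resolve[OF assms(1) *(1)] ninv_resolve[OF assms(1) *(1)] by auto
qed

text \<open>Every resolution loses at least one crossing, so the differential is the part of
  \<open>all_resolutions\<close> with the largest inversion number that can occur.\<close>

lemma strand_diff_restr:
 assumes "braid mu"
 shows "strand_diff mu = restr (%nu. ninv nu + 1 = ninv mu) (all_resolutions mu)"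
proof -
 let ?c = "%p. case p of (a, b) => ninv (resolve mu a b) + 1 = ninv mu"
 have "finite (inversions mu)" using assms by (simp add: braid_def)
 have "strand_diff mu = (\<Sum>p\<in>{p \<in> inversions mu. ?c p}. case p of (a, b) => basis (resolve mu a b))"
  unfolding strand_diff_def by (rule sum.cong) auto
 also have "... = (\<Sum>p\<in>inversions mu. if ?c p then (case p of (a, b) => basis (resolve mu a b)) else 0)"
  by (rule sum.inter_filter) fact
 also have "... = restr (%nu. ninv nu + 1 = ninv mu) (all_resolutions mu)"
  unfolding all_resolutions_def restr_sum
  by (rule sum.cong[OF refl]) (auto simp: basis_def restr_single split: prod.splits)
 finally show ?thesis .
qed

lemma strand_diff_props:
 assumes "braid mu" "nu \<in> keys (strand_diff mu)"
 shows "braid nu" "Domain nu = Domain mu" "Range nu = Range mu" "ninv nu + 1 = ninv mu"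
 using assms all_resolutions_props[OF assms(1)] by (auto simp: strand_diff_restr)

lemma lin_restr: "lin g (restr P x) = lin (%k. if P k then g k else 0) x"
 by (simp add: lin_def sum.inter_filter)

lemma restr_lin: "restr Q (lin f x) = lin (%k. restr Q (f k)) x"
 unfolding lin_def by (rule restr_sum)

lemma Domain_relcomp_eq: "Range r = Domain s ==> Domain (r O s) = Domain r"
 and Range_relcomp_eq: "Range r = Domain s ==> Range (r O s) = Range s"
 by blast+

lemma strand_mult_props:
 assumes "braid mu" "braid nu" "xi \<in> keys (strand_mult mu nu)"
 shows "braid xi" "Domain xi = Domain mu" "Range xi = Range nu" "Range mu = Domain nu" "xi = mu O nu"
  "ninv xi = ninv mu + ninv nu"
proof -
 have *: "Range mu = Domain nu" "ninv (mu O nu) = ninv mu + ninv nu" "xi = mu O nu"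
  using assms(3) by (simp_all add: strand_mult_def basis_def split: if_splits)
 then show "braid xi" "Domain xi = Domain mu" "Range xi = Range nu" "Range mu = Domain nu" "xi = mu O nu"
  "ninv xi = ninv mu + ninv nu"
  using braid_comp[OF assms(1,2)] Domain_relcomp_eq Range_relcomp_eq by metis+
qed

text \<open>Project the identity for \<open>all_resolutions\<close> to inversion number
  \<open>ninv al + ninv be - 1\<close>. Composition never creates inversions, so only terms of the
  actual differentials and products reach this number.\<close>

lemma strand_leibniz:
 assumes "braid al" "braid be"
 shows "vec_diff (strand_mult al be) = vec_mult (strand_diff al) (basis be) + vec_mult (basis al) (strand_diff be)"
proof (cases "Range al = Domain be")
 case False
 have "vec_mult (strand_diff al) (basis be) = lin (%mu. 0) (strand_diff al)"
  unfolding vec_mult_lin basis_def lin_single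
  by (rule lin_cong) (use False strand_diff_props[OF assms(1)] in \<open>auto simp: strand_mult_def\<close>)
 moreover have "vec_mult (basis al) (strand_diff be) = lin (%mu. 0) (strand_diff be)"
  unfolding vec_mult_lin basis_def lin_single
  by (rule lin_cong) (use False strand_diff_props[OF assms(2)] in \<open>auto simp: strand_mult_def\<close>)
 ultimately show ?thesis using False by (simp add: strand_mult_def)
next
 case True
 define n where "n = ninv al + ninv be"
 let ?Q = "%xi. ninv xi + 1 = n"
 have ab: "braid (al O be)" using braid_comp assms True by blast
 have "vec_diff (strand_mult al be) = restr ?Q (all_resolutions (al O be))"
 proof (cases "ninv (al O be) = n")
  case True2: True
  then show ?thesis using True ab by (simp add: strand_mult_def n_def[symmetric] strand_diff_restr)
 next
  case False
  \<comment> \<open>The product is zero here, and correspondingly every resolution of the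
    composition has too few crossings to survive the projection.\<close>
  then have "ninv (al O be) < n" using ninv_comp_le[OF assms True] n_def by simp
  then have "restr ?Q (all_resolutions (al O be)) = 0"
   using all_resolutions_props(4)[OF ab] by (intro restr_none) fastforce
  then show ?thesis using False by (simp add: strand_mult_def n_def)
 qed
 moreover have "vec_mult (strand_diff al) (basis be) = restr ?Q (lin (%mu. basis (mu O be)) (all_resolutions al))"
  unfolding restr_lin vec_mult_lin basis_def lin_single strand_diff_restr[OF assms(1)] lin_restr
 proof (rule lin_cong, goal_cases)
  case (1 mu)
  note p = all_resolutions_props[OF assms(1) 1]
  have "ninv (mu O be) <= ninv mu + ninv be" using ninv_comp_le[OF p(1) assms(2)] p True by simp
  then show ?case using p True by (auto simp: strand_mult_def basis_def restr_single n_def)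
 qed
 moreover have "vec_mult (basis al) (strand_diff be) = restr ?Q (lin (%nu. basis (al O nu)) (all_resolutions be))"
  unfolding restr_lin vec_mult_lin basis_def lin_single strand_diff_restr[OF assms(2)] lin_restr
 proof (rule lin_cong, goal_cases)
  case (1 mu)
  note p = all_resolutions_props[OF assms(2) 1]
  have "ninv (al O mu) <= ninv al + ninv mu" using ninv_comp_le[OF assms(1) p(1)] p True by simp
  then show ?case using p True by (auto simp: strand_mult_def basis_def restr_single n_def)
 qed
 ultimately show ?thesis using all_resolutions_comp[OF assms True] by (simp add: restr_add)
qed

section \<open>Leibniz rule, square of the differential and associativity for vectors\<close>

definition braids :: "vec => bool" where
 "braids x \<longleftrightarrow> (\<forall>mu\<in>keys x. braid mu)"

lemma vec_eq_lin_basis: "x = lin basis x"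
 unfolding basis_def by (rule vec_eq_sum)

lemma leibniz:
 assumes "braids x" "braids y"
 shows "vec_diff (vec_mult x y) = vec_mult (vec_diff x) y + vec_mult x (vec_diff y)"
proof -
 have "vec_diff (vec_mult x y) = lin (%mu. lin (%nu. vec_diff (strand_mult mu nu)) y) x"
  unfolding vec_mult_lin additive_lin[of vec_diff, OF vec_diff_add] by (rule refl)
 also have "... = lin (%mu. lin (%nu. vec_mult (strand_diff mu) (basis nu) + vec_mult (basis mu) (strand_diff nu)) y) x"
  using assms unfolding braids_def by (intro lin_cong strand_leibniz) auto
 also have "... = lin (%mu. lin (%nu. vec_mult (strand_diff mu) (basis nu)) y) x +
   lin (%mu. lin (%nu. vec_mult (basis mu) (strand_diff nu)) y) x"
  by (simp add: lin_fun_add)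
 also have "lin (%mu. lin (%nu. vec_mult (strand_diff mu) (basis nu)) y) x = vec_mult (vec_diff x) y"
  by (simp add: vec_diff_lin additive_lin[of "%x. vec_mult x y" strand_diff x, OF vec_mult_add_left]
   flip: additive_lin[of "%y. vec_mult z y" basis y for z, OF vec_mult_add_right] vec_eq_lin_basis)
 also have "lin (%mu. lin (%nu. vec_mult (basis mu) (strand_diff nu)) y) x = vec_mult x (vec_diff y)"
 proof -
  have "vec_mult w (vec_diff y) = lin (%nu. vec_mult w (strand_diff nu)) y" for w
   by (simp add: vec_diff_lin additive_lin[of "%z. vec_mult w z" for w, OF vec_mult_add_right])
  note * = this
  show ?thesis
   by (simp flip: * additive_lin[of "%x. vec_mult x (vec_diff y)" basis x, OF vec_mult_add_left] vec_eq_lin_basis)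
 qed
 finally show ?thesis .
qed

lemma ninv_0_diff: "braid mu ==> ninv mu = 0 ==> strand_diff mu = 0"
 using strand_diff_props(4)[of mu] by (metis Suc_eq_plus1 all_not_in_conv keys_eq_empty nat.distinct(1))

text \<open>Take a crossing pair whose starts are closest. A strand starting between them would
  cross one of the two, and this crossing pair would be closer.\<close>

lemma adjacent_inversion:
 assumes "line_map I f" "finite I" "ninv (gr I id f) ~= 0"
 obtains u v where "u \<in> I" "v \<in> I" "u \<prec> v" "f v \<prec> f u" "\<forall>w\<in>I. \<not> (u \<prec> w & w \<prec> v)"
proof -
 define C where "C = crossing_pairs I id f"
 have "C ~= {}" using assms ninv_line_map[OF line_map_id assms(1)] by (auto simp: C_def)
 moreover have "finite C" using assms by (simp add: C_def)
 ultimately obtain p where p: "p \<in> C" "!!q. q \<in> C ==> snd (snd p) - snd (fst p) <= snd (snd q) - snd (fst q)"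
 proof -
  let ?g = "%p :: point \<times> point. snd (snd p) - snd (fst p)"
  have "Min (?g ` C) \<in> ?g ` C" using \<open>finite C\<close> \<open>C ~= {}\<close> by simp
  then obtain p where p: "Min (?g ` C) = ?g p" "p \<in> C" by (rule imageE)
  have "?g p <= ?g q" if "q \<in> C" for q
   unfolding p(1)[symmetric] using that \<open>finite C\<close> by (intro Min_le) auto
  then show thesis using that p by blast
 qed
 obtain u v where uv: "p = (u, v)" by (rule prod.exhaust)
 have C: "(u, v) \<in> C \<longleftrightarrow> u \<in> I & v \<in> I & u \<prec> v & f v \<prec> f u" for u v
 proof -
  have "(id u \<prec> id v) ~= (f u \<prec> f v) \<longleftrightarrow> f v \<prec> f u" if "u \<in> I" "v \<in> I" "u \<prec> v"
  proof -
   have "fst u = fst v" "u ~= v" using that by (auto simp: pt_less_def)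
   then show ?thesis using line_map_less_iff[OF assms(1)] that by auto
  qed
  then show ?thesis unfolding C_def crossing_pairs_def by blast
 qed
 have *: "u \<in> I" "v \<in> I" "u \<prec> v" "f v \<prec> f u" using p(1) C uv by auto
 have "False" if w: "w \<in> I" "u \<prec> w" "w \<prec> v" for w
 proof -
  have "\<not> f w \<prec> f u" using p(2)[of "(u, w)"] w * unfolding C uv by (auto simp: pt_less_def)
  then have "f u \<prec> f w" using line_map_less_iff[OF assms(1), of w u] w * by (auto simp: pt_less_def)
  then have "f v \<prec> f w" using * pt_less_trans by blast
  then show False using p(2)[of "(w, v)"] w * unfolding C uv by (auto simp: pt_less_def)
 qed
 then show ?thesis using that * by blast
qed

text \<open>Induction on the number of crossings. \<open>mu\<close> is the product of
  \<open>s\<close> and \<open>nu\<close> without loss of crossings, where \<open>s\<close> crosses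
  two strands with neighbouring starts. Applying the Leibniz rule twice produces the mixed term
  twice; the other terms vanish by the induction hypothesis and because \<open>s\<close> has a
  single crossing.\<close>

lemma strand_diff_diff: "braid mu ==> vec_diff (strand_diff mu) = 0"
proof (induction "ninv mu" arbitrary: mu rule: less_induct)
 case less
 show ?case
 proof (cases "ninv mu = 0")
  case True
  then show ?thesis using ninv_0_diff less.prems by simp
 next
  case False
  obtain f where f: "mu = gr (Domain mu) id f" "finite (Domain mu)" "line_map (Domain mu) f"
   using braid_line_map[OF less.prems] by metis
  define I where "I = Domain mu"
  note f = f[folded I_def]
  obtain u v where uv: "u \<in> I" "v \<in> I" "u \<prec> v" "f v \<prec> f u" "\<forall>w\<in>I. \<not> (u \<prec> w & w \<prec> v)"
   using adjacent_inversion[OF f(3,2)] False f(1) by metis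
  have "fst u = fst v" using uv by (simp add: pt_less_def)
  then have lm: "line_map I (swapf u v id)" "line_map I (swapf u v f)"
   using line_map_swapf f(3) uv line_map_id by blast+
  define s where "s = gr I id (swapf u v id)"
  define nu where "nu = gr I id (swapf u v f)"
  have br: "braid s" "braid nu"
   unfolding s_def nu_def using lm f(2) by (auto intro!: braid_gr simp: line_map_def)
  \<comment> \<open>No strand starts between \<open>u\<close> and \<open>v\<close>, so the
    correction term of \<open>ninv_swapf\<close> is zero.\<close>
  have e: "{w \<in> I. u \<prec> w & w \<prec> v & P w} = {}" for P using uv(5) by auto
  have "u ~= v" using uv by auto
  then have sv: "swapf u v id v \<prec> swapf u v id u" using uv(3) by (simp add: swapf_apply)
  have n0: "ninv (gr I id id) = 0"       by (simp add: ninv_line_map crossing_pairs_def)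
  have n: "ninv s = 1" "ninv mu = ninv nu + 1"
  proof -
   have "ninv s = 0 + 1 + 2 * 0"
    using ninv_swapf[OF lm(1) f(2) uv(1,2,3) sv] unfolding s_def e swapf_swapf n0 by (simp only: card.empty)
   then show "ninv s = 1" by simp
   have "ninv (gr I id f) = ninv nu + 1 + 2 * 0"
    using ninv_swapf[OF f(3,2) uv(1,2,3,4)] unfolding nu_def e by simp
   then show "ninv mu = ninv nu + 1" unfolding f(1)[symmetric] by simp
  qed
  have c: "s O nu = mu"
  proof -
   have "s O nu = gr I (swapf u v id) id O gr I id (swapf u v f)"
    unfolding s_def nu_def gr_swap_left[OF uv(1,2)] ..
   also have "... = gr I (swapf u v id) (swapf u v f)" by (rule gr_comp) simp
   also have "... = mu" unfolding gr_swap_left[OF uv(1,2)] using f(1) by simp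
   finally show ?thesis .
  qed
  have R: "Range s = Domain nu" unfolding s_def nu_def by (simp add: swapf_image uv)
  have m: "strand_mult s nu = basis mu" unfolding strand_mult_def using R c n by simp
  have b: "braids (basis s)" "braids (basis nu)" "braids (strand_diff s)" "braids (strand_diff nu)"
   using br strand_diff_props(1) by (auto simp: braids_def basis_def)
  \<comment> \<open>A resolution of the only crossing of \<open>s\<close> has no crossings
    left.\<close>
  have ds: "vec_diff (strand_diff s) = 0"
   unfolding vec_diff_lin lin_def
   using strand_diff_props[OF br(1)] n(1) by (intro sum.neutral ballI ninv_0_diff) auto
  have dnu: "vec_diff (strand_diff nu) = 0" using less.hyps[OF _ br(2)] n by simp
  have "vec_diff (strand_diff mu) = vec_diff (vec_diff (strand_mult s nu))" by (simp add: m)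
  also have "... = vec_diff (vec_mult (strand_diff s) (basis nu) + vec_mult (basis s) (strand_diff nu))"
   by (simp add: strand_leibniz br)
  also have "... = 0"
   by (simp add: vec_diff_add leibniz b ds dnu)
  finally show ?thesis .
 qed
qed

lemma vec_diff_diff: "braids x ==> vec_diff (vec_diff x) = 0"
proof -
 assume "braids x"
 then have "lin (%mu. vec_diff (strand_diff mu)) x = lin (%mu. 0) x"
  unfolding braids_def by (intro lin_cong strand_diff_diff) auto
 then show ?thesis
  using additive_lin[of vec_diff strand_diff x, OF vec_diff_add] by (simp add: vec_diff_lin)
qed

text \<open>Either bracketing is nonzero exactly if the inversions of the triple composition are the
  sum of those of the three factors: by subadditivity this forces the partial products to be
  additive as well.\<close>

lemma strand_mult_assoc:
 assumes "braid al" "braid be" "braid gm"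
 shows "vec_mult (strand_mult al be) (basis gm) = vec_mult (basis al) (strand_mult be gm)"
proof (cases "Range al = Domain be & Range be = Domain gm")
 case True
 then have R: "Range (al O be) = Domain gm" "Domain (be O gm) = Range al" by blast+
 have "braid (al O be)" "braid (be O gm)" using braid_comp assms True by blast+
 then have "ninv (al O be O gm) <= ninv (al O be) + ninv gm" "ninv (al O be O gm) <= ninv al + ninv (be O gm)"
   "ninv (al O be) <= ninv al + ninv be" "ninv (be O gm) <= ninv be + ninv gm"
  using ninv_comp_le[of "al O be" gm] ninv_comp_le[of al "be O gm"] ninv_comp_le[of al be] ninv_comp_le[of be gm]
   assms True R by (simp_all add: O_assoc)
 then show ?thesis using True R unfolding strand_mult_def by (auto simp: O_assoc strand_mult_def)
next
 case False
 have "strand_mult (al O be) gm = 0" if "Range al = Domain be" using False that Range_relcomp_eq[OF that] by (simp add: strand_mult_def)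
 moreover have "strand_mult al (be O gm) = 0" if "Range be = Domain gm"
 proof -
  have "Domain (be O gm) = Domain be" using that by blast
  then show ?thesis using False that by (simp add: strand_mult_def)
 qed
 ultimately show ?thesis
  by (cases "Range al = Domain be"; cases "Range be = Domain gm"; simp add: strand_mult_def[of al be] strand_mult_def[of be gm])
qed

lemma vec_mult_assoc:
 assumes "braids x" "braids y" "braids z"
 shows "vec_mult (vec_mult x y) z = vec_mult x (vec_mult y z)"
proof -
 have "vec_mult (vec_mult x y) z = lin (%al. lin (%be. lin (%gm. vec_mult (strand_mult al be) (basis gm)) z) y) x"
  unfolding vec_mult_lin[of x y]
  by (simp add: additive_lin[of "%x. vec_mult x z", OF vec_mult_add_left]
   additive_lin[of "%z. vec_mult w z" basis z for w, OF vec_mult_add_right, symmetric] vec_eq_lin_basis[of z, symmetric])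
 also have "... = lin (%al. lin (%be. lin (%gm. vec_mult (basis al) (strand_mult be gm)) z) y) x"
  using assms unfolding braids_def by (intro lin_cong strand_mult_assoc) auto
 also have "... = vec_mult x (vec_mult y z)"
 proof -
  have "vec_mult w (vec_mult y z) = lin (%be. lin (%gm. vec_mult w (strand_mult be gm)) z) y" for w
   by (simp add: vec_mult_lin[of y z] additive_lin[of "%z. vec_mult w z" for w, OF vec_mult_add_right])
  note * = this
  show ?thesis
   by (simp flip: * additive_lin[of "%x. vec_mult x (vec_mult y z)" basis x, OF vec_mult_add_left] vec_eq_lin_basis)
 qed
 finally show ?thesis .
qed

section \<open>Diagrams as classes of strand diagrams\<close>

text \<open>Stated for any two strands on one interval, crossing or not: the exchange of ends also
  creates crossings and undoes itself, which is how terms are traced back through the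
  differential.\<close>

lemma resolve_props:
 assumes "braid mu" "a \<in> mu" "b \<in> mu" "a ~= b" "fst (fst a) = fst (fst b)"
 shows "braid (resolve mu a b)" "Domain (resolve mu a b) = Domain mu" "Range (resolve mu a b) = Range mu"
  "resolve (resolve mu a b) (fst a, snd b) (fst b, snd a) = mu" "mu - resolve mu a b = {a, b}"
  "resolve mu a b - mu = {(fst a, snd b), (fst b, snd a)}"
proof -
 obtain f where f: "mu = gr (Domain mu) id f" "finite (Domain mu)" "line_map (Domain mu) f"
  using braid_line_map[OF assms(1)] by metis
 define I where "I = Domain mu"
 note f = f[folded I_def]
 define u v where "u = fst a" and "v = fst b"
 have uv: "u \<in> I" "v \<in> I" "a = (u, f u)" "b = (v, f v)"
  using assms(2,3) f(1) unfolding u_def v_def gr_def by force+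
 have ne: "u ~= v" using assms(4) uv by auto
 have l: "line_map I (swapf u v f)" using line_map_swapf f(3) uv assms(5) by simp
 have r: "resolve mu a b = gr I id (swapf u v f)"
  using resolve_gr[of id I u v f] uv f(1) ne by (metis id_apply inj_on_id)
 show "braid (resolve mu a b)" unfolding r using f(2) l by (intro braid_gr) (auto simp: line_map_def)
 show "Domain (resolve mu a b) = Domain mu" unfolding r by (simp add: I_def)
 show "Range (resolve mu a b) = Range mu"
  unfolding r Range_gr swapf_image[OF uv(1,2)] using f(1) by (metis Range_gr)
 have "resolve (gr I id (swapf u v f)) (u, f v) (v, f u) = gr I id (swapf u v (swapf u v f))"
  using resolve_gr[of id I u v "swapf u v f"] uv(1,2) ne by (simp add: swapf_apply)
 then have "resolve (resolve mu a b) (u, f v) (v, f u) = mu"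
  unfolding r swapf_swapf f(1)[symmetric] .
 then show "resolve (resolve mu a b) (fst a, snd b) (fst b, snd a) = mu"
  unfolding uv(3,4) fst_conv snd_conv .
 have fne: "f u ~= f v" using f(3) uv ne by (auto simp: line_map_def dest: inj_onD)
 have *: "(u, f v) \<notin> mu" "(v, f u) \<notin> mu" using fne f(1) by (auto simp: in_gr)
 then show "resolve mu a b - mu = {(fst a, snd b), (fst b, snd a)}"
  unfolding resolve_def uv(3,4) by auto
 show "mu - resolve mu a b = {a, b}"
  using assms(2,3) * unfolding resolve_def uv(3,4) by auto
qed

lemma of_nat_bit: "(of_nat n :: bit) = (if odd n then 1 else 0)"
 by (induction n) auto

text \<open>Membership in a support is a parity. Closure of the algebra under product and
  differential thereby reduces to bijections between the sets counted here.\<close>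

lemma keys_lin:
 fixes f :: "'k => ('j \<Rightarrow>\<^sub>0 bit)"
 shows "keys (lin f x) = {j. odd (card {k \<in> keys x. j \<in> keys (f k)})}"
proof -
 have "(Poly_Mapping.lookup (lin f x) j ~= 0) = odd (card {k \<in> keys x. j \<in> keys (f k)})" for j
 proof -
  have b: "Poly_Mapping.lookup (f k) j = (if j \<in> keys (f k) then 1 else 0)" for k
   by (auto simp: in_keys_iff)
  have "Poly_Mapping.lookup (lin f x) j = (\<Sum>k\<in>{k \<in> keys x. j \<in> keys (f k)}. 1)"
   unfolding lin_def lookup_sum b by (rule sum.inter_filter[symmetric]) simp
  also have "... = of_nat (card {k \<in> keys x. j \<in> keys (f k)})" by simp
  finally show ?thesis by (simp add: of_nat_bit)
 qed
 then show ?thesis unfolding set_eq_iff in_keys_iff by blast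
qed

lemma keys_lin2:
 fixes f :: "'k => 'l => ('j \<Rightarrow>\<^sub>0 bit)"
 shows "keys (lin (%k. lin (f k) y) x) = {j. odd (card {(k, l).
  k \<in> keys x & l \<in> keys y & j \<in> keys (f k l)})}"
proof -
 let ?z = "vecof (keys x \<times> keys y)"
 have "lin (%k. lin (f k) y) x = lin (%(k, l). f k l) ?z"
  unfolding lin_def by (simp add: sum.cartesian_product)
 moreover have "{p \<in> keys ?z. j \<in> keys (case p of (k, l) => f k l)} =
  {(k, l). k \<in> keys x & l \<in> keys y & j \<in> keys (f k l)}" for j
  by auto
 ultimately show ?thesis by (simp add: keys_lin)
qed

definition mv :: "strands => strands" where
 "mv nu = {p \<in> nu. fst p ~= snd p}"

lemma in_mv: "(x, y) \<in> mv nu \<longleftrightarrow> (x, y) \<in> nu & x ~= y"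
 by (simp add: mv_def)

text \<open>\<open>reduces al nu\<close>: the diagram \<open>nu\<close> is a term of the differential of \<open>al\<close>.\<close>

definition reduces :: "strands => strands => bool" where
 "reduces al nu \<longleftrightarrow> (\<exists>x y x' y'. (x, y) \<in> al & (x', y') \<in> al & x \<prec> x' & y' \<prec> y &
  nu = resolve al (x, y) (x', y') & (\<forall>(c, d)\<in>al. \<not> (x \<prec> c & c \<prec> x' & y' \<prec> d & d \<prec> y)))"

text \<open>The strands lost in a resolution are the two resolved ones, so different inversions have
  different resolutions and nothing cancels.\<close>

lemma keys_strand_diff:
 assumes "braid al"
 shows "keys (strand_diff al) = {nu. reduces al nu}"
proof -
 define J where "J = {(a, b) \<in> inversions al. ninv (resolve al a b) + 1 = ninv al}"
 have fin: "finite al" using assms by (simp add: braid_def)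
 have J: "finite J" unfolding J_def by (rule finite_subset[OF _ finite_inversions[OF fin]]) auto
 have inj: "inj_on (%(a, b). resolve al a b) J"
 proof (rule inj_onI)
  fix p q assume p: "p \<in> J" and q: "q \<in> J" and e: "(%(a, b). resolve al a b) p = (%(a, b). resolve al a b) q"
  obtain a b c d where pq: "p = (a, b)" "q = (c, d)" by (metis surj_pair)
  have i: "a \<in> al" "b \<in> al" "c \<in> al" "d \<in> al" "fst a \<prec> fst b" "fst c \<prec> fst d"
   using p q by (auto simp: pq J_def inversions_def)
  then have ne: "a ~= b" "fst (fst a) = fst (fst b)" "c ~= d" "fst (fst c) = fst (fst d)"
   by (auto simp: pt_less_def)
  have "{a, b} = {c, d}"
   using resolve_props(5)[OF assms i(1,2) ne(1,2)] resolve_props(5)[OF assms i(3,4) ne(3,4)] e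
   by (simp add: pq)
  then show "p = q" using i(5,6) unfolding pq doubleton_eq_iff by (auto dest: pt_less_asym)
 qed
 have "strand_diff al = (\<Sum>p\<in>J. single (case p of (a, b) => resolve al a b) 1)"
  unfolding strand_diff_def J_def basis_def by (rule sum.cong) auto
 also have "... = vecof ((%(a, b). resolve al a b) ` J)"
  unfolding vecof_def sum.reindex[OF inj] o_def ..
 finally have "keys (strand_diff al) = (%(a, b). resolve al a b) ` J" using J by simp
 also have "... = {nu. reduces al nu}"
 proof -
  have *: "((x, y), (x', y')) \<in> J \<longleftrightarrow> (x, y) \<in> al & (x', y') \<in> al & x \<prec> x' & y' \<prec> y &
    (\<forall>(c, d)\<in>al. \<not> (x \<prec> c & c \<prec> x' & y' \<prec> d & d \<prec> y))" for x y x' y'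
  proof -
   have inv: "((x, y), (x', y')) \<in> inversions al \<longleftrightarrow> (x, y) \<in> al & (x', y') \<in> al & x \<prec> x' & y' \<prec> y"
    by (simp add: inversions_def)
   have bt: "between al (x, y) (x', y') = {} \<longleftrightarrow> (\<forall>(c, d)\<in>al. \<not> (x \<prec> c & c \<prec> x' & y' \<prec> d & d \<prec> y))"
    by (auto simp: between_def)
   have "finite (between al (x, y) (x', y'))" using fin by (auto simp: between_def intro: finite_subset)
   then have "ninv (resolve al (x, y) (x', y')) + 1 = ninv al \<longleftrightarrow> between al (x, y) (x', y') = {}"
    if "((x, y), (x', y')) \<in> inversions al"
    using ninv_resolve[OF assms that] by (simp add: card_eq_0_iff)
   then show ?thesis unfolding J_def inv[symmetric] bt[symmetric] using inv by auto
  qed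
  show ?thesis
  proof (intro subset_antisym subsetI)
   fix nu assume "nu \<in> (%(a, b). resolve al a b) ` J"
   then obtain p where p: "nu = (%(a, b). resolve al a b) p" "p \<in> J" by (rule imageE)
   obtain x y x' y' where "p = ((x, y), (x', y'))" by (metis surj_pair)
   then show "nu \<in> {nu. reduces al nu}" using p * unfolding reduces_def by blast
  next
   fix nu assume "nu \<in> {nu. reduces al nu}"
   then obtain x y x' y' where "((x, y), (x', y')) \<in> J" "nu = resolve al (x, y) (x', y')"
    unfolding reduces_def * by blast
   then show "nu \<in> (%(a, b). resolve al a b) ` J"
    by (intro image_eqI[of _ _ "((x, y), (x', y'))"]) auto
  qed
 qed
 finally show ?thesis .
qed

lemma keys_vec_diff:
 assumes "braids x"
 shows "keys (vec_diff x) = {nu. odd (card {al \<in> keys x. reduces al nu})}"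
proof -
 have "{al \<in> keys x. nu \<in> keys (strand_diff al)} = {al \<in> keys x. reduces al nu}" for nu
  using assms keys_strand_diff unfolding braids_def by auto
 then show ?thesis unfolding vec_diff_lin keys_lin by simp
qed

definition composes :: "strands => strands => strands => bool" where
 "composes al be gm \<longleftrightarrow> Range al = Domain be & ninv (al O be) = ninv al + ninv be & gm = al O be"

lemma keys_strand_mult: "keys (strand_mult al be) = {gm. composes al be gm}"
 by (auto simp: strand_mult_def composes_def basis_def)

lemma keys_vec_mult:
 "keys (vec_mult x y) =
  {gm. odd (card {(al, be). al \<in> keys x & be \<in> keys y & composes al be gm})}"
 unfolding vec_mult_lin keys_lin2 keys_strand_mult by simp

section \<open>Horizontal strands\<close>

definition over :: "strands => point => nat" where
 "over mu v = card {p \<in> mu. fst p \<prec> v & v \<prec> snd p}"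

definition rising :: "strands => bool" where
 "rising mu \<longleftrightarrow> (\<forall>(x, y)\<in>mu. x = y \<or> x \<prec> y)"

lemma risingD: "rising mu ==> (x, y) \<in> mu ==> x = y \<or> x \<prec> y"
 unfolding rising_def by (drule (1) bspec) simp

text \<open>A horizontal strand crosses exactly the strands running over its point. Two horizontal
  strands never cross, and as all strands rise, a horizontal strand is always the later starting one
  of a crossing.\<close>

lemma ninv_horizontals:
 assumes "braid mu" "rising mu" "finite V" "V Int (Domain mu Un Range mu) = {}"
 shows "ninv (mu Un Id_on V) = ninv mu + (\<Sum>v\<in>V. over mu v)"
proof -
 let ?W = "SIGMA v:V. {p \<in> mu. fst p \<prec> v & v \<prec> snd p}"
 have fin: "finite mu" using assms(1) by (simp add: braid_def)
 have 1: "inversions (mu Un Id_on V) = inversions mu Un (%(v, p). (p, (v, v))) ` ?W"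
 proof (intro subset_antisym subsetI)
  fix q assume q: "q \<in> inversions (mu Un Id_on V)"
  obtain x y x' y' where e: "q = ((x, y), (x', y'))" by (metis surj_pair)
  have q: "(x, y) \<in> mu Un Id_on V" "(x', y') \<in> mu Un Id_on V" "x \<prec> x'" "y' \<prec> y"
   using q by (auto simp only: e inversions_def mem_Collect_eq case_prod_conv fst_conv snd_conv)
  have xy: "(x, y) \<in> mu"
  proof (rule ccontr)
   assume "(x, y) \<notin> mu"
   then have "x = y" using q(1) by (simp add: Id_on_iff)
   have "x' = y' \<or> x' \<prec> y'" using q(2) risingD[OF assms(2), of x' y'] by (auto simp only: Id_on_iff Un_iff)
   then have "x \<prec> y'" using q(3) pt_less_trans by blast
   then show False using q(4) pt_less_asym[of y' y] \<open>x = y\<close> by blast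
  qed
  show "q \<in> inversions mu Un (%(v, p). (p, (v, v))) ` ?W"
  proof (cases "(x', y') \<in> mu")
   case True
   then show ?thesis using q xy by (simp add: e inversions_def)
  next
   case False
   then have "x' = y'" "x' \<in> V" using q(2) by (auto simp only: Id_on_iff Un_iff)
   then have "(x', (x, y)) \<in> ?W" using q xy by simp
   then show ?thesis using \<open>x' = y'\<close> unfolding e by (intro UnI2 image_eqI[of _ _ "(x', (x, y))"]) auto
  qed
 next
  fix q assume "q \<in> inversions mu Un (%(v, p). (p, (v, v))) ` ?W"
  then show "q \<in> inversions (mu Un Id_on V)"
  proof
   assume "q \<in> (%(v, p). (p, (v, v))) ` ?W"
   then obtain w where w: "q = (%(v, p). (p, (v, v))) w" "w \<in> ?W" by (rule imageE)
   obtain v p where "w = (v, p)" by (rule prod.exhaust)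
   then show ?thesis using w by (simp add: inversions_def Id_on_iff)
  qed (auto simp only: inversions_def)
 qed
 have 2: "inversions mu Int (%(v, p). (p, (v, v))) ` ?W = {}"
 proof -
  have "(v, v) \<notin> mu" if "v \<in> V" for v using assms(4) that by blast
  then show ?thesis by (auto simp only: inversions_def mem_Sigma_iff image_iff mem_Collect_eq case_prod_conv)
 qed
 have 3: "finite ?W" using fin assms(3) by auto
 have "ninv (mu Un Id_on V) = ninv mu + card ?W"
  unfolding ninv_def 1 using 2 3 fin
  by (subst card_Un_disjoint) (auto simp: card_image inj_on_def)
 also have "card ?W = (\<Sum>v\<in>V. over mu v)"
  unfolding over_def using fin assms(3) by (intro card_SigmaI) auto
 finally show ?thesis .
qed

text \<open>A strand of the composition that runs over \<open>v\<close> does not stop at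
  \<open>v\<close> in the middle, so it runs over \<open>v\<close> in exactly one factor.\<close>

lemma over_comp:
 assumes "braid al" "braid be" "Range al = Domain be" "rising al" "rising be" "v \<notin> Range al"
 shows "over (al O be) v = over al v + over be v"
proof -
 obtain I a b where *: "al = gr I a id" "be = gr I id b" "al O be = gr I a b" "finite I"
  "inj_on a I" "inj_on b I" using braid_comp_index[OF assms(1-3)] by metis
 have ov: "over (gr I c d) v = card {u \<in> I. c u \<prec> v & v \<prec> d u}" if "inj_on c I" for c d
 proof -
  have "{p \<in> gr I c d. fst p \<prec> v & v \<prec> snd p} = (%u. (c u, d u)) ` {u \<in> I. c u \<prec> v & v \<prec> d u}"
   by (auto simp: gr_def)
  then show ?thesis unfolding over_def using that by (simp add: card_image inj_on_def)
 qed
 have r: "a u = u \<or> a u \<prec> u" "u = b u \<or> u \<prec> b u" "u ~= v" if "u \<in> I" for u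
  using assms(4,5,6) that unfolding rising_def *(1,2) by (auto simp: gr_def)
 have "{u \<in> I. a u \<prec> v & v \<prec> b u} = {u \<in> I. a u \<prec> v & v \<prec> id u} Un {u \<in> I. id u \<prec> v & v \<prec> b u}"
 proof -
  have "(a u \<prec> v & v \<prec> b u) \<longleftrightarrow> (a u \<prec> v & v \<prec> u) \<or> (u \<prec> v & v \<prec> b u)" if u: "u \<in> I" for u
  proof
   assume h: "a u \<prec> v & v \<prec> b u"
   have "fst u = fst v" using h r(1)[OF u] by (auto simp: pt_less_def)
   then show "(a u \<prec> v & v \<prec> u) \<or> (u \<prec> v & v \<prec> b u)" using h pt_less_total[of u v] r(3)[OF u] by blast
  next
   assume "(a u \<prec> v & v \<prec> u) \<or> (u \<prec> v & v \<prec> b u)"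
   then show "a u \<prec> v & v \<prec> b u" using r[OF u] pt_less_trans by metis
  qed
  then show ?thesis by auto
 qed
 moreover have "{u \<in> I. a u \<prec> v & v \<prec> id u} Int {u \<in> I. id u \<prec> v & v \<prec> b u} = {}"
  by (auto simp only: id_apply dest: pt_less_asym)
 ultimately show ?thesis
  unfolding *(3) ov[OF *(5)] unfolding *(1,2) ov[OF *(5)] ov[OF inj_on_id] 
  using *(4) by (simp add: card_Un_disjoint)
qed

lemma rising_fst: "rising mu ==> (x, y) \<in> mu ==> fst x = fst y"
 by (auto dest: risingD simp: pt_less_def)

locale arc =
 fixes Z :: arc_data
 assumes arc: "arc_diagram Z"
begin

abbreviation (input) "bds \<equiv> boundaries Z"
abbreviation (input) "homog \<equiv> maslov_homogeneous Z"
abbreviation (input) "mismatch \<equiv> idempotent_mismatch Z"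
abbreviation (input) "zeroH \<equiv> zero (homology Z)"
abbreviation (input) "addH \<equiv> add (homology Z)"
abbreviation (input) "tightH \<equiv> tight_hdata Z"
abbreviation (input) "thd \<equiv> tensor_hdata Z"
abbreviation (input) "tmas \<equiv> tensor_maslov Z"
abbreviation (input) "summand \<equiv> alg_summand Z"
abbreviation (input) "H \<equiv> carrier (homology Z)"

abbreviation "pr \<equiv> pair_of Z"
abbreviation "Pl \<equiv> places Z"

lemma pair_of_place: "p \<in> Pl ==> pr p \<in> pairs Z"
 using arc by (auto simp: arc_diagram_def)

lemma places_subset: "Pl \<subseteq> points Z"
 by (auto simp: places_def points_def)

lemma finite_points [simp]: "finite (points Z)"
proof (rule finite_subset)
 show "points Z \<subseteq> (SIGMA i:{..<length (sizes Z)}. {..sizes Z ! i + 1})" by (auto simp: points_def)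
qed simp

lemma finite_places [simp]: "finite Pl"
 using finite_subset[OF places_subset finite_points] .

lemma finite_pairs [simp]: "finite (pairs Z)"
 by (simp add: pairs_def)

definition srcs :: "strands => nat set" where "srcs nu = pr ` (Domain nu Int Pl)"
definition tgts :: "strands => nat set" where "tgts nu = pr ` (Range nu Int Pl)"

text \<open>The strand diagrams that survive multiplication by some idempotent on each side: at
  either end at most one place of a matched pair is used.\<close>

definition good :: "strands => bool" where
 "good nu \<longleftrightarrow> strand_diagram Z nu & inj_on pr (Domain nu Int Pl) & inj_on pr (Range nu Int Pl)"

definition hdat :: "strands => hdata" where
 "hdat nu = (h_grading nu, srcs nu, tgts nu)"

text \<open>The terms of one and the same diagram.\<close>

definition sim :: "strands => strands => bool" (infix "~~" 50) where
 "nu ~~ nu' \<longleftrightarrow> good nu & good nu' & mv nu = mv nu' & srcs nu = srcs nu' & tgts nu = tgts nu'"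

definition Dg :: "strands => vec" where
 "Dg nu = vecof {nu'. nu ~~ nu'}"

text \<open>Distinct diagrams have disjoint supports, so the elements of the strand algebra are the
  unions of classes of \<open>~~\<close>; see \<open>carrier_strand_alg\<close>.\<close>

definition inA :: "vec => bool" where
 "inA x \<longleftrightarrow> (\<forall>nu\<in>keys x. good nu) & (\<forall>nu nu'. nu ~~ nu' --> nu \<in> keys x --> nu' \<in> keys x)"

lemma sim_refl: "good nu ==> nu ~~ nu" by (simp add: sim_def)
lemma sim_sym: "nu ~~ nu' ==> nu' ~~ nu" by (simp add: sim_def)
lemma sim_trans: "nu ~~ nu' ==> nu' ~~ nu'' ==> nu ~~ nu''" by (simp add: sim_def)
lemma sim_good: "nu ~~ nu' ==> good nu" "nu ~~ nu' ==> good nu'" by (simp_all add: sim_def)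

lemma strand_diagramD:
 assumes "strand_diagram Z nu"
 shows "braid nu" "rising nu" "nu \<subseteq> points Z \<times> points Z" "finite nu"
  "Domain nu \<subseteq> points Z" "Range nu \<subseteq> points Z"
proof -
 show *: "nu \<subseteq> points Z \<times> points Z" using assms by (simp add: strand_diagram_def)
 then show "finite nu" by (rule finite_subset) simp
 moreover show r: "rising nu" using assms by (simp add: strand_diagram_def rising_def)
 moreover have "\<forall>(x, y)\<in>nu. fst x = fst y"
  by (auto dest!: rising_fst[OF r])
 ultimately show "braid nu" using assms by (simp add: strand_diagram_def braid_def)
 show "Domain nu \<subseteq> points Z" "Range nu \<subseteq> points Z" using Domain_mono[OF *] Range_mono[OF *] by auto
qed

lemma strand_diagramI: "braid nu ==> rising nu ==> nu \<subseteq> points Z \<times> points Z ==> strand_diagram Z nu"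
 by (simp add: strand_diagram_def braid_def rising_def)

lemma goodD:
 assumes "good nu"
 shows "strand_diagram Z nu" "braid nu" "rising nu" "nu \<subseteq> points Z \<times> points Z" "finite nu"
  "Domain nu \<subseteq> points Z" "Range nu \<subseteq> points Z" "inj_on pr (Domain nu Int Pl)" "inj_on pr (Range nu Int Pl)"
 using assms strand_diagramD[of nu] by (simp_all add: good_def)

lemma inA_braids: "inA x ==> braids x"
 unfolding inA_def braids_def using goodD by blast

lemma finite_good: "finite {nu. good nu}"
 by (rule finite_subset[of _ "Pow (points Z \<times> points Z)"]) (auto dest: goodD(4))

lemma finite_sim [simp]: "finite {nu'. nu ~~ nu'}"
 by (rule finite_subset[OF _ finite_good]) (auto simp: sim_def)

lemma keys_Dg [simp]: "keys (Dg nu) = {nu'. nu ~~ nu'}"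
 by (simp add: Dg_def)

lemma Dg_eq: "nu ~~ nu' ==> Dg nu = Dg nu'"
 by (simp add: Dg_def sim_def)

lemma inA_Dg: "inA (Dg nu)"
 unfolding inA_def keys_Dg using sim_good sim_trans by blast

lemma inA_0: "inA 0" by (simp add: inA_def)

lemma inA_add: "inA x ==> inA y ==> inA (x + y)"
 unfolding inA_def keys_add_bit using sim_sym by blast

lemma inA_sum: "(!!i. i \<in> I ==> inA (f i)) ==> inA (sum f I)"
 by (induction I rule: infinite_finite_induct) (auto simp: inA_0 inA_add)

definition sim_invariant :: "(strands => bool) => bool" where
 "sim_invariant Q \<longleftrightarrow> (\<forall>nu nu'. nu ~~ nu' --> Q nu --> Q nu')"

lemma inA_restr: "inA x ==> sim_invariant Q ==> inA (restr Q x)"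
 unfolding inA_def sim_invariant_def keys_restr by blast

subsection \<open>Spans of diagrams\<close>

lemma z2_span_0: "0 \<in> z2_span B"
 unfolding z2_span_def by (intro CollectI exI[of _ "{}"]) simp

lemma z2_span_step:
 assumes "x \<in> z2_span B" "D \<in> B"
 shows "x + D \<in> z2_span B"
proof -
 obtain F where F: "x = (\<Sum>D\<in>F. D)" "finite F" "F \<subseteq> B" using assms(1) by (auto simp: z2_span_def)
 show ?thesis
 proof (cases "D \<in> F")
  case True
  have "x = D + (\<Sum>D\<in>F - {D}. D)" unfolding F(1) using F(2) True by (rule sum.remove)
  then have "x + D = (\<Sum>D\<in>F - {D}. D)" by (simp add: add.commute add.left_commute)
  then show ?thesis using F unfolding z2_span_def by blast
 next
  case False
  then have "x + D = (\<Sum>D\<in>insert D F. D)" using F by (simp add: add.commute)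
  then show ?thesis using F assms(2) unfolding z2_span_def by blast
 qed
qed

text \<open>The support of an element contains with each term its whole class, so adding
  \<open>Dg nu\<close> strips off this class. Induction on the size of the support.\<close>

lemma z2_span_Dg:
 assumes "sim_invariant Q"
 shows "z2_span (Dg ` {nu. good nu & Q nu}) = {x. inA x & (\<forall>nu\<in>keys x. Q nu)}" (is "?L = ?R")
proof (intro subset_antisym subsetI)
 fix x assume "x \<in> ?L"
 then obtain F where F: "x = (\<Sum>D\<in>F. D)" "finite F" "F \<subseteq> Dg ` {nu. good nu & Q nu}" by (auto simp: z2_span_def)
 have 1: "inA D" "\<forall>nu\<in>keys D. Q nu" if D: "D \<in> F" for D
 proof -
  obtain nu where "D = Dg nu" "Q nu" using D F(3) by blast
  then show "inA D" "\<forall>nu\<in>keys D. Q nu" using inA_Dg assms unfolding sim_invariant_def by auto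
 qed
 have "inA x" unfolding F(1) using 1(1) by (rule inA_sum)
 moreover have "Q nu" if "nu \<in> keys x" for nu
  using subsetD[OF keys_sum_subset that[unfolded F(1)]] 1(2) by blast
 ultimately show "x \<in> ?R" by blast
next
 fix x assume "x \<in> ?R"
 then show "x \<in> ?L"
 proof (induction "card (keys x)" arbitrary: x rule: less_induct)
  case less
  show ?case
  proof (cases "x = 0")
   case True
   then show ?thesis by (simp add: z2_span_0)
  next
   case False
   then obtain nu where nu: "nu \<in> keys x" by (metis all_not_in_conv keys_eq_empty)
   have g: "good nu" "Q nu" "inA x" using less.prems nu unfolding inA_def by auto
   have sub: "{nu'. nu ~~ nu'} \<subseteq> keys x" using g(3) nu unfolding inA_def by blast
   have k: "keys (x + Dg nu) = keys x - {nu'. nu ~~ nu'}"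
    unfolding keys_add_bit keys_Dg using sub by blast
   have "card (keys (x + Dg nu)) < card (keys x)"
    unfolding k using nu sim_refl[OF g(1)] by (intro psubset_card_mono) auto
   moreover have "inA (x + Dg nu)" using g(3) inA_Dg inA_add by blast
   moreover have "\<forall>nu\<in>keys (x + Dg nu). Q nu" using less.prems unfolding k by blast
   ultimately have "x + Dg nu \<in> ?L" using less.hyps by blast
   moreover have "Dg nu \<in> Dg ` {nu. good nu & Q nu}" using g by blast
   ultimately have "x + Dg nu + Dg nu \<in> ?L" by (rule z2_span_step)
   then show ?thesis by (simp only: add.assoc add_self add.right_neutral)
  qed
 qed
qed

lemma h_grading_mv: "h_grading (mv nu) = h_grading nu"
proof -
 have "{(x, y) \<in> mv nu. fst x = i & snd x <= j & j < snd y} = {(x, y) \<in> nu. fst x = i & snd x <= j & j < snd y}" for i j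
  by (auto simp: mv_def)
 then show ?thesis unfolding h_grading_def by simp
qed

lemma sim_hdat: "nu ~~ nu' ==> hdat nu = hdat nu'"
 unfolding sim_def hdat_def using h_grading_mv by metis

lemma sim_invariant_hdat: "sim_invariant (%nu. P (hdat nu))"
 unfolding sim_invariant_def using sim_hdat by metis

subsection \<open>Idempotents\<close>

definition sections :: "nat set => point set set" where
 "sections s = {S. S \<subseteq> points Z & (\<forall>P\<in>pairs Z. card (S Int fibre Z P) = (if P \<in> s then 1 else 0))}"

lemma finite_sections: "finite (sections s)"
 by (rule finite_subset[of _ "Pow (points Z)"]) (auto simp: sections_def)

lemma in_sections:
 assumes "s \<subseteq> pairs Z"
 shows "S \<in> sections s \<longleftrightarrow> S \<subseteq> points Z & inj_on pr (S Int Pl) & pr ` (S Int Pl) = s"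
proof -
 have fin: "finite (S Int fibre Z P)" for P
  by (rule finite_subset[OF _ finite_places]) (auto simp: fibre_def)
 have el: "S Int fibre Z P = {p \<in> S Int Pl. pr p = P}" for P by (auto simp: fibre_def)
 have "(\<forall>P\<in>pairs Z. card (S Int fibre Z P) = (if P \<in> s then 1 else 0)) \<longleftrightarrow>
   inj_on pr (S Int Pl) & pr ` (S Int Pl) = s" (is "?L \<longleftrightarrow> ?R")
 proof
  assume L: ?L
  have c1: "card (S Int fibre Z P) <= Suc 0" if "P \<in> pairs Z" for P using L that by simp
  have "inj_on pr (S Int Pl)"
  proof (rule inj_onI)
   fix p q assume pq: "p \<in> S Int Pl" "q \<in> S Int Pl" "pr p = pr q"
   then have "p \<in> S Int fibre Z (pr p)" "q \<in> S Int fibre Z (pr p)" unfolding el by simp_all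
   then show "p = q" using c1[of "pr p"] pq pair_of_place card_le_Suc0_iff_eq[OF fin] by blast
  qed
  moreover have "pr ` (S Int Pl) = s"
  proof (intro subset_antisym subsetI)
   fix P assume "P \<in> pr ` (S Int Pl)"
   then obtain p where p: "p \<in> S Int Pl" "P = pr p" by blast
   then have "S Int fibre Z P ~= {}" unfolding el by blast
   then have "card (S Int fibre Z P) ~= 0" using fin by simp
   then show "P \<in> s" using L p pair_of_place by (metis Int_iff)
  next
   fix P assume "P \<in> s"
   then have "card (S Int fibre Z P) = 1" using L assms by auto
   then have "S Int fibre Z P ~= {}" by auto
   then show "P \<in> pr ` (S Int Pl)" unfolding el by blast
  qed
  ultimately show ?R ..
 next
  assume R: ?R
  show ?L
  proof
   fix P assume "P \<in> pairs Z"
   show "card (S Int fibre Z P) = (if P \<in> s then 1 else 0)"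
   proof (cases "P \<in> s")
    case True
    then obtain p where p: "p \<in> S Int Pl" "pr p = P" using R by blast
    have "S Int fibre Z P = {p}" unfolding el using p R inj_onD[of pr "S Int Pl"] by blast
    then show ?thesis using True by simp
   next
    case False
    then have "S Int fibre Z P = {}" unfolding el using R by blast
    then show ?thesis using False by simp
   qed
  qed
 qed
 then show ?thesis by (simp add: sections_def)
qed

lemma idem_eq: "idem Z s = vecof (Id_on ` sections s)"
proof -
 have "inj_on Id_on A" for A :: "point set set" by (rule inj_onI) (metis Domain_Id_on)
 then show ?thesis unfolding idem_def sections_def vecof_def basis_def by (simp add: sum.reindex)
qed

lemma ninv_Id_on [simp]: "ninv (Id_on S) = 0"
proof -
 have "inversions (Id_on S) = {}" by (auto simp: inversions_def Id_on_iff dest: pt_less_asym)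
 then show ?thesis by (simp add: ninv_def)
qed

lemma strand_mult_Id_left: "strand_mult (Id_on S) nu = (if S = Domain nu then basis nu else 0)"
proof -
 have "Id_on (Domain nu) O nu = nu" by auto
 then show ?thesis by (simp add: strand_mult_def)
qed

lemma strand_mult_Id_right: "strand_mult nu (Id_on S) = (if Range nu = S then basis nu else 0)"
proof -
 have "nu O Id_on (Range nu) = nu" by auto
 then show ?thesis by (auto simp only: strand_mult_def Domain_Id_on ninv_Id_on add_0_right if_True simp_thms split: if_split)
qed

lemma idem_left: "vec_mult (idem Z s) x = restr (%nu. Domain nu \<in> sections s) x"
proof -
 have inj: "inj_on Id_on A" for A :: "point set set" by (rule inj_onI) (metis Domain_Id_on)
 have "vec_mult (idem Z s) x = lin (%nu. lin (%mu. strand_mult mu nu) (idem Z s)) x"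
  unfolding vec_mult_lin by (rule lin_swap)
 also have "... = lin (%nu. if Domain nu \<in> sections s then basis nu else 0) x"
 proof (rule lin_cong)
  fix nu
  have "lin (%mu. strand_mult mu nu) (idem Z s) = (\<Sum>S\<in>sections s. strand_mult (Id_on S) nu)"
   unfolding idem_eq using finite_sections inj by (simp add: lin_vecof sum.reindex)
  also have "... = (if Domain nu \<in> sections s then basis nu else 0)"
   unfolding strand_mult_Id_left using finite_sections by simp
  finally show "lin (%mu. strand_mult mu nu) (idem Z s) = ..." .
 qed
 finally show ?thesis by (simp only: restr_def basis_def)
qed

lemma idem_right: "vec_mult x (idem Z s) = restr (%nu. Range nu \<in> sections s) x"
proof -
 have inj: "inj_on Id_on A" for A :: "point set set" by (rule inj_onI) (metis Domain_Id_on)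
 have "vec_mult x (idem Z s) = lin (%nu. if Range nu \<in> sections s then basis nu else 0) x"
  unfolding vec_mult_lin
 proof (rule lin_cong)
  fix nu
  have "lin (strand_mult nu) (idem Z s) = (\<Sum>S\<in>sections s. strand_mult nu (Id_on S))"
   unfolding idem_eq using finite_sections inj by (simp add: lin_vecof sum.reindex)
  also have "... = (if Range nu \<in> sections s then basis nu else 0)"
   unfolding strand_mult_Id_right using finite_sections by simp
  finally show "lin (strand_mult nu) (idem Z s) = ..." .
 qed
 then show ?thesis by (simp only: restr_def basis_def)
qed

lemma single_valued_Un:
 "single_valued r ==> single_valued s ==> Domain r Int Domain s = {} ==> single_valued (r Un s)"
 unfolding single_valued_def by blast

lemma strand_diagram_mv: "strand_diagram Z nu ==> strand_diagram Z (mv nu)"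
 unfolding strand_diagram_def mv_def by (auto intro: single_valued_subset[of _ nu] single_valued_subset[of _ "nu^-1"])

lemma mv_Id: "nu = mv nu Un Id_on {v. (v, v) \<in> nu}"
 by (auto simp: mv_def)

lemma mv_horizontal_disjoint:
 assumes "braid nu" "(v, v) \<in> nu"
 shows "v \<notin> Domain (mv nu)" "v \<notin> Range (mv nu)"
proof -
 have *: "(v, w) \<in> nu ==> v = w" "(w, v) \<in> nu ==> v = w" for w
  using assms unfolding braid_def single_valued_def converse_iff by metis+
 then show "v \<notin> Domain (mv nu)" "v \<notin> Range (mv nu)" unfolding Domain_iff Range_iff in_mv by blast+
qed

text \<open>Products with identity diagrams create no crossings, so the idempotents merely select
  among the terms of \<open>add_horizontals\<close> those with the right pairs at their
  ends.\<close>

lemma dgm_eq: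
 assumes "strand_diagram Z mu" "\<forall>(x, y)\<in>mu. x ~= y" "s \<subseteq> pairs Z" "t \<subseteq> pairs Z"
 shows "dgm Z s mu t = vecof {nu. good nu & mv nu = mu & srcs nu = s & tgts nu = t}"
proof -
 let ?U = "Pow (points Z - (Domain mu Un Range mu))"
 let ?f = "%U. mu Un Id_on U"
 have mvf: "mv (?f U) = mu" for U using assms(2) by (auto simp: mv_def)
 have inj: "inj_on ?f ?U"
 proof (rule inj_onI)
  fix U V assume *: "U \<in> ?U" "V \<in> ?U" "?f U = ?f V"
  have "Domain (?f U) - Domain mu = Domain (?f V) - Domain mu" using *(3) by simp
  moreover have "Domain (?f W) - Domain mu = W" if "W \<in> ?U" for W using that by auto
  ultimately show "U = V" using * by metis
 qed
 have fU: "finite ?U" by simp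
 have ah: "add_horizontals Z mu = vecof (?f ` ?U)"
  unfolding add_horizontals_def vecof_def sum.reindex[OF inj] basis_def o_def ..
 have "nu \<in> ?f ` ?U & Domain nu \<in> sections s & Range nu \<in> sections t \<longleftrightarrow>
   good nu & mv nu = mu & srcs nu = s & tgts nu = t" for nu
 proof -
  have "nu \<in> ?f ` ?U \<longleftrightarrow> strand_diagram Z nu & mv nu = mu"
  proof
   assume "nu \<in> ?f ` ?U"
   then obtain U where U: "nu = ?f U" "U \<subseteq> points Z" "U Int (Domain mu Un Range mu) = {}" by blast
   have p: "nu \<subseteq> points Z \<times> points Z" using U strand_diagramD(3)[OF assms(1)] by (auto simp: Id_on_iff)
   have r: "rising nu" using strand_diagramD(2)[OF assms(1)] unfolding U(1) rising_def by (auto simp: Id_on_iff)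
   have sv: "single_valued nu"
    using assms(1) U(3) unfolding U(1) strand_diagram_def
    by (intro single_valued_Un) (auto simp: Int_Un_distrib2 Int_commute)
   have "nu^-1 = mu^-1 Un Id_on U" unfolding U(1) by auto
   moreover have "single_valued (mu^-1 Un Id_on U)"
    using assms(1) U(3) unfolding strand_diagram_def
    by (intro single_valued_Un) (auto simp: Int_Un_distrib2 Int_commute)
   ultimately have "strand_diagram Z nu" using p r sv unfolding strand_diagram_def rising_def by simp
   then show "strand_diagram Z nu & mv nu = mu" using mvf U by simp
  next
   assume *: "strand_diagram Z nu & mv nu = mu"
   define U where "U = {v. (v, v) \<in> nu}"
   have "nu = ?f U" using mv_Id[of nu] * by (simp add: U_def)
   moreover have "U \<in> ?U"
    using * mv_horizontal_disjoint[OF strand_diagramD(1)] strand_diagramD(3)[of nu] unfolding U_def by blast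
   ultimately show "nu \<in> ?f ` ?U" by blast
  qed
  moreover have "Domain nu \<in> sections s \<longleftrightarrow> inj_on pr (Domain nu Int Pl) & srcs nu = s"
   "Range nu \<in> sections t \<longleftrightarrow> inj_on pr (Range nu Int Pl) & tgts nu = t" if "strand_diagram Z nu"
   unfolding in_sections[OF assms(3)] in_sections[OF assms(4)] srcs_def tgts_def
   using strand_diagramD(5,6)[OF that] by simp_all
  ultimately show ?thesis unfolding good_def by meson
 qed
 then have "{nu \<in> {nu \<in> ?f ` ?U. Domain nu \<in> sections s}. Range nu \<in> sections t} =
   {nu. good nu & mv nu = mu & srcs nu = s & tgts nu = t}" by blast
 moreover have "finite {nu. good nu & mv nu = mu & srcs nu = s & tgts nu = t}"
  by (rule finite_subset[OF _ finite_good]) auto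
 ultimately show ?thesis
  unfolding dgm_def idem_left idem_right ah by (intro vec_eqI) (simp add: fU)
qed

lemma srcs_pairs: "srcs nu \<subseteq> pairs Z" "tgts nu \<subseteq> pairs Z"
 using pair_of_place by (auto simp: srcs_def tgts_def)

lemma Dg_dgm: "good nu ==> Dg nu = dgm Z (srcs nu) (mv nu) (tgts nu)"
proof -
 assume g: "good nu"
 have "{nu'. nu ~~ nu'} = {nu'. good nu' & mv nu' = mv nu & srcs nu' = srcs nu & tgts nu' = tgts nu}"
  using g unfolding sim_def by auto
 moreover have "\<forall>(x, y)\<in>mv nu. x ~= y" by (auto simp: mv_def)
 ultimately show ?thesis
  unfolding Dg_def using dgm_eq[OF strand_diagram_mv[OF goodD(1)[OF g]]] srcs_pairs by simp
qed

lemma diagrams_with_eq: "diagrams_with Z d = Dg ` {nu. good nu & hdat nu = d}"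
proof -
 obtain h s t where d: "d = (h, s, t)" by (metis surj_pair)
 show ?thesis
 proof (intro subset_antisym subsetI)
  fix D assume "D \<in> diagrams_with Z d"
  then obtain mu where mu: "D = dgm Z s mu t" "strand_diagram Z mu" "\<forall>(x, y)\<in>mu. x ~= y" "s \<subseteq> pairs Z"
   "t \<subseteq> pairs Z" "h_grading mu = h" "dgm Z s mu t ~= 0"
   unfolding d diagrams_with_def case_prod_conv by blast
  have e: "dgm Z s mu t = vecof {nu. good nu & mv nu = mu & srcs nu = s & tgts nu = t}"
   by (rule dgm_eq[OF mu(2-5)])
  have "vecof {} = (0 :: vec)" by (simp add: vecof_def)
  then have "{nu. good nu & mv nu = mu & srcs nu = s & tgts nu = t} ~= {}"
   using mu(7) e by metis
  then obtain nu where nu: "good nu" "mv nu = mu" "srcs nu = s" "tgts nu = t" by blast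
  then have "D = Dg nu" using Dg_dgm mu by simp
  moreover have "hdat nu = d" using nu mu(6) h_grading_mv[of nu] by (simp add: hdat_def d)
  ultimately show "D \<in> Dg ` {nu. good nu & hdat nu = d}" using nu by blast
 next
  fix D assume "D \<in> Dg ` {nu. good nu & hdat nu = d}"
  then obtain nu where nu: "D = Dg nu" "good nu" "hdat nu = d" by blast
  have n0: "D ~= 0"
  proof
   assume "D = 0"
   then have "{nu'. nu ~~ nu'} = {}" unfolding keys_Dg[symmetric] nu(1)[symmetric] by simp
   then show False using sim_refl[OF nu(2)] by blast
  qed
  have m: "\<forall>(x, y)\<in>mv nu. x ~= y" by (auto simp: mv_def)
  have e: "srcs nu = s" "tgts nu = t" "h_grading (mv nu) = h"
   using nu(3) by (simp_all add: hdat_def d h_grading_mv)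
  show "D \<in> diagrams_with Z d"
   unfolding d diagrams_with_def case_prod_conv
   by (intro CollectI exI[of _ "mv nu"] conjI)
    (use n0 m e srcs_pairs[of nu] strand_diagram_mv[OF goodD(1)[OF nu(2)]] Dg_dgm[OF nu(2)] nu(1) in simp_all)
 qed
qed

lemma diagrams_eq: "diagrams Z = Dg ` {nu. good nu}"
 unfolding diagrams_def diagrams_with_eq by blast

lemma alg_summand_eq: "x \<in> summand d \<longleftrightarrow> inA x & (\<forall>nu\<in>keys x. hdat nu = d)"
 unfolding alg_summand_def diagrams_with_eq
 using z2_span_Dg[OF sim_invariant_hdat[of "%e. e = d"]] by simp

lemma carrier_strand_alg: "x \<in> carrier (strand_alg Z) \<longleftrightarrow> inA x"
 unfolding strand_alg_def diagrams_eq using z2_span_Dg[of "%_. True"] by (simp add: sim_invariant_def)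

end

context arc
begin

section \<open>Closure under differential and product\<close>

lemma reduces_good:
 assumes "good al" "reduces al nu"
 shows "good nu" "Domain nu = Domain al" "Range nu = Range al" "srcs nu = srcs al" "tgts nu = tgts al"
proof -
 obtain x y x' y' where r: "(x, y) \<in> al" "(x', y') \<in> al" "x \<prec> x'" "y' \<prec> y" "nu = resolve al (x, y) (x', y')"
  using assms(2) unfolding reduces_def by blast
 have ne: "(x, y) ~= (x', y')" "fst x = fst x'" using r(3) by (auto simp: pt_less_def)
 note p = resolve_props[OF goodD(2)[OF assms(1)] r(1,2) ne(1), unfolded fst_conv snd_conv, OF ne(2), folded r(5)]
 show D: "Domain nu = Domain al" "Range nu = Range al" using p by blast+
 have xy: "x' = y' \<or> x' \<prec> y'" using risingD[OF goodD(3)[OF assms(1)] r(2)] .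
 have "x \<prec> y'" "x' \<prec> y" using xy r(3,4) pt_less_trans by blast+
 then have "rising nu" using goodD(3)[OF assms(1)] unfolding r(5) resolve_def rising_def by simp
 moreover have "nu \<subseteq> points Z \<times> points Z"
  using r(1,2) goodD(4)[OF assms(1)] unfolding r(5) resolve_def by auto
 ultimately have "strand_diagram Z nu" using p(1) strand_diagramI by blast
 then show "good nu" using goodD(8,9)[OF assms(1)] unfolding good_def D by simp
 show "srcs nu = srcs al" "tgts nu = tgts al" unfolding srcs_def tgts_def D by simp_all
qed

text \<open>Diagrams \<open>nu ~~ nu'\<close> differ only in horizontal strands, and only strands of \<open>al\<close> that become moving
 strands of \<open>nu\<close> are resolved.\<close>

definition shift :: "strands => strands => strands => strands" where
 "shift nu nu' al = (nu' - (nu - al)) Un (al - nu)"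

text \<open>Both strands created by the resolution move, hence they belong to every
  \<open>nu'\<close> with \<open>nu ~~ nu'\<close>. So the same resolution can be undone in
  \<open>nu'\<close>.\<close>

lemma reduces_shift:
 assumes "good al" "reduces al nu" "nu ~~ nu'"
 shows "reduces (shift nu nu' al) nu'" "shift nu nu' al ~~ al" "shift nu' nu (shift nu nu' al) = al"
proof -
 obtain x y x' y' where r: "(x, y) \<in> al" "(x', y') \<in> al" "x \<prec> x'" "y' \<prec> y" "nu = resolve al (x, y) (x', y')"
  and bt: "\<forall>(c, d)\<in>al. \<not> (x \<prec> c & c \<prec> x' & y' \<prec> d & d \<prec> y)"
  using assms(2) unfolding reduces_def by blast
 have ne: "(x, y) ~= (x', y')" "fst x = fst x'" "x ~= x'" "y ~= y'" using r(3,4) by (auto simp: pt_less_def)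
 note p = resolve_props[OF goodD(2)[OF assms(1)] r(1,2) ne(1), unfolded fst_conv snd_conv, OF ne(2), folded r(5)]
 have xy: "x' = y' \<or> x' \<prec> y'" using risingD[OF goodD(3)[OF assms(1)] r(2)] .
 have c: "x \<prec> y'" "x' \<prec> y" using xy r(3,4) pt_less_trans by blast+
 then have xne: "x ~= y'" "x' ~= y" by auto
 have mvs: "mv nu = mv nu'" using assms(3) by (simp add: sim_def)
 have g: "good nu" "good nu'" using assms(3) by (simp_all add: sim_def)
 have innu: "(x, y') \<in> nu" "(x', y) \<in> nu" unfolding r(5) resolve_def by auto
 then have "(x, y') \<in> mv nu" "(x', y) \<in> mv nu" using xne by (auto simp: in_mv)
 then have innu': "(x, y') \<in> nu'" "(x', y) \<in> nu'" unfolding mvs by (auto simp: in_mv)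
 define al' where "al' = resolve nu' (x, y') (x', y)"
 have s: "shift nu nu' al = al'"
  unfolding shift_def al'_def resolve_def p(5,6) by simp
 have ne': "(x, y') ~= (x', y)" using ne by simp
 note p' = resolve_props[OF goodD(2)[OF g(2)] innu' ne', unfolded fst_conv snd_conv, OF ne(2), folded al'_def]
 have inal': "(x, y) \<in> al'" "(x', y') \<in> al'" unfolding al'_def resolve_def by auto
 have "(c, d) \<in> al" if "(c, d) \<in> al'" "c ~= d" for c d
 proof (cases "(c, d) \<in> nu'")
  case True
  then have "(c, d) \<in> nu" using mvs that(2) in_mv by metis
  moreover have "(c, d) \<notin> {(x, y'), (x', y)}" using that(1) True unfolding p'(5)[symmetric] by simp
  ultimately have "(c, d) \<notin> nu - al" "(c, d) \<in> nu" unfolding p(6) by simp_all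
  then show ?thesis by simp
 next
  case False
  then have "(c, d) \<in> {(x, y), (x', y')}" using that(1) unfolding p'(6)[symmetric] by simp
  then show ?thesis using r(1,2) by (elim insertE emptyE) simp_all
 qed
 \<comment> \<open>A horizontal strand cannot lie between the resolved strands: it would start
   before x' and end after y', while x' is at most y'. So only moving strands could obstruct, and
   these are shared.\<close>
 moreover have "\<not> (x \<prec> c & c \<prec> x' & y' \<prec> c & c \<prec> y)" for c
  using xy pt_less_trans pt_less_asym by metis
 ultimately have "\<forall>(c, d)\<in>al'. \<not> (x \<prec> c & c \<prec> x' & y' \<prec> d & d \<prec> y)"
  using bt by (smt (verit, best) case_prodD case_prodI2)
 then show "reduces (shift nu nu' al) nu'"
  unfolding s reduces_def
  by (intro exI[of _ x] exI[of _ y] exI[of _ x'] exI[of _ y'] conjI inal' r(3,4) p'(4)[symmetric])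
 have mv: "mv (resolve mu a b) = (mv mu - {a, b}) Un mv {(fst a, snd b), (fst b, snd a)}" for mu a b
  by (auto simp: mv_def resolve_def)
 have mval: "mv al' = mv al"
 proof -
  have "al = resolve nu (x, y') (x', y)" using p(4) by simp
  then show ?thesis unfolding al'_def mv mvs by (simp add: mv mvs)
 qed
 have "rising al'"
  using goodD(3)[OF g(2)] risingD[OF goodD(3)[OF assms(1)] r(1)] xy unfolding al'_def resolve_def rising_def by simp
 moreover have "al' \<subseteq> points Z \<times> points Z"
  using innu' goodD(4)[OF g(2)] unfolding al'_def resolve_def by auto
 ultimately have "strand_diagram Z al'" using p'(1) strand_diagramI by blast
 then have gal': "good al'" using goodD(8,9)[OF g(2)] p'(2,3) unfolding good_def by simp
 have "srcs al' = srcs nu'" "tgts al' = tgts nu'" using p'(2,3) unfolding srcs_def tgts_def by simp_all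
 moreover have "srcs nu' = srcs nu" "tgts nu' = tgts nu" using assms(3) by (simp_all add: sim_def)
 ultimately show "shift nu nu' al ~~ al"
  unfolding s sim_def using gal' assms(1) mval reduces_good(4,5)[OF assms(1,2)] by simp
 have "shift nu' nu al' = resolve nu (x, y') (x', y)"
  unfolding shift_def resolve_def p'(5,6) by simp
 then show "shift nu' nu (shift nu nu' al) = al" unfolding s using p(4) by simp
qed

text \<open>\<open>shift\<close> matches the terms of \<open>x\<close> that reduce to
  \<open>nu\<close> with those that reduce to \<open>nu'\<close>, so the two parities agree.\<close>

lemma inA_vec_diff:
 assumes "inA x"
 shows "inA (vec_diff x)"
proof -
 have k: "keys (vec_diff x) = {nu. odd (card {al \<in> keys x. reduces al nu})}"
  by (rule keys_vec_diff[OF inA_braids[OF assms]])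
 have good: "good al" if "al \<in> keys x" for al using assms that by (simp add: inA_def)
 have cl: "al' \<in> keys x" if "al \<in> keys x" "al ~~ al'" for al al'
  using assms that unfolding inA_def by blast
 have 1: "good nu" if "nu \<in> keys (vec_diff x)" for nu
 proof -
  have "{al \<in> keys x. reduces al nu} ~= {}" using that unfolding k mem_Collect_eq by (metis card.empty even_zero)
  then show ?thesis using reduces_good(1) good by blast
 qed
 have 2: "card {al \<in> keys x. reduces al nu} = card {al \<in> keys x. reduces al nu'}"
  if s: "nu ~~ nu'" for nu nu'
 proof (rule bij_betw_same_card[of "shift nu nu'"], rule bij_betw_byWitness[where f' = "shift nu' nu"])
  show "\<forall>al\<in>{al \<in> keys x. reduces al nu}. shift nu' nu (shift nu nu' al) = al"
   using reduces_shift(3) good s by blast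
  show "\<forall>al\<in>{al \<in> keys x. reduces al nu'}. shift nu nu' (shift nu' nu al) = al"
   using reduces_shift(3) good sim_sym[OF s] by blast
  show "shift nu nu' ` {al \<in> keys x. reduces al nu} \<subseteq> {al \<in> keys x. reduces al nu'}"
   using reduces_shift(1)[OF good _ s] cl[OF _ sim_sym[OF reduces_shift(2)[OF good _ s]]] by blast
  show "shift nu' nu ` {al \<in> keys x. reduces al nu'} \<subseteq> {al \<in> keys x. reduces al nu}"
   using reduces_shift(1)[OF good _ sim_sym[OF s]] cl[OF _ sim_sym[OF reduces_shift(2)[OF good _ sim_sym[OF s]]]] by blast
 qed
 show ?thesis unfolding inA_def using 1 2 unfolding k by simp
qed

text \<open>Trades the horizontal strands of \<open>gm\<close> for those of \<open>gm'\<close>. A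
  horizontal strand of a product is horizontal in both factors, so the same trade is made in each of
  them.\<close>

definition replace :: "strands => strands => strands => strands" where
 "replace gm gm' al = (al - (gm - gm')) Un (gm' - gm)"

lemma end_places: "p \<in> points Z ==> p \<notin> Pl ==> (\<forall>q\<in>points Z. \<not> q \<prec> p) \<or> (\<forall>q\<in>points Z. \<not> p \<prec> q)"
 by (cases p) (auto simp: points_def places_def pt_less_def)

lemma card_bij_betw_pairs:
 assumes "!!p. p \<in> A ==> f p \<in> B & g (f p) = p" "!!p. p \<in> B ==> g p \<in> A & f (g p) = p"
 shows "card A = card B"
 by (rule bij_betw_same_card[of f], rule bij_betw_byWitness[where f' = g]) (use assms in blast)+

lemma relcomp_Un_Id:
 assumes "Range al Int V = {}" "Domain be Int V = {}"
 shows "(al Un Id_on V) O (be Un Id_on V) = al O be Un Id_on V"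
 using assms by (auto simp: Id_on_iff)

lemma Un_cancel_disjoint: "A Un V = B Un V ==> V Int A = {} ==> V Int B = {} ==> A = B"
 by blast

lemma mv_Un_Id: "mv (X Un Id_on W) = mv X"
 by (auto simp: mv_def Id_on_iff)

text \<open>The crossings of a horizontal strand are additive by \<open>over_comp\<close>, so
  trading it in both factors keeps inversion numbers additive, provided that no other strand of the
  factors stops at the new point in the middle. Excluding the latter is what takes the work.\<close>

lemma composes_replace:
 assumes ga: "good al" and gb: "good be" and c: "composes al be gm" and s: "gm ~~ gm'"
 shows "composes (replace gm gm' al) (replace gm gm' be) gm'" "replace gm gm' al ~~ al" "replace gm gm' be ~~ be"
  "replace gm' gm (replace gm gm' al) = al" "replace gm' gm (replace gm gm' be) = be"
proof -
 have R: "Range al = Domain be" and n: "ninv (al O be) = ninv al + ninv be" and gm: "gm = al O be"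
  using c by (auto simp only: composes_def)
 have g: "good gm" "good gm'" and mvs: "mv gm = mv gm'" and st: "srcs gm = srcs gm'" "tgts gm = tgts gm'"
  using s by (auto simp only: sim_def)
 define V where "V = {v. (v, v) \<in> gm}"
 define V' where "V' = {v. (v, v) \<in> gm'}"
 define gm0 where "gm0 = mv gm"
 define al0 where "al0 = al - Id_on V"
 define be0 where "be0 = be - Id_on V"
 have gme: "gm = gm0 Un Id_on V" using mv_Id[of gm] by (simp only: gm0_def V_def)
 have gm'e: "gm' = gm0 Un Id_on V'" using mv_Id[of gm'] by (simp only: gm0_def V'_def mvs)
 have sval: "(x, y) \<in> al ==> (x, z) \<in> al ==> y = z" "(x, y) \<in> al ==> (z, y) \<in> al ==> x = z" for x y z
  using goodD(2)[OF ga] unfolding braid_def single_valued_def converse_iff by metis+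
 have svbe: "(x, y) \<in> be ==> (x, z) \<in> be ==> y = z" "(x, y) \<in> be ==> (z, y) \<in> be ==> x = z" for x y z
  using goodD(2)[OF gb] unfolding braid_def single_valued_def converse_iff by metis+
 \<comment> \<open>Strands rise, so a strand that is back at its start has never left it.\<close>
 have Vab: "(v, v) \<in> al & (v, v) \<in> be" if v: "v \<in> V" for v
 proof -
  obtain w where w: "(v, w) \<in> al" "(w, v) \<in> be" using v unfolding V_def gm by blast
  have "v = w \<or> v \<prec> w" "w = v \<or> w \<prec> v"
   using risingD[OF goodD(3)[OF ga] w(1)] risingD[OF goodD(3)[OF gb] w(2)] by auto
  then have "v = w" using pt_less_asym by blast
  then show ?thesis using w by simp
 qed
 have ale: "al = al0 Un Id_on V" and bee: "be = be0 Un Id_on V"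
  using Vab unfolding al0_def be0_def by auto
 have dV: "V Int Domain al0 = {}" "V Int Range al0 = {}" "V Int Domain be0 = {}" "V Int Range be0 = {}"
  using Vab sval svbe unfolding al0_def be0_def Id_on_iff by blast+
 have dgm: "V Int Domain gm0 = {}" "V Int Range gm0 = {}" "V' Int Domain gm0 = {}" "V' Int Range gm0 = {}"
  using mv_horizontal_disjoint[OF goodD(2)[OF g(1)]] mv_horizontal_disjoint[OF goodD(2)[OF g(2)]]
  unfolding V_def V'_def gm0_def mvs by blast+
 have R0: "Range al0 = Domain be0"
 proof -
  have "Range al = Range al0 Un V" "Domain be = Domain be0 Un V" unfolding ale bee by auto
  then show ?thesis using R Un_cancel_disjoint[OF _ dV(2,3)] by simp
 qed
 have gm0: "gm0 = al0 O be0"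
 proof -
  have "gm0 Un Id_on V = al0 O be0 Un Id_on V"
   using gm unfolding gme ale bee using relcomp_Un_Id[of al0 V be0] dV by blast
  moreover have "gm0 Int Id_on V = {}" using dgm by (auto simp: Id_on_iff)
  moreover have "(al0 O be0) Int Id_on V = {}" using dV by (auto simp: Id_on_iff)
  ultimately show ?thesis by blast
 qed
 have D0: "Domain gm0 = Domain al0" "Range gm0 = Range be0"
  unfolding gm0 using Domain_relcomp_eq[OF R0] Range_relcomp_eq[OF R0] by simp_all
 have b0: "braid al0" "braid be0" "rising al0" "rising be0"
 proof -
  have br: "braid (mu - X)" if "braid mu" for mu X
   using that unfolding braid_def
   by (auto intro: single_valued_subset[of "mu - X" mu] single_valued_subset[of "(mu - X)^-1" "mu^-1"])
  show "braid al0" "braid be0" unfolding al0_def be0_def using br goodD(2) ga gb by blast+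
  show "rising al0" "rising be0" unfolding al0_def be0_def using goodD(3)[OF ga] goodD(3)[OF gb]
   by (auto simp: rising_def)
 qed
 have pV: "V \<subseteq> points Z" "V' \<subseteq> points Z"
  using goodD(4)[OF g(1)] goodD(4)[OF g(2)] unfolding V_def V'_def by blast+
 have fV: "finite V" "finite V'" using pV finite_points finite_subset by blast+
 have DV: "Domain gm = Domain gm0 Un V" "Domain gm' = Domain gm0 Un V'" "Range gm = Range gm0 Un V" "Range gm' = Range gm0 Un V'"
  unfolding gme gm'e by auto
 have prV: "pr ` (V Int Pl) = pr ` (V' Int Pl)"
 proof -
  have e: "pr ` (W Int Pl) = pr ` ((E Un W) Int Pl) - pr ` (E Int Pl)"
   if "inj_on pr ((E Un W) Int Pl)" "W Int E = {}" for E W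
  proof -
   have "pr ` (((E Un W) Int Pl) - (E Int Pl)) = pr ` ((E Un W) Int Pl) - pr ` (E Int Pl)"
    by (rule inj_on_image_set_diff[OF that(1)]) auto
   moreover have "((E Un W) Int Pl) - (E Int Pl) = W Int Pl" using that(2) by auto
   ultimately show ?thesis by simp
  qed
  show ?thesis
   using e[of "Domain gm0" V] e[of "Domain gm0" V'] goodD(8)[OF g(1)] goodD(8)[OF g(2)] dgm st(1)
   unfolding DV srcs_def by simp
 qed
 have RV: "Range al = Range al0 Un V" unfolding ale by auto
 \<comment> \<open>If \<open>w\<close> is a place, a strand through \<open>w\<close> in the middle
   would use a pair that a strand of \<open>V\<close> already uses there. If \<open>w\<close> is an
   end of an interval, a strand cannot both arrive and leave there, so \<open>w\<close> is an
   endpoint of a moving strand of the product, which \<open>V'\<close> avoids.\<close>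
 have dV': "V' Int Range al0 = {}"
 proof (rule ccontr)
  assume "V' Int Range al0 ~= {}"
  then obtain w where w: "w \<in> V'" "w \<in> Range al0" by blast
  show False
  proof (cases "w \<in> Pl")
   case True
   then have "pr w \<in> pr ` (V Int Pl)" using prV w by blast
   then obtain v where "pr w = pr v" "v \<in> V Int Pl" by (rule imageE)
   then have v: "v \<in> V" "v \<in> Pl" "pr v = pr w" by simp_all
   have "v = w" using goodD(9)[OF ga] v w True unfolding RV by (auto dest: inj_onD)
   then show False using v w dV by blast
  next
   case False
   obtain u z where uz: "(u, w) \<in> al0" "(w, z) \<in> be0" using w(2) R0 by blast
   have pts: "u \<in> points Z" "w \<in> points Z" "z \<in> points Z"
    using uz goodD(4)[OF ga] goodD(4)[OF gb] unfolding al0_def be0_def by blast+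
   have "u = w \<or> w = z"
    using end_places[OF pts(2) False] pts risingD[OF b0(3) uz(1)] risingD[OF b0(4) uz(2)] by blast
   then have "w \<in> Domain al0 \<or> w \<in> Range be0" using uz by blast
   then show False using w(1) dgm(3,4) unfolding D0[symmetric] disjoint_iff by meson
  qed
 qed
 define al' where "al' = al0 Un Id_on V'"
 define be' where "be' = be0 Un Id_on V'"
 have r: "replace gm gm' al = al'" "replace gm gm' be = be'" "replace gm' gm al' = al" "replace gm' gm be' = be"
 proof -
  have d: "X Int Id_on W = {}" if "W Int Domain X = {}" for X W using that by (auto simp: Id_on_iff)
  have dd: "gm0 Int Id_on V = {}" "gm0 Int Id_on V' = {}" "al0 Int Id_on V = {}" "al0 Int Id_on V' = {}"
   "be0 Int Id_on V = {}" "be0 Int Id_on V' = {}"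
   using d[OF dgm(1)] d[OF dgm(3)] d[OF dV(1)] d[OF dgm(3)[unfolded D0]] d[OF dV(3)] d[OF dV'[unfolded R0]]
   by simp_all
  have 1: "gm - gm' = Id_on V - Id_on V'" "gm' - gm = Id_on V' - Id_on V"
   unfolding gme gm'e using dd by blast+
  show "replace gm gm' al = al'" "replace gm gm' be = be'" "replace gm' gm al' = al" "replace gm' gm be' = be"
   unfolding replace_def 1 unfolding ale bee al'_def be'_def using dd by blast+
 qed
 \<comment> \<open>The sums of \<open>over\<close> on the two sides cancel, so additivity of
   inversions can be tested on the parts without these horizontal strands, and carries over from
   \<open>V\<close> to \<open>V'\<close>.\<close>
 have nn: "ninv (gm0 Un Id_on W) = ninv (al0 Un Id_on W) + ninv (be0 Un Id_on W) \<longleftrightarrow> ninv gm0 = ninv al0 + ninv be0"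
  if W: "finite W" "W Int Domain gm0 = {}" "W Int Range gm0 = {}" "W Int Range al0 = {}" for W
 proof -
  have bgm: "braid gm0" "rising gm0"
  proof -
   show "braid gm0" unfolding gm0 using braid_comp b0 R0 by blast
   show "rising gm0" unfolding gm0_def using goodD(3)[OF g(1)] by (auto simp: rising_def mv_def)
  qed
  have "(\<Sum>v\<in>W. over gm0 v) = (\<Sum>v\<in>W. over al0 v) + (\<Sum>v\<in>W. over be0 v)"
   unfolding sum.distrib[symmetric] gm0
   by (rule sum.cong[OF refl], rule over_comp) (use b0 R0 W in auto)
  moreover have "W Int (Domain gm0 Un Range gm0) = {}" "W Int (Domain al0 Un Range al0) = {}" "W Int (Domain be0 Un Range be0) = {}"
   using W unfolding D0 R0 Int_Un_distrib by simp_all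
  ultimately show ?thesis
   using ninv_horizontals[OF bgm W(1)] ninv_horizontals[OF b0(1,3) W(1)] ninv_horizontals[OF b0(2,4) W(1)] by simp
 qed
 have n': "ninv gm' = ninv al' + ninv be'"
  using n nn[of V] nn[of V'] fV dV dV' dgm unfolding gm[symmetric] unfolding gme gm'e ale bee al'_def be'_def by blast
 have comp': "al' O be' = gm'"
  unfolding al'_def be'_def gm'e gm0 using relcomp_Un_Id[of al0 V' be0] dV' R0 by blast
 have RR: "Range al' = Domain be'" unfolding al'_def be'_def using R0 by auto
 show "composes (replace gm gm' al) (replace gm gm' be) gm'"
  unfolding r composes_def using RR n' comp' by simp
 show "replace gm' gm (replace gm gm' al) = al" "replace gm' gm (replace gm gm' be) = be" unfolding r by simp_all
 have D': "Domain al' = Domain gm'" "Range be' = Range gm'" "Range al' = Range al0 Un V'"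
  unfolding al'_def be'_def DV D0 by auto
 have Rinj: "inj_on pr (Range al' Int Pl)" and Rtg: "pr ` (Range al' Int Pl) = pr ` (Range al Int Pl)"
 proof -
  have iV': "inj_on pr (V' Int Pl)" using goodD(8)[OF g(2)] unfolding DV by (auto intro: inj_on_subset)
  have i: "inj_on pr (Range al0 Int Pl)" using goodD(9)[OF ga] unfolding RV by (auto intro: inj_on_subset)
  have "pr ` (Range al0 Int Pl) Int pr ` (V Int Pl) = {}"
  proof (rule ccontr)
   assume "pr ` (Range al0 Int Pl) Int pr ` (V Int Pl) ~= {}"
   then obtain z where z: "z \<in> pr ` (Range al0 Int Pl)" "z \<in> pr ` (V Int Pl)" by blast
   obtain a where a: "z = pr a" "a \<in> Range al0 Int Pl" using z(1) by (rule imageE)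
   obtain b where b: "z = pr b" "b \<in> V Int Pl" using z(2) by (rule imageE)
   have ab: "a \<in> Range al0" "a \<in> Pl" "b \<in> V" "b \<in> Pl" "pr a = pr b" using a b by simp_all
   then have "a = b" using goodD(9)[OF ga] unfolding RV by (auto dest: inj_onD)
   then show False using ab dV by blast
  qed
  then have "inj_on pr (Range al0 Int Pl Un V' Int Pl)"
   unfolding prV using i iV' by (subst inj_on_Un) blast
  then show "inj_on pr (Range al' Int Pl)" unfolding D' Int_Un_distrib2 .
  show "pr ` (Range al' Int Pl) = pr ` (Range al Int Pl)"
   unfolding D' RV Int_Un_distrib2 image_Un prV ..
 qed
 have sd: "strand_diagram Z (mu Un Id_on V')" if "braid mu" "rising mu" "mu \<subseteq> points Z \<times> points Z"
  "V' Int Domain mu = {}" "V' Int Range mu = {}" for mu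
 proof (rule strand_diagramI)
  have "(mu Un Id_on V')^-1 = mu^-1 Un Id_on V'" by auto
  moreover have "single_valued (mu Un Id_on V')" "single_valued (mu^-1 Un Id_on V')"
   using that unfolding braid_def by (auto intro!: single_valued_Un)
  moreover have "finite (Id_on V')" using fV by (simp add: Id_on_def)
  moreover have "\<forall>(x, y)\<in>mu Un Id_on V'. fst x = fst y" using that(1) unfolding braid_def by (auto simp: Id_on_iff)
  ultimately show "braid (mu Un Id_on V')" using that(1) unfolding braid_def by simp
  show "rising (mu Un Id_on V')" using that(2) unfolding rising_def by (auto simp: Id_on_iff)
  show "mu Un Id_on V' \<subseteq> points Z \<times> points Z" using that(3) pV by (auto simp: Id_on_iff)
 qed
 have "al0 \<subseteq> points Z \<times> points Z" "be0 \<subseteq> points Z \<times> points Z"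
  using goodD(4)[OF ga] goodD(4)[OF gb] unfolding al0_def be0_def by blast+
 then have "strand_diagram Z al'" "strand_diagram Z be'"
  unfolding al'_def be'_def
  using sd[OF b0(1,3) _ dgm(3)[unfolded D0] dV'] sd[OF b0(2,4) _ dV'[unfolded R0] dgm(4)[unfolded D0]] by blast+
 then have g': "good al'" "good be'"
  unfolding good_def RR[symmetric] D' using goodD(8,9)[OF g(2)] Rinj unfolding D' by simp_all
 have mv': "mv al' = mv al" "mv be' = mv be"
  unfolding al'_def be'_def mv_Un_Id using mv_Un_Id[of al0 V] mv_Un_Id[of be0 V] ale bee by simp_all
 have "srcs al' = srcs al" "tgts be' = tgts be" "tgts al' = tgts al" "srcs be' = srcs be"
 proof -
  have "Domain al = Domain gm" "Range be = Range gm"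
   unfolding gm using Domain_relcomp_eq[OF R] Range_relcomp_eq[OF R] by simp_all
  then show "srcs al' = srcs al" "tgts be' = tgts be"
   using st unfolding srcs_def tgts_def D' by simp_all
  show "tgts al' = tgts al" using Rtg unfolding tgts_def .
  then show "srcs be' = srcs be" unfolding srcs_def tgts_def RR R .
 qed
 then show "replace gm gm' al ~~ al" "replace gm gm' be ~~ be"
  unfolding r sim_def using g' ga gb mv' by simp_all
qed

lemma composes_good:
 assumes "good al" "good be" "composes al be gm"
 shows "good gm" "srcs gm = srcs al" "tgts gm = tgts be" "tgts al = srcs be"
proof -
 have R: "Range al = Domain be" and gm: "gm = al O be" using assms(3) by (auto simp only: composes_def)
 have D: "Domain gm = Domain al" "Range gm = Range be"
  unfolding gm using Domain_relcomp_eq[OF R] Range_relcomp_eq[OF R] by simp_all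
 have "braid gm" unfolding gm using braid_comp goodD(2) assms R by blast
 moreover have "rising gm"
  unfolding rising_def
 proof (rule ballI)
  fix p assume p: "p \<in> gm"
  obtain u z where e: "p = (u, z)" by (rule prod.exhaust)
  obtain w where w: "(u, w) \<in> al" "(w, z) \<in> be" using p unfolding gm e by (rule relcompEpair)
  have "u = z \<or> u \<prec> z"
   using risingD[OF goodD(3)[OF assms(1)] w(1)] risingD[OF goodD(3)[OF assms(2)] w(2)] pt_less_trans by metis
  then show "case p of (x, y) => x = y \<or> x \<prec> y" unfolding e by simp
 qed
 moreover have "gm \<subseteq> points Z \<times> points Z" using goodD(4)[OF assms(1)] goodD(4)[OF assms(2)] unfolding gm by blast
 ultimately have "strand_diagram Z gm" by (rule strand_diagramI)
 then show "good gm" unfolding good_def D using goodD(8)[OF assms(1)] goodD(9)[OF assms(2)] by simp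
 show "srcs gm = srcs al" "tgts gm = tgts be" "tgts al = srcs be" unfolding srcs_def tgts_def D R by simp_all
qed

lemma keys_vec_mult_ex:
 assumes "gm \<in> keys (vec_mult x y)"
 obtains al be where "al \<in> keys x" "be \<in> keys y" "composes al be gm"
proof -
 have "{(al, be). al \<in> keys x & be \<in> keys y & composes al be gm} ~= {}"
  using assms unfolding keys_vec_mult mem_Collect_eq by (metis card.empty even_zero)
 then show ?thesis using that by auto
qed

text \<open>Trading horizontal strands in both factors matches the factorisations of
  \<open>gm\<close> with those of \<open>gm'\<close>.\<close>

lemma inA_vec_mult:
 assumes "inA x" "inA y"
 shows "inA (vec_mult x y)"
proof -
 define K where "K = (%gm. {(al, be). al \<in> keys x & be \<in> keys y & composes al be gm})"
 have k: "keys (vec_mult x y) = {gm. odd (card (K gm))}" unfolding keys_vec_mult K_def ..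
 have good: "good al" if "al \<in> keys x \<or> al \<in> keys y" for al
  using assms that by (auto simp: inA_def)
 have cl: "al \<in> keys x ==> al' ~~ al ==> al' \<in> keys x"
  "al \<in> keys y ==> al' ~~ al ==> al' \<in> keys y" for al al'
  using assms sim_sym unfolding inA_def by blast+
 have 1: "good gm" if gm: "gm \<in> keys (vec_mult x y)" for gm
  using keys_vec_mult_ex[OF gm] composes_good(1) good by metis
 define f where "f = (%gm gm' (al, be). (replace gm gm' al, replace gm gm' be))"
 have f: "f gm gm' p \<in> K gm' & f gm' gm (f gm gm' p) = p" if s: "gm ~~ gm'" and p: "p \<in> K gm" for gm gm' p
 proof -
  obtain al be where e: "p = (al, be)" by (rule prod.exhaust)
  have m: "al \<in> keys x" "be \<in> keys y" "composes al be gm"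
   using p unfolding K_def e by simp_all
  then have "good al" "good be" using good by blast+
  note c = composes_replace[OF this m(3) s]
  show ?thesis unfolding e f_def K_def using c cl m by simp
 qed
 have 2: "card (K gm) = card (K gm')" if "gm ~~ gm'" for gm gm'
  using f[OF that] f[OF sim_sym[OF that]] by (rule card_bij_betw_pairs)
 show ?thesis unfolding inA_def using 1 2 unfolding k by simp
qed

end

context arc
begin

section \<open>The homology ring\<close>

lemma strand_alg_simps [simp]:
 "zero (strand_alg Z) = 0" "mult (strand_alg Z) = vec_mult" "add (strand_alg Z) = (+)"
 by (simp_all add: strand_alg_def)

lemma cycle_ring_simps [simp]:
 "zero (cycle_ring Z) = 0" "mult (cycle_ring Z) = vec_mult" "add (cycle_ring Z) = (+)"
 "one (cycle_ring Z) = one (strand_alg Z)"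
 by (simp_all add: cycle_ring_def)

lemma carrier_cycle_ring: "x \<in> carrier (cycle_ring Z) \<longleftrightarrow> inA x & vec_diff x = 0"
 by (simp add: cycle_ring_def carrier_strand_alg)

lemma good_Id_on: "s \<subseteq> pairs Z ==> S \<in> sections s ==> good (Id_on S)"
proof -
 assume s: "s \<subseteq> pairs Z" "S \<in> sections s"
 then have S: "S \<subseteq> points Z" "inj_on pr (S Int Pl)" using in_sections by blast+
 then have "finite (Id_on S)" using finite_subset[OF S(1) finite_points] by (simp add: Id_on_def)
 then have "braid (Id_on S)" by (auto simp: braid_def single_valued_def)
 moreover have "Id_on S \<subseteq> points Z \<times> points Z" using S(1) by (auto simp: Id_on_iff)
 moreover have "rising (Id_on S)" by (auto simp: rising_def)
 ultimately show ?thesis using S(2) strand_diagramI[of "Id_on S"] by (simp add: good_def)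
qed

lemma inA_idem:
 assumes "s \<subseteq> pairs Z"
 shows "inA (idem Z s)"
proof -
 have fin: "finite (Id_on ` sections s)" using finite_sections by simp
 have "nu' \<in> Id_on ` sections s" if sim: "nu ~~ nu'" and nu: "nu \<in> Id_on ` sections s" for nu nu'
 proof -
  obtain S where S: "nu = Id_on S" "S \<in> sections s" using nu by (rule imageE)
  have "mv nu = {}" unfolding S(1) by (auto simp: mv_def Id_on_iff)
  then have m: "mv nu' = {}" using sim by (simp add: sim_def)
  then have e: "nu' = Id_on {v. (v, v) \<in> nu'}" using mv_Id[of nu'] by simp
  have D: "Domain nu' = {v. (v, v) \<in> nu'}" by (subst e) simp
  have g: "good nu'" using sim by (simp add: sim_def)
  have "srcs nu = s" using S in_sections[OF assms] by (simp add: srcs_def)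
  then have "srcs nu' = s" using sim by (simp add: sim_def)
  then have "Domain nu' \<in> sections s"
   unfolding in_sections[OF assms] using goodD(6,8)[OF g] by (simp add: srcs_def)
  then show ?thesis unfolding D by (subst e) (rule imageI)
 qed
 then show ?thesis unfolding inA_def idem_eq keys_vecof[OF fin] using good_Id_on[OF assms] by blast
qed

lemma one_strand_alg: "one (strand_alg Z) = (\<Sum>s\<in>Pow (pairs Z). idem Z s)"
 by (simp add: strand_alg_def)

lemma inA_one: "inA (one (strand_alg Z))"
 unfolding one_strand_alg using inA_idem by (intro inA_sum) blast

lemma sum_restr_fibres:
 assumes "finite I" "!!k. k \<in> keys x ==> f k \<in> I"
  "!!k i. k \<in> keys x ==> i \<in> I ==> P i k \<longleftrightarrow> i = f k"
 shows "(\<Sum>i\<in>I. restr (P i) x) = (x :: 'k \<Rightarrow>\<^sub>0 bit)"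
proof -
 have "(\<Sum>i\<in>I. restr (P i) x) = lin (%k. \<Sum>i\<in>I. if P i k then single k 1 else 0) x"
  unfolding restr_def lin_def by (rule sum.swap)
 also have "... = lin (%k. single k 1) x"
 proof (rule lin_cong)
  fix k assume k: "k \<in> keys x"
  have "(\<Sum>i\<in>I. if P i k then single k (1::bit) else 0) = (\<Sum>i\<in>I. if i = f k then single k 1 else 0)"
   using assms(3)[OF k] by (intro sum.cong) auto
  then show "(\<Sum>i\<in>I. if P i k then single k (1::bit) else 0) = single k 1"
   using assms(1,2) k by simp
 qed
 finally show ?thesis using vec_eq_sum[of x] by simp
qed

lemma one_mult:
 assumes "inA x"
 shows "vec_mult (one (strand_alg Z)) x = x" "vec_mult x (one (strand_alg Z)) = x"
proof -
 have s: "Domain nu \<in> sections s \<longleftrightarrow> s = srcs nu" "Range nu \<in> sections s \<longleftrightarrow> s = tgts nu"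
  if "nu \<in> keys x" "s \<in> Pow (pairs Z)" for nu s
 proof -
  have g: "good nu" using assms that by (simp add: inA_def)
  have "s \<subseteq> pairs Z" using that by simp
  then show "Domain nu \<in> sections s \<longleftrightarrow> s = srcs nu" "Range nu \<in> sections s \<longleftrightarrow> s = tgts nu"
   using goodD(6-9)[OF g] by (auto simp only: in_sections srcs_def tgts_def)
 qed
 show "vec_mult (one (strand_alg Z)) x = x"
  unfolding one_strand_alg vec_mult_sum_left idem_left
  by (rule sum_restr_fibres[where f = srcs]) (use s srcs_pairs in auto)
 show "vec_mult x (one (strand_alg Z)) = x"
  unfolding one_strand_alg vec_mult_sum_right idem_right
  by (rule sum_restr_fibres[where f = tgts]) (use s srcs_pairs in auto)
qed

lemma vec_diff_one: "vec_diff (one (strand_alg Z)) = 0"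
proof -
 have "vec_diff (idem Z s) = 0" if s: "s \<subseteq> pairs Z" for s
 proof -
  have "strand_diff nu = 0" if "nu \<in> Id_on ` sections s" for nu
   using that ninv_0_diff[OF goodD(2)[OF good_Id_on[OF s]]] ninv_Id_on by blast
  then show ?thesis unfolding idem_eq vec_diff_lin using finite_sections by (simp add: lin_vecof)
 qed
 then show ?thesis unfolding one_strand_alg vec_diff_sum by simp
qed

lemma ring_strand_alg: "ring (strand_alg Z)"
proof (intro ringI abelian_groupI monoidI)
 fix x y z assume "x \<in> carrier (strand_alg Z)" "y \<in> carrier (strand_alg Z)" "z \<in> carrier (strand_alg Z)"
 then show "mult (strand_alg Z) (mult (strand_alg Z) x y) z = mult (strand_alg Z) x (mult (strand_alg Z) y z)"
  using vec_mult_assoc inA_braids by (simp add: carrier_strand_alg)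
next
 fix x assume "x \<in> carrier (strand_alg Z)"
 then show "\<exists>y\<in>carrier (strand_alg Z). add (strand_alg Z) y x = zero (strand_alg Z)"
  by (intro bexI[of _ x]) auto
qed (auto simp: carrier_strand_alg inA_0 inA_add inA_one inA_vec_mult one_mult vec_mult_add_left vec_mult_add_right
 add.assoc add.commute)

lemma vec_diff_mult:
 "inA x ==> inA y ==> vec_diff (vec_mult x y) = vec_mult (vec_diff x) y + vec_mult x (vec_diff y)"
 using leibniz inA_braids by blast

lemma diff_diff: "inA x ==> vec_diff (vec_diff x) = 0"
 using vec_diff_diff inA_braids by blast

lemma ring_cycle_ring: "ring (cycle_ring Z)"
proof (intro ringI abelian_groupI monoidI)
 fix x y z assume "x \<in> carrier (cycle_ring Z)" "y \<in> carrier (cycle_ring Z)" "z \<in> carrier (cycle_ring Z)"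
 then show "mult (cycle_ring Z) (mult (cycle_ring Z) x y) z = mult (cycle_ring Z) x (mult (cycle_ring Z) y z)"
  using vec_mult_assoc inA_braids by (simp add: carrier_cycle_ring)
next
 fix x assume "x \<in> carrier (cycle_ring Z)"
 then show "\<exists>y\<in>carrier (cycle_ring Z). add (cycle_ring Z) y x = zero (cycle_ring Z)"
  by (intro bexI[of _ x]) auto
qed (auto simp: carrier_cycle_ring inA_0 inA_add inA_one inA_vec_mult one_mult vec_mult_add_left vec_mult_add_right
 vec_diff_add vec_diff_mult vec_diff_one add.assoc add.commute)

lemma in_boundaries: "b \<in> bds \<longleftrightarrow> (\<exists>x. inA x & b = vec_diff x)"
 unfolding boundaries_def using carrier_strand_alg by auto

lemma boundaries_0 [simp]: "0 \<in> bds"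
 unfolding in_boundaries using inA_0 by (intro exI[of _ 0]) simp

lemma boundaries_add: "a \<in> bds ==> b \<in> bds ==> a + b \<in> bds"
 unfolding in_boundaries by (metis inA_add vec_diff_add)

lemma boundaries_cycle: "b \<in> bds ==> inA b & vec_diff b = 0"
 unfolding in_boundaries using inA_vec_diff diff_diff by blast

text \<open>By the Leibniz rule, a cycle times \<open>vec_diff y\<close> is the boundary of the
  cycle times \<open>y\<close>.\<close>

lemma ideal_boundaries: "ideal bds (cycle_ring Z)"
proof -
 interpret ring "cycle_ring Z" by (rule ring_cycle_ring)
 have neg: "a_inv (cycle_ring Z) a = a" if "a \<in> carrier (cycle_ring Z)" for a
  using that by (intro minus_equality) auto
 show ?thesis
 proof (rule idealI[OF ring_cycle_ring])
  show "subgroup bds (add_monoid (cycle_ring Z))"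
  proof (rule add.subgroupI)
   show "bds \<subseteq> carrier (cycle_ring Z)" using boundaries_cycle carrier_cycle_ring by blast
   then show "a_inv (cycle_ring Z) a \<in> bds" if "a \<in> bds" for a using neg that by auto
   show "bds ~= {}" using boundaries_0 by blast
  qed (simp add: boundaries_add)
 next
  fix a x assume "a \<in> bds" "x \<in> carrier (cycle_ring Z)"
  then obtain y where y: "inA y" "a = vec_diff y" and x: "inA x" "vec_diff x = 0"
   unfolding in_boundaries carrier_cycle_ring by blast
  show "mult (cycle_ring Z) x a \<in> bds"
   unfolding in_boundaries using x y by (intro exI[of _ "vec_mult x y"]) (simp add: inA_vec_mult vec_diff_mult)
  show "mult (cycle_ring Z) a x \<in> bds"
   unfolding in_boundaries using x y by (intro exI[of _ "vec_mult y x"]) (simp add: inA_vec_mult vec_diff_mult)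
 qed
qed

lemma ring_homology: "ring (homology Z)"
 unfolding homology_def by (rule ideal.quotient_is_ring[OF ideal_boundaries])

abbreviation "cyc x \<equiv> inA x & vec_diff x = 0"

lemma hclass_hom:
 assumes "cyc x" "cyc y"
 shows "addH (hclass Z x) (hclass Z y) = hclass Z (x + y)"
  "mult (homology Z) (hclass Z x) (hclass Z y) = hclass Z (vec_mult x y)"
proof -
 note h = ideal.rcos_ring_hom[OF ideal_boundaries]
 have c: "x \<in> carrier (cycle_ring Z)" "y \<in> carrier (cycle_ring Z)" using assms carrier_cycle_ring by auto
 show "addH (hclass Z x) (hclass Z y) = hclass Z (x + y)"
  using ring_hom_add[OF h c] by (simp add: homology_def hclass_def)
 show "mult (homology Z) (hclass Z x) (hclass Z y) = hclass Z (vec_mult x y)"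
  using ring_hom_mult[OF h c] by (simp add: homology_def hclass_def)
qed

lemma carrier_homology: "a \<in> H \<longleftrightarrow> (\<exists>x. cyc x & a = hclass Z x)"
 unfolding homology_def FactRing_def hclass_def by (auto simp: A_RCOSETS_def' carrier_cycle_ring)

lemma hclass_carrier: "cyc x ==> hclass Z x \<in> H"
 unfolding carrier_homology by blast

lemma hclass_elem: "y \<in> hclass Z x \<longleftrightarrow> (\<exists>b\<in>bds. y = b + x)"
 unfolding hclass_def a_r_coset_def' by auto

lemma hclass_eq_iff:
 assumes "cyc x" "cyc y"
 shows "hclass Z x = hclass Z y \<longleftrightarrow> x + y \<in> bds"
proof
 assume h: "hclass Z x = hclass Z y"
 have "x \<in> hclass Z x" unfolding hclass_elem by (intro bexI[of _ 0]) auto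
 then have "x \<in> hclass Z y" unfolding h .
 then obtain b where "b \<in> bds" "x = b + y" unfolding hclass_elem by blast
 then show "x + y \<in> bds" by (simp add: add.assoc)
next
 have *: "hclass Z x \<subseteq> hclass Z y" if "x + y \<in> bds" for x y
 proof
  fix z assume "z \<in> hclass Z x"
  then obtain b where "b \<in> bds" "z = b + x" unfolding hclass_elem by blast
  then have "b + (x + y) \<in> bds" "z = (b + (x + y)) + y"
   using that boundaries_add by (auto simp: add.assoc)
  then show "z \<in> hclass Z y" unfolding hclass_elem by blast
 qed
 assume "x + y \<in> bds"
 then show "hclass Z x = hclass Z y" using *[of x y] *[of y x] by (simp add: add.commute)
qed

lemma zero_homology: "zeroH = hclass Z 0"
proof -
 have "hclass Z 0 = bds" unfolding set_eq_iff hclass_elem by simp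
 then show ?thesis by (simp add: homology_def FactRing_def)
qed

lemma cyc_0: "cyc 0" by (simp add: inA_0)

lemma hclass_zero_iff: "cyc x ==> hclass Z x = zeroH \<longleftrightarrow> x \<in> bds"
 unfolding zero_homology using hclass_eq_iff[OF _ cyc_0, of x] by simp

section \<open>Gradings\<close>

definition covers :: "point \<times> point => step => bool" where
 "covers p e \<longleftrightarrow> fst (fst p) = fst e & snd (fst p) <= snd e & snd e < snd (snd p)"

lemma h_grading_covers: "h_grading mu e = int (card {p \<in> mu. covers p e})"
proof -
 obtain i j where e: "e = (i, j)" by (rule prod.exhaust)
 have "{(x, y) \<in> mu. fst x = i & snd x <= j & j < snd y} = {p \<in> mu. covers p e}"
  by (auto simp: covers_def e)
 then show ?thesis by (simp add: h_grading_def e)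
qed

lemma h_grading_nonneg: "0 <= h_grading mu e"
 by (simp add: h_grading_covers)

lemma h_grading_gr:
 "inj_on c I ==> h_grading (gr I c d) e = int (card {u \<in> I. covers (c u, d u) e})"
proof -
 assume inj: "inj_on c I"
 have "{p \<in> gr I c d. covers p e} = (%u. (c u, d u)) ` {u \<in> I. covers (c u, d u) e}"
  by (auto simp only: gr_def)
 then show ?thesis unfolding h_grading_covers using inj by (simp add: card_image inj_on_def)
qed

lemma h_grading_comp:
 assumes "good al" "good be" "Range al = Domain be"
 shows "h_grading (al O be) e = h_grading al e + h_grading be e"
proof -
 obtain I a b where *: "al = gr I a id" "be = gr I id b" "al O be = gr I a b" "finite I"
  "inj_on a I" "inj_on b I"
  using braid_comp_index[OF goodD(2)[OF assms(1)] goodD(2)[OF assms(2)] assms(3)] by metis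
 have r: "snd (a u) <= snd u" "snd u <= snd (b u)" "fst (a u) = fst u" "fst (b u) = fst u" if u: "u \<in> I" for u
 proof -
  have "(a u, u) \<in> al" "(u, b u) \<in> be" using u unfolding *(1,2) in_gr by auto
  then have "a u = u \<or> a u \<prec> u" "u = b u \<or> u \<prec> b u"
   using risingD[OF goodD(3)[OF assms(1)]] risingD[OF goodD(3)[OF assms(2)]] by blast+
  then show "snd (a u) <= snd u" "snd u <= snd (b u)" "fst (a u) = fst u" "fst (b u) = fst u"
   by (auto simp: pt_less_def)
 qed
 have iff: "covers (a u, b u) e \<longleftrightarrow> covers (a u, u) e \<or> covers (u, b u) e"
  and disj: "\<not> (covers (a u, u) e & covers (u, b u) e)" if u: "u \<in> I" for u
  using r[OF u] unfolding covers_def fst_conv snd_conv by auto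
 have "{u \<in> I. covers (a u, b u) e} = {u \<in> I. covers (a u, id u) e} Un {u \<in> I. covers (id u, b u) e}"
  unfolding id_apply using iff by blast
 moreover have "{u \<in> I. covers (a u, id u) e} Int {u \<in> I. covers (id u, b u) e} = {}"
  unfolding id_apply using disj by blast
 ultimately have "card {u \<in> I. covers (a u, b u) e} = card {u \<in> I. covers (a u, id u) e} + card {u \<in> I. covers (id u, b u) e}"
  using *(4) by (simp add: card_Un_disjoint)
 then show ?thesis
  unfolding *(3) h_grading_gr[OF *(5)] unfolding *(1,2) h_grading_gr[OF *(5)] h_grading_gr[OF inj_on_id] by simp
qed

text \<open>With x < x' <= y' < y, the strands from x to y and from x' to y' together cover each
  step as often as those from x to y' and from x' to y.\<close>

lemma reduces_hdat:
 assumes "good al" "reduces al nu"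
 shows "hdat nu = hdat al"
proof -
 obtain x y x' y' where r: "(x, y) \<in> al" "(x', y') \<in> al" "x \<prec> x'" "y' \<prec> y" "nu = resolve al (x, y) (x', y')"
  using assms(2) unfolding reduces_def by blast
 have ne: "(x, y) ~= (x', y')" "fst x = fst x'" "x ~= x'" using r(3) by (auto simp: pt_less_def)
 note p = resolve_props[OF goodD(2)[OF assms(1)] r(1,2) ne(1), unfolded fst_conv snd_conv, OF ne(2), folded r(5)]
 have c: "snd x < snd x'" "snd x' <= snd y'" "snd y' < snd y" "fst x = fst x'"
  using r(3,4) risingD[OF goodD(3)[OF assms(1)] r(2)] ne by (auto simp: pt_less_def)
 have "h_grading nu e = h_grading al e" for e
 proof -
  let ?n = "%A. card {p \<in> A. covers p e}"
  have fin: "finite al" "finite nu" using goodD(5) assms(1) reduces_good(1)[OF assms] by auto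
  have card: "?n A = ?n (A Int B) + ?n (A - B)" if "finite A" for A B
  proof -
   have "{p \<in> A. covers p e} = {p \<in> A Int B. covers p e} Un {p \<in> A - B. covers p e}" by blast
   moreover have "{p \<in> A Int B. covers p e} Int {p \<in> A - B. covers p e} = {}" by blast
   ultimately show ?thesis using that by (metis (no_types, lifting) card_Un_disjoint finite_Un finite_subset mem_Collect_eq subsetI Int_iff Diff_iff)
  qed
  have two: "?n {p, q} = of_bool (covers p e) + of_bool (covers q e)" if "p ~= q" for p q
  proof -
   have "{r \<in> {p, q}. covers r e} = (if covers p e then {p} else {}) Un (if covers q e then {q} else {})" by auto
   then show ?thesis using that by auto
  qed
  have "?n al = ?n (al Int nu) + ?n {(x, y), (x', y')}" using card[OF fin(1), of nu] p(5) by simp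
  moreover have "?n nu = ?n (al Int nu) + ?n {(x, y'), (x', y)}" using card[OF fin(2), of al] p(6) by (simp add: Int_commute)
  moreover have "?n {(x, y), (x', y')} = ?n {(x, y'), (x', y)}"
   using two[of "(x, y)" "(x', y')"] two[of "(x, y')" "(x', y)"] ne(3) c by (auto simp: covers_def)
  ultimately show ?thesis unfolding h_grading_covers by simp
 qed
 then show ?thesis unfolding hdat_def using reduces_good(4,5)[OF assms] by auto
qed

lemma reduces_ninv: "good al ==> reduces al nu ==> ninv nu + 1 = ninv al"
 using strand_diff_props(4)[OF goodD(2)] keys_strand_diff[OF goodD(2)] by blast

lemma reduces_maslov:
 assumes "good al" "reduces al nu"
 shows "maslov_term Z nu = maslov_term Z al - 1"
proof -
 have "h_grading nu = h_grading al" using reduces_hdat[OF assms] by (simp add: hdat_def)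
 then show ?thesis
  using reduces_ninv[OF assms, symmetric] reduces_good(2)[OF assms] by (simp add: maslov_term_def)
qed

lemma covers_step:
 assumes "fst x = fst y" "x = y \<or> x \<prec> y" "0 < snd p"
 shows "covers (x, y) (step_before p) \<longleftrightarrow> x \<prec> p & p \<prec> y \<or> x ~= y & y = p"
  "covers (x, y) (step_after p) \<longleftrightarrow> x \<prec> p & p \<prec> y \<or> x ~= y & x = p"
 using assms by (cases x; cases y; cases p; auto simp: covers_def step_before_def step_after_def pt_less_def)+

text \<open>Besides the strands running over \<open>p\<close>, the step before \<open>p\<close>
  carries only a moving strand that ends there, and the step after \<open>p\<close> only one that
  starts there. The later analysis of multiplicities at places rests on this.\<close>

lemma h_grading_at:
 assumes "braid mu" "rising mu" "0 < snd p"
 shows "h_grading mu (step_before p) = int (over mu p) + of_bool (p \<in> Range (mv mu))"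
  "h_grading mu (step_after p) = int (over mu p) + of_bool (p \<in> Domain (mv mu))"
proof -
 have fin: "finite mu" using assms(1) by (simp add: braid_def)
 let ?O = "{q \<in> mu. fst q \<prec> p & p \<prec> snd q}"
 have fst: "fst (fst q) = fst (snd q)" if "q \<in> mu" for q
  using that assms(1) unfolding braid_def by (cases q) auto
 have 1: "{q \<in> mu. covers q (step_before p)} = ?O Un {q \<in> mv mu. snd q = p}"
 proof -
  have "covers q (step_before p) \<longleftrightarrow> fst q \<prec> p & p \<prec> snd q \<or> fst q ~= snd q & snd q = p" if q: "q \<in> mu" for q
   using covers_step(1)[OF fst[OF q] _ assms(3)] risingD[OF assms(2), of "fst q" "snd q"] q by simp
  then show ?thesis unfolding mv_def by blast
 qed
 have 2: "{q \<in> mu. covers q (step_after p)} = ?O Un {q \<in> mv mu. fst q = p}"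
 proof -
  have "covers q (step_after p) \<longleftrightarrow> fst q \<prec> p & p \<prec> snd q \<or> fst q ~= snd q & fst q = p" if q: "q \<in> mu" for q
   using covers_step(2)[OF fst[OF q] _ assms(3)] risingD[OF assms(2), of "fst q" "snd q"] q by simp
  then show ?thesis unfolding mv_def by blast
 qed
 have sv: "(x, y) \<in> mu ==> (x, z) \<in> mu ==> y = z" "(x, y) \<in> mu ==> (z, y) \<in> mu ==> x = z" for x y z
  using assms(1) unfolding braid_def single_valued_def converse_iff by metis+
 have c1: "card {q \<in> mv mu. snd q = p} = of_bool (p \<in> Range (mv mu))"
 proof (cases "p \<in> Range (mv mu)")
  case True
  then obtain x where x: "(x, p) \<in> mv mu" by (rule RangeE)
  have "{q \<in> mv mu. snd q = p} = {(x, p)}"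
  proof (intro subset_antisym subsetI)
   fix q assume q: "q \<in> {q \<in> mv mu. snd q = p}"
   then have "(fst q, p) \<in> mu" by (auto simp: mv_def)
   then have "fst q = x" using x sv(2) by (auto simp: mv_def)
   then show "q \<in> {(x, p)}" using q by (auto simp: prod_eq_iff)
  qed (use x in simp)
  then show ?thesis using True by simp
 next
  case False
  then have "{q \<in> mv mu. snd q = p} = {}" unfolding Range_iff by (metis (mono_tags, lifting) empty_Collect_eq prod.collapse)
  then show ?thesis using False by (simp only: card.empty of_bool_eq)
 qed
 have c2: "card {q \<in> mv mu. fst q = p} = of_bool (p \<in> Domain (mv mu))"
 proof (cases "p \<in> Domain (mv mu)")
  case True
  then obtain x where x: "(p, x) \<in> mv mu" by (rule DomainE)
  have "{q \<in> mv mu. fst q = p} = {(p, x)}"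
  proof (intro subset_antisym subsetI)
   fix q assume q: "q \<in> {q \<in> mv mu. fst q = p}"
   then have "(p, snd q) \<in> mu" by (auto simp: mv_def)
   then have "snd q = x" using x sv(1) by (auto simp: mv_def)
   then show "q \<in> {(p, x)}" using q by (auto simp: prod_eq_iff)
  qed (use x in simp)
  then show ?thesis using True by simp
 next
  case False
  then have "{q \<in> mv mu. fst q = p} = {}" unfolding Domain_iff by (metis (mono_tags, lifting) empty_Collect_eq prod.collapse)
  then show ?thesis using False by (simp only: card.empty of_bool_eq)
 qed
 have fm: "finite (mv mu)" using fin by (simp add: mv_def)
 have d: "?O Int {q \<in> mv mu. snd q = p} = {}" "?O Int {q \<in> mv mu. fst q = p} = {}" by auto
 show "h_grading mu (step_before p) = int (over mu p) + of_bool (p \<in> Range (mv mu))"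
  unfolding h_grading_covers 1 over_def using c1 fin fm d(1) by (simp add: card_Un_disjoint)
 show "h_grading mu (step_after p) = int (over mu p) + of_bool (p \<in> Domain (mv mu))"
  unfolding h_grading_covers 2 over_def using c2 fin fm d(2) by (simp add: card_Un_disjoint)
qed

lemma place_snd: "p \<in> Pl ==> 0 < snd p"
 by (auto simp: places_def)

lemma horizontal_iff:
 assumes "braid mu"
 shows "p \<in> Domain mu \<longleftrightarrow> (p, p) \<in> mu \<or> p \<in> Domain (mv mu)" "p \<in> Range mu \<longleftrightarrow> (p, p) \<in> mu \<or> p \<in> Range (mv mu)"
  "(p, p) \<in> mu ==> p \<notin> Domain (mv mu) & p \<notin> Range (mv mu)"
 using mv_horizontal_disjoint[OF assms] unfolding Domain_iff Range_iff in_mv by metis+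

lemma h_boundary_grading:
 assumes "good mu" "p \<in> Pl"
 shows "h_boundary (h_grading mu) p = of_bool (p \<in> Range mu) - of_bool (p \<in> Domain mu)"
 using h_grading_at[OF goodD(2,3)[OF assms(1)] place_snd[OF assms(2)]] place_snd[OF assms(2)]
  horizontal_iff[OF goodD(2)[OF assms(1)], of p]
 by (auto simp: h_boundary_def)

lemma avg_mult_add_left: "avg_mult Z (%e. h e + h' e) c = avg_mult Z h c + avg_mult Z h' c"
 unfolding avg_mult_def sum.distrib[symmetric] by (rule sum.cong) (auto simp: field_simps)

lemma avg_mult_add_right: "avg_mult Z h (%p. c p + c' p) = avg_mult Z h c + avg_mult Z h c'"
 unfolding avg_mult_def sum.distrib[symmetric] by (rule sum.cong) (auto simp: field_simps)

lemma avg_mult_diff_right: "avg_mult Z h (%p. c p - c' p) = avg_mult Z h c - avg_mult Z h c'"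
 unfolding avg_mult_def sum_subtractf[symmetric] by (rule sum.cong) (auto simp: field_simps)

lemma avg_mult_cong: "(!!p. p \<in> Pl ==> c p = c' p) ==> avg_mult Z h c = avg_mult Z h c'"
 unfolding avg_mult_def by (rule sum.cong) auto

text \<open>Inversions add, but \<open>m\<close> of the second factor is measured at its own start
  and not at the start of the product. The two differ by the endpoints minus the starting points of
  \<open>al\<close>, which is the boundary of its H-grading.\<close>

lemma composes_maslov:
 assumes "good al" "good be" "composes al be gm"
 shows "maslov_term Z gm = maslov_term Z al + maslov_term Z be + avg_mult Z (h_grading be) (h_boundary (h_grading al))"
proof -
 have R: "Range al = Domain be" and gm: "gm = al O be" "ninv gm = ninv al + ninv be"
  using assms(3) by (auto simp only: composes_def)
 have D: "Domain gm = Domain al" unfolding gm using Domain_relcomp_eq[OF R] .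
 have h: "h_grading gm = (%e. h_grading al e + h_grading be e)"
  unfolding gm using h_grading_comp[OF assms(1,2) R] by auto
 have "avg_mult Z (h_grading be) (h_boundary (h_grading al)) =
   avg_mult Z (h_grading be) (%p. of_bool (p \<in> Domain be) - of_bool (p \<in> Domain al))"
  by (rule avg_mult_cong) (simp add: h_boundary_grading[OF assms(1)] R)
 then show ?thesis
  unfolding maslov_term_def h D gm(2) avg_mult_add_left avg_mult_diff_right by simp
qed

text \<open>A horizontal strand at a place crosses the strands running over it, and both steps there
  have exactly this multiplicity. So its crossings cancel its share of \<open>m\<close>, and all
  terms of a diagram have the same degree.\<close>

lemma maslov_mv:
 assumes "good nu"
 shows "maslov_term Z nu = maslov_term Z (mv nu)"
proof -
 define V where "V = {v. (v, v) \<in> nu}"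
 have e: "nu = mv nu Un Id_on V" unfolding V_def by (rule mv_Id)
 have V: "V \<subseteq> points Z" using goodD(4)[OF assms] unfolding V_def by blast
 then have fV: "finite V" using finite_subset finite_points by blast
 have sd: "strand_diagram Z (mv nu)" by (rule strand_diagram_mv[OF goodD(1)[OF assms]])
 note b = strand_diagramD[OF sd]
 have d: "v \<notin> Domain (mv nu)" "v \<notin> Range (mv nu)" if "v \<in> V" for v
  using mv_horizontal_disjoint[OF goodD(2)[OF assms]] that unfolding V_def by blast+
 have n: "ninv nu = ninv (mv nu) + (\<Sum>v\<in>V. over (mv nu) v)"
  by (subst e, rule ninv_horizontals[OF b(1,2) fV]) (use d in blast)
 have mm: "mv (mv nu) = mv nu" by (auto simp: mv_def)
 \<comment> \<open>Ends of intervals do not enter \<open>m\<close>, and no strand runs over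
   them.\<close>
 have 0: "over (mv nu) v = 0" if v: "v \<in> V - Pl" for v
 proof -
  have "\<not> (fst q \<prec> v & v \<prec> snd q)" if "q \<in> mv nu" for q
   using end_places[of v] v V b(3) that by (cases q) auto
  then have "{q \<in> mv nu. fst q \<prec> v & v \<prec> snd q} = {}" by blast
  then show ?thesis unfolding over_def by (simp only: card.empty)
 qed
 have "(\<Sum>v\<in>V. over (mv nu) v) = (\<Sum>v\<in>V Int Pl. over (mv nu) v)"
  using fV 0 by (intro sum.mono_neutral_right) auto
 also have "rat_of_nat ... = avg_mult Z (h_grading nu) (%a. of_bool (a \<in> V))"
 proof -
  have "avg_mult Z (h_grading nu) (%a. of_bool (a \<in> V)) =
    (\<Sum>a\<in>Pl. if a \<in> V then rat_of_int (h_grading nu (step_before a) + h_grading nu (step_after a)) / 2 else 0)"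
   unfolding avg_mult_def by (rule sum.cong) auto
  also have "... = (\<Sum>a\<in>Pl Int V. rat_of_int (h_grading nu (step_before a) + h_grading nu (step_after a)) / 2)"
   by (rule sum.inter_restrict[symmetric]) simp
  also have "... = (\<Sum>a\<in>Pl Int V. rat_of_nat (over (mv nu) a))"
  proof (rule sum.cong[OF refl])
   fix a assume a: "a \<in> Pl Int V"
   then have "a \<notin> Domain (mv nu)" "a \<notin> Range (mv nu)" "0 < snd a" using d place_snd by auto
   then show "rat_of_int (h_grading nu (step_before a) + h_grading nu (step_after a)) / 2 = rat_of_nat (over (mv nu) a)"
    using h_grading_at[OF b(1,2)] unfolding h_grading_mv mm by simp
  qed
  finally show ?thesis by (simp add: Int_commute)
 qed
 finally have o: "rat_of_nat (\<Sum>v\<in>V. over (mv nu) v) = avg_mult Z (h_grading nu) (%a. of_bool (a \<in> V))" .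
 have "avg_mult Z (h_grading nu) (%a. of_bool (a \<in> Domain nu)) =
  avg_mult Z (h_grading nu) (%a. of_bool (a \<in> Domain (mv nu)) + of_bool (a \<in> V))"
  using horizontal_iff[OF goodD(2)[OF assms]] d by (intro avg_mult_cong) (auto simp: V_def)
 then show ?thesis
  unfolding maslov_term_def n of_nat_add o avg_mult_add_right h_grading_mv by simp
qed

lemma sim_maslov: "nu ~~ nu' ==> maslov_term Z nu = maslov_term Z nu'"
 using maslov_mv unfolding sim_def by metis

lemma sim_invariant_grading: "sim_invariant (%nu. P (hdat nu) (maslov_term Z nu))"
 unfolding sim_invariant_def using sim_hdat sim_maslov by metis

end

section \<open>Non-viable summands are acyclic\<close>

text \<open>At the first step of an interval with multiplicity at least two, a strand starts at a place over
 which exactly one other strand passes. Exchanging the ends of these two strands is a contracting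
 homotopy, up to terms with the wrong number of inversions.\<close>

definition passing :: "point set => (point => point) => point => point => bool" where
 "passing I f p x \<longleftrightarrow> line_map I f & finite I & (\<forall>u\<in>I. u = f u \<or> u \<prec> f u) & p \<in> I & p \<prec> f p &
  x \<in> I & x \<prec> p & p \<prec> f x & (\<forall>c\<in>I. c ~= x --> c \<prec> p --> f c \<prec> p)"

lemma passing_other: "passing I f p x ==> c \<in> I ==> c ~= x ==> c \<prec> p ==> f c \<prec> p"
 by (simp add: passing_def)

lemma add_eq_char2: "a + b = c ==> a = c + (b :: 'a :: char2)"
 by (auto simp: add.assoc)

definition toggle :: "point => strands => strands" where
 "toggle p nu = resolve nu (THE q. q \<in> nu & fst q \<prec> p & p \<prec> snd q) (THE q. q \<in> nu & fst q = p)"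

lemma toggle_gr:
 assumes "passing I f p x"
 shows "toggle p (gr I id f) = gr I id (swapf x p f)"
  "(THE q. q \<in> gr I id f & fst q \<prec> p & p \<prec> snd q) = (x, f x)" "(THE q. q \<in> gr I id f & fst q = p) = (p, f p)"
proof -
 have x: "x \<in> I" "p \<in> I" "x \<prec> p" "p \<prec> f x" "x ~= p" using assms by (auto simp: passing_def)
 have el: "q \<in> gr I id f \<longleftrightarrow> fst q \<in> I & snd q = f (fst q)" for q
  by (cases q) (auto simp: in_gr)
 show 1: "(THE q. q \<in> gr I id f & fst q \<prec> p & p \<prec> snd q) = (x, f x)"
 proof (rule the_equality)
  show "(x, f x) \<in> gr I id f & fst (x, f x) \<prec> p & p \<prec> snd (x, f x)" using x by (simp add: el)
  fix q assume q: "q \<in> gr I id f & fst q \<prec> p & p \<prec> snd q"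
  then have "fst q = x" using assms unfolding passing_def el by (metis pt_less_asym)
  moreover have "snd q = f (fst q)" using q el by blast
  ultimately show "q = (x, f x)" by (intro prod_eqI) simp_all
 qed
 show 2: "(THE q. q \<in> gr I id f & fst q = p) = (p, f p)"
  by (rule the_equality) (use x in \<open>auto simp: el prod_eq_iff\<close>)
 show "toggle p (gr I id f) = gr I id (swapf x p f)"
  unfolding toggle_def 1 2 using resolve_gr[of id I x p f] x by simp
qed

text \<open>Conjugation rules for transpositions; they identify the error terms of toggling before
  and after a resolution.\<close>

lemma swapf_braids:
 assumes "x ~= p" "c ~= x" "c ~= p"
 shows "swapf c p (swapf x c f) = swapf x c (swapf x p f)" "swapf x p (swapf x c f) = swapf c p (swapf x p f)"
 using assms by (auto simp: swapf_def fun_eq_iff)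

text \<open>After a resolution there is still exactly one strand over \<open>p\<close>. Its start
  changes only if it is resolved against a strand starting at some \<open>v\<close> before
  \<open>p\<close>: that one ended before \<open>p\<close>, and the two exchange their ends.\<close>

lemma passing_swapf:
 assumes "passing I f p x" "(u, v) \<in> crossing_pairs I id f"
 shows "passing I (swapf u v f) p (if u = x & v \<prec> p then v else x)"
proof -
 have a: "line_map I f" "finite I" "p \<in> I" "p \<prec> f p" "x \<in> I" "x \<prec> p" "p \<prec> f x"
  using assms(1) by (simp_all add: passing_def)
 have r: "w = f w \<or> w \<prec> f w" if "w \<in> I" for w using assms(1) that unfolding passing_def by blast
 have o: "f c \<prec> p" if "c \<in> I" "c ~= x" "c \<prec> p" for c using assms(1) that unfolding passing_def by blast
 have uv: "u \<in> I" "v \<in> I" "u \<prec> v" using assms(2) by (auto simp: crossing_pairs_def)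
 have fuv: "fst u = fst v" "u ~= v" using uv(3) by (auto simp: pt_less_def)
 have c: "f v \<prec> f u"
  using line_map_less_iff[OF a(1) uv(1,2) fuv] assms(2) uv(3) unfolding crossing_pairs_def by simp
 have vu: "v \<prec> f u" using r[OF uv(2)] c pt_less_trans by metis
 have lm: "line_map I (swapf u v f)" using line_map_swapf a(1) uv fuv by blast
 have r': "\<forall>w\<in>I. w = swapf u v f w \<or> w \<prec> swapf u v f w"
 proof
  fix w assume w: "w \<in> I"
  have "u \<prec> f v" using r[OF uv(2)] uv(3) pt_less_trans by metis
  then show "w = swapf u v f w \<or> w \<prec> swapf u v f w" using vu r[OF w] by (simp add: swapf_apply)
 qed
 have xp: "x ~= p" using a by auto
 show ?thesis
 proof (cases "u = x")
  case u: True
  show ?thesis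
  proof (cases "v \<prec> p")
   case True
   have "v ~= p" "v ~= x" using True uv fuv u by auto
   then show ?thesis
    unfolding passing_def using lm a u True uv r' xp o r
    by (auto simp: swapf_apply split: if_splits)
  next
   case False
   have "v ~= x" using fuv u by simp
   have fv: "p \<prec> f v"
   proof (cases "v = p")
    case False2: False
    have "fst v = fst p" using uv a(6) u by (simp add: pt_less_def)
    then have "p \<prec> v" using False False2 pt_less_total by blast
    then show ?thesis using r[OF uv(2)] pt_less_trans by metis
   qed (use a in simp)
   have px: "x ~= p" by fact
   have e: "swapf u v f x = f v" "swapf u v f p = (if v = p then f x else f p)"
    using u px \<open>v ~= x\<close> by (simp_all add: swapf_apply)
   have o': "swapf u v f c \<prec> p" if "c \<in> I" "c ~= x" "c \<prec> p" for c
   proof -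
    have "c ~= v" using False that(3) by blast
    then show ?thesis using o[OF that] u that(2) by (simp add: swapf_apply)
   qed
   have "p \<prec> swapf u v f p" unfolding e using a by simp
   moreover have "p \<prec> swapf u v f x" unfolding e by fact
   moreover have "(if u = x & v \<prec> p then v else x) = x" using False by simp
   ultimately show ?thesis
    unfolding passing_def using lm a(2,3,5,6) r' o' by simp
  qed
 next
  case u: False
  have vx: "v ~= x"
  proof
   assume "v = x"
   then have "u \<prec> p" "p \<prec> f u" using uv(3) a(6,7) c pt_less_trans by blast+
   then show False using o[OF uv(1) u] pt_less_asym by blast
  qed
  have up: "f v \<prec> p & v \<prec> p & v ~= p" if "u \<prec> p"
  proof -
   have "f v \<prec> p" using o[OF uv(1) u that] c pt_less_trans by blast
   moreover have "v \<prec> p" using r[OF uv(2)] calculation pt_less_trans by metis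
   ultimately show ?thesis by auto
  qed
  have pu: "p \<prec> f v" if "u = p"
   using r[OF uv(2)] uv(3) that pt_less_trans by metis
  have nv: "u \<prec> p" if "v \<prec> p" using uv(3) that pt_less_trans by blast
  have vp: "u \<prec> p" if "v = p" using uv(3) that by blast
  have e: "swapf u v f x = f x" using u vx by (simp add: swapf_apply)
  have vp': "v ~= p" using vp up by blast
  have "p \<prec> swapf u v f p" using vp' pu a(4) by (cases "u = p") (auto simp: swapf_apply)
  moreover have "swapf u v f c \<prec> p" if c: "c \<in> I" "c ~= x" "c \<prec> p" for c
   using up o[OF c] o[OF uv(1) u] nv c(3) by (auto simp: swapf_apply)
  moreover have "(if u = x & v \<prec> p then v else x) = x" using u by simp
  ultimately show ?thesis
   unfolding passing_def using lm a(2,3,5,6,7) r' e by simp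
 qed
qed

text \<open>Every other strand starting before \<open>p\<close> ends before \<open>p\<close>, hence
  not between the ends of the exchanged strands. So no third strand contributes, and exactly one
  crossing is gained or lost.\<close>

lemma ninv_toggle:
 assumes "passing I f p x"
 shows "if f p \<prec> f x then ninv (gr I id f) = ninv (gr I id (swapf x p f)) + 1
  else ninv (gr I id (swapf x p f)) = ninv (gr I id f) + 1"
proof -
 have a: "line_map I f" "finite I" "p \<in> I" "p \<prec> f p" "x \<in> I" "x \<prec> p" "p \<prec> f x"
  using assms(1) by (simp_all add: passing_def)
 have o: "f c \<prec> p" if "c \<in> I" "c ~= x" "c \<prec> p" for c using assms(1) that unfolding passing_def by blast
 have xp: "x ~= p" "fst x = fst p" using a by (auto simp: pt_less_def)
 have e: "{w \<in> I. x \<prec> w & w \<prec> p & g p \<prec> g w & g w \<prec> g x} = {}"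
  if "g = f \<or> g = swapf x p f" for g
 proof -
  have "\<not> g p \<prec> g w" if w: "w \<in> I" "x \<prec> w" "w \<prec> p" for w
  proof -
   have "w ~= x" "w ~= p" using w by auto
   then have "g w = f w" "g p = f p \<or> g p = f x" using \<open>g = f \<or> g = swapf x p f\<close> by (auto simp: swapf_apply)
   moreover have "f w \<prec> p" using o w \<open>w ~= x\<close> by blast
   ultimately show ?thesis using a(4,7) pt_less_trans pt_less_asym by metis
  qed
  then show ?thesis by blast
 qed
 show ?thesis
 proof (cases "f p \<prec> f x")
  case True
  have "ninv (gr I id f) = ninv (gr I id (swapf x p f)) + 1 + 2 * card {w \<in> I. x \<prec> w & w \<prec> p & f p \<prec> f w & f w \<prec> f x}"
   using ninv_swapf[OF a(1,2,5,3,6) True] .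
  then show ?thesis using True e[of f] by (simp only: card.empty mult_0_right add_0_right if_True refl simp_thms)
 next
  case False
  let ?g = "swapf x p f"
  have l: "line_map I ?g" using line_map_swapf a(1,3,5) xp by blast
  have "f x \<prec> f p" using False line_map_less_iff[OF a(1,3,5)] xp by simp
  then have "?g p \<prec> ?g x" using xp by (simp add: swapf_apply)
  then have "ninv (gr I id ?g) = ninv (gr I id (swapf x p ?g)) + 1 + 2 * card {w \<in> I. x \<prec> w & w \<prec> p & ?g p \<prec> ?g w & ?g w \<prec> ?g x}"
   using ninv_swapf[OF l a(2,5,3,6)] by blast
  then show ?thesis using False e[of ?g] by (simp only: card.empty mult_0_right add_0_right if_False swapf_swapf refl simp_thms)
 qed
qed

lemma gr_comp_perm:
 assumes "a ` I \<subseteq> I"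
 shows "gr I id a O gr I id f = gr I id (f \<circ> a)"
proof (intro subset_antisym subrelI)
 fix u v assume "(u, v) \<in> gr I id a O gr I id f"
 then show "(u, v) \<in> gr I id (f \<circ> a)" by (auto simp: in_gr relcomp_unfold)
next
 fix u v assume "(u, v) \<in> gr I id (f \<circ> a)"
 then have "u \<in> I" "v = f (a u)" by (auto simp: in_gr)
 then have "(u, a u) \<in> gr I id a" "(a u, v) \<in> gr I id f" using assms by (auto simp: in_gr)
 then show "(u, v) \<in> gr I id a O gr I id f" by (rule relcompI)
qed

lemma comp_swapf: "f \<circ> swapf u v b = swapf u v (f \<circ> b)"
 by (auto simp: swapf_def fun_eq_iff)

lemma swapf_comp: "swapf u v f \<circ> swapf x p id = swapf x p (swapf u v f)"
 by (auto simp: swapf_def fun_eq_iff)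

text \<open>Toggling is composition on the left with the transposition \<open>s\<close> of
  \<open>x\<close> and \<open>p\<close>, so \<open>all_resolutions_comp\<close> applies. Resolving
  the crossing of \<open>x\<close> with \<open>p\<close> in \<open>s\<close> returns the diagram.
  The other crossings of \<open>s\<close> give error terms, and the same errors arise on the other
  side from resolutions that change the start of the strand over \<open>p\<close>.\<close>

lemma all_resolutions_toggle:
 assumes "passing I f p x"
 shows "all_resolutions (toggle p (gr I id f)) + lin (%xi. basis (toggle p xi)) (all_resolutions (gr I id f)) =
  basis (gr I id f)"
proof -
 have a: "line_map I f" "finite I" "p \<in> I" "p \<prec> f p" "x \<in> I" "x \<prec> p" "p \<prec> f x"
  using assms(1) by (simp_all add: passing_def)
 have o: "f c \<prec> p" if "c \<in> I" "c ~= x" "c \<prec> p" for c using assms(1) that unfolding passing_def by blast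
 have xp: "x ~= p" "fst x = fst p" using a by (auto simp: pt_less_def)
 define B where "B = (%g. basis (gr I id g))"
 define C where "C = {c \<in> I. x \<prec> c & c \<prec> p}"
 have finC: "finite C" using a(2) by (simp add: C_def)
 have Cne: "c ~= x" "c ~= p" if "c \<in> C" for c using that by (auto simp: C_def)
 define X where "X = crossing_pairs I id f"
 have finX: "finite X" using a(2) by (simp add: X_def)
 define s where "s = gr I id (swapf x p id)"
 have ls: "line_map I (swapf x p id)" using line_map_swapf[OF line_map_id a(5,3) xp(2)] .
 have im: "swapf x p id ` I \<subseteq> I" using swapf_image[OF a(5,3), of id] by simp
 have im2: "swapf u v (swapf x p id) ` I \<subseteq> I" if "u \<in> I" "v \<in> I" for u v
  using swapf_image[OF that, of "swapf x p id"] swapf_image[OF a(5,3), of id]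
  by (simp only: image_id id_apply subset_refl)
 have tog: "toggle p (gr I id f) = s O gr I id f"
  unfolding s_def gr_comp_perm[OF im] toggle_gr(1)[OF assms] comp_swapf by simp
 have br: "braid s" "braid (gr I id f)"
  unfolding s_def using a ls by (auto intro!: braid_gr simp: line_map_def)
 have "Range s = Domain (gr I id f)" unfolding s_def using swapf_image[OF a(5,3), of id] by simp
 then have "all_resolutions (s O gr I id f) = lin (%mu. basis (mu O gr I id f)) (all_resolutions s) +
   lin (%nu. basis (s O nu)) (all_resolutions (gr I id f))"
  by (rule all_resolutions_comp[OF br])
 moreover have "lin (%nu. basis (s O nu)) (all_resolutions (gr I id f)) = (\<Sum>(u, v)\<in>X. B (swapf x p (swapf u v f)))"
  unfolding all_resolutions_gr[OF line_map_id a(1)] lin_sum X_def[symmetric] B_def s_def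
  by (simp add: basis_def gr_comp_perm[OF im] swapf_comp case_prod_beta)
 moreover have "lin (%mu. basis (mu O gr I id f)) (all_resolutions s) =
   B f + (\<Sum>c\<in>C. B (swapf x c (swapf x p f)) + B (swapf c p (swapf x p f)))"
 proof -
  let ?Y = "crossing_pairs I id (swapf x p id)"
  \<comment> \<open>The transposition crosses \<open>x\<close> with \<open>p\<close>, and both of
    them with every point strictly between.\<close>
  have Y: "?Y = insert (x, p) ((%c. (x, c)) ` C Un (%c. (c, p)) ` C)"
  proof (intro subset_antisym subsetI)
   fix q assume "q \<in> ?Y"
   then obtain u v where q: "q = (u, v)" "u \<in> I" "v \<in> I" "u \<prec> v" "\<not> swapf x p id u \<prec> swapf x p id v"
    unfolding crossing_pairs_def by auto
   have fuv: "fst u = fst v" "u ~= v" using q(4) by (auto simp: pt_less_def)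
   have sw: "swapf x p id w = (if w = p then x else if w = x then p else w)" for w
    by (simp add: swapf_apply)
   have "u = x & v = p \<or> u = x & v \<in> C \<or> v = p & u \<in> C"
   proof (cases "u = x")
    case True
    show ?thesis
    proof (cases "v = p")
     case False
     then have "\<not> p \<prec> v" "fst p = fst v" using q(5) True fuv xp unfolding sw by auto
     then have "v \<prec> p" using pt_less_total False by metis
     then show ?thesis using True q(3,4) by (simp add: C_def)
    qed (use True in simp)
   next
    case ux: False
    show ?thesis
    proof (cases "u = p")
     case True
     then have "x \<prec> v" "v ~= p" "v ~= x" using q(4) a(6) fuv pt_less_trans pt_less_asym by blast+
     then show ?thesis using q(5) True unfolding sw by simp
    next
     case up: False
     show ?thesis
     proof (cases "v = p")
      case True
      then have "\<not> u \<prec> x" "fst u = fst x" using q(5) ux up fuv xp unfolding sw by auto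
      then have "x \<prec> u" using pt_less_total ux by metis
      then show ?thesis using True q(2,4) by (simp add: C_def)
     next
      case vp: False
      have "u \<prec> p" if "v = x" using q(4) a(6) that pt_less_trans by blast
      then show ?thesis using q(4,5) ux up vp unfolding sw by (auto split: if_splits)
     qed
    qed
   qed
   then show "q \<in> insert (x, p) ((%c. (x, c)) ` C Un (%c. (c, p)) ` C)" unfolding q(1) by blast
  next
   have m: "(u, v) \<in> ?Y" if "u \<in> I" "v \<in> I" "u \<prec> v" "\<not> swapf x p id u \<prec> swapf x p id v" for u v
    using that by (simp add: crossing_pairs_def)
   fix q assume "q \<in> insert (x, p) ((%c. (x, c)) ` C Un (%c. (c, p)) ` C)"
   then consider "q = (x, p)" | c where "c \<in> C" "q = (x, c)" | c where "c \<in> C" "q = (c, p)" by blast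
   then show "q \<in> ?Y"
   proof cases
    case 1
    then show ?thesis using a xp pt_less_asym[OF a(6)] by (auto intro!: m simp: swapf_apply)
   next
    case (2 c)
    then show ?thesis using a xp Cne[OF 2(1)] pt_less_asym[of c p] by (auto intro!: m simp: swapf_apply C_def)
   next
    case (3 c)
    then show ?thesis using a xp Cne[OF 3(1)] pt_less_asym[of x c] by (auto intro!: m simp: swapf_apply C_def)
   qed
  qed
  have "lin (%mu. basis (mu O gr I id f)) (all_resolutions s) = (\<Sum>(u, v)\<in>?Y. B (swapf u v (swapf x p f)))"
   unfolding s_def all_resolutions_gr[OF line_map_id ls] lin_sum B_def
  proof (rule sum.cong[OF refl], clarify, goal_cases)
   case (1 u1 u2 v1 v2)
   then have "(u1, u2) \<in> I" "(v1, v2) \<in> I" by (auto simp: crossing_pairs_def)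
   then show ?case by (simp add: basis_def gr_comp_perm[OF im2] comp_swapf)
  qed
  also have "... = B (swapf x p (swapf x p f)) + (\<Sum>(u, v)\<in>(%c. (x, c)) ` C Un (%c. (c, p)) ` C. B (swapf u v (swapf x p f)))"
   unfolding Y using finC Cne by (subst sum.insert) auto
  also have "(\<Sum>(u, v)\<in>(%c. (x, c)) ` C Un (%c. (c, p)) ` C. B (swapf u v (swapf x p f))) =
    (\<Sum>(u, v)\<in>(%c. (x, c)) ` C. B (swapf u v (swapf x p f))) + (\<Sum>(u, v)\<in>(%c. (c, p)) ` C. B (swapf u v (swapf x p f)))"
   using finC Cne xp by (intro sum.union_disjoint) auto
  also have "(\<Sum>(u, v)\<in>(%c. (x, c)) ` C. B (swapf u v (swapf x p f))) = (\<Sum>c\<in>C. B (swapf x c (swapf x p f)))"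
   by (subst sum.reindex) (auto simp: inj_on_def)
  also have "(\<Sum>(u, v)\<in>(%c. (c, p)) ` C. B (swapf u v (swapf x p f))) = (\<Sum>c\<in>C. B (swapf c p (swapf x p f)))"
   by (subst sum.reindex) (auto simp: inj_on_def)
  finally show ?thesis by (simp only: sum.distrib swapf_swapf)
 qed
 moreover have "lin (%xi. basis (toggle p xi)) (all_resolutions (gr I id f)) =
   (\<Sum>(u, v)\<in>X. B (swapf x p (swapf u v f))) +
   (\<Sum>c\<in>C. B (swapf x c (swapf x p f)) + B (swapf c p (swapf x p f)))"
 proof -
  \<comment> \<open>The resolutions after which the strand over \<open>p\<close> starts at
    \<open>c\<close> instead of \<open>x\<close>. Only for these does toggling differ from
    exchanging \<open>x\<close> and \<open>p\<close>.\<close>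
  let ?E = "(%c. (x, c)) ` C"
  have E: "?E \<subseteq> X"
  proof
   fix q assume "q \<in> ?E"
   then obtain c where c: "q = (x, c)" "c \<in> C" by blast
   then have "f c \<prec> f x" using o[of c] Cne a(7) pt_less_trans[of "f c" p "f x"] by (auto simp: C_def)
   then show "q \<in> X" using c a pt_less_asym[of "f c" "f x"] by (auto simp: X_def crossing_pairs_def C_def)
  qed
  have ind: "(u, v) \<in> ?E \<longleftrightarrow> u = x & v \<prec> p" if "(u, v) \<in> X" for u v
   using that by (auto simp: X_def crossing_pairs_def C_def)
  have "lin (%xi. basis (toggle p xi)) (all_resolutions (gr I id f)) =
    (\<Sum>q\<in>X. basis (toggle p (gr I id (swapf (fst q) (snd q) f))))"
   unfolding all_resolutions_gr[OF line_map_id a(1)] lin_sum X_def[symmetric]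
   by (simp add: basis_def case_prod_beta)
  also have "... = (\<Sum>q\<in>X. if q \<in> ?E then B (swapf (snd q) p (swapf x (snd q) f)) else B (swapf x p (swapf (fst q) (snd q) f)))"
  proof (rule sum.cong[OF refl])
   fix q assume q: "q \<in> X"
   obtain u v where e: "q = (u, v)" by (rule prod.exhaust)
   show "basis (toggle p (gr I id (swapf (fst q) (snd q) f))) =
     (if q \<in> ?E then B (swapf (snd q) p (swapf x (snd q) f)) else B (swapf x p (swapf (fst q) (snd q) f)))"
    using toggle_gr(1)[OF passing_swapf[OF assms q[unfolded X_def e]]] ind[of u v] q
    unfolding e B_def by auto
  qed
  also have "... = (\<Sum>q\<in>X. B (swapf x p (swapf (fst q) (snd q) f)) +
    (if q \<in> ?E then B (swapf x p (swapf x (snd q) f)) + B (swapf (snd q) p (swapf x (snd q) f)) else 0))"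
   by (rule sum.cong) auto
  also have "... = (\<Sum>q\<in>X. B (swapf x p (swapf (fst q) (snd q) f))) +
    (\<Sum>q\<in>X. if q \<in> ?E then B (swapf x p (swapf x (snd q) f)) + B (swapf (snd q) p (swapf x (snd q) f)) else 0)"
   by (rule sum.distrib)
  also have "(\<Sum>q\<in>X. if q \<in> ?E then B (swapf x p (swapf x (snd q) f)) + B (swapf (snd q) p (swapf x (snd q) f)) else 0) =
    (\<Sum>q\<in>X Int ?E. B (swapf x p (swapf x (snd q) f)) + B (swapf (snd q) p (swapf x (snd q) f)))"
   by (rule sum.inter_restrict[OF finX, symmetric])
  also have "X Int ?E = ?E" using E by blast
  also have "(\<Sum>q\<in>?E. B (swapf x p (swapf x (snd q) f)) + B (swapf (snd q) p (swapf x (snd q) f))) =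
    (\<Sum>c\<in>C. B (swapf x p (swapf x c f)) + B (swapf c p (swapf x c f)))"
   by (subst sum.reindex) (auto simp: inj_on_def)
  also have "... = (\<Sum>c\<in>C. B (swapf x c (swapf x p f)) + B (swapf c p (swapf x p f)))"
  proof (rule sum.cong[OF refl])
   fix c assume "c \<in> C"
   show "B (swapf x p (swapf x c f)) + B (swapf c p (swapf x c f)) =
     B (swapf x c (swapf x p f)) + B (swapf c p (swapf x p f))"
    unfolding swapf_braids[OF xp(1) Cne[OF \<open>c \<in> C\<close>]] by (rule add.commute)
  qed
  finally show ?thesis unfolding case_prod_beta .
 qed
 ultimately show ?thesis unfolding tog B_def by (simp add: add.assoc add.left_commute)
qed

text \<open>A homotopy has to gain one crossing because the differential loses one, so only the
  toggles that gain a crossing are kept.\<close>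

definition toggle_up :: "point => strands => vec" where
 "toggle_up p nu = (if ninv (toggle p nu) = ninv nu + 1 then basis (toggle p nu) else 0)"

text \<open>Projection of \<open>all_resolutions_toggle\<close> to the inversion number of
  \<open>nu\<close>. Toggling changes this number by exactly one, so only a toggle upwards combined
  with a resolution losing one crossing lands there.\<close>

lemma toggle_homotopy:
 assumes "passing I f p x" "nu = gr I id f"
 shows "vec_diff (toggle_up p nu) + lin (toggle_up p) (strand_diff nu) = basis nu"
proof -
 have a: "line_map I f" "finite I" "p \<in> I" "x \<in> I" "x \<prec> p"
  using assms(1) by (simp_all add: passing_def)
 have fxp: "fst x = fst p" using a(5) by (simp add: pt_less_def)
 have br: "braid nu" unfolding assms(2) using a by (auto intro!: braid_gr simp: line_map_def)
 have brt: "braid (toggle p nu)" unfolding assms(2) toggle_gr(1)[OF assms(1)]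
  using a line_map_swapf[OF a(1,4,3) fxp] by (auto intro!: braid_gr simp: line_map_def)
 have n1: "ninv (toggle p nu) = ninv nu + 1 \<or> ninv nu = ninv (toggle p nu) + 1"
  using ninv_toggle[OF assms(1)] unfolding assms(2) toggle_gr(1)[OF assms(1)] by metis
 let ?R = "restr (%xi. ninv xi = ninv nu)"
 have "?R (all_resolutions (toggle p nu)) = vec_diff (toggle_up p nu)"
 proof (cases "ninv (toggle p nu) = ninv nu + 1")
  case True
  then show ?thesis using strand_diff_restr[OF brt] by (simp add: toggle_up_def)
 next
  case False
  then have "?R (all_resolutions (toggle p nu)) = 0"
   using n1 all_resolutions_props(4)[OF brt] by (intro restr_none) fastforce
  then show ?thesis using False by (simp add: toggle_up_def)
 qed
 moreover have "?R (lin (%xi. basis (toggle p xi)) (all_resolutions nu)) = lin (toggle_up p) (strand_diff nu)"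
  unfolding restr_lin strand_diff_restr[OF br] lin_restr
 proof (rule lin_cong)
  fix xi assume xi: "xi \<in> keys (all_resolutions nu)"
  have lt: "ninv xi < ninv nu" using all_resolutions_props(4)[OF br xi] .
  have "xi \<in> (\<Union>q\<in>crossing_pairs I id f. keys (case q of (u, v) => basis (gr I id (swapf u v f))))"
   using subsetD[OF keys_sum_subset xi[unfolded assms(2) all_resolutions_gr[OF line_map_id a(1)]]] .
  then obtain q where q: "q \<in> crossing_pairs I id f" "xi \<in> keys (case q of (u, v) => basis (gr I id (swapf u v f)))"
   by (rule UN_E)
  obtain u v where e: "q = (u, v)" by (rule prod.exhaust)
  have xie: "xi = gr I id (swapf u v f)" using q(2) by (simp add: e basis_def)
  note ps = passing_swapf[OF assms(1) q(1)[unfolded e]]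
  have "ninv (toggle p xi) = ninv xi + 1 \<or> ninv xi = ninv (toggle p xi) + 1"
   using ninv_toggle[OF ps] unfolding xie toggle_gr(1)[OF ps] by metis
  then show "restr (%xi. ninv xi = ninv nu) (basis (toggle p xi)) =
    (if ninv xi + 1 = ninv nu then toggle_up p xi else 0)"
   using lt by (auto simp: basis_def restr_single toggle_up_def)
 qed
 moreover have "?R (basis nu) = basis nu" by (simp add: basis_def restr_single)
 ultimately show ?thesis
  using all_resolutions_toggle[OF assms(1)] unfolding assms(2)[symmetric] by (metis restr_add)
qed

section \<open>Toggling on diagrams and acyclicity of non-viable summands\<close>

context arc
begin

definition stacked :: "point => strands => bool" where
 "stacked p nu \<longleftrightarrow> good nu & over nu p = 1 & p \<in> Domain (mv nu) & p \<notin> Range (mv nu)"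

lemma stacked_passing:
 assumes "stacked p nu"
 obtains f x where "nu = gr (Domain nu) id f" "passing (Domain nu) f p x"
proof -
 have g: "good nu" using assms by (simp add: stacked_def)
 obtain f where f: "nu = gr (Domain nu) id f" "finite (Domain nu)" "line_map (Domain nu) f"
  using braid_line_map[OF goodD(2)[OF g]] by metis
 define I where "I = Domain nu"
 note f = f[folded I_def]
 have el: "(u, v) \<in> nu \<longleftrightarrow> u \<in> I & v = f u" for u v using f(1) by (metis id_apply in_gr)
 have r: "u = f u \<or> u \<prec> f u" if "u \<in> I" for u using risingD[OF goodD(3)[OF g]] el that by blast
 obtain z where z: "(p, z) \<in> mv nu" using assms unfolding stacked_def by blast
 then have p: "p \<in> I" "p \<prec> f p" using r[of p] by (auto simp: in_mv el)
 have "card {q \<in> nu. fst q \<prec> p & p \<prec> snd q} = 1"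
  using assms unfolding stacked_def over_def by simp
 then obtain q where q: "{q \<in> nu. fst q \<prec> p & p \<prec> snd q} = {q}" by (rule card_1_singletonE)
 have qnu: "q \<in> nu" "fst q \<prec> p" "p \<prec> snd q" using q by blast+
 define x where "x = fst q"
 have x: "x \<in> I" "x \<prec> p" "p \<prec> f x" using qnu el[of "fst q" "snd q"] by (auto simp: x_def)
 have "f c \<prec> p" if c: "c \<in> I" "c ~= x" "c \<prec> p" for c
 proof -
  have "(c, f c) \<in> nu" using el c by blast
  have 1: "\<not> p \<prec> f c"
  proof
   assume "p \<prec> f c"
   then have "(c, f c) \<in> {q}" unfolding q[symmetric] using c \<open>(c, f c) \<in> nu\<close> by simp
   then show False using c(2) unfolding x_def by auto
  qed
  have 2: "f c ~= p"
  proof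
   assume "f c = p"
   then have "(c, p) \<in> mv nu" using \<open>(c, f c) \<in> nu\<close> c(3) by (auto simp: in_mv)
   then show False using assms unfolding stacked_def by blast
  qed
  have "fst (f c) = fst p" using f(3) c unfolding line_map_def by (simp add: pt_less_def)
  then show ?thesis using 1 2 pt_less_total by blast
 qed
 then have "passing I f p x" unfolding passing_def using f(2,3) r p x by blast
 then show ?thesis using that f(1) unfolding I_def by blast
qed

lemma stacked_toggle:
 assumes "stacked p nu"
 shows "good (toggle p nu)" "toggle p (toggle p nu) = nu" "Domain (toggle p nu) = Domain nu" "Range (toggle p nu) = Range nu"
  "ninv (toggle p nu) = ninv nu + 1 ==> hdat (toggle p nu) = hdat nu"
proof -
 obtain f x where f: "nu = gr (Domain nu) id f" "passing (Domain nu) f p x" using stacked_passing[OF assms] .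
 define I where "I = Domain nu"
 note f = f[folded I_def]
 have g: "good nu" using assms by (simp add: stacked_def)
 have a: "line_map I f" "finite I" "p \<in> I" "p \<prec> f p" "x \<in> I" "x \<prec> p" "p \<prec> f x"
  using f(2) by (simp_all add: passing_def)
 have o: "f c \<prec> p" if "c \<in> I" "c ~= x" "c \<prec> p" for c using f(2) that unfolding passing_def by blast
 have xp: "x ~= p" "fst x = fst p" using a by (auto simp: pt_less_def)
 have q: "(x, f x) \<in> nu" "(p, f p) \<in> nu" "(x, f x) ~= (p, f p)" "fst (fst (x, f x)) = fst (fst (p, f p))"
  using a xp f(1) by (auto simp: in_gr)
 have t: "toggle p nu = resolve nu (x, f x) (p, f p)"
  unfolding toggle_def using toggle_gr(2,3)[OF f(2)] f(1) by simp
 note r = resolve_props[OF goodD(2)[OF g] q(1-4), unfolded fst_conv snd_conv]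
 show D: "Domain (toggle p nu) = Domain nu" "Range (toggle p nu) = Range nu" unfolding t using r by blast+
 have xf: "x \<prec> f p" using a(4,6) pt_less_trans by blast
 have "rising (toggle p nu)"
  using goodD(3)[OF g] xf a(7) unfolding t resolve_def rising_def by simp
 moreover have "toggle p nu \<subseteq> points Z \<times> points Z"
  using q(1,2) goodD(4)[OF g] unfolding t resolve_def by auto
 ultimately have "strand_diagram Z (toggle p nu)" using r(1) strand_diagramI unfolding t by blast
 then show g': "good (toggle p nu)" using goodD(8,9)[OF g] unfolding good_def D by simp
 have te: "toggle p nu = gr I id (swapf x p f)" using toggle_gr(1)[OF f(2)] f(1) by simp
 have ps: "passing I (swapf x p f) p x"
  using f(2) xp line_map_swapf[OF a(1,5,3) xp(2)] xf unfolding passing_def by (auto simp: swapf_apply)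
 show "toggle p (toggle p nu) = nu" unfolding te toggle_gr(1)[OF ps] using f(1) by simp
 assume n: "ninv (toggle p nu) = ninv nu + 1"
 have "\<not> f p \<prec> f x" using ninv_toggle[OF f(2)] n unfolding te f(1)[symmetric] by auto
 then have fx: "f x \<prec> f p" using line_map_less_iff[OF a(1,3,5)] xp by simp
 \<comment> \<open>When toggling gains a crossing, \<open>nu\<close> is the resolution of that
   crossing, so the H-data agree.\<close>
 have "reduces (toggle p nu) nu"
  unfolding reduces_def
 proof (intro exI conjI)
  show "(x, f p) \<in> toggle p nu" "(p, f x) \<in> toggle p nu" unfolding t resolve_def by auto
  show "x \<prec> p" "f x \<prec> f p" by fact+
  show "nu = resolve (toggle p nu) (x, f p) (p, f x)" unfolding t using r(4) by simp
  have "\<not> (x \<prec> c & c \<prec> p & f x \<prec> d & d \<prec> f p)" if cd: "(c, d) \<in> toggle p nu" for c d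
  proof
   assume h: "x \<prec> c & c \<prec> p & f x \<prec> d & d \<prec> f p"
   then have "c ~= x" "c ~= p" by auto
   moreover have "c \<in> I" "d = swapf x p f c" using cd unfolding te in_gr by auto
   ultimately have "d = f c" "f c \<prec> p" using o h by (auto simp: swapf_apply)
   then show False using h a(7) pt_less_trans pt_less_asym by metis
  qed
  then show "\<forall>(c, d)\<in>toggle p nu. \<not> (x \<prec> c & c \<prec> p & f x \<prec> d & d \<prec> f p)" by blast
 qed
 then show "hdat (toggle p nu) = hdat nu" using reduces_hdat[OF g'] by simp
qed

text \<open>Both exchanged strands move, so they are the same in all terms of a diagram, and
  toggling respects \<open>~~\<close>.\<close>

lemma stacked_sim:
 assumes "stacked p nu" "nu ~~ nu'"
 shows "stacked p nu'" "toggle p nu ~~ toggle p nu'" "ninv (toggle p nu) = ninv nu + 1 ==> ninv (toggle p nu') = ninv nu' + 1"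
proof -
 have m: "mv nu = mv nu'" and g: "good nu" "good nu'" using assms(2) by (simp_all add: sim_def)
 have om: "over mu p = over (mv mu) p" for mu
  unfolding over_def mv_def by (rule arg_cong[of _ _ card]) (auto dest: pt_less_asym)
 have "over nu' p = over nu p" using om[of nu] om[of nu'] m by simp
 then show st': "stacked p nu'" using assms(1) g unfolding stacked_def m by simp
 obtain f x where f: "nu = gr (Domain nu) id f" "passing (Domain nu) f p x" using stacked_passing[OF assms(1)] .
 obtain f' x' where f': "nu' = gr (Domain nu') id f'" "passing (Domain nu') f' p x'" using stacked_passing[OF st'] .
 have el: "(u, v) \<in> nu \<longleftrightarrow> u \<in> Domain nu & v = f u" "(u, v) \<in> nu' \<longleftrightarrow> u \<in> Domain nu' & v = f' u" for u v
  using f(1) f'(1) by (metis id_apply in_gr)+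
 have a: "p \<in> Domain nu" "p \<prec> f p" "x \<in> Domain nu" "x \<prec> p" "p \<prec> f x"
  using f(2) by (simp_all add: passing_def)
 have "x \<prec> f x" using a pt_less_trans by blast
 then have "(x, f x) \<in> mv nu" "(p, f p) \<in> mv nu" using a el by (auto simp: in_mv)
 then have in': "(x, f x) \<in> nu'" "(p, f p) \<in> nu'" unfolding m by (simp_all add: in_mv)
 then have x: "x \<in> Domain nu'" "f' x = f x" "f' p = f p" using el(2) by simp_all
 have "x' = x"
 proof (rule ccontr)
  assume "x' ~= x"
  then have "f' x \<prec> p" using passing_other[OF f'(2) x(1) _ a(4)] by simp
  then show False using a(5) x(2) pt_less_asym by simp
 qed
 note f' = f'[unfolded this]
 have t: "toggle p nu = resolve nu (x, f x) (p, f p)" "toggle p nu' = resolve nu' (x, f x) (p, f p)"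
  unfolding toggle_def using toggle_gr(2,3)[OF f(2)] f(1) toggle_gr(2,3)[OF f'(2)] f'(1) x by simp_all
 have mv: "mv (resolve mu a b) = (mv mu - {a, b}) Un mv {(fst a, snd b), (fst b, snd a)}" for mu a b
  by (auto simp: mv_def resolve_def)
 have "mv (toggle p nu) = mv (toggle p nu')" unfolding t mv m ..
 then show "toggle p nu ~~ toggle p nu'"
  using stacked_toggle[OF assms(1)] stacked_toggle[OF st'] assms(2) unfolding sim_def srcs_def tgts_def by simp
 assume n: "ninv (toggle p nu) = ninv nu + 1"
 have "\<not> f p \<prec> f x"
  using n ninv_toggle[OF f(2)] f(1) toggle_gr(1)[OF f(2)] by (metis add_cancel_right_right add.assoc one_neq_zero add_is_0)
 then show "ninv (toggle p nu') = ninv nu' + 1"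
  using ninv_toggle[OF f'(2)] f'(1) toggle_gr(1)[OF f'(2)] x by metis
qed

text \<open>The homotopy formula turns a cycle into the boundary of its upward toggles. It remains
  to see that these form whole diagrams.\<close>

lemma stacked_acyclic:
 assumes "inA x" "vec_diff x = 0" "\<forall>nu\<in>keys x. stacked p nu"
 shows "x \<in> bds"
proof -
 define y where "y = lin (toggle_up p) x"
 have st: "stacked p nu" if "nu \<in> keys x" for nu using assms(3) that by blast
 have k: "keys y = (toggle p) ` {nu \<in> keys x. ninv (toggle p nu) = ninv nu + 1}"
 proof -
  have inj: "inj_on (toggle p) {nu \<in> keys x. ninv (toggle p nu) = ninv nu + 1}"
   by (rule inj_on_inverseI[where g = "toggle p"]) (use stacked_toggle(2) st in blast)
  have "y = (\<Sum>nu\<in>{nu \<in> keys x. ninv (toggle p nu) = ninv nu + 1}. basis (toggle p nu))"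
   unfolding y_def lin_def toggle_up_def by (simp add: sum.inter_filter)
  also have "... = vecof (toggle p ` {nu \<in> keys x. ninv (toggle p nu) = ninv nu + 1})"
   unfolding vecof_def basis_def sum.reindex[OF inj] o_def ..
  finally show ?thesis by simp
 qed
 have "inA y"
  unfolding inA_def
 proof (intro conjI ballI allI impI)
  fix xi assume "xi \<in> keys y"
  then show "good xi" unfolding k using stacked_toggle(1) st by blast
 next
  fix xi xi' assume s: "xi ~~ xi'" "xi \<in> keys y"
  then obtain nu where nu: "xi = toggle p nu" "nu \<in> keys x" "ninv (toggle p nu) = ninv nu + 1"
   unfolding k by blast
  have tx: "toggle p xi = nu" using stacked_toggle(2)[OF st[OF nu(2)]] nu(1) by simp
  \<comment> \<open>Once a strand starts at \<open>p\<close>, being stacked can be read off from the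
    multiplicities at \<open>p\<close>, and toggling upwards preserves these.\<close>
  have stxi: "stacked p xi"
  proof -
   obtain f x where f: "nu = gr (Domain nu) id f" "passing (Domain nu) f p x" using stacked_passing[OF st[OF nu(2)]] .
   have h: "hdat xi = hdat nu" using stacked_toggle(5)[OF st[OF nu(2)] nu(3)] nu(1) by simp
   have g: "good xi" "good nu" using s(1) st[OF nu(2)] by (simp_all add: sim_def stacked_def)
   have "p \<in> Domain (mv xi)"
   proof -
    have te: "xi = gr (Domain nu) id (swapf x p f)" using toggle_gr(1)[OF f(2)] f(1) nu(1) by simp
    have "(p, f x) \<in> xi" unfolding te in_gr using f(2) by (auto simp: passing_def swapf_apply)
    moreover have "p ~= f x" using f(2) by (auto simp: passing_def)
    ultimately show ?thesis by (auto simp: in_mv)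
   qed
   moreover have "0 < snd p" using f(2) by (auto simp: passing_def pt_less_def)
   ultimately show ?thesis
    using h_grading_at[OF goodD(2,3)[OF g(1)], of p] h_grading_at[OF goodD(2,3)[OF g(2)], of p] h st[OF nu(2)] g(1)
    unfolding stacked_def hdat_def by (auto split: if_splits)
  qed
  have "toggle p xi ~~ toggle p xi'" using stacked_sim(2)[OF stxi s(1)] .
  then have m: "toggle p xi' \<in> keys x" using assms(1) nu(2) tx unfolding inA_def by blast
  have e: "toggle p (toggle p xi') = xi'" using stacked_toggle(2)[OF stacked_sim(1)[OF stxi s(1)]] .
  have "ninv (toggle p (toggle p xi')) = ninv (toggle p xi') + 1"
   using stacked_sim(3)[OF st[OF nu(2)], of "toggle p xi'"] \<open>toggle p xi ~~ toggle p xi'\<close> nu(3) unfolding tx by blast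
  then show "xi' \<in> keys y" unfolding k using m e by (intro image_eqI[of _ _ "toggle p xi'"]) auto
 qed
 moreover have "vec_diff y = x"
 proof -
  have "vec_diff y = lin (%nu. vec_diff (toggle_up p nu)) x"
   unfolding y_def by (rule additive_lin[OF vec_diff_add])
  also have "... = lin (%nu. basis nu + lin (toggle_up p) (strand_diff nu)) x"
  proof (rule lin_cong)
   fix nu assume "nu \<in> keys x"
   then obtain f x where "nu = gr (Domain nu) id f" "passing (Domain nu) f p x" using stacked_passing st by metis
   then have "vec_diff (toggle_up p nu) + lin (toggle_up p) (strand_diff nu) = basis nu"
    using toggle_homotopy by blast
   then show "vec_diff (toggle_up p nu) = basis nu + lin (toggle_up p) (strand_diff nu)"
    by (rule add_eq_char2)
  qed
  also have "... = x + lin (toggle_up p) (vec_diff x)"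
   unfolding lin_fun_add vec_diff_lin lin_lin vec_eq_lin_basis[symmetric] ..
  finally show ?thesis using assms(2) by simp
 qed
 ultimately show ?thesis unfolding in_boundaries by blast
qed

text \<open>Left of the first step of multiplicity at least two the multiplicity is at most one. By
  \<open>h_grading_at\<close> this jump forces, in every term, one strand over the point between,
  one starting there and none ending there.\<close>

lemma nonviable_acyclic:
 assumes "\<not> viable Z h" "x \<in> summand (h, s, t)" "vec_diff x = 0"
 shows "x \<in> bds"
proof (cases "x = 0")
 case False
 have A: "inA x" and hd: "hdat nu = (h, s, t)" if "nu \<in> keys x" for nu
  using assms(2) that unfolding alg_summand_eq by auto
 have A: "inA x" using assms(2) unfolding alg_summand_eq by auto
 have hnu: "h_grading nu = h" "good nu" if "nu \<in> keys x" for nu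
  using hd[OF that] A that unfolding hdat_def inA_def by auto
 obtain nu0 where nu0: "nu0 \<in> keys x" using False by (metis all_not_in_conv keys_eq_empty)
 obtain i j where ij: "(i, j) \<in> steps Z" "h (i, j) ~= 0" "h (i, j) ~= 1" using assms(1) unfolding viable_def by auto
 have nn: "0 <= h e" for e using hnu[OF nu0] h_grading_nonneg by metis
 have "2 <= h (i, j)" using nn[of "(i, j)"] ij by linarith
 define j0 where "j0 = (LEAST j. 2 <= h (i, j))"
 have j0: "2 <= h (i, j0)" unfolding j0_def by (rule LeastI) fact
 have j0le: "j0 <= j" unfolding j0_def by (rule Least_le) fact
 \<comment> \<open>A strand covering the first step must start at the start of the interval, and
   only one does. So a step precedes \<open>j0\<close>.\<close>
 have start: "h (i, 0) <= 1"
 proof -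
  have "{q \<in> nu0. covers q (i, 0)} \<subseteq> {q \<in> nu0. fst q = (i, 0)}" by (auto simp: covers_def)
  moreover have "card {q \<in> nu0. fst q = (i, 0)} <= Suc 0"
  proof (subst card_le_Suc0_iff_eq)
   show "finite {q \<in> nu0. fst q = (i, 0)}" using goodD(5)[OF hnu(2)[OF nu0]] by simp
   show "\<forall>a\<in>{q \<in> nu0. fst q = (i, 0)}. \<forall>b\<in>{q \<in> nu0. fst q = (i, 0)}. a = b"
    using goodD(2)[OF hnu(2)[OF nu0]] unfolding braid_def single_valued_def by auto
  qed
  ultimately have "card {q \<in> nu0. covers q (i, 0)} <= 1"
   using card_mono[of "{q \<in> nu0. fst q = (i, 0)}" "{q \<in> nu0. covers q (i, 0)}"] goodD(5)[OF hnu(2)[OF nu0]] by simp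
  then show ?thesis unfolding hnu(1)[OF nu0, symmetric] h_grading_covers by simp
 qed
 have pos: "0 < j0" using j0 start by (cases j0) auto
 have "\<not> 2 <= h (i, j0 - 1)" unfolding j0_def by (rule not_less_Least) (use pos in \<open>simp add: j0_def\<close>)
 then have before: "h (i, j0 - 1) <= 1" by linarith
 have "stacked (i, j0) nu" if nu: "nu \<in> keys x" for nu
 proof -
  note hg = h_grading_at[OF goodD(2,3)[OF hnu(2)[OF nu]], of "(i, j0)", unfolded hnu(1)[OF nu] step_before_def step_after_def fst_conv snd_conv, OF pos]
  show ?thesis unfolding stacked_def using hg before j0 hnu(2)[OF nu] by (auto simp: of_bool_def split: if_splits)
 qed
 then show ?thesis using stacked_acyclic A assms(3) by blast
qed simp

end

section \<open>The complex of partial transversals\<close>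

text \<open>A viable summand is isomorphic to the following complex: \<open>C\<close> is the set of places at which strands
 may be broken, \<open>\<pi>\<close> sends a place to its matched pair, at most one place of each pair is broken, and
 the differential breaks one more strand.\<close>

lemma sum_symmetric_zero:
 fixes g :: "'a => 'a => 'b::char2"
 assumes "finite R" "!!a b. (a, b) \<in> R ==> (b, a) \<in> R & a ~= b & g a b = g b a"
 shows "(\<Sum>(a, b)\<in>R. g a b) = 0"
 using assms
proof (induction "card R" arbitrary: R rule: less_induct)
 case less
 show ?case
 proof (cases "R = {}")
  case False
  then obtain a b where ab: "(a, b) \<in> R" by auto
  then have ba: "(b, a) \<in> R" "a ~= b" "g a b = g b a" using less.prems(2) by blast+
  let ?R = "R - {(a, b), (b, a)}"
  have "card ?R < card R" using ab less.prems(1) by (intro psubset_card_mono) auto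
  then have "(\<Sum>(a, b)\<in>?R. g a b) = 0" using less.prems by (intro less.hyps) auto
  moreover have "(\<Sum>(a, b)\<in>R. g a b) = (\<Sum>(a, b)\<in>?R. g a b) + (\<Sum>(a, b)\<in>{(a, b), (b, a)}. g a b)"
   using ab ba less.prems(1) by (intro sum.subset_diff) auto
  moreover have "(\<Sum>(a, b)\<in>{(a, b), (b, a)}. g a b) = 0" using ba by simp
  ultimately show ?thesis by simp
 qed simp
qed

locale transversals =
 fixes C :: "'p set" and \<pi> :: "'p => 'q"
 assumes finC: "finite C"
begin

definition pt :: "'p set set" where "pt = {B. B \<subseteq> C & inj_on \<pi> B}"

definition ext :: "'p set => 'p set" where "ext B = {p \<in> C. \<pi> p \<notin> \<pi> ` B}"

definition dC :: "'p set => ('p set \<Rightarrow>\<^sub>0 bit)" where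
 "dC B = (\<Sum>p\<in>ext B. single (insert p B) 1)"

text \<open>Rejoins the strands at \<open>q\<close>: the model of the creation operator, as
  \<open>creation_op_lin\<close> shows.\<close>

definition join :: "'p => 'p set => ('p set \<Rightarrow>\<^sub>0 bit)" where
 "join q B = (if q \<in> B then single (B - {q}) 1 else 0)"

definition full :: "'p set => bool" where "full B \<longleftrightarrow> \<pi> ` B = \<pi> ` C"

lemma finite_ext [simp]: "finite (ext B)" using finC by (simp add: ext_def)

lemma ext_notin: "p \<in> ext B ==> p \<notin> B" by (auto simp: ext_def)

lemma pt_insert: "B \<in> pt ==> p \<in> ext B ==> insert p B \<in> pt"
 by (auto simp: pt_def ext_def inj_on_insert)

lemma pt_subset: "B \<in> pt ==> B' \<subseteq> B ==> B' \<in> pt"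
 by (auto simp: pt_def intro: inj_on_subset)

lemma full_iff: "B \<in> pt ==> full B \<longleftrightarrow> ext B = {}"
 by (auto simp: pt_def full_def ext_def)

lemma keys_dC: "keys (dC B) = (%p. insert p B) ` ext B"
proof -
 have "inj_on (%p. insert p B) (ext B)" using ext_notin by (intro inj_onI) blast
 then have "dC B = vecof ((%p. insert p B) ` ext B)" by (simp add: dC_def vecof_def sum.reindex)
 then show ?thesis by simp
qed

lemma dC_dC: "lin dC (dC B) = 0"
proof -
 have "lin dC (dC B) = (\<Sum>p\<in>ext B. \<Sum>q\<in>ext (insert p B). single (insert q (insert p B)) 1)"
  unfolding dC_def[of B] lin_sum lin_single by (simp add: dC_def)
 also have "... = (\<Sum>(p, q)\<in>(SIGMA p:ext B. ext (insert p B)). single (insert q (insert p B)) 1)"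
  by (rule sum.Sigma) auto
 also have "... = 0"
 \<comment> \<open>Two breaks can be made in either order.\<close>
 proof (rule sum_symmetric_zero)
  show "finite (SIGMA p:ext B. ext (insert p B))" by (intro finite_SigmaI) auto
 qed (auto simp: ext_def insert_commute)
 finally show ?thesis .
qed

text \<open>If \<open>q\<close> is broken, rejoining frees its pair, which can be broken again at
  any of its places, whereas breaking first reaches only other pairs. If \<open>q\<close> is
  unbroken, rejoining is possible only after breaking \<open>q\<close> itself.\<close>

lemma join_homotopy:
 assumes "B \<in> pt" "q \<in> C"
 shows "lin dC (join q B) + lin (join q) (dC B) =
  (if q \<in> B then single B 1 + (\<Sum>p\<in>{p \<in> C. \<pi> p = \<pi> q} - {q}. single (insert p (B - {q})) 1)
  else if \<pi> q \<in> \<pi> ` B then 0 else single B 1)"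
proof (cases "q \<in> B")
 case True
 let ?F = "{p \<in> C. \<pi> p = \<pi> q}"
 let ?g = "%p. single (insert p (B - {q})) (1::bit)"
 have e: "ext (B - {q}) = ext B Un ?F"
  using assms True unfolding ext_def pt_def inj_on_def by (auto simp: image_iff)
 have d: "ext B Int ?F = {}" using True by (auto simp: ext_def)
 have fF: "finite ?F" using finC by simp
 have "lin dC (join q B) = sum ?g (ext B) + sum ?g ?F"
  using True fF d by (simp add: join_def dC_def e sum.union_disjoint)
 moreover have "lin (join q) (dC B) = sum ?g (ext B)"
  unfolding dC_def lin_sum lin_single
 proof (rule sum.cong[OF refl])
  fix p assume "p \<in> ext B"
  then have "p ~= q" using True ext_notin by blast
  then show "join q (insert p B) = ?g p" using True by (simp add: join_def insert_Diff_if)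
 qed
 moreover have "sum ?g ?F = single B 1 + sum ?g (?F - {q})"
  using sum.remove[OF fF, of q ?g] assms True by (simp add: insert_absorb)
 ultimately show ?thesis using True by (simp add: add.commute add.left_commute)
next
 case False
 have "lin (join q) (dC B) = (\<Sum>p\<in>ext B. if p = q then single B 1 else 0)"
  unfolding dC_def lin_sum lin_single using False by (intro sum.cong) (auto simp: join_def)
 also have "... = (if \<pi> q \<in> \<pi> ` B then 0 else single B 1)"
  unfolding sum.delta[OF finite_ext] using assms(2) by (auto simp: ext_def)
 finally show ?thesis using False by (simp add: join_def)
qed

definition chains :: "('p set \<Rightarrow>\<^sub>0 bit) set" where
 "chains = {c. keys c \<subseteq> pt}"

lemma chains_add: "x \<in> chains ==> y \<in> chains ==> x + y \<in> chains"
 unfolding chains_def mem_Collect_eq keys_add_bit by blast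

lemma chains_lin:
 assumes "x \<in> chains" "!!B. B \<in> pt ==> keys (g B) \<subseteq> pt"
 shows "lin g x \<in> chains"
 using keys_lin_subset[of g x] assms unfolding chains_def by blast

lemma chains_dC: "x \<in> chains ==> lin dC x \<in> chains"
 by (rule chains_lin) (auto simp: keys_dC pt_insert)

lemma chains_join: "x \<in> chains ==> lin (join q) x \<in> chains"
 by (rule chains_lin) (auto simp: join_def split: if_splits intro: pt_subset)

lemma homotopy_lin:
 assumes "x \<in> chains"
 shows "lin dC (lin (join q) x) + lin (join q) (lin dC x) = lin (%B. lin dC (join q B) + lin (join q) (dC B)) x"
 unfolding lin_lin lin_fun_add ..

text \<open>If \<open>q\<close> is the only place of its pair, the correction terms of
  \<open>join_homotopy\<close> are absent, and the pair can be broken only at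
  \<open>q\<close>.\<close>

lemma lone_place_acyclic:
 assumes "x \<in> chains" "q \<in> C" "{p \<in> C. \<pi> p = \<pi> q} = {q}"
 shows "lin dC (lin (join q) x) + lin (join q) (lin dC x) = x"
proof -
 have "lin (%B. lin dC (join q B) + lin (join q) (dC B)) x = lin (%B. single B 1) x"
 proof (rule lin_cong)
  fix B assume "B \<in> keys x"
  then have B: "B \<in> pt" using assms(1) by (auto simp: chains_def)
  have "\<pi> q \<in> \<pi> ` B ==> q \<in> B" using B assms(3) by (auto simp: pt_def)
  then show "lin dC (join q B) + lin (join q) (dC B) = single B 1"
   unfolding join_homotopy[OF B assms(2)] assms(3) by simp
 qed
 then show ?thesis unfolding homotopy_lin[OF assms(1)] using vec_eq_sum[of x] by simp
qed

text \<open>The augmentation: the number modulo 2 of terms in which every pair is broken. It detects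
  the homology class when every place has a twin.\<close>

definition eps :: "('p set \<Rightarrow>\<^sub>0 bit) => bit" where
 "eps x = lin (%B. if full B then 1 else 0) x"

lemma eps_add: "eps (x + y) = eps x + eps y" by (simp add: eps_def lin_add)

end

locale doubled_transversals = transversals +
 assumes twin: "p \<in> C ==> \<exists>p'. p' ~= p & {r \<in> C. \<pi> r = \<pi> p} = {p, p'}"
begin

text \<open>The last unbroken pair can be broken at either of its two places, so full sets arise in
  twos.\<close>

lemma eps_dC: "eps (lin dC x) = 0"
proof -
 have "lin (%B. if full B then (1::bit) else 0) (dC B) = 0" for B
 proof -
  have l: "lin (%B. if full B then (1::bit) else 0) (dC B) = (\<Sum>p\<in>ext B. if full (insert p B) then 1 else 0)"
   unfolding dC_def lin_sum lin_single ..
  show ?thesis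
  proof (cases "\<exists>p\<in>ext B. full (insert p B)")
   case True
   then obtain p where p: "p \<in> C" "\<pi> p \<notin> \<pi> ` B" "insert (\<pi> p) (\<pi> ` B) = \<pi> ` C" by (auto simp: ext_def full_def)
   obtain p' where p': "p' ~= p" "{r \<in> C. \<pi> r = \<pi> p} = {p, p'}" using twin[OF p(1)] by blast
   have "\<pi> r \<notin> \<pi> ` B \<longleftrightarrow> \<pi> r = \<pi> p" if "r \<in> C" for r using p that by (metis imageI insert_iff)
   then have e: "ext B = {p, p'}" unfolding p'(2)[symmetric] ext_def by blast
   have "\<pi> p' = \<pi> p" using p'(2) by blast
   then have "full (insert p B)" "full (insert p' B)" using p(3) by (simp_all add: full_def)
   then show ?thesis unfolding l e using p'(1) by simp
  qed (simp add: l)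
 qed
 then show ?thesis unfolding eps_def lin_lin by simp
qed

text \<open>The homotopy \<open>join q\<close> moves a break from \<open>q\<close> to its twin and
  discards the sets in which the pair of \<open>q\<close> is unbroken. Done for all places outside
  \<open>c\<close>, this leaves only \<open>c\<close>, with coefficient
  \<open>eps x\<close>.\<close>

lemma homologous_to_transversal:
 assumes "x \<in> chains" "lin dC x = 0" "c \<in> pt" "full c"
 shows "\<exists>y\<in>chains. x + lin dC y = (if eps x = 1 then single c 1 else 0)"
proof -
 \<comment> \<open>Invariant for the places treated so far: their pairs are broken, but at the twin
   place.\<close>
 have "\<exists>y\<in>chains. \<forall>B\<in>keys (x + lin dC y). \<forall>q\<in>Q. q \<notin> B & \<pi> q \<in> \<pi> ` B"
  if "finite Q" "Q \<subseteq> C - c" for Q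
  using that
 proof (induction Q rule: finite_induct)
  case empty
  have "0 \<in> chains" by (simp add: chains_def)
  then show ?case by blast
 next
  case (insert q Q)
  then obtain y where y: "y \<in> chains" "\<forall>B\<in>keys (x + lin dC y). \<forall>q\<in>Q. q \<notin> B & \<pi> q \<in> \<pi> ` B" by blast
  define x' where "x' = x + lin dC y"
  have x': "x' \<in> chains" unfolding x'_def using chains_add assms(1) chains_dC y(1) by blast
  have "lin dC (lin dC y) = 0" unfolding lin_lin dC_dC by simp
  then have dx': "lin dC x' = 0" unfolding x'_def lin_add assms(2) by simp
  have q: "q \<in> C" "q \<notin> c" using insert by auto
  have "\<pi> q \<in> \<pi> ` c" using q assms(4) by (auto simp: full_def)
  then obtain p where p: "p \<in> c" "\<pi> p = \<pi> q" by force
  have pC: "p \<in> C" "p ~= q" using p q assms(3) by (auto simp: pt_def)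
  have F: "{r \<in> C. \<pi> r = \<pi> q} = {q, p}" using twin[OF q(1)] p pC by blast
  define z where "z = lin (join q) x'"
  have "x' + lin dC z = lin (%B. single B 1 + (lin dC (join q B) + lin (join q) (dC B))) x'"
   unfolding lin_fun_add[of "%B. single B 1"] homotopy_lin[OF x', symmetric] dx' lin_zero z_def
   using vec_eq_sum[of x'] by simp
  also have "... = lin (%B. if q \<in> B then single (insert p (B - {q})) 1
    else if \<pi> q \<in> \<pi> ` B then single B 1 else 0) x'"
  proof (rule lin_cong)
   fix B assume "B \<in> keys x'"
   then have B: "B \<in> pt" using x' by (auto simp: chains_def)
   have "{r \<in> C. \<pi> r = \<pi> q} - {q} = {p}" unfolding F using pC by auto
   then show "single B 1 + (lin dC (join q B) + lin (join q) (dC B)) =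
     (if q \<in> B then single (insert p (B - {q})) 1 else if \<pi> q \<in> \<pi> ` B then single B 1 else 0)"
    unfolding join_homotopy[OF B q(1)] by simp
  qed
  finally have e: "x' + lin dC z = ..." .
  have "q' \<notin> B' & \<pi> q' \<in> \<pi> ` B'" if B': "B' \<in> keys (x' + lin dC z)" and q': "q' \<in> insert q Q" for B' q'
  proof -
   obtain B where B: "B \<in> keys x'" "B' \<in> keys (if q \<in> B then single (insert p (B - {q})) (1::bit)
    else if \<pi> q \<in> \<pi> ` B then single B 1 else 0)"
    using subsetD[OF keys_lin_subset B'[unfolded e]] by blast
   have Q: "r \<notin> B & \<pi> r \<in> \<pi> ` B" if "r \<in> Q" for r using B(1) y(2) that unfolding x'_def by blast
   have pQ: "p \<notin> insert q Q" using p insert.prems by auto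
   show ?thesis
   proof (cases "q \<in> B")
    case True
    then have B'e: "B' = insert p (B - {q})" using B(2) by simp
    have "\<pi> ` B' = \<pi> ` B" unfolding B'e using True p(2) by (auto simp: image_iff)
    then show ?thesis using q' Q pQ True unfolding B'e by auto
   next
    case False
    then have "B' = B" "\<pi> q \<in> \<pi> ` B" using B(2) by (auto split: if_splits)
    then show ?thesis using q' Q False by auto
   qed
  qed
  moreover have "x' + lin dC z = x + lin dC (y + z)" unfolding x'_def lin_add by (simp add: add.assoc)
  moreover have "y + z \<in> chains" unfolding z_def using chains_add y(1) chains_join x' by blast
  ultimately show ?case by metis
 qed
 from this[of "C - c"] obtain y where y: "y \<in> chains"
  "\<forall>B\<in>keys (x + lin dC y). \<forall>q\<in>C - c. q \<notin> B & \<pi> q \<in> \<pi> ` B" using finC by auto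
 define x' where "x' = x + lin dC y"
 have x': "x' \<in> chains" unfolding x'_def using chains_add assms(1) chains_dC y(1) by blast
 have "B = c" if B: "B \<in> keys x'" for B
 proof -
  have Bpt: "B \<in> pt" using x' B by (auto simp: chains_def)
  have "B \<subseteq> c" using y(2) B Bpt unfolding x'_def pt_def by blast
  moreover have "r \<in> B" if r: "r \<in> c" for r
  proof -
   have rC: "r \<in> C" using r assms(3) by (auto simp: pt_def)
   obtain r' where r': "r' ~= r" "{s \<in> C. \<pi> s = \<pi> r} = {r, r'}" using twin[OF rC] by blast
   have "r' \<in> C" "\<pi> r' = \<pi> r" using r' by blast+
   moreover have "r' \<notin> c" using r r' calculation assms(3) by (auto simp: pt_def dest: inj_onD)
   ultimately have "\<pi> r' \<in> \<pi> ` B" "\<pi> r' = \<pi> r" using y(2) B unfolding x'_def by blast+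
   then have "\<pi> r \<in> \<pi> ` B" by simp
   then obtain b where "b \<in> B" "\<pi> b = \<pi> r" by force
   then show ?thesis using \<open>B \<subseteq> c\<close> r assms(3) by (auto simp: pt_def dest: inj_onD)
  qed
  ultimately show ?thesis by blast
 qed
 then have k: "keys x' \<subseteq> {c}" by blast
 have ex: "eps x' = eps x" unfolding x'_def eps_add eps_dC by simp
 have "x' = (if eps x = 1 then single c 1 else 0)"
 proof (cases "keys x' = {}")
  case True
  then have "x' = 0" by simp
  then show ?thesis using ex by (simp add: eps_def)
 next
  case False
  then have "keys x' = {c}" using k by blast
  then have "keys x' = keys (single c (1::bit))" by simp
  then have "x' = single c 1" by (rule vec_eqI)
  then show ?thesis using ex assms(4) by (simp add: eps_def)
 qed
 then show ?thesis using y(1) unfolding x'_def by blast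
qed

end

section \<open>Viable summands\<close>

lemma card_nonzero: "finite S ==> q \<in> S ==> card S ~= 0"
 by auto

lemma mv_less: "rising nu ==> (x, y) \<in> mv nu ==> (x, y) \<in> nu & x \<prec> y"
 using risingD[of nu x y] by (simp only: in_mv) blast

lemma Domain_remove: "single_valued r ==> (x, y) \<in> r ==> Domain (r - {(x, y)}) = Domain r - {x}"
 unfolding single_valued_def by blast

lemma Range_remove: "single_valued (r^-1) ==> (x, y) \<in> r ==> Range (r - {(x, y)}) = Range r - {y}"
 unfolding single_valued_def by blast

locale viable_summand = arc +
 fixes h :: h1 and s t :: "nat set"
 assumes viable: "viable Z h"
begin

definition V :: "strands set" where "V = {nu. good nu & hdat nu = (h, s, t)}"

text \<open>In a viable summand these places determine the diagram
  (\<open>sim_iff_brk\<close>).\<close>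

definition brk :: "strands => point set" where "brk nu = Domain (mv nu) Int Range (mv nu)"

text \<open>The matched pairs at which a horizontal strand can be joined with the strands at a place.\<close>

definition Act :: "nat set" where
 "Act = {P \<in> s Int t. \<forall>q\<in>fibre Z P. h (step_before q) = h (step_after q)}"

text \<open>The places where a strand of the summand may be broken: both adjacent steps are covered,
  and the pair can carry a horizontal strand.\<close>

definition C0 :: "point set" where
 "C0 = {p \<in> Pl. h (step_before p) = 1 & h (step_after p) = 1 & pr p \<in> Act}"

lemma finite_V: "finite V"
 by (rule finite_subset[OF _ finite_good]) (auto simp: V_def)

sublocale T: transversals C0 pr
 by standard (auto simp: C0_def)

lemma VD:
 assumes "nu \<in> V"
 shows "good nu" "h_grading nu = h" "srcs nu = s" "tgts nu = t" "braid nu" "rising nu" "finite nu" "hdat nu = (h, s, t)"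
 using assms goodD[of nu] by (auto simp: V_def hdat_def)

lemma steps_at: "p \<in> Pl ==> step_before p \<in> steps Z" "p \<in> Pl ==> step_after p \<in> steps Z"
 by (auto simp: places_def steps_def step_before_def step_after_def)

lemma h_01: "e \<in> steps Z ==> h e = 0 \<or> h e = 1"
 using viable by (auto simp: viable_def)

lemma h_before:
 assumes "nu \<in> V" "p \<in> Pl"
 shows "h (step_before p) = int (over nu p) + of_bool (p \<in> Range (mv nu))"
 using h_grading_at(1)[OF VD(5,6)[OF assms(1)] place_snd[OF assms(2)]] VD(2)[OF assms(1)] by simp

lemma h_after:
 assumes "nu \<in> V" "p \<in> Pl"
 shows "h (step_after p) = int (over nu p) + of_bool (p \<in> Domain (mv nu))"
 using h_grading_at(2)[OF VD(5,6)[OF assms(1)] place_snd[OF assms(2)]] VD(2)[OF assms(1)] by simp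

lemma at_place:
 assumes "nu \<in> V" "p \<in> Pl"
 shows "over nu p <= 1" "p \<in> Range (mv nu) ==> over nu p = 0" "p \<in> Domain (mv nu) ==> over nu p = 0"
  "p \<in> brk nu ==> h (step_before p) = 1 & h (step_after p) = 1"
proof -
 have b: "int (over nu p) + of_bool (p \<in> Range (mv nu)) <= 1" "int (over nu p) + of_bool (p \<in> Domain (mv nu)) <= 1"
  using h_before[OF assms] h_after[OF assms] h_01[OF steps_at(1)[OF assms(2)]] h_01[OF steps_at(2)[OF assms(2)]]
  by linarith+
 show 1: "over nu p <= 1" using b(1) by (cases "p \<in> Range (mv nu)") simp_all
 show 2: "p \<in> Range (mv nu) ==> over nu p = 0" using b(1) by simp
 show "p \<in> Domain (mv nu) ==> over nu p = 0" using b(2) by simp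
 show "p \<in> brk nu ==> h (step_before p) = 1 & h (step_after p) = 1"
  unfolding h_before[OF assms] h_after[OF assms] using 2 by (simp add: brk_def)
qed

lemma covers_unique:
 assumes "nu \<in> V" "q \<in> nu" "r \<in> nu" "covers q e" "covers r e" "e \<in> steps Z"
 shows "q = r"
proof -
 have "int (card {p \<in> nu. covers p e}) <= 1"
  using h_01[OF assms(6)] VD(2)[OF assms(1)] h_grading_covers[of nu e] by auto
 then have "card {p \<in> nu. covers p e} <= Suc 0" by simp
 moreover have "finite {p \<in> nu. covers p e}" using VD(7)[OF assms(1)] by simp
 ultimately show ?thesis using assms card_le_Suc0_iff_eq by blast
qed

lemma overE:
 assumes "nu \<in> V" "p \<in> Pl" "over nu p = 1"
 obtains x y where "(x, y) \<in> nu" "x \<prec> p" "p \<prec> y" "!!c d. (c, d) \<in> nu ==> c \<prec> p ==> p \<prec> d ==> c = x & d = y"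
proof -
 obtain q where q: "{q \<in> nu. fst q \<prec> p & p \<prec> snd q} = {q}"
  using assms(3) unfolding over_def by (rule card_1_singletonE)
 have "q \<in> nu" "fst q \<prec> p" "p \<prec> snd q" using q by blast+
 moreover have "c = fst q & d = snd q" if "(c, d) \<in> nu" "c \<prec> p" "p \<prec> d" for c d
 proof -
  have "(c, d) \<in> {q \<in> nu. fst q \<prec> p & p \<prec> snd q}" using that by simp
  then show ?thesis unfolding q by auto
 qed
 ultimately show ?thesis using that[of "fst q" "snd q"] by simp
qed

lemma over_pos: "nu \<in> V ==> (x, y) \<in> nu ==> x \<prec> p ==> p \<prec> y ==> over nu p ~= 0"
proof -
 assume *: "nu \<in> V" "(x, y) \<in> nu" "x \<prec> p" "p \<prec> y"
 have "(x, y) \<in> {q \<in> nu. fst q \<prec> p & p \<prec> snd q}" using * by simp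
 moreover have "finite {q \<in> nu. fst q \<prec> p & p \<prec> snd q}" using VD(7)[OF *(1)] by simp
 ultimately show ?thesis unfolding over_def by (rule card_nonzero[rotated])
qed

lemma between_place:
 assumes "x \<in> points Z" "y \<in> points Z" "x \<prec> p" "p \<prec> y"
 shows "p \<in> Pl"
 using assms by (cases p) (auto simp: points_def places_def pt_less_def)

lemma strand_points: "nu \<in> V ==> (x, y) \<in> nu ==> x \<in> points Z & y \<in> points Z"
 using goodD(4)[OF VD(1)] by blast

lemma step_at_start: "x \<in> points Z ==> y \<in> points Z ==> x \<prec> y ==> x \<in> steps Z"
 by (cases x) (auto simp: points_def steps_def pt_less_def)

text \<open>Each step is covered by at most one strand, so the strand of the other diagram on the
  first step of a given strand is determined. If it started or ended elsewhere, one of the diagrams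
  would run through a place where the other is broken.\<close>

lemma mv_subset_if_brk_eq:
 assumes "nu \<in> V" "nu' \<in> V" "brk nu = brk nu'"
 shows "mv nu \<subseteq> mv nu'"
proof (rule subrelI)
 fix x y assume xy: "(x, y) \<in> mv nu"
 have xynu: "(x, y) \<in> nu" "x \<prec> y" using xy risingD[OF VD(6)[OF assms(1)], of x y] by (auto simp: in_mv)
 note pxy = strand_points[OF assms(1) xynu(1)]
 have "covers (x, y) x" using xynu(2) by (auto simp: covers_def pt_less_def)
 then have "(x, y) \<in> {p \<in> nu. covers p x}" using xynu by simp
 then have "card {p \<in> nu. covers p x} ~= 0" using VD(7)[OF assms(1)] by (intro card_nonzero) auto
 then have "card {p \<in> nu'. covers p x} ~= 0"
  using VD(2)[OF assms(1)] VD(2)[OF assms(2)] h_grading_covers[of nu x] h_grading_covers[of nu' x] by simp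
 then obtain q where q: "q \<in> nu'" "covers q x" by (metis (mono_tags, lifting) card.empty empty_Collect_eq)
 obtain x' y' where e: "q = (x', y')" by (rule prod.exhaust)
 note q = q[unfolded e]
 have lines: "fst x' = fst x" "fst x' = fst y'" "fst x = fst y"
  using q rising_fst[OF VD(6)[OF assms(2)]] xynu(2) by (auto simp: covers_def pt_less_def)
 have c: "x' = x \<or> x' \<prec> x" "x \<prec> y'" using q(2) lines by (auto simp: covers_def pt_less_def prod_eq_iff)
 note pxy' = strand_points[OF assms(2) q(1)]
 have brk_over: "p \<notin> brk mu" if "mu \<in> V" "p \<in> Pl" "over mu p ~= 0" for mu p
  using at_place(2)[OF that(1,2)] that(3) by (auto simp: brk_def)
 have over_brk: "p \<in> brk mu"
  if "mu \<in> V" "p \<in> Pl" "over mu p = 0" "h (step_before p) ~= 0" "h (step_after p) ~= 0" for mu p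
  using h_before[OF that(1,2)] h_after[OF that(1,2)] that(3-5) by (auto simp: brk_def split: if_splits)
 have hne: "h (step_before p) ~= 0" "h (step_after p) ~= 0" if "mu \<in> V" "p \<in> Pl" "over mu p ~= 0" for mu p
  using h_before[OF that(1,2)] h_after[OF that(1,2)] that(3) by auto
 have x: "x' = x"
 proof (rule ccontr)
  assume "x' ~= x"
  then have "x' \<prec> x" using c by blast
  then have o: "over nu' x ~= 0" using over_pos[OF assms(2) q(1)] c by blast
  have px: "x \<in> Pl" using between_place pxy' \<open>x' \<prec> x\<close> c by blast
  have "over nu x = 0" using at_place(3)[OF assms(1) px] xy by blast
  then have "x \<in> brk nu" using over_brk[OF assms(1) px] hne[OF assms(2) px o] by blast
  then show False using brk_over[OF assms(2) px o] assms(3) by blast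
 qed
 have y: "y' = y"
 proof (rule ccontr)
  assume "y' ~= y"
  then consider "y \<prec> y'" | "y' \<prec> y" using pt_less_total lines by metis
  then show False
  proof cases
   case 1
   have "x' \<prec> y" using xynu(2) x by simp
   then have o: "over nu' y ~= 0" using over_pos[OF assms(2) q(1)] 1 by blast
   have py: "y \<in> Pl" using between_place pxy' \<open>x' \<prec> y\<close> 1 by blast
   have "over nu y = 0" using at_place(2)[OF assms(1) py] xy by blast
   then have "y \<in> brk nu" using over_brk[OF assms(1) py] hne[OF assms(2) py o] by blast
   then show False using brk_over[OF assms(2) py o] assms(3) by blast
  next
   case 2
   have o: "over nu y' ~= 0" using over_pos[OF assms(1) xynu(1)] c(2) 2 by blast
   have py: "y' \<in> Pl" using between_place pxy c(2) 2 by blast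
   have "(x', y') \<in> mv nu'" using q(1) x c(2) by (auto simp: in_mv)
   then have "over nu' y' = 0" using at_place(2)[OF assms(2) py] by blast
   then have "y' \<in> brk nu'" using over_brk[OF assms(2) py] hne[OF assms(1) py o] by blast
   then show False using brk_over[OF assms(1) py o] assms(3) by blast
  qed
 qed
 show "(x, y) \<in> mv nu'" using q(1) xy x y by (simp add: in_mv)
qed

lemma sim_iff_brk: "nu \<in> V ==> nu' \<in> V ==> nu ~~ nu' \<longleftrightarrow> brk nu = brk nu'"
proof -
 assume *: "nu \<in> V" "nu' \<in> V"
 have "mv nu = mv nu' \<longleftrightarrow> brk nu = brk nu'"
  using mv_subset_if_brk_eq[OF *] mv_subset_if_brk_eq[OF *(2,1)] by (auto simp: brk_def)
 then show ?thesis unfolding sim_def using VD[OF *(1)] VD[OF *(2)] by simp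
qed

lemma sim_V: "nu \<in> V ==> nu ~~ nu' ==> nu' \<in> V"
 using sim_hdat[of nu nu'] by (auto simp: V_def sim_def)

lemma brk_places: "nu \<in> V ==> p \<in> brk nu ==> p \<in> Pl"
proof -
 assume nu: "nu \<in> V" and "p \<in> brk nu"
 then obtain x y where xy: "(x, p) \<in> mv nu" "(p, y) \<in> mv nu" unfolding brk_def by blast
 then have "(x, p) \<in> nu" "(p, y) \<in> nu" "x ~= p" "p ~= y" by (simp_all add: in_mv)
 moreover from this have "x \<prec> p" "p \<prec> y" using risingD[OF VD(6)[OF nu]] by blast+
 ultimately show ?thesis using strand_points[OF nu] between_place by blast
qed

lemma mv_Dom_Ran: "p \<in> Domain (mv nu) ==> p \<in> Domain nu" "p \<in> Range (mv nu) ==> p \<in> Range nu"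
 by (auto simp: in_mv)

lemma Dom_unique: "nu \<in> V ==> p \<in> Domain nu ==> q \<in> Domain nu ==> p \<in> Pl ==> q \<in> Pl ==> pr p = pr q ==> p = q"
 using goodD(8)[OF VD(1)] by (auto dest: inj_onD)

lemma Ran_unique: "nu \<in> V ==> p \<in> Range nu ==> q \<in> Range nu ==> p \<in> Pl ==> q \<in> Pl ==> pr p = pr q ==> p = q"
 using goodD(9)[OF VD(1)] by (auto dest: inj_onD)

lemma in_fibre: "q \<in> fibre Z P \<longleftrightarrow> q \<in> Pl & pr q = P" by (simp add: fibre_def)

text \<open>A strand breaking or resting at \<open>p\<close> uses up the pair at both ends of the
  diagram. Nothing starts or ends at the twin, so the multiplicity does not change there
  either.\<close>

lemma active:
 assumes "nu \<in> V" "p \<in> Pl" "p \<in> brk nu \<or> (p, p) \<in> nu"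
 shows "pr p \<in> Act"
proof -
 have D: "p \<in> Domain nu" "p \<in> Range nu" using assms(3) mv_Dom_Ran unfolding brk_def by blast+
 have "pr p \<in> srcs nu" "pr p \<in> tgts nu" unfolding srcs_def tgts_def using D assms(2) by blast+
 then have st: "pr p \<in> s Int t" using VD(3,4)[OF assms(1)] by simp
 have "h (step_before q) = h (step_after q)" if q: "q \<in> Pl" "pr q = pr p" for q
 proof (cases "q = p")
  case True
  have "p \<in> Range (mv nu) \<longleftrightarrow> p \<in> Domain (mv nu)"
   using assms(3) horizontal_iff(3)[OF VD(5)[OF assms(1)], of p] by (auto simp: brk_def)
  then show ?thesis unfolding True h_before[OF assms(1,2)] h_after[OF assms(1,2)] by simp
 next
  case False
  have "q \<notin> Domain (mv nu)" "q \<notin> Range (mv nu)"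
   using Dom_unique[OF assms(1) D(1)] Ran_unique[OF assms(1) D(2)] mv_Dom_Ran assms(2) q False by metis+
  then show ?thesis unfolding h_before[OF assms(1) q(1)] h_after[OF assms(1) q(1)] by simp
 qed
 then show ?thesis using st by (auto simp: Act_def in_fibre)
qed

lemma brk_pt: "nu \<in> V ==> brk nu \<in> T.pt"
proof -
 assume nu: "nu \<in> V"
 have "brk nu \<subseteq> C0"
 proof
  fix p assume p: "p \<in> brk nu"
  have "p \<in> Pl" using brk_places nu p by blast
  then show "p \<in> C0" unfolding C0_def using at_place(4)[OF nu _ p] active[OF nu] p by blast
 qed
 moreover have "inj_on pr (brk nu)"
 proof (rule inj_onI)
  fix p q assume pq: "p \<in> brk nu" "q \<in> brk nu" "pr p = pr q"
  then have "p \<in> Domain nu" "q \<in> Domain nu" using mv_Dom_Ran(1) by (simp_all add: brk_def)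
  then show "p = q" using Dom_unique[OF nu] brk_places[OF nu] pq by simp
 qed
 ultimately show ?thesis by (simp add: T.pt_def)
qed

lemma horizontal_ext:
 assumes "nu \<in> V" "p \<in> Pl" "(p, p) \<in> nu"
 shows "pr p \<notin> pr ` brk nu"
proof
 assume "pr p \<in> pr ` brk nu"
 then obtain b where b: "pr p = pr b" "b \<in> brk nu" by (rule imageE)
 have "b \<in> Domain nu" using b(2) mv_Dom_Ran(1) unfolding brk_def by blast
 then have "p = b" using Dom_unique[OF assms(1) _ _ assms(2) brk_places[OF assms(1) b(2)] b(1)] assms(3) by blast
 then show False using b(2) horizontal_iff(3)[OF VD(5)[OF assms(1)] assms(3)] by (simp add: brk_def)
qed

text \<open>The pair belongs to \<open>s\<close>, so a strand starts at one of its places. If it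
  moved, the equal multiplicities on both sides would force another strand to end there, and the
  pair would be broken.\<close>

lemma active_horizontal:
 assumes "nu \<in> V" "p \<in> Pl" "pr p \<in> Act" "pr p \<notin> pr ` brk nu"
 obtains q where "q \<in> Pl" "pr q = pr p" "(q, q) \<in> nu"
proof -
 have "pr p \<in> srcs nu" using assms(3) VD(3)[OF assms(1)] by (auto simp: Act_def)
 then obtain q where q: "pr p = pr q" "q \<in> Domain nu Int Pl" unfolding srcs_def by (rule imageE)
 have "(q, q) \<in> nu"
 proof (rule ccontr)
  assume n: "(q, q) \<notin> nu"
  then have D: "q \<in> Domain (mv nu)" using q horizontal_iff(1)[OF VD(5)[OF assms(1)], of q] by blast
  have "q \<in> fibre Z (pr p)" using q by (simp add: in_fibre)
  then have "h (step_before q) = h (step_after q)" using assms(3) by (auto simp: Act_def)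
  then have "q \<in> Range (mv nu)"
   using D q(2) h_before[OF assms(1), of q] h_after[OF assms(1), of q] by (auto split: if_splits)
  then have "q \<in> brk nu" using D by (simp add: brk_def)
  then show False using assms(4) q(1) by blast
 qed
 then show ?thesis using that[of q] q by simp
qed

text \<open>This is the choice between the two dotted strands of a pair.\<close>

lemma move_horizontal:
 assumes "nu \<in> V" "p \<in> Pl" "q \<in> Pl" "pr q = pr p" "(q, q) \<in> nu"
 obtains nu' where "nu ~~ nu'" "(p, p) \<in> nu'"
proof (cases "p = q")
 case True
 then show ?thesis using that sim_refl[OF VD(1)[OF assms(1)]] assms(5) by blast
next
 case False
 let ?nu = "(nu - {(q, q)}) Un Id_on {p}"
 note b = VD(5)[OF assms(1)]
 have g: "good nu" by (rule VD(1)[OF assms(1)])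
 have Dq: "q \<in> Domain nu" "q \<in> Range nu" using assms(5) by blast+
 have p: "p \<notin> Domain nu" "p \<notin> Range nu"
  using Dom_unique[OF assms(1) Dq(1)] Ran_unique[OF assms(1) Dq(2)] assms(2-4) False by metis+
 have sv: "single_valued nu" "single_valued (nu^-1)" using b by (simp_all add: braid_def)
 have D: "Domain (nu - {(q, q)}) = Domain nu - {q}" "Range (nu - {(q, q)}) = Range nu - {q}"
  using sv assms(5) unfolding single_valued_def by auto
 have D': "Domain ?nu = insert p (Domain nu - {q})" "Range ?nu = insert p (Range nu - {q})"
  unfolding Domain_Un_eq Range_Un_eq D by auto
 have "single_valued ?nu"
  using sv(1) D p by (intro single_valued_Un) (auto intro: single_valued_subset)
 moreover have "single_valued (?nu^-1)"
 proof -
  have "?nu^-1 = (nu - {(q, q)})^-1 Un Id_on {p}" by auto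
  moreover have "single_valued ((nu - {(q, q)})^-1)" using sv(2) by (auto intro: single_valued_subset[of _ "nu^-1"])
  moreover have "Domain ((nu - {(q, q)})^-1) Int Domain (Id_on {p}) = {}" unfolding Domain_converse D using p by simp
  ultimately show ?thesis using single_valued_Un[of "(nu - {(q, q)})^-1" "Id_on {p}"] by simp
 qed
 moreover have "rising ?nu" using VD(6)[OF assms(1)] unfolding rising_def by (auto simp: Id_on_iff)
 moreover have "?nu \<subseteq> points Z \<times> points Z" using goodD(4)[OF g] assms(2) places_subset by auto
 ultimately have sd: "strand_diagram Z ?nu" by (auto simp: strand_diagram_def rising_def)
 have im: "pr ` (insert p (S - {q}) Int Pl) = pr ` (S Int Pl)" "inj_on pr (S Int Pl) ==> inj_on pr (insert p (S - {q}) Int Pl)"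
  if "q \<in> S" for S
 proof -
  show "pr ` (insert p (S - {q}) Int Pl) = pr ` (S Int Pl)"
  proof (intro subset_antisym subsetI)
   fix z assume "z \<in> pr ` (insert p (S - {q}) Int Pl)"
   then obtain r where "z = pr r" "r \<in> insert p (S - {q}) Int Pl" by (rule imageE)
   then show "z \<in> pr ` (S Int Pl)" using that assms(3,4) by (cases "r = p") (auto intro: rev_image_eqI)
  next
   fix z assume "z \<in> pr ` (S Int Pl)"
   then obtain r where "z = pr r" "r \<in> S Int Pl" by (rule imageE)
   then show "z \<in> pr ` (insert p (S - {q}) Int Pl)"
    using assms(2,4) by (cases "r = q") (auto intro: rev_image_eqI)
  qed
  assume i: "inj_on pr (S Int Pl)"
  have "pr p \<notin> pr ` ((S - {q}) Int Pl)"
  proof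
   assume "pr p \<in> pr ` ((S - {q}) Int Pl)"
   then obtain r where "pr p = pr r" "r \<in> (S - {q}) Int Pl" by (rule imageE)
   then show False using i that assms(3,4) by (auto dest: inj_onD)
  qed
  moreover have "inj_on pr ((S - {q}) Int Pl)" using i by (rule inj_on_subset) auto
  moreover have "insert p (S - {q}) Int Pl = insert p ((S - {q}) Int Pl)" using assms(2) by auto
  ultimately show "inj_on pr (insert p (S - {q}) Int Pl)" by (auto simp: inj_on_insert)
 qed
 have g': "good ?nu" unfolding good_def D' using sd im(2)[OF Dq(1)] im(2)[OF Dq(2)] goodD(8,9)[OF g] by blast
 have "mv ?nu = mv nu" unfolding mv_Un_Id by (auto simp: mv_def)
 moreover have "srcs ?nu = srcs nu" "tgts ?nu = tgts nu" unfolding srcs_def tgts_def D' using im(1) Dq by blast+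
 ultimately have "nu ~~ ?nu" using g g' by (simp add: sim_def)
 then show ?thesis using that[of ?nu] by (simp add: Id_on_iff)
qed

lemma V_reduces: "al \<in> V ==> reduces al nu ==> nu \<in> V"
 using reduces_good(1)[of al nu] reduces_hdat[of al nu] by (simp add: V_def)

text \<open>If the strand of the crossing that starts later also moved, its first step would be
  covered twice. So this strand is horizontal, and the resolution breaks the other one at its
  place.\<close>

lemma reduces_brk:
 assumes "al \<in> V" "reduces al nu"
 obtains x q y where "(x, y) \<in> al" "(q, q) \<in> al" "x \<prec> q" "q \<prec> y" "q \<in> T.ext (brk al)" "brk nu = insert q (brk al)"
  "al = resolve nu (x, q) (q, y)" "(x, q) \<in> nu" "(q, y) \<in> nu"
proof -
 obtain x y x' y' where r: "(x, y) \<in> al" "(x', y') \<in> al" "x \<prec> x'" "y' \<prec> y" "nu = resolve al (x, y) (x', y')"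
  using assms(2) unfolding reduces_def by blast
 have ne: "(x, y) ~= (x', y')" "fst x = fst x'" using r(3) by (auto simp: pt_less_def)
 note p = resolve_props[OF VD(5)[OF assms(1)] r(1,2) ne(1), unfolded fst_conv snd_conv, OF ne(2), folded r(5)]
 have xy': "x' = y' \<or> x' \<prec> y'" using risingD[OF VD(6)[OF assms(1)] r(2)] .
 have "x' = y'"
 proof (rule ccontr)
  assume "x' ~= y'"
  then have l: "x' \<prec> y'" using xy' by blast
  have "x' \<in> steps Z" using step_at_start l strand_points[OF assms(1) r(2)] by blast
  moreover have "covers (x', y') x'" using l by (auto simp: covers_def pt_less_def)
  moreover have "covers (x, y) x'" using l r(3,4) by (auto simp: covers_def pt_less_def)
  ultimately show False using covers_unique[OF assms(1) r(1,2)] ne by blast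
 qed
 then have q: "(x', x') \<in> al" "x' \<prec> y" "nu = resolve al (x, y) (x', x')" using r by auto
 have pl: "x' \<in> Pl" using between_place strand_points[OF assms(1) r(1)] r(3) q(2) by blast
 have nm: "x' \<notin> Domain (mv al)" "x' \<notin> Range (mv al)" using horizontal_iff(3)[OF VD(5)[OF assms(1)] q(1)] by blast+
 have "over al x' = 1"
  using over_pos[OF assms(1) r(1,3) q(2)] at_place(1)[OF assms(1) pl] by simp
 then have "x' \<in> C0"
  unfolding C0_def using pl active[OF assms(1) pl] q(1) h_before[OF assms(1) pl] h_after[OF assms(1) pl] nm by simp
 then have ext: "x' \<in> T.ext (brk al)" using horizontal_ext[OF assms(1) pl q(1)] by (simp add: T.ext_def)
 have xne: "x ~= x'" "x' ~= y" "x ~= y" using r(3) q(2) pt_less_trans[OF r(3) q(2)] by auto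
 have "mv nu = (mv al - {(x, y)}) Un {(x, x'), (x', y)}"
  unfolding q(3) mv_def resolve_def using xne by auto
 then have "Domain (mv nu) = insert x' (Domain (mv al))" "Range (mv nu) = insert x' (Range (mv al))"
 proof -
  assume e: "mv nu = (mv al - {(x, y)}) Un {(x, x'), (x', y)}"
  have m: "(x, y) \<in> mv al" using r(1) xne by (simp add: in_mv)
  have "single_valued (mv al)" "single_valued ((mv al)^-1)"
   using strand_diagram_mv[OF goodD(1)[OF VD(1)[OF assms(1)]]] by (simp_all add: strand_diagram_def)
  then have D: "Domain (mv al - {(x, y)}) = Domain (mv al) - {x}" "Range (mv al - {(x, y)}) = Range (mv al) - {y}"
   using Domain_remove[OF _ m] Range_remove[OF _ m] by simp_all
  have xy: "x \<in> Domain (mv al)" "y \<in> Range (mv al)" using m by blast+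
  have xx: "Domain {(x, x'), (x', y)} = {x, x'}" "Range {(x, x'), (x', y)} = {x', y}" by auto
  show "Domain (mv nu) = insert x' (Domain (mv al))" "Range (mv nu) = insert x' (Range (mv al))"
   unfolding e Domain_Un_eq Range_Un_eq D xx using xy by blast+
 qed
 then have "brk nu = insert x' (brk al)" unfolding brk_def by auto
 moreover have "al = resolve nu (x, x') (x', y)" using p(4) \<open>x' = y'\<close> by simp
 moreover have "(x, x') \<in> nu" "(x', y) \<in> nu" unfolding q(3) resolve_def by auto
 ultimately show ?thesis using that[of x y x'] r(1,3) q(1,2) ext by blast
qed

lemma reduces_break:
 assumes "nu \<in> V" "p \<in> C0" "(p, p) \<in> nu"
 obtains nu' where "reduces nu nu'" "brk nu' = insert p (brk nu)"
proof -
 have pl: "p \<in> Pl" using assms(2) by (simp add: C0_def)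
 have nm: "p \<notin> Domain (mv nu)" "p \<notin> Range (mv nu)" using horizontal_iff(3)[OF VD(5)[OF assms(1)] assms(3)] by blast+
 have "over nu p = 1" using assms(2) h_before[OF assms(1) pl] nm by (simp add: C0_def)
 then obtain x y where xy: "(x, y) \<in> nu" "x \<prec> p" "p \<prec> y" "!!c d. (c, d) \<in> nu ==> c \<prec> p ==> p \<prec> d ==> c = x & d = y"
  using overE[OF assms(1) pl] by blast
 have "\<not> (x \<prec> c & c \<prec> p & p \<prec> d & d \<prec> y)" if cd: "(c, d) \<in> nu" for c d
  using xy(4)[OF cd] by auto
 then have "\<forall>(c, d)\<in>nu. \<not> (x \<prec> c & c \<prec> p & p \<prec> d & d \<prec> y)" by blast
 then have r: "reduces nu (resolve nu (x, y) (p, p))"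
  unfolding reduces_def using xy(1-3) assms(3) by blast
 obtain x' q y' where q: "brk (resolve nu (x, y) (p, p)) = insert q (brk nu)" "q \<in> T.ext (brk nu)"
  by (rule reduces_brk[OF assms(1) r])
 have "(x, p) \<in> mv (resolve nu (x, y) (p, p))" "(p, y) \<in> mv (resolve nu (x, y) (p, p))"
  using xy(2,3) by (auto simp: in_mv resolve_def)
 then have "p \<in> brk (resolve nu (x, y) (p, p))" unfolding brk_def by blast
 moreover have "p \<notin> brk nu" using nm by (simp add: brk_def)
 ultimately have "q = p" using q(1) by auto
 then show ?thesis using that r q(1) by blast
qed

text \<open>Breaking in reverse: undoing the resolution puts a horizontal strand at
  \<open>q\<close>. The formula for \<open>mv al\<close> is the one in
  \<open>create_diagram\<close>.\<close>

lemma join_strands: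
 assumes "nu \<in> V" "q \<in> brk nu"
 obtains al where "al \<in> V" "reduces al nu" "brk al = brk nu - {q}"
  "mv al = {(x, y) \<in> mv nu. x ~= q & y ~= q} Un {(x, y). (x, q) \<in> mv nu & (q, y) \<in> mv nu}"
proof -
 obtain x y where xy: "(x, q) \<in> mv nu" "(q, y) \<in> mv nu" using assms(2) unfolding brk_def by blast
 have xynu: "(x, q) \<in> nu" "(q, y) \<in> nu" "x \<prec> q" "q \<prec> y"
  using mv_less[OF VD(6)[OF assms(1)] xy(1)] mv_less[OF VD(6)[OF assms(1)] xy(2)] by simp_all
 note g = VD(1)[OF assms(1)]
 have pl: "q \<in> Pl" by (rule brk_places[OF assms])
 have ne: "(x, q) ~= (q, y)" "fst x = fst q" using xynu(3) by (auto simp: pt_less_def)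
 define al where "al = resolve nu (x, q) (q, y)"
 note p = resolve_props[OF VD(5)[OF assms(1)] xynu(1,2) ne(1), unfolded fst_conv snd_conv, OF ne(2), folded al_def]
 have xley: "x \<prec> y" using xynu pt_less_trans by blast
 have "rising al" using VD(6)[OF assms(1)] xley unfolding al_def resolve_def rising_def by simp
 moreover have "al \<subseteq> points Z \<times> points Z"
  using goodD(4)[OF g] xynu(1,2) unfolding al_def resolve_def by auto
 ultimately have "strand_diagram Z al" using p(1) strand_diagramI by blast
 then have gal: "good al" using goodD(8,9)[OF g] unfolding good_def p(2,3) by simp
 have o: "over nu q = 0" using at_place(2)[OF assms(1) pl] xy by blast
 have "reduces al nu"
  unfolding reduces_def
 proof (intro exI conjI)
  show "(x, y) \<in> al" "(q, q) \<in> al" unfolding al_def resolve_def by auto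
  show "x \<prec> q" "q \<prec> y" by fact+
  show "nu = resolve al (x, y) (q, q)" using p(4) by simp
  have "\<not> (x \<prec> c & c \<prec> q & q \<prec> d & d \<prec> y)" if cd: "(c, d) \<in> al" for c d
  proof
   assume h: "x \<prec> c & c \<prec> q & q \<prec> d & d \<prec> y"
   then have "(c, d) \<in> nu" using cd unfolding al_def resolve_def by auto
   then show False using over_pos[OF assms(1)] h o by blast
  qed
  then show "\<forall>(c, d)\<in>al. \<not> (x \<prec> c & c \<prec> q & q \<prec> d & d \<prec> y)" by blast
 qed
 moreover have alV: "al \<in> V"
  using gal reduces_hdat[OF gal calculation] VD(8)[OF assms(1)] by (simp add: V_def)
 moreover obtain x2 q' y2 where q': "brk nu = insert q' (brk al)" "q' \<in> T.ext (brk al)"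
  by (rule reduces_brk[OF alV calculation(1)])
 moreover have sv: "(u, v) \<in> nu ==> (u, w) \<in> nu ==> v = w" "(u, v) \<in> nu ==> (w, v) \<in> nu ==> u = w" for u v w
  using VD(5)[OF assms(1)] unfolding braid_def single_valued_def converse_iff by metis+
 moreover have m: "mv al = {(x, y) \<in> mv nu. x ~= q & y ~= q} Un {(x, y). (x, q) \<in> mv nu & (q, y) \<in> mv nu}"
 proof (intro subset_antisym subrelI)
  fix u v assume "(u, v) \<in> mv al"
  then have uv: "(u, v) \<in> al" "u ~= v" by (simp_all add: in_mv)
  show "(u, v) \<in> {(x, y) \<in> mv nu. x ~= q & y ~= q} Un {(x, y). (x, q) \<in> mv nu & (q, y) \<in> mv nu}"
  proof (cases "(u, v) = (x, y)")
   case True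
   then show ?thesis using xy by simp
  next
   case False
   then have m: "(u, v) \<in> nu" "(u, v) ~= (x, q)" "(u, v) ~= (q, y)" using uv unfolding al_def resolve_def by auto
   then have "u ~= q" "v ~= q" using sv(1)[OF xynu(2), of v] sv(2)[OF xynu(1), of u] by auto
   then show ?thesis using m(1) uv(2) by (simp add: in_mv)
  qed
 next
  fix u v assume "(u, v) \<in> {(x, y) \<in> mv nu. x ~= q & y ~= q} Un {(x, y). (x, q) \<in> mv nu & (q, y) \<in> mv nu}"
  then consider "(u, v) \<in> mv nu" "u ~= q" "v ~= q" | "(u, q) \<in> mv nu" "(q, v) \<in> mv nu" by auto
  then show "(u, v) \<in> mv al"
  proof cases
   case 1
   then show ?thesis by (simp add: in_mv al_def resolve_def)
  next
   case 2
   then have "u = x" "v = y" using sv(1)[OF xynu(2), of v] sv(2)[OF xynu(1), of u] by (simp_all add: in_mv)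
   then show ?thesis using xley by (auto simp: in_mv al_def resolve_def)
  qed
 qed
 moreover have "q \<notin> brk al"
 proof
  assume "q \<in> brk al"
  then have "q \<in> Domain (mv al)" by (simp add: brk_def)
  moreover have "(q, q) \<in> al" unfolding al_def resolve_def by auto
  ultimately show False using horizontal_iff(3)[OF VD(5)[OF alV]] by blast
 qed
 ultimately show ?thesis using that[of al] assms(2) T.ext_notin by (metis Diff_insert_absorb insertE)
qed

end

lemma sum_vecof_disjoint:
 assumes "finite I" "!!i. i \<in> I ==> finite (K i)" "!!i j. i \<in> I ==> j \<in> I ==> i ~= j ==> K i Int K j = {}"
 shows "(\<Sum>i\<in>I. vecof (K i)) = vecof (\<Union>i\<in>I. K i)"
 unfolding vecof_def using assms by (intro sum.UNION_disjoint[symmetric]) auto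

lemma (in transversals) ex_full: "\<exists>B\<in>pt. full B"
proof -
 obtain B where "B \<subseteq> C" "inj_on \<pi> B" "\<pi> ` C = \<pi> ` B"
  using subset_image_inj[of "\<pi> ` C" \<pi> C] by auto
 then show ?thesis by (auto simp: pt_def full_def)
qed

section \<open>Projections to graded pieces\<close>

context arc
begin

text \<open>Two predicates are allowed so that the lemma serves both gradings: the differential
  preserves H-data but lowers the Maslov degree by one.\<close>

lemma restr_vec_diff:
 assumes "inA x" "!!al nu. good al ==> reduces al nu ==> Q' nu \<longleftrightarrow> Q al"
 shows "restr Q' (vec_diff x) = vec_diff (restr Q x)"
proof (rule vec_eqI)
 have br: "braids x" "braids (restr Q x)" using inA_braids[OF assms(1)] by (auto simp: braids_def)
 have g: "good al" if "al \<in> keys x" for al using assms(1) that by (simp add: inA_def)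
 have "{al \<in> keys (restr Q x). reduces al nu} =
   (if Q' nu then {al \<in> keys x. reduces al nu} else {})" for nu
  using assms(2) g by auto
 then show "keys (restr Q' (vec_diff x)) = keys (vec_diff (restr Q x))"
  unfolding keys_restr keys_vec_diff[OF br(1)] keys_vec_diff[OF br(2)] by auto
qed

lemma alg_summand_inA: "x \<in> summand d ==> inA x"
 by (simp add: alg_summand_eq)

lemma restr_alg_summand: "inA x ==> restr (%nu. hdat nu = d) x \<in> summand d"
 using inA_restr[OF _ sim_invariant_hdat] by (simp add: alg_summand_eq)

lemma restr_alg_summand_id: "x \<in> summand d ==> restr (%nu. hdat nu = d) x = x"
 by (rule restr_id) (simp add: alg_summand_eq)

lemma boundary_in_summand:
 assumes "b \<in> bds" "b \<in> summand d"
 obtains y where "y \<in> summand d" "b = vec_diff y"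
proof -
 obtain y where y: "inA y" "b = vec_diff y" using assms(1) in_boundaries by blast
 have "b = vec_diff (restr (%nu. hdat nu = d) y)"
  using restr_vec_diff[OF y(1), of "%nu. hdat nu = d" "%nu. hdat nu = d"] reduces_hdat
   restr_alg_summand_id[OF assms(2)] y(2) by simp
 then show ?thesis using that restr_alg_summand[OF y(1)] by blast
qed

lemma alg_summand_add: "x \<in> summand d ==> y \<in> summand d ==> x + y \<in> summand d"
 unfolding alg_summand_eq keys_add_bit using inA_add by blast

lemma alg_summand_0 [simp]: "0 \<in> summand d"
 by (simp add: alg_summand_eq inA_0)

end

section \<open>Viable summands as complexes of partial transversals\<close>

context viable_summand
begin

definition Dgd :: "point set => vec" where "Dgd B = vecof {nu \<in> V. brk nu = B}"

lemma keys_Dgd [simp]: "keys (Dgd B) = {nu \<in> V. brk nu = B}"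
 using finite_V by (simp add: Dgd_def)

lemma Dg_V: "nu \<in> V ==> Dg nu = Dgd (brk nu)"
proof -
 assume nu: "nu \<in> V"
 have "{nu'. nu ~~ nu'} = {nu' \<in> V. brk nu' = brk nu}"
  using sim_iff_brk[OF nu] sim_V[OF nu] by auto
 then show ?thesis by (simp add: Dg_def Dgd_def)
qed

lemma diagrams_with_V: "diagrams_with Z (h, s, t) = Dgd ` brk ` V"
 unfolding diagrams_with_eq image_image using Dg_V by (auto simp: V_def)

lemma ex_unbroken: "V ~= {} ==> \<exists>nu\<in>V. brk nu = {}"
proof -
 assume "V ~= {}"
 then obtain nu where "nu \<in> V" by blast
 then show ?thesis
 proof (induction "card (brk nu)" arbitrary: nu rule: less_induct)
  case less
  show ?case
  proof (cases "brk nu = {}")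
   case False
   then obtain q where q: "q \<in> brk nu" by blast
   obtain al where al: "al \<in> V" "brk al = brk nu - {q}" by (rule join_strands[OF less.prems q])
   have "finite (brk nu)" using brk_pt[OF less.prems] T.finC finite_subset by (auto simp: T.pt_def)
   then have "card (brk al) < card (brk nu)" unfolding al(2) using q by (rule card_Diff1_less)
   then show ?thesis using less.hyps al(1) by blast
  qed (use less.prems in blast)
 qed
qed

text \<open>From an unbroken diagram every break set is reached one place at a time: some term has
  the horizontal strand of the active pair at the prescribed place, and \<open>reduces_break\<close>
  breaks the strand over it.\<close>

lemma brk_image: "V ~= {} ==> brk ` V = T.pt"
proof (intro subset_antisym subsetI)
 fix B assume V: "V ~= {}" and B: "B \<in> T.pt"
 have "finite B" using B T.finC finite_subset by (auto simp: T.pt_def)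
 then show "B \<in> brk ` V" using B
 proof (induction B rule: finite_induct)
  case empty
  then show ?case using ex_unbroken[OF V] by blast
 next
  case (insert p B)
  have "B \<in> T.pt" using insert.prems T.pt_subset by blast
  then have "B \<in> brk ` V" by (rule insert.IH)
  then obtain nu where nu: "B = brk nu" "nu \<in> V" by (rule imageE)
  have p: "p \<in> C0" "pr p \<notin> pr ` brk nu"
   using insert.prems insert.hyps(2) unfolding nu(1)[symmetric] T.pt_def by (auto simp: inj_on_insert)
  then have p': "p \<in> Pl" "pr p \<in> Act" by (simp_all add: C0_def)
  obtain q where q: "q \<in> Pl" "pr q = pr p" "(q, q) \<in> nu" by (rule active_horizontal[OF nu(2) p' p(2)])
  obtain nu' where nu': "nu ~~ nu'" "(p, p) \<in> nu'" by (rule move_horizontal[OF nu(2) p'(1) q])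
  have V': "nu' \<in> V" using sim_V[OF nu(2) nu'(1)] .
  obtain nu'' where nu'': "reduces nu' nu''" "brk nu'' = insert p (brk nu')" by (rule reduces_break[OF V' p(1) nu'(2)])
  have "brk nu' = B" using sim_iff_brk[OF nu(2) V'] nu' nu(1) by simp
  then show ?case using V_reduces[OF V' nu''(1)] nu''(2) by blast
 qed
qed (use brk_pt in blast)

lemma keys_lin_Dgd:
 assumes "c \<in> T.chains"
 shows "keys (lin Dgd c) = {nu \<in> V. brk nu \<in> keys c}"
proof -
 have "lin Dgd c = vecof (\<Union>B\<in>keys c. {nu \<in> V. brk nu = B})"
  unfolding lin_def Dgd_def using finite_V by (intro sum_vecof_disjoint) auto
 moreover have "(\<Union>B\<in>keys c. {nu \<in> V. brk nu = B}) = {nu \<in> V. brk nu \<in> keys c}" by auto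
 ultimately show ?thesis using finite_V by simp
qed

lemma lin_Dgd_summand: "c \<in> T.chains ==> lin Dgd c \<in> summand (h, s, t)"
proof -
 assume c: "c \<in> T.chains"
 have "nu' \<in> {nu \<in> V. brk nu \<in> keys c}" if "nu ~~ nu'" "nu \<in> {nu \<in> V. brk nu \<in> keys c}" for nu nu'
  using that sim_V[of nu nu'] sim_iff_brk[of nu nu'] by auto
 then have "inA (lin Dgd c)" unfolding inA_def keys_lin_Dgd[OF c] using VD(1) by simp
 then show ?thesis unfolding alg_summand_eq keys_lin_Dgd[OF c] using VD(8) by simp
qed

lemma summand_chain:
 assumes "x \<in> summand (h, s, t)"
 obtains c where "c \<in> T.chains" "x = lin Dgd c"
proof -
 have x: "inA x" "keys x \<subseteq> V" using assms by (auto simp: alg_summand_eq V_def inA_def)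
 define c where "c = vecof (brk ` keys x)"
 have k: "keys c = brk ` keys x" unfolding c_def by simp
 have c: "c \<in> T.chains"
  unfolding T.chains_def mem_Collect_eq k image_subset_iff using x(2) brk_pt by blast
 have "nu \<in> keys x" if nuV: "nu \<in> V" and nux: "brk nu \<in> brk ` keys x" for nu
 proof -
  obtain nu' where nu': "brk nu = brk nu'" "nu' \<in> keys x" using nux by (rule imageE)
  then have "nu' ~~ nu" using sim_iff_brk x(2) nuV by auto
  then show ?thesis using x(1) nu'(2) unfolding inA_def by blast
 qed
 then have "keys (lin Dgd c) = keys x"
  unfolding keys_lin_Dgd[OF c] k using x(2) by auto
 then have "x = lin Dgd c" using vec_eqI by metis
 then show ?thesis using that c by blast
qed

lemma lin_Dgd_inj:
 assumes "V ~= {}" "c \<in> T.chains" "c' \<in> T.chains" "lin Dgd c = lin Dgd c'"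
 shows "c = c'"
proof -
 have "keys c = brk ` keys (lin Dgd c)" if "c \<in> T.chains" for c
 proof (intro subset_antisym subsetI)
  fix B assume B: "B \<in> keys c"
  then have "B \<in> brk ` V" unfolding brk_image[OF assms(1)] using that by (auto simp: T.chains_def)
  then obtain nu where "B = brk nu" "nu \<in> V" by (rule imageE)
  then show "B \<in> brk ` keys (lin Dgd c)" unfolding keys_lin_Dgd[OF that] using B by simp
 next
  fix B assume "B \<in> brk ` keys (lin Dgd c)"
  then obtain nu where "B = brk nu" "nu \<in> keys (lin Dgd c)" by (rule imageE)
  then show "B \<in> keys c" unfolding keys_lin_Dgd[OF that] by simp
 qed
 from this[OF assms(2)] this[OF assms(3)] assms(4) have "keys c = keys c'" by simp
 then show ?thesis by (rule vec_eqI)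
qed

lemma single_chain: "B \<in> T.pt ==> single B 1 \<in> T.chains"
 by (simp add: T.chains_def)

lemma dC_chain: "B \<in> T.pt ==> T.dC B \<in> T.chains"
 using T.chains_dC[OF single_chain] by simp

text \<open>A strand diagram with break set \<open>insert p B\<close> is the resolution of a single
  one with break set \<open>B\<close>, the one joined at \<open>p\<close>, so every term occurs
  once.\<close>

lemma vec_diff_Dgd:
 assumes "B \<in> T.pt"
 shows "vec_diff (Dgd B) = lin Dgd (T.dC B)"
proof (rule vec_eqI)
 have br: "braids (Dgd B)" using VD(5) by (simp add: braids_def)
 define A where "A = (%gm. {al \<in> {nu \<in> V. brk nu = B}. reduces al gm})"
 have "odd (card (A gm)) \<longleftrightarrow> gm \<in> V & brk gm \<in> (%p. insert p B) ` T.ext B" for gm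
 proof
  assume "odd (card (A gm))"
  then have "A gm ~= {}" by (metis card.empty even_zero)
  then obtain al where al: "al \<in> V" "brk al = B" "reduces al gm" by (auto simp: A_def)
  obtain x q y where "q \<in> T.ext (brk al)" "brk gm = insert q (brk al)" by (rule reduces_brk[OF al(1,3)])
  then show "gm \<in> V & brk gm \<in> (%p. insert p B) ` T.ext B" using V_reduces[OF al(1,3)] al(2) by blast
 next
  assume *: "gm \<in> V & brk gm \<in> (%p. insert p B) ` T.ext B"
  then obtain p where p: "p \<in> T.ext B" "brk gm = insert p B" by blast
  have pB: "p \<notin> B" using T.ext_notin p(1) by blast
  have "p \<in> brk gm" using p by simp
  then obtain al where al: "al \<in> V" "reduces al gm" "brk al = brk gm - {p}"
   using join_strands[of gm p] * by metis
  then have "al \<in> A gm" using p pB by (auto simp: A_def)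
  moreover have "be = al" if be: "be \<in> A gm" for be
  proof -
   have e: "\<exists>x y. be = resolve gm (x, p) (p, y) & (x, p) \<in> gm & (p, y) \<in> gm" if be: "be \<in> A gm" for be
   proof -
    have b: "be \<in> V" "brk be = B" "reduces be gm" using be by (auto simp: A_def)
    obtain x q y where q: "q \<in> T.ext (brk be)" "brk gm = insert q (brk be)" "be = resolve gm (x, q) (q, y)"
     "(x, q) \<in> gm" "(q, y) \<in> gm" by (rule reduces_brk[OF b(1,3)])
    have "q \<notin> B" using q(1) T.ext_notin b(2) by blast
    then have "q = p" using q(2) p(2) b(2) by (metis insert_iff)
    then show ?thesis using q by blast
   qed
   have sv: "(u, v) \<in> gm ==> (u, w) \<in> gm ==> v = w" "(u, v) \<in> gm ==> (w, v) \<in> gm ==> u = w" for u v w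
    using VD(5)[of gm] * unfolding braid_def single_valued_def converse_iff by metis+
   obtain x y where 1: "be = resolve gm (x, p) (p, y)" "(x, p) \<in> gm" "(p, y) \<in> gm" using e[OF be] by blast
   obtain x' y' where 2: "al = resolve gm (x', p) (p, y')" "(x', p) \<in> gm" "(p, y') \<in> gm"
    using e[OF \<open>al \<in> A gm\<close>] by blast
   have "x = x'" "y = y'" using sv 1 2 by blast+
   then show ?thesis using 1 2 by simp
  qed
  ultimately have "A gm = {al}" by blast
  then show "odd (card (A gm))" by simp
 qed
 then show "keys (vec_diff (Dgd B)) = keys (lin Dgd (T.dC B))"
  unfolding keys_vec_diff[OF br] keys_lin_Dgd[OF dC_chain[OF assms]] T.keys_dC keys_Dgd A_def by blast
qed

lemma vec_diff_lin_Dgd: "c \<in> T.chains ==> vec_diff (lin Dgd c) = lin Dgd (lin T.dC c)"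
proof -
 assume c: "c \<in> T.chains"
 have "vec_diff (lin Dgd c) = lin (%B. vec_diff (Dgd B)) c"
  by (rule additive_lin[OF vec_diff_add])
 also have "... = lin (%B. lin Dgd (T.dC B)) c"
  using c by (intro lin_cong vec_diff_Dgd) (auto simp: T.chains_def)
 finally show ?thesis by (simp add: lin_lin)
qed

text \<open>The crossing at an unbroken place is visible only in terms whose horizontal strand lies
  at that place, so the proof first passes to such a term.\<close>

lemma ext_crossing:
 assumes "nu \<in> V" "p \<in> T.ext (brk nu)"
 obtains nu' a where "nu ~~ nu'" "(a, (p, p)) \<in> inversions nu'"
proof -
 have p: "p \<in> C0" "pr p \<notin> pr ` brk nu" using assms(2) by (auto simp: T.ext_def)
 then have p': "p \<in> Pl" "pr p \<in> Act" by (simp_all add: C0_def)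
 obtain q where q: "q \<in> Pl" "pr q = pr p" "(q, q) \<in> nu" by (rule active_horizontal[OF assms(1) p' p(2)])
 obtain nu' where nu': "nu ~~ nu'" "(p, p) \<in> nu'" by (rule move_horizontal[OF assms(1) p'(1) q])
 have V': "nu' \<in> V" using sim_V[OF assms(1) nu'(1)] .
 have "p \<notin> Range (mv nu')" using horizontal_iff(3)[OF VD(5)[OF V'] nu'(2)] by blast
 then have "over nu' p = 1" using p(1) h_before[OF V' p'(1)] by (simp add: C0_def)
 then obtain x y where xy: "(x, y) \<in> nu'" "x \<prec> p" "p \<prec> y" by (rule overE[OF V' p'(1)])
 then have "((x, y), (p, p)) \<in> inversions nu'" using nu'(2) by (simp add: inversions_def)
 then show ?thesis using that nu'(1) by blast
qed

lemma inversion_horizontal: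
 assumes "nu \<in> V" "(a, b) \<in> inversions nu"
 obtains p where "b = (p, p)" "p \<in> T.ext (brk nu)"
proof -
 obtain x y x' y' where e: "a = (x, y)" "b = (x', y')" by (metis surj_pair)
 have r: "(x, y) \<in> nu" "(x', y') \<in> nu" "x \<prec> x'" "y' \<prec> y" using assms(2) by (auto simp: inversions_def e)
 have "x' = y'"
 proof (rule ccontr)
  assume "x' ~= y'"
  then have l: "x' \<prec> y'" using risingD[OF VD(6)[OF assms(1)] r(2)] by blast
  have "x' \<in> steps Z" using step_at_start l strand_points[OF assms(1) r(2)] by blast
  moreover have "covers (x', y') x'" using l by (auto simp: covers_def pt_less_def)
  moreover have "covers (x, y) x'" using l r(3,4) by (auto simp: covers_def pt_less_def)
  ultimately have "(x, y) = (x', y')" using covers_unique[OF assms(1) r(1,2)] by blast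
  then show False using r(3) by simp
 qed
 then have x: "(x', x') \<in> nu" "x' \<prec> y" using r by simp_all
 have pl: "x' \<in> Pl" using between_place strand_points[OF assms(1) r(1)] r(3) x(2) by blast
 have nm: "x' \<notin> Domain (mv nu)" "x' \<notin> Range (mv nu)" using horizontal_iff(3)[OF VD(5)[OF assms(1)] x(1)] by blast+
 have "over nu x' = 1"
  using over_pos[OF assms(1) r(1,3) x(2)] at_place(1)[OF assms(1) pl] by simp
 then have "x' \<in> C0"
  unfolding C0_def using pl active[OF assms(1) pl] x(1) h_before[OF assms(1) pl] h_after[OF assms(1) pl] nm by simp
 then have "x' \<in> T.ext (brk nu)" using horizontal_ext[OF assms(1) pl x(1)] by (simp add: T.ext_def)
 then show ?thesis using that e \<open>x' = y'\<close> by blast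
qed

lemma has_crossing_iff:
 assumes "nu \<in> V"
 shows "has_crossing (Dgd (brk nu)) \<longleftrightarrow> T.ext (brk nu) ~= {}"
proof
 assume "has_crossing (Dgd (brk nu))"
 then obtain mu a b where "mu \<in> V" "brk mu = brk nu" "(a, b) \<in> inversions mu" by (auto simp: has_crossing_def)
 then show "T.ext (brk nu) ~= {}" using inversion_horizontal by (metis empty_iff)
next
 assume "T.ext (brk nu) ~= {}"
 then obtain p where "p \<in> T.ext (brk nu)" by blast
 then obtain nu' a where "nu ~~ nu'" "(a, (p, p)) \<in> inversions nu'" by (rule ext_crossing[OF assms])
 then show "has_crossing (Dgd (brk nu))"
  unfolding has_crossing_def keys_Dgd using sim_V[OF assms] sim_iff_brk[OF assms] by blast
qed

lemma crossing_at_iff: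
 assumes "nu \<in> V"
 shows "crossing_at Z (Dgd (brk nu)) P \<longleftrightarrow> (\<exists>p\<in>T.ext (brk nu). pr p = P)"
proof
 assume "crossing_at Z (Dgd (brk nu)) P"
 then obtain mu a b p where mu: "mu \<in> V" "brk mu = brk nu" "(a, b) \<in> inversions mu" "p \<in> fibre Z P" "a = (p, p) \<or> b = (p, p)"
  unfolding crossing_at_def keys_Dgd by blast
 obtain q where q: "b = (q, q)" "q \<in> T.ext (brk mu)" by (rule inversion_horizontal[OF mu(1,3)])
 have "a ~= (p, p)"
 proof
  assume "a = (p, p)"
  then have "p \<prec> q" "q \<prec> p" using mu(3) q(1) by (auto simp: inversions_def)
  then show False using pt_less_asym by blast
 qed
 then have "q = p" using mu(5) q(1) by simp
 then show "\<exists>p\<in>T.ext (brk nu). pr p = P" using q(2) mu(2,4) by (auto simp: in_fibre)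
next
 assume "\<exists>p\<in>T.ext (brk nu). pr p = P"
 then obtain p where p: "p \<in> T.ext (brk nu)" "pr p = P" by blast
 obtain nu' a where nu': "nu ~~ nu'" "(a, (p, p)) \<in> inversions nu'" by (rule ext_crossing[OF assms p(1)])
 have "p \<in> C0" using p(1) by (simp add: T.ext_def)
 then have "p \<in> fibre Z P" using p(2) by (simp add: in_fibre C0_def)
 moreover have "nu' \<in> {mu \<in> V. brk mu = brk nu}" using sim_V[OF assms nu'(1)] sim_iff_brk[OF assms] nu'(1) by auto
 ultimately show "crossing_at Z (Dgd (brk nu)) P" unfolding crossing_at_def keys_Dgd using nu'(2) by blast
qed

lemma once_C0:
 assumes "P \<in> s Int t" "once_occupied_at Z h P q"
 shows "q \<in> C0" "{p \<in> C0. pr p = pr q} = {q}" "pr q = P"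
proof -
 have q: "q \<in> Pl" "pr q = P" "h (step_before q) ~= 0" "h (step_after q) ~= 0"
  and o: "!!r. r \<in> Pl ==> pr r = P ==> r ~= q ==> h (step_before r) = 0 & h (step_after r) = 0"
  using assms(2) by (auto simp: once_occupied_at_def in_fibre)
 have h: "h (step_before q) = 1" "h (step_after q) = 1"
  using q h_01[OF steps_at(1)[OF q(1)]] h_01[OF steps_at(2)[OF q(1)]] by simp_all
 have "h (step_before r) = h (step_after r)" if "r \<in> fibre Z P" for r
  using that o[of r] h by (cases "r = q") (auto simp: in_fibre)
 then have "P \<in> Act" using assms(1) by (simp add: Act_def)
 then show "q \<in> C0" using q h by (simp add: C0_def)
 moreover have "r = q" if "r \<in> C0" "pr r = pr q" for r
  using o[of r] that q(2) by (auto simp: C0_def)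
 ultimately show "{p \<in> C0. pr p = pr q} = {q}" by blast
 show "pr q = P" by fact
qed

text \<open>At the places of an active pair the multiplicity does not change. If the twin of a
  breakable place were uncovered, the pair would be once occupied; so the twin is breakable
  too.\<close>

lemma not_once_doubled:
 assumes "\<not> (\<exists>P\<in>s Int t. \<exists>p. once_occupied_at Z h P p)"
 shows "doubled_transversals C0 pr"
proof
 fix p assume p: "p \<in> C0"
 then have p': "p \<in> Pl" "pr p \<in> Act" "pr p \<in> s Int t" "h (step_before p) = 1" "h (step_after p) = 1"
  by (auto simp: C0_def Act_def)
 have "card (fibre Z (pr p)) = 2" using arc pair_of_place[OF p'(1)] by (auto simp: arc_diagram_def)
 then obtain a b where ab: "fibre Z (pr p) = {a, b}" "a ~= b" by (auto simp: card_2_iff)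
 have "p \<in> fibre Z (pr p)" using p' by (simp add: in_fibre)
 then obtain p2 where p2: "fibre Z (pr p) = {p, p2}" "p2 ~= p" using ab by (metis doubleton_eq_iff insertE singletonD)
 have p2': "p2 \<in> Pl" "pr p2 = pr p" using p2 in_fibre[of p2 "pr p"] by auto
 have "\<not> once_occupied_at Z h (pr p) p" using assms p'(3) by blast
 then have "h (step_before p2) ~= 0 \<or> h (step_after p2) ~= 0"
  using p' p2 by (auto simp: once_occupied_at_def)
 moreover have "h (step_before p2) = h (step_after p2)" using p'(2) p2 by (auto simp: Act_def)
 ultimately have "p2 \<in> C0"
  using p2' p'(2) h_01[OF steps_at(1)[OF p2'(1)]] by (auto simp: C0_def)
 moreover have "{r \<in> C0. pr r = pr p} \<subseteq> {p, p2}"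
 proof
  fix r assume "r \<in> {r \<in> C0. pr r = pr p}"
  then have "r \<in> fibre Z (pr p)" by (simp add: C0_def in_fibre)
  then show "r \<in> {p, p2}" unfolding p2(1) .
 qed
 ultimately show "\<exists>p'. p' ~= p & {r \<in> C0. pr r = pr p} = {p, p'}" using p p2(2) p2'(2) by blast
qed

lemma once_homotopy:
 assumes "P \<in> s Int t" "once_occupied_at Z h P q" "c \<in> T.chains"
 shows "vec_diff (lin Dgd (lin (T.join q) c)) + lin Dgd (lin (T.join q) (lin T.dC c)) = lin Dgd c"
 using T.lone_place_acyclic[OF assms(3) once_C0(1,2)[OF assms(1,2)]] vec_diff_lin_Dgd[OF T.chains_join[OF assms(3)]]
 by (simp add: lin_add[symmetric])

lemma once_acyclic:
 assumes "P \<in> s Int t" "once_occupied_at Z h P q" "V ~= {}" "x \<in> summand (h, s, t)" "vec_diff x = 0"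
 shows "x \<in> bds"
proof -
 obtain c where c: "c \<in> T.chains" "x = lin Dgd c" by (rule summand_chain[OF assms(4)])
 have "lin Dgd (lin T.dC c) = lin Dgd 0" using assms(5) vec_diff_lin_Dgd[OF c(1)] c(2) by simp
 moreover have "0 \<in> T.chains" by (simp add: T.chains_def)
 ultimately have "lin T.dC c = 0" using lin_Dgd_inj[OF assms(3) T.chains_dC[OF c(1)]] by blast
 then have "x = vec_diff (lin Dgd (lin (T.join q) c))"
  using once_homotopy[OF assms(1,2) c(1)] c(2) by simp
 then show ?thesis
  unfolding in_boundaries using alg_summand_inA[OF lin_Dgd_summand[OF T.chains_join[OF c(1)]]] by blast
qed

lemma Dgd_summand: "B \<in> T.pt ==> Dgd B \<in> summand (h, s, t)"
 using lin_Dgd_summand[OF single_chain] by simp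

lemma full_cycle: "B \<in> T.pt ==> T.full B ==> vec_diff (Dgd B) = 0"
 by (simp add: vec_diff_Dgd T.full_iff T.dC_def)

section \<open>Homology in the absence of once occupied pairs\<close>

context
 assumes no_once: "\<not> (\<exists>P\<in>s Int t. \<exists>p. once_occupied_at Z h P p)" and V_ne: "V ~= {}"
begin

interpretation T: doubled_transversals C0 pr
 by (rule not_once_doubled[OF no_once])

lemma full_not_boundary:
 assumes "c \<in> T.chains" "lin Dgd c \<in> bds"
 shows "T.eps c = 0"
proof -
 obtain y where y: "y \<in> summand (h, s, t)" "lin Dgd c = vec_diff y"
  by (rule boundary_in_summand[OF assms(2) lin_Dgd_summand[OF assms(1)]])
 obtain c' where c': "c' \<in> T.chains" "y = lin Dgd c'" by (rule summand_chain[OF y(1)])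
 have "c = lin T.dC c'"
  using lin_Dgd_inj[OF V_ne assms(1) T.chains_dC[OF c'(1)]] y(2) c' vec_diff_lin_Dgd by simp
 then show ?thesis using T.eps_dC by simp
qed

lemma cycle_homologous:
 assumes "c \<in> T.chains" "vec_diff (lin Dgd c) = 0" "B \<in> T.pt" "T.full B"
 shows "lin Dgd c + (if T.eps c = 1 then Dgd B else 0) \<in> bds"
proof -
 have "lin Dgd (lin T.dC c) = lin Dgd 0" using assms(2) vec_diff_lin_Dgd[OF assms(1)] by simp
 moreover have "0 \<in> T.chains" by (simp add: T.chains_def)
 ultimately have "lin T.dC c = 0" using lin_Dgd_inj[OF V_ne T.chains_dC[OF assms(1)]] by blast
 then obtain y where y: "y \<in> T.chains" "c + lin T.dC y = (if T.eps c = 1 then single B 1 else 0)"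
  using T.homologous_to_transversal[OF assms(1) _ assms(3,4)] by blast
 have "c + (if T.eps c = 1 then single B 1 else 0) = lin T.dC y"
  unfolding y(2)[symmetric] by (simp add: add.assoc[symmetric])
 then have "lin Dgd c + lin Dgd (if T.eps c = 1 then single B 1 else 0) = vec_diff (lin Dgd y)"
  unfolding vec_diff_lin_Dgd[OF y(1)] by (metis lin_add)
 moreover have "lin Dgd (if T.eps c = 1 then single B 1 else 0) = (if T.eps c = 1 then Dgd B else 0)"
  by simp
 ultimately show ?thesis
  unfolding in_boundaries using alg_summand_inA[OF lin_Dgd_summand[OF y(1)]]
  by (intro exI[of _ "lin Dgd y"] conjI) simp_all
qed

end

end

context viable_summand
begin

section \<open>Tight and twisted data\<close>

abbreviation "once \<equiv> \<exists>P\<in>s Int t. \<exists>p. once_occupied_at Z h P p"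

lemma in_diagrams_with: "D \<in> diagrams_with Z (h, s, t) \<longleftrightarrow> V ~= {} & (\<exists>B\<in>T.pt. D = Dgd B)"
 unfolding diagrams_with_V using brk_image by (cases "V = {}") auto

lemma pt_brkE:
 assumes "V ~= {}" "B \<in> T.pt"
 obtains nu where "nu \<in> V" "brk nu = B"
 using assms(2) unfolding brk_image[OF assms(1), symmetric] by blast

lemma Dgd_cycle: "B \<in> T.pt ==> T.full B ==> Dgd B \<in> carrier (cycle_ring Z)"
 using full_cycle alg_summand_inA[OF Dgd_summand] by (simp add: carrier_cycle_ring)

lemma no_crossing_iff: "V ~= {} ==> B \<in> T.pt ==> \<not> has_crossing (Dgd B) \<longleftrightarrow> T.full B"
 using has_crossing_iff T.full_iff pt_brkE by metis

lemma uncrossed_cases: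
 "D \<in> diagrams_with Z (h, s, t) & viable Z h & \<not> has_crossing D & D \<in> carrier (cycle_ring Z) \<longleftrightarrow>
  V ~= {} & (\<exists>B\<in>T.pt. T.full B & D = Dgd B)"
 unfolding in_diagrams_with using no_crossing_iff Dgd_cycle viable by blast

text \<open>A once occupied pair makes the summand acyclic. Without one, \<open>eps\<close> is 1 on
  a single full set and 0 on boundaries.\<close>

lemma full_boundary_iff:
 assumes "V ~= {}" "B \<in> T.pt" "T.full B"
 shows "hclass Z (Dgd B) = zeroH \<longleftrightarrow> once"
proof -
 have c: "cyc (Dgd B)" using Dgd_cycle[OF assms(2,3)] by (simp add: carrier_cycle_ring)
 have "Dgd B \<in> bds" if o: "once"
  using o once_acyclic[OF _ _ assms(1) Dgd_summand[OF assms(2)]] c by blast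
 moreover have "Dgd B \<notin> bds" if "\<not> once"
 proof
  assume "Dgd B \<in> bds"
  then have "T.eps (single B 1) = 0"
   using full_not_boundary[OF that assms(1) single_chain[OF assms(2)]] by simp
  then show False using assms(3) by (simp add: T.eps_def)
 qed
 ultimately show ?thesis using hclass_zero_iff[OF c] by blast
qed

lemma tight_iff: "tight Z (h, s, t) D \<longleftrightarrow> V ~= {} & \<not> once & (\<exists>B\<in>T.pt. T.full B & D = Dgd B)"
 unfolding tight_def fst_conv using uncrossed_cases[of D] full_boundary_iff by metis

lemma twisted_iff: "twisted Z (h, s, t) D \<longleftrightarrow> V ~= {} & once & (\<exists>B\<in>T.pt. T.full B & D = Dgd B)"
 unfolding twisted_def fst_conv using uncrossed_cases[of D] full_boundary_iff by metis

lemma tight_hdata_iff: "tightH (h, s, t) \<longleftrightarrow> V ~= {} & \<not> once"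
 unfolding tight_hdata_def tight_iff using T.ex_full by blast

lemma twisted_hdata_iff: "twisted_hdata Z (h, s, t) \<longleftrightarrow> V ~= {} & once"
 unfolding twisted_hdata_def twisted_iff using T.ex_full by blast

lemma moving_strands_Dgd:
 assumes "nu \<in> V"
 shows "moving_strands (Dgd (brk nu)) = mv nu"
proof -
 have m: "mv mu = mv nu" if "mu \<in> {mu \<in> V. brk mu = brk nu}" for mu
  using that sim_iff_brk[OF assms, of mu] by (simp add: sim_def)
 have "moving_strands (Dgd (brk nu)) = (\<Union>mu\<in>{mu \<in> V. brk mu = brk nu}. mv mu)"
  unfolding moving_strands_def keys_Dgd mv_def by auto
 also have "... = mv nu" using m assms by blast
 finally show ?thesis .
qed

definition doubly_pairs :: "nat set" where
 "doubly_pairs = {P \<in> s Int t. doubly_occupied Z h P}"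

lemma doubly_C0: "P \<in> doubly_pairs ==> p \<in> fibre Z P ==> p \<in> C0"
proof -
 assume P: "P \<in> doubly_pairs" and p: "p \<in> fibre Z P"
 have *: "h (step_before q) = 1 & h (step_after q) = 1" if "q \<in> fibre Z P" for q
 proof -
  have "q \<in> Pl" using that by (simp add: in_fibre)
  then show ?thesis
   using P that h_01[OF steps_at(1)[of q]] h_01[OF steps_at(2)[of q]]
   by (auto simp: doubly_pairs_def doubly_occupied_def)
 qed
 then have "P \<in> Act" using P by (simp add: Act_def doubly_pairs_def)
 then show ?thesis using * p by (simp add: C0_def in_fibre)
qed

lemma pr_C0:
 assumes "\<not> once" "V ~= {}"
 shows "pr ` C0 = doubly_pairs"
proof -
 interpret D: doubled_transversals C0 pr by (rule not_once_doubled[OF assms(1)])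
 obtain nu where nu: "nu \<in> V" using assms(2) by blast
 have sp: "s \<subseteq> pairs Z" using srcs_pairs(1)[of nu] VD(3)[OF nu] by simp
 show ?thesis
 proof (intro subset_antisym subsetI)
  fix P assume "P \<in> pr ` C0"
  then obtain p where p: "P = pr p" "p \<in> C0" by (rule imageE)
  obtain p' where p': "p' ~= p" "{r \<in> C0. pr r = pr p} = {p, p'}" using D.twin[OF p(2)] by blast
  have P: "P \<in> s Int t" using p by (auto simp: C0_def Act_def)
  have c2: "card (fibre Z P) = 2" using arc P sp by (auto simp: arc_diagram_def)
  have sub: "{p, p'} \<subseteq> fibre Z P" unfolding p'(2)[symmetric] using p(1) by (auto simp: C0_def in_fibre)
  have "finite (fibre Z P)" using c2 by (metis card.infinite zero_neq_numeral)
  then have "fibre Z P = {p, p'}" using card_subset_eq[OF _ sub] c2 p'(1) by simp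
  then have "fibre Z P \<subseteq> C0" using p'(2) by blast
  then have "doubly_occupied Z h P" unfolding doubly_occupied_def C0_def by fastforce
  then show "P \<in> doubly_pairs" using P by (simp add: doubly_pairs_def)
 next
  fix P assume P: "P \<in> doubly_pairs"
  then have "card (fibre Z P) = 2" using arc sp by (auto simp: arc_diagram_def doubly_pairs_def)
  then have "fibre Z P ~= {}" by (metis card.empty zero_neq_numeral)
  then obtain p where p: "p \<in> fibre Z P" by blast
  then show "P \<in> pr ` C0" using doubly_C0[OF P p] by (auto simp: in_fibre)
 qed
qed

text \<open>Starts and ends of moving strands meet in the break set, so the defining condition says
  that it contains the chosen places. A break set has at most one place per pair, so it equals the
  chosen set.\<close>

lemma chosen_diagram_eq:
 assumes "\<not> once" "V ~= {}" "cycle_choice Z CY"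
 shows "CY (h, s, t) ` doubly_pairs \<in> T.pt" "T.full (CY (h, s, t) ` doubly_pairs)"
  "chosen_diagram Z CY (h, s, t) = Dgd (CY (h, s, t) ` doubly_pairs)"
proof -
 let ?B = "CY (h, s, t) ` doubly_pairs"
 have cy: "CY (h, s, t) P \<in> fibre Z P" if "P \<in> doubly_pairs" for P
  using assms that tight_hdata_iff unfolding cycle_choice_def doubly_pairs_def by blast
 then have prcy: "pr (CY (h, s, t) P) = P" if "P \<in> doubly_pairs" for P
  using that by (simp add: in_fibre)
 have "?B \<subseteq> C0" using doubly_C0 cy by blast
 moreover have "inj_on pr ?B"
 proof (rule inj_onI)
  fix a b assume "a \<in> ?B" "b \<in> ?B" and e: "pr a = pr b"
  then obtain P Q where "P \<in> doubly_pairs" "a = CY (h, s, t) P" "Q \<in> doubly_pairs" "b = CY (h, s, t) Q" by blast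
  then show "a = b" using prcy[of P] prcy[of Q] e by simp
 qed
 ultimately show B: "?B \<in> T.pt" by (simp add: T.pt_def)
 have "pr ` ?B = doubly_pairs" using prcy by (force simp: image_image)
 then show full: "T.full ?B" using pr_C0[OF assms(1,2)] by (simp add: T.full_def)
 have key: "(\<forall>P\<in>s Int t. doubly_occupied Z h P --> CY (h, s, t) P \<in> Domain (moving_strands (Dgd B')) Int Range (moving_strands (Dgd B')))
   \<longleftrightarrow> ?B \<subseteq> B'" if B': "B' \<in> T.pt" for B'
 proof -
  obtain nu where "nu \<in> V" "brk nu = B'" by (rule pt_brkE[OF assms(2) B'])
  then have "Domain (moving_strands (Dgd B')) Int Range (moving_strands (Dgd B')) = B'"
   using moving_strands_Dgd by (auto simp: brk_def)
  then show ?thesis by (auto simp: doubly_pairs_def)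
 qed
 show "chosen_diagram Z CY (h, s, t) = Dgd ?B"
  unfolding chosen_diagram_def case_prod_conv
 proof (rule the_equality)
  show "tight Z (h, s, t) (Dgd ?B) & (\<forall>P\<in>s Int t. doubly_occupied Z h P -->
    CY (h, s, t) P \<in> Domain (moving_strands (Dgd ?B)) Int Range (moving_strands (Dgd ?B)))"
   unfolding key[OF B] tight_iff using B full assms by blast
  fix D assume D: "tight Z (h, s, t) D & (\<forall>P\<in>s Int t. doubly_occupied Z h P -->
    CY (h, s, t) P \<in> Domain (moving_strands D) Int Range (moving_strands D))"
  then obtain B' where B': "B' \<in> T.pt" "T.full B'" "D = Dgd B'" unfolding tight_iff by blast
  have sub: "?B \<subseteq> B'" using D key[OF B'(1)] B'(3) by blast
  have "b \<in> ?B" if b: "b \<in> B'" for b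
  proof -
   have "pr b \<in> pr ` ?B" using b B'(2) full unfolding T.full_def by blast
   then obtain a where a: "pr b = pr a" "a \<in> ?B" by (rule imageE)
   then have "a = b" using sub b B'(1) by (auto simp: T.pt_def dest: inj_onD)
   then show ?thesis using a(2) by simp
  qed
  then have "B' = ?B" using sub by blast
  then show "D = Dgd ?B" using B'(3) by simp
 qed
qed

text \<open>The diagram has a crossing at the pair of \<open>q\<close> iff \<open>q\<close> is
  unbroken; otherwise its strands are joined at \<open>q\<close>. In terms of break sets this is
  \<open>join q\<close>.\<close>

lemma creation_op_lin:
 assumes "V ~= {}" "CR (h, s, t) \<in> s Int t" "once_occupied_at Z h (CR (h, s, t)) q" "c \<in> T.chains"
 shows "creation_op Z CR (h, s, t) (lin Dgd c) = lin Dgd (lin (T.join q) c)"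
proof -
 let ?P = "CR (h, s, t)"
 note o = once_C0[OF assms(2,3)]
 have the: "(THE p. once_occupied_at Z h ?P p) = q"
 proof (rule the_equality)
  show "once_occupied_at Z h ?P q" by fact
  fix p assume p: "once_occupied_at Z h ?P p"
  have "p \<in> {r \<in> C0. pr r = pr q}" using once_C0(1,3)[OF assms(2) p] o(3) by simp
  then show "p = q" unfolding o(2) by simp
 qed
 have cd: "create_diagram Z CR (h, s, t) (Dgd B) = lin Dgd (T.join q B)" if B: "B \<in> T.pt" for B
 proof -
  obtain nu where nu: "nu \<in> V" "brk nu = B" by (rule pt_brkE[OF assms(1) B])
  have qB: "pr q \<in> pr ` B \<longleftrightarrow> q \<in> B" using B o(1,2) by (auto simp: T.pt_def)
  have cr: "crossing_at Z (Dgd B) ?P \<longleftrightarrow> q \<notin> B"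
   unfolding crossing_at_iff[OF nu(1), unfolded nu(2)] T.ext_def
  proof
   assume "\<exists>p\<in>{p \<in> C0. pr p \<notin> pr ` B}. pr p = ?P"
   then have "pr q \<notin> pr ` B" unfolding o(3)[symmetric] by fastforce
   then show "q \<notin> B" unfolding qB .
  next
   assume "q \<notin> B"
   then have "q \<in> {p \<in> C0. pr p \<notin> pr ` B}" using o(1) qB by simp
   then show "\<exists>p\<in>{p \<in> C0. pr p \<notin> pr ` B}. pr p = ?P" using o(3) by (rule rev_bexI)
  qed
  show ?thesis
  proof (cases "q \<in> B")
   case True
   obtain al where al: "al \<in> V" "brk al = brk nu - {q}"
    "mv al = {(x, y) \<in> mv nu. x ~= q & y ~= q} Un {(x, y). (x, q) \<in> mv nu & (q, y) \<in> mv nu}"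
    by (rule join_strands[OF nu(1), of q]) (use True nu(2) in simp)
   have "create_diagram Z CR (h, s, t) (Dgd B) = dgm Z s (mv al) t"
    unfolding create_diagram_def case_prod_conv Let_def the using cr True
     moving_strands_Dgd[OF nu(1)] nu(2) al(3) by simp
   also have "... = Dg al" using Dg_dgm[OF VD(1)[OF al(1)]] VD(3,4)[OF al(1)] by simp
   also have "... = Dgd (B - {q})" using Dg_V[OF al(1)] al(2) nu(2) by simp
   finally show ?thesis using True by (simp add: T.join_def)
  next
   case False
   then show ?thesis using cr by (simp add: create_diagram_def Let_def T.join_def)
  qed
 qed
 have inj: "inj_on Dgd T.pt"
 proof (rule inj_onI)
  fix B B' assume "B \<in> T.pt" "B' \<in> T.pt" "Dgd B = Dgd B'"
  then have "single B (1::bit) = single B' 1"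
   using lin_Dgd_inj[OF assms(1) single_chain[of B] single_chain[of B']] by simp
  then have "keys (single B (1::bit)) = keys (single B' (1::bit))"
   by (rule arg_cong)
  then show "B = B'" by simp
 qed
 have kc: "keys c \<subseteq> T.pt" using assms(4) by (simp add: T.chains_def)
 have "{D \<in> diagrams_with Z (h, s, t). keys D \<subseteq> keys (lin Dgd c)} = Dgd ` keys c"
 proof -
  have "keys (Dgd B) \<subseteq> keys (lin Dgd c) \<longleftrightarrow> B \<in> keys c" if B: "B \<in> T.pt" for B
  proof -
   obtain nu where "nu \<in> V" "brk nu = B" by (rule pt_brkE[OF assms(1) B])
   then show ?thesis unfolding keys_lin_Dgd[OF assms(4)] keys_Dgd by blast
  qed
  then show ?thesis unfolding in_diagrams_with using assms(1) kc by blast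
 qed
 then have "creation_op Z CR (h, s, t) (lin Dgd c) = (\<Sum>B\<in>keys c. create_diagram Z CR (h, s, t) (Dgd B))"
  unfolding creation_op_def using inj_on_subset[OF inj kc] by (simp add: sum.reindex)
 also have "... = (\<Sum>B\<in>keys c. lin Dgd (T.join q B))"
  using cd kc by (intro sum.cong) auto
 also have "... = lin Dgd (lin (T.join q) c)" unfolding lin_lin by (simp add: lin_def)
 finally show ?thesis .
qed

text \<open>Each break lowers the degree by one, being a term of the differential, and all unbroken
  strand diagrams of the summand are terms of one diagram.\<close>

lemma maslov_brk:
 obtains m where "!!nu. nu \<in> V ==> maslov_term Z nu = m - of_nat (card (brk nu))"
proof (cases "V = {}")
 case False
 obtain nu0 where nu0: "nu0 \<in> V" "brk nu0 = {}" using ex_unbroken[OF False] by blast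
 have "maslov_term Z nu = maslov_term Z nu0 - of_nat (card (brk nu))" if "nu \<in> V" for nu
  using that
 proof (induction "card (brk nu)" arbitrary: nu rule: less_induct)
  case less
  have fin: "finite (brk nu)" using brk_pt[OF less.prems] T.finC finite_subset by (auto simp: T.pt_def)
  show ?case
  proof (cases "brk nu = {}")
   case True
   then have "nu ~~ nu0" using sim_iff_brk[OF less.prems nu0(1)] nu0(2) by simp
   then show ?thesis using sim_maslov True by simp
  next
   case ne: False
   then obtain q where q: "q \<in> brk nu" by blast
   obtain al where al: "al \<in> V" "reduces al nu" "brk al = brk nu - {q}" by (rule join_strands[OF less.prems q])
   have c: "card (brk nu) = Suc (card (brk al))" unfolding al(3) using card.remove[OF fin q] by simp
   then have "maslov_term Z al = maslov_term Z nu0 - of_nat (card (brk al))" using less.hyps al(1) by simp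
   then show ?thesis using reduces_maslov[OF VD(1)[OF al(1)] al(2)] c by simp
  qed
 qed
 then show ?thesis using that by blast
qed simp

end

section \<open>The ideal of non-viable diagrams and crossings at doubly occupied pairs\<close>

context arc
begin

text \<open>Phrased for a single term: in a viable diagram, a crossing at a doubly occupied pair
  means that every term has a horizontal strand at one of its two places
  (\<open>in_F_Dg\<close>).\<close>

definition in_F :: "strands => bool" where
 "in_F nu \<longleftrightarrow> \<not> viable Z (h_grading nu) \<or>
  (\<exists>P\<in>pairs Z. doubly_occupied Z (h_grading nu) P & (\<exists>p\<in>fibre Z P. (p, p) \<in> nu))"

lemma in_F_Dg:
 assumes "good nu"
 shows "in_F nu \<longleftrightarrow> \<not> viable Z (h_grading nu) \<or>
  (\<exists>P\<in>pairs Z. doubly_occupied Z (h_grading nu) P & crossing_at Z (Dg nu) P)"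
proof (cases "viable Z (h_grading nu)")
 case True
 interpret S: viable_summand Z "h_grading nu" "srcs nu" "tgts nu"
  by standard (rule True)
 have nu: "nu \<in> S.V" using assms by (simp add: S.V_def hdat_def)
 have "crossing_at Z (Dg nu) P \<longleftrightarrow> (\<exists>p\<in>fibre Z P. (p, p) \<in> nu)" if P: "doubly_occupied Z (h_grading nu) P" for P
  unfolding S.Dg_V[OF nu] S.crossing_at_iff[OF nu]
 proof
  assume "\<exists>p\<in>S.T.ext (S.brk nu). pr p = P"
  then obtain p where p: "p \<in> S.C0" "pr p \<notin> pr ` S.brk nu" "pr p = P" by (auto simp: S.T.ext_def)
  then have p': "p \<in> Pl" "pr p \<in> S.Act" by (simp_all add: S.C0_def)
  obtain q where "q \<in> Pl" "pr q = pr p" "(q, q) \<in> nu" by (rule S.active_horizontal[OF nu p' p(2)])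
  then show "\<exists>p\<in>fibre Z P. (p, p) \<in> nu" using p(3) by (auto simp: S.in_fibre)
 next
  assume "\<exists>p\<in>fibre Z P. (p, p) \<in> nu"
  then obtain p where p: "p \<in> Pl" "pr p = P" "(p, p) \<in> nu" by (auto simp: S.in_fibre)
  have "h_grading nu (step_before p) ~= 0" "h_grading nu (step_after p) ~= 0"
   using P p(1,2) by (auto simp: doubly_occupied_def S.in_fibre)
  then have "p \<in> S.C0"
   unfolding S.C0_def using S.h_01[OF S.steps_at(1)[OF p(1)]] S.h_01[OF S.steps_at(2)[OF p(1)]]
    S.active[OF nu p(1)] p by simp
  then show "\<exists>p\<in>S.T.ext (S.brk nu). pr p = P"
   using S.horizontal_ext[OF nu p(1,3)] p(2) unfolding S.T.ext_def by blast
 qed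
 then show ?thesis unfolding in_F_def by blast
qed (simp add: in_F_def)

lemma sim_invariant_in_F: "sim_invariant in_F"
 unfolding sim_invariant_def
proof (intro allI impI)
 fix nu nu' assume "nu ~~ nu'" "in_F nu"
 moreover have "h_grading nu = h_grading nu'" "Dg nu = Dg nu'" "good nu" "good nu'"
  using calculation(1) sim_hdat Dg_eq sim_good by (auto simp: hdat_def)
 ultimately show "in_F nu'" using in_F_Dg by simp
qed

lemma ideal_F_eq: "x \<in> ideal_F Z \<longleftrightarrow> inA x & (\<forall>nu\<in>keys x. in_F nu)"
proof -
 have "{D. \<exists>h s t. D \<in> diagrams_with Z (h, s, t) &
   (\<not> viable Z h \<or> (\<exists>P\<in>pairs Z. doubly_occupied Z h P & crossing_at Z D P))} = Dg ` {nu. good nu & in_F nu}"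
  (is "?L = ?R")
 proof (intro subset_antisym subsetI)
  fix D assume "D \<in> ?L"
  then obtain h s t where D: "D \<in> diagrams_with Z (h, s, t)"
   "\<not> viable Z h \<or> (\<exists>P\<in>pairs Z. doubly_occupied Z h P & crossing_at Z D P)" by blast
  then obtain nu where nu: "D = Dg nu" "good nu" "hdat nu = (h, s, t)" unfolding diagrams_with_eq by blast
  have "h_grading nu = h" using nu(3) by (simp add: hdat_def)
  then have "in_F nu" using in_F_Dg[OF nu(2)] D(2) nu(1) by simp
  then show "D \<in> ?R" using nu by blast
 next
  fix D assume "D \<in> ?R"
  then obtain nu where nu: "D = Dg nu" "good nu" "in_F nu" by blast
  have "D \<in> diagrams_with Z (h_grading nu, srcs nu, tgts nu)"
   unfolding diagrams_with_eq using nu by (auto simp: hdat_def)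
  then show "D \<in> ?L" using nu in_F_Dg[OF nu(2)] by blast
 qed
 then show ?thesis unfolding ideal_F_def using z2_span_Dg[OF sim_invariant_in_F] by simp
qed

lemma ideal_F_0 [simp]: "0 \<in> ideal_F Z" by (simp add: ideal_F_eq inA_0)

lemma ideal_F_add: "x \<in> ideal_F Z ==> y \<in> ideal_F Z ==> x + y \<in> ideal_F Z"
 unfolding ideal_F_eq keys_add_bit using inA_add by blast

text \<open>A factor resting at a place of a pair that it doubly occupies already covers the steps
  there. Viability of the product keeps the other factor from covering them again, so it rests there
  too and the horizontal strand persists.\<close>

lemma composes_in_F:
 assumes "good al" "good be" "composes al be gm" "in_F al \<or> in_F be"
 shows "in_F gm"
proof (rule ccontr)
 assume n: "\<not> in_F gm"
 have R: "Range al = Domain be" and gm: "gm = al O be" using assms(3) by (auto simp only: composes_def)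
 have hs: "h_grading gm e = h_grading al e + h_grading be e" for e
  unfolding gm by (rule h_grading_comp[OF assms(1,2) R])
 note nn = h_grading_nonneg[of al] h_grading_nonneg[of be]
 have via: "viable Z (h_grading gm)" using n by (simp add: in_F_def)
 then have le: "h_grading al e + h_grading be e <= 1" if "e \<in> steps Z" for e
  using that hs[of e] unfolding viable_def by fastforce
 have via2: "viable Z (h_grading al)" "viable Z (h_grading be)"
  unfolding viable_def using le nn by (smt (verit))+
 have dbl: "doubly_occupied Z (h_grading gm) P"
  if "doubly_occupied Z (h_grading al) P \<or> doubly_occupied Z (h_grading be) P" for P
  using that nn unfolding doubly_occupied_def hs by (smt (verit))
 have st: "step_before p \<in> steps Z" "step_after p \<in> steps Z" if "p \<in> Pl" for p
  using that by (auto simp: places_def steps_def step_before_def step_after_def)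
 have "\<exists>P\<in>pairs Z. doubly_occupied Z (h_grading gm) P & (\<exists>p\<in>fibre Z P. (p, p) \<in> gm)"
  using assms(4)
 proof
  assume "in_F al"
  then obtain P p where P: "P \<in> pairs Z" "doubly_occupied Z (h_grading al) P" "p \<in> fibre Z P" "(p, p) \<in> al"
   using via2(1) unfolding in_F_def by blast
  have p: "p \<in> Pl" using P(3) by (simp add: fibre_def)
  have pos: "h_grading al (step_after p) \<ge> 1"
   using P(2,3) nn(1)[of "step_after p"] unfolding doubly_occupied_def by (smt (verit))
  obtain z where z: "(p, z) \<in> be" using P(4) R by blast
  have "z = p"
  proof (rule ccontr)
   assume "z ~= p"
   then have "p \<in> Domain (mv be)" using z by (auto simp: in_mv)
   then have "h_grading be (step_after p) \<ge> 1"
    using h_grading_at(2)[OF goodD(2,3)[OF assms(2)] place_snd[OF p]] by simp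
   then show False using pos le[OF st(2)[OF p]] by simp
  qed
  then have "(p, p) \<in> gm" using P(4) z unfolding gm by blast
  then show ?thesis using P dbl by blast
 next
  assume "in_F be"
  then obtain P p where P: "P \<in> pairs Z" "doubly_occupied Z (h_grading be) P" "p \<in> fibre Z P" "(p, p) \<in> be"
   using via2(2) unfolding in_F_def by blast
  have p: "p \<in> Pl" using P(3) by (simp add: fibre_def)
  have pos: "h_grading be (step_before p) \<ge> 1"
   using P(2,3) nn(2)[of "step_before p"] unfolding doubly_occupied_def by (smt (verit))
  obtain z where z: "(z, p) \<in> al" using P(4) R by blast
  have "z = p"
  proof (rule ccontr)
   assume "z ~= p"
   then have "p \<in> Range (mv al)" using z by (auto simp: in_mv)
   then have "h_grading al (step_before p) \<ge> 1"
    using h_grading_at(1)[OF goodD(2,3)[OF assms(1)] place_snd[OF p]] by simp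
   then show False using pos le[OF st(1)[OF p]] by simp
  qed
  then have "(p, p) \<in> gm" using P(4) z unfolding gm by blast
  then show ?thesis using P dbl by blast
 qed
 then show False using n by (simp add: in_F_def)
qed

lemma ideal_F_mult:
 assumes "inA x" "inA y" "x \<in> ideal_F Z \<or> y \<in> ideal_F Z"
 shows "vec_mult x y \<in> ideal_F Z"
 unfolding ideal_F_eq
proof (intro conjI ballI)
 show "inA (vec_mult x y)" by (rule inA_vec_mult[OF assms(1,2)])
 fix gm assume "gm \<in> keys (vec_mult x y)"
 then obtain al be where *: "al \<in> keys x" "be \<in> keys y" "composes al be gm"
  by (rule keys_vec_mult_ex)
 have "good al" "good be" using * assms(1,2) by (auto simp: inA_def)
 moreover have "in_F al \<or> in_F be" using * assms(3) by (auto simp: ideal_F_eq)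
 ultimately show "in_F gm" using composes_in_F *(3) by blast
qed

lemma nonviable_in_F: "\<not> viable Z h ==> x \<in> summand (h, s, t) ==> x \<in> ideal_F Z"
 unfolding alg_summand_eq ideal_F_eq in_F_def hdat_def by auto

end

context viable_summand
begin

lemma in_F_iff:
 assumes "nu \<in> V"
 shows "in_F nu \<longleftrightarrow> (\<exists>p\<in>T.ext (brk nu). doubly_occupied Z h (pr p))"
proof -
 have "in_F nu \<longleftrightarrow> (\<exists>P\<in>pairs Z. doubly_occupied Z h P & (\<exists>p\<in>T.ext (brk nu). pr p = P))"
  using in_F_Dg[OF VD(1)[OF assms]] VD(2)[OF assms] viable Dg_V[OF assms] crossing_at_iff[OF assms] by simp
 moreover have "pr p \<in> pairs Z" if "p \<in> T.ext (brk nu)" for p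
 proof -
  have "p \<in> C0" using that by (simp add: T.ext_def)
  then show ?thesis using pair_of_place by (simp add: C0_def)
 qed
 ultimately show ?thesis by blast
qed

lemma in_F_full:
 assumes "\<not> once" "nu \<in> V"
 shows "in_F nu \<longleftrightarrow> \<not> T.full (brk nu)"
proof -
 have "V ~= {}" using assms(2) by blast
 then have "doubly_occupied Z h (pr p)" if "p \<in> T.ext (brk nu)" for p
  using pr_C0[OF assms(1)] that by (auto simp: T.ext_def doubly_pairs_def)
 then show ?thesis using in_F_iff[OF assms(2)] T.full_iff[OF brk_pt[OF assms(2)]] by blast
qed

text \<open>Homogeneity fixes the number of breaks. Outside F some term has all pairs broken, so
  every term has, and nothing is left for the differential to break.\<close>

lemma tight_not_in_F_cycle:
 assumes "\<not> once" "V ~= {}" "x \<in> summand (h, s, t)" "homog g x" "x \<notin> ideal_F Z"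
 shows "vec_diff x = 0"
proof -
 obtain c where c: "c \<in> T.chains" "x = lin Dgd c" by (rule summand_chain[OF assms(3)])
 have k: "keys x = {nu \<in> V. brk nu \<in> keys c}" unfolding c(2) by (rule keys_lin_Dgd[OF c(1)])
 obtain nu where nu: "nu \<in> keys x" "\<not> in_F nu"
  using assms(5) alg_summand_inA[OF assms(3)] unfolding ideal_F_eq by blast
 then have nuV: "nu \<in> V" "T.full (brk nu)" using k in_F_full[OF assms(1)] by auto
 obtain m where m: "!!nu. nu \<in> V ==> maslov_term Z nu = m - of_nat (card (brk nu))" using maslov_brk by blast
 have full: "T.full B" if B: "B \<in> keys c" for B
 proof -
  have Bpt: "B \<in> T.pt" using B c(1) by (auto simp: T.chains_def)
  obtain mu where mu: "mu \<in> V" "brk mu = B" by (rule pt_brkE[OF assms(2) Bpt])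
  have "mu \<in> keys x" unfolding k using mu B by simp
  then have "maslov_term Z mu = maslov_term Z nu" using assms(4) nu(1) by (simp add: maslov_homogeneous_def)
  then have e: "card B = card (brk nu)" using m[OF mu(1)] m[OF nuV(1)] mu(2) by simp
  have ci: "card (pr ` B) = card B" "card (pr ` brk nu) = card (brk nu)"
   using Bpt brk_pt[OF nuV(1)] by (auto simp: T.pt_def card_image)
  have "pr ` B \<subseteq> pr ` C0" using Bpt by (auto simp: T.pt_def)
  then have "pr ` B = pr ` C0"
   using ci e nuV(2) T.finC by (intro card_subset_eq) (simp_all add: T.full_def)
  then show ?thesis by (simp add: T.full_def)
 qed
 have "lin T.dC c = lin (%B. 0) c"
 proof (rule lin_cong)
  fix B assume B: "B \<in> keys c"
  then have "B \<in> T.pt" using c(1) by (auto simp: T.chains_def)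
  then have "T.ext B = {}" using full[OF B] T.full_iff by blast
  then show "T.dC B = 0" unfolding T.dC_def by (simp only: sum.empty)
 qed
 then show ?thesis unfolding c(2) vec_diff_lin_Dgd[OF c(1)] by simp
qed

text \<open>Every term in F has an unbroken pair, so \<open>eps\<close> vanishes on the
  cycle.\<close>

lemma tight_in_F_boundary:
 assumes "\<not> once" "V ~= {}" "x \<in> summand (h, s, t)" "vec_diff x = 0" "x \<in> ideal_F Z"
 shows "x \<in> bds"
proof -
 obtain c where c: "c \<in> T.chains" "x = lin Dgd c" by (rule summand_chain[OF assms(3)])
 have "\<not> T.full B" if B: "B \<in> keys c" for B
 proof -
  have Bpt: "B \<in> T.pt" using B c(1) by (auto simp: T.chains_def)
  obtain mu where mu: "mu \<in> V" "brk mu = B" by (rule pt_brkE[OF assms(2) Bpt])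
  have "mu \<in> keys x" unfolding c(2) keys_lin_Dgd[OF c(1)] using mu B by simp
  then have "in_F mu" using assms(5) by (simp add: ideal_F_eq)
  then show ?thesis using in_F_full[OF assms(1) mu(1)] mu(2) by simp
 qed
 then have "T.eps c = lin (%B. 0) c" unfolding T.eps_def by (intro lin_cong) auto
 then have "T.eps c = 0" by simp
 moreover obtain B where "B \<in> T.pt" "T.full B" using T.ex_full by blast
 ultimately show ?thesis using cycle_homologous[OF assms(1,2) c(1)] assms(4) c(2) by fastforce
qed

lemma tight_homologous:
 assumes "\<not> once" "V ~= {}" "x \<in> summand (h, s, t)" "vec_diff x = 0" "x \<notin> bds" "B \<in> T.pt" "T.full B"
 shows "x + Dgd B \<in> bds"
proof -
 obtain c where c: "c \<in> T.chains" "x = lin Dgd c" by (rule summand_chain[OF assms(3)])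
 have "x + (if T.eps c = 1 then Dgd B else 0) \<in> bds"
  using cycle_homologous[OF assms(1,2) c(1) _ assms(6,7)] assms(4) c(2) by simp
 then show ?thesis using assms(5) by (auto split: if_splits)
qed

lemma creation_op_props:
 assumes "V ~= {}" "CR (h, s, t) \<in> s Int t" "once_occupied_at Z h (CR (h, s, t)) q"
 shows "x \<in> summand (h, s, t) ==> creation_op Z CR (h, s, t) x \<in> summand (h, s, t)"
  "x \<in> summand (h, s, t) ==> vec_diff x = 0 ==> vec_diff (creation_op Z CR (h, s, t) x) = x"
  "x \<in> summand (h, s, t) ==> y \<in> summand (h, s, t) ==>
   creation_op Z CR (h, s, t) (x + y) = creation_op Z CR (h, s, t) x + creation_op Z CR (h, s, t) y"
  "x \<in> summand (h, s, t) ==> homog g x ==> homog (g + 1) (creation_op Z CR (h, s, t) x)"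
  "x \<in> summand (h, s, t) ==> x \<in> ideal_F Z ==> creation_op Z CR (h, s, t) x \<in> ideal_F Z"
proof -
 note op = creation_op_lin[where CR = CR, OF assms]
 show 1: "creation_op Z CR (h, s, t) x \<in> summand (h, s, t)" if "x \<in> summand (h, s, t)" for x
  using op lin_Dgd_summand T.chains_join summand_chain[OF that] by metis
 show "vec_diff (creation_op Z CR (h, s, t) x) = x" if x: "x \<in> summand (h, s, t)" "vec_diff x = 0"
 proof -
  obtain c where c: "c \<in> T.chains" "x = lin Dgd c" by (rule summand_chain[OF x(1)])
  have "lin Dgd (lin T.dC c) = lin Dgd 0" using x(2) vec_diff_lin_Dgd[OF c(1)] c(2) by simp
  moreover have "0 \<in> T.chains" by (simp add: T.chains_def)
  ultimately have "lin T.dC c = 0" using lin_Dgd_inj[OF assms(1) T.chains_dC[OF c(1)]] by blast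
  then show ?thesis using once_homotopy[OF assms(2,3) c(1)] op[OF c(1)] c(2) by simp
 qed
 show "creation_op Z CR (h, s, t) (x + y) = creation_op Z CR (h, s, t) x + creation_op Z CR (h, s, t) y"
  if x: "x \<in> summand (h, s, t)" "y \<in> summand (h, s, t)"
 proof -
  obtain c where c: "c \<in> T.chains" "x = lin Dgd c" by (rule summand_chain[OF x(1)])
  obtain c' where c': "c' \<in> T.chains" "y = lin Dgd c'" by (rule summand_chain[OF x(2)])
  show ?thesis
   unfolding c(2) c'(2) op[OF c(1)] op[OF c'(1)] lin_add[symmetric] op[OF T.chains_add[OF c(1) c'(1)]] ..
 qed
 have keys: "\<exists>nu\<in>keys x. q \<in> brk nu & mu \<in> V & nu \<in> V & brk mu = brk nu - {q}"
  if x: "x \<in> summand (h, s, t)" and mu: "mu \<in> keys (creation_op Z CR (h, s, t) x)" for x mu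
 proof -
  obtain c where c: "c \<in> T.chains" "x = lin Dgd c" by (rule summand_chain[OF x])
  have mu: "mu \<in> V" "brk mu \<in> keys (lin (T.join q) c)"
   using mu unfolding c(2) op[OF c(1)] keys_lin_Dgd[OF T.chains_join[OF c(1)]] by blast+
  obtain B where B: "B \<in> keys c" "brk mu \<in> keys (T.join q B)"
   using subsetD[OF keys_lin_subset mu(2)] by blast
  have q: "q \<in> B" "brk mu = B - {q}" using B(2) by (auto simp: T.join_def split: if_splits)
  have "B \<in> T.pt" using B(1) c(1) by (auto simp: T.chains_def)
  then obtain nu where nu: "nu \<in> V" "brk nu = B" by (rule pt_brkE[OF assms(1)])
  then have "nu \<in> keys x" unfolding c(2) keys_lin_Dgd[OF c(1)] using B(1) by simp
  then show ?thesis using nu q mu(1) by blast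
 qed
 show "homog (g + 1) (creation_op Z CR (h, s, t) x)"
  if x: "x \<in> summand (h, s, t)" "homog g x"
  unfolding maslov_homogeneous_def
 proof
  fix mu assume "mu \<in> keys (creation_op Z CR (h, s, t) x)"
  then obtain nu where nu: "nu \<in> keys x" "q \<in> brk nu" "mu \<in> V" "nu \<in> V" "brk mu = brk nu - {q}"
   using keys[OF x(1)] by blast
  obtain m where m: "!!nu. nu \<in> V ==> maslov_term Z nu = m - of_nat (card (brk nu))" using maslov_brk by blast
  have "finite (brk nu)" using brk_pt[OF nu(4)] T.finC finite_subset by (auto simp: T.pt_def)
  then have "card (brk nu) = Suc (card (brk mu))" unfolding nu(5) using card.remove[OF _ nu(2)] by simp
  then show "maslov_term Z mu = g + 1" using m[OF nu(3)] m[OF nu(4)] x(2) nu(1) by (simp add: maslov_homogeneous_def)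
 qed
 show "creation_op Z CR (h, s, t) x \<in> ideal_F Z" if x: "x \<in> summand (h, s, t)" "x \<in> ideal_F Z"
  unfolding ideal_F_eq
 proof (intro conjI ballI)
  show "inA (creation_op Z CR (h, s, t) x)" using alg_summand_inA[OF 1[OF x(1)]] .
  fix mu assume "mu \<in> keys (creation_op Z CR (h, s, t) x)"
  then obtain nu where nu: "nu \<in> keys x" "mu \<in> V" "nu \<in> V" "brk mu = brk nu - {q}"
   using keys[OF x(1)] by blast
  have "in_F nu" using x(2) nu(1) by (simp add: ideal_F_eq)
  then obtain p where "p \<in> T.ext (brk nu)" "doubly_occupied Z h (pr p)" using in_F_iff[OF nu(3)] by blast
  \<comment> \<open>Joining at \<open>q\<close> keeps unbroken places unbroken, so a crossing at a
    doubly occupied pair survives.\<close>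
  moreover have "T.ext (brk nu) \<subseteq> T.ext (brk mu)" unfolding nu(4) T.ext_def by blast
  ultimately show "in_F mu" using in_F_iff[OF nu(2)] by blast
 qed
qed

end

section \<open>Generators of the homology\<close>

text \<open>The homogeneous parts of a boundary are boundaries. If the degrees differed, the part of
  degree \<open>g\<close> of the sum would be \<open>x\<close> itself.\<close>

lemma (in arc) homogeneous_cycles_same_degree:
 assumes "inA x" "homog g x" "x \<notin> bds" "inA y" "homog g' y"
  "x + y \<in> bds"
 shows "g = g'"
proof (rule ccontr)
 assume "g ~= g'"
 obtain z where z: "inA z" "x + y = vec_diff z" using assms(6) in_boundaries by blast
 let ?Q = "%nu. maslov_term Z nu = g" and ?Q' = "%nu. maslov_term Z nu = g + 1"
 have inv: "sim_invariant ?Q'" using sim_invariant_grading[of "%_ m. m = g + 1"] by simp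
 have "x = restr ?Q x" using assms(2) by (intro restr_id[symmetric]) (simp add: maslov_homogeneous_def)
 moreover have "restr ?Q y = 0" using assms(5) \<open>g ~= g'\<close> by (intro restr_none) (auto simp: maslov_homogeneous_def)
 ultimately have "x = restr ?Q (x + y)" unfolding restr_add by simp
 also have "... = vec_diff (restr ?Q' z)"
  unfolding z(2) by (rule restr_vec_diff[OF z(1)]) (auto simp: reduces_maslov)
 finally show False using assms(3) inA_restr[OF z(1) inv] in_boundaries by blast
qed

lemma (in arc) Dg_homogeneous: "good nu ==> homog (maslov_term Z nu) (Dg nu)"
 using sim_maslov by (simp add: maslov_homogeneous_def)

locale choices = arc +
 fixes CY :: "hdata => nat => point" and CR :: "hdata => nat"
 assumes cycle_choice: "cycle_choice Z CY" and creation_choice: "creation_choice Z CR"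
begin

definition cd :: "hdata => vec" where "cd d = chosen_diagram Z CY d"

definition gen :: "hdata => vec set" where "gen d = hclass Z (cd d)"

lemma tight_data_viable: "tightH (h, s, t) ==> viable Z h"
 by (auto simp: tight_hdata_def tight_def)

lemma twisted_data_viable: "twisted_hdata Z (h, s, t) ==> viable Z h"
 by (auto simp: twisted_hdata_def twisted_def)

lemma cd_tight:
 assumes "tightH d"
 shows "tight Z d (cd d)"
proof -
 obtain h s t where d: "d = (h, s, t)" by (metis surj_pair)
 interpret S: viable_summand Z h s t by unfold_locales (rule tight_data_viable[OF assms[unfolded d]])
 have *: "S.V ~= {}" "\<not> S.once" using S.tight_hdata_iff assms d by auto
 show ?thesis unfolding cd_def d S.tight_iff using S.chosen_diagram_eq[OF *(2,1) cycle_choice] * by blast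
qed

lemma tight_props:
 assumes "tight Z d D"
 shows "D \<in> diagrams_with Z d" "D \<in> summand d" "inA D" "vec_diff D = 0" "D \<notin> bds"
proof -
 show 1: "D \<in> diagrams_with Z d" using assms by (simp add: tight_def)
 have "0 + D \<in> summand d" unfolding alg_summand_def by (rule z2_span_step[OF z2_span_0 1])
 then show "D \<in> summand d" by simp
 have c: "cyc D" using assms by (simp add: tight_def carrier_cycle_ring)
 then show "inA D" "vec_diff D = 0" by simp_all
 show "D \<notin> bds" using hclass_zero_iff[OF c] assms by (simp add: tight_def)
qed

lemmas cd_props = tight_props[OF cd_tight]

text \<open>Only tight summands carry homology: non-viable summands and those with a once occupied
  pair are acyclic, and a summand without diagrams is zero.\<close>

lemma nontrivial_cycle:
 assumes "x \<in> summand d" "vec_diff x = 0" "x \<notin> bds"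
 shows "tightH d" "x + cd d \<in> bds"
proof -
 obtain h s t where d: "d = (h, s, t)" by (metis surj_pair)
 have v: "viable Z h" using nonviable_acyclic assms d by blast
 interpret S: viable_summand Z h s t by unfold_locales (rule v)
 have V: "S.V ~= {}"
 proof
  assume "S.V = {}"
  then have "keys x = {}"
   using assms(1) unfolding d alg_summand_eq inA_def S.V_def by blast
  then show False using assms(3) by simp
 qed
 have o: "\<not> S.once" using S.once_acyclic V assms d by blast
 show t: "tightH d" unfolding d S.tight_hdata_iff using V o by blast
 show "x + cd d \<in> bds"
  using S.chosen_diagram_eq[OF o V cycle_choice] S.tight_homologous[OF o V] assms
  unfolding cd_def d by simp
qed

lemma gen_carrier: "tightH d ==> gen d \<in> H"
 unfolding gen_def using cd_props hclass_carrier by blast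

lemma summand_class:
 assumes "x \<in> summand d" "vec_diff x = 0"
 shows "x \<in> bds & hclass Z x = zeroH \<or>
  x \<notin> bds & tightH d & hclass Z x = gen d"
proof (cases "x \<in> bds")
 case True
 then show ?thesis using hclass_zero_iff alg_summand_inA[OF assms(1)] assms(2) by blast
next
 case False
 have "hclass Z x = gen d"
  unfolding gen_def using hclass_eq_iff[of x "cd d"] nontrivial_cycle[OF assms False] cd_props[of d]
   alg_summand_inA[OF assms(1)] assms(2) by blast
 then show ?thesis using False nontrivial_cycle[OF assms False] by blast
qed

lemma class_with_hdata_iff: "class_with_hdata Z d M \<longleftrightarrow> tightH d & M = gen d"
proof
 assume "class_with_hdata Z d M"
 then obtain D where "D \<in> diagrams_with Z d Int carrier (cycle_ring Z)" "M = hclass Z D" "M ~= zeroH"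
  unfolding class_with_hdata_def by blast
 then have D: "D \<in> diagrams_with Z d" "cyc D" "M = hclass Z D" "M ~= zeroH"
  by (simp_all add: carrier_cycle_ring)
 have "0 + D \<in> summand d" unfolding alg_summand_def by (rule z2_span_step[OF z2_span_0 D(1)])
 then show "tightH d & M = gen d" using summand_class[of D d] D by auto
next
 assume *: "tightH d & M = gen d"
 then have "gen d ~= zeroH" unfolding gen_def using hclass_zero_iff[of "cd d"] cd_props[of d] by blast
 then show "class_with_hdata Z d M"
  unfolding class_with_hdata_def using * cd_props[of d] by (auto simp: gen_def carrier_cycle_ring)
qed

lemma hom_generator_eq: "tightH d ==> hom_generator Z d = gen d"
 unfolding hom_generator_def
proof (rule the_equality)
 assume t: "tightH d"
 show "\<exists>D. tight Z d D & gen d = hclass Z D" using cd_tight[OF t] gen_def by blast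
 fix M assume "\<exists>D. tight Z d D & M = hclass Z D"
 then obtain D where D: "tight Z d D" "M = hclass Z D" by blast
 then show "M = gen d" using summand_class[of D d] tight_props[OF D(1)] by blast
qed

lemma gen_inj:
 assumes "tightH d" "tightH d'" "gen d = gen d'"
 shows "d = d'"
proof (rule ccontr)
 assume ne: "d ~= d'"
 have "cd d + cd d' \<in> bds"
  using hclass_eq_iff[of "cd d" "cd d'"] cd_props[OF assms(1)] cd_props[OF assms(2)] assms(3) by (simp add: gen_def)
 then obtain z where z: "inA z" "cd d + cd d' = vec_diff z" using in_boundaries by blast
 let ?Q = "%nu. hdat nu = d"
 have "restr ?Q (cd d') = 0"
  using cd_props(2)[OF assms(2)] ne by (intro restr_none) (auto simp: alg_summand_eq)
 then have "cd d = restr ?Q (cd d + cd d')"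
  unfolding restr_add using restr_alg_summand_id[OF cd_props(2)[OF assms(1)]] by simp
 also have "... = vec_diff (restr ?Q z)"
  unfolding z(2) by (rule restr_vec_diff[OF z(1)]) (simp add: reduces_hdat)
 finally show False
  using cd_props(5)[OF assms(1)] alg_summand_inA[OF restr_alg_summand[OF z(1)]] in_boundaries by blast
qed

lemma class_hdata_gen: "tightH d ==> class_hdata Z (gen d) = d"
 unfolding class_hdata_def class_with_hdata_iff using gen_inj by (intro the_equality) blast+

lemma diagram_classes_eq: "diagram_classes Z = gen ` {d. tightH d}"
 unfolding diagram_classes_def class_with_hdata_iff by blast

lemma cd_homogeneous: "tightH d ==> \<exists>g. homog g (cd d)"
proof -
 assume "tightH d"
 then obtain nu where "cd d = Dg nu" "good nu" using cd_props(1)[of d] unfolding diagrams_with_eq by blast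
 then show ?thesis using Dg_homogeneous by metis
qed

lemma class_maslov_gen:
 assumes "tightH d"
 shows "homog (class_maslov Z (gen d)) (cd d)"
  "x \<in> summand d ==> vec_diff x = 0 ==> x \<notin> bds ==> homog g x ==>
   g = class_maslov Z (gen d)"
proof -
 obtain m where m: "homog m (cd d)" using cd_homogeneous[OF assms] by blast
 note p = cd_props[OF assms]
 have same: "g = m" if "x \<in> summand d" "vec_diff x = 0" "x \<notin> bds" "homog g x" for x g
  using homogeneous_cycles_same_degree[OF alg_summand_inA[OF that(1)] that(4,3) p(3) m nontrivial_cycle(2)[OF that(1-3)]] .
 have "class_maslov Z (gen d) = m"
  unfolding class_maslov_def
 proof (rule the_equality)
  have "cd d \<in> diagrams Z" using p(1) unfolding diagrams_def by blast
  then show "\<exists>D\<in>diagrams Z Int carrier (cycle_ring Z). gen d = hclass Z D & homog m D"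
   using p m by (auto simp: gen_def carrier_cycle_ring)
  fix g assume "\<exists>D\<in>diagrams Z Int carrier (cycle_ring Z). gen d = hclass Z D & homog g D"
  then obtain D where D: "D \<in> diagrams Z" "D \<in> carrier (cycle_ring Z)" "gen d = hclass Z D" "homog g D"
   by blast
  obtain d' where d': "D \<in> diagrams_with Z d'" using D(1) unfolding diagrams_def by blast
  have "gen d ~= zeroH" unfolding gen_def using hclass_zero_iff[of "cd d"] p by blast
  then have "class_with_hdata Z d' (gen d)" unfolding class_with_hdata_def using D d' by blast
  then have "d' = d" unfolding class_with_hdata_iff using gen_inj assms by blast
  then have "0 + D \<in> summand d" unfolding alg_summand_def using d' by (intro z2_span_step[OF z2_span_0]) simp
  moreover have "cyc D" using D(2) by (simp add: carrier_cycle_ring)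
  moreover have "D \<notin> bds"
   using hclass_zero_iff[OF \<open>cyc D\<close>] \<open>gen d ~= zeroH\<close> D(3) by simp
  ultimately show "g = m" using same[of D g] D(4) by simp
 qed
 then show "homog (class_maslov Z (gen d)) (cd d)"
  "x \<in> summand d ==> vec_diff x = 0 ==> x \<notin> bds ==> homog g x ==>
   g = class_maslov Z (gen d)" using m same by simp_all
qed

lemma twisted_not_tight: "twisted_hdata Z d ==> \<not> tightH d"
proof -
 assume t: "twisted_hdata Z d"
 obtain h s t where d: "d = (h, s, t)" by (metis surj_pair)
 interpret S: viable_summand Z h s t by unfold_locales (rule twisted_data_viable[OF t[unfolded d]])
 show ?thesis using t unfolding d S.tight_hdata_iff S.twisted_hdata_iff by blast
qed

lemma creation:
 assumes "twisted_hdata Z d"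
 shows "x \<in> summand d ==> creation_op Z CR d x \<in> summand d"
  "x \<in> summand d ==> vec_diff x = 0 ==> vec_diff (creation_op Z CR d x) = x"
  "x \<in> summand d ==> y \<in> summand d ==> creation_op Z CR d (x + y) = creation_op Z CR d x + creation_op Z CR d y"
  "x \<in> summand d ==> homog g x ==> homog (g + 1) (creation_op Z CR d x)"
  "x \<in> summand d ==> x \<in> ideal_F Z ==> creation_op Z CR d x \<in> ideal_F Z"
proof -
 obtain h s t where d: "d = (h, s, t)" by (metis surj_pair)
 interpret S: viable_summand Z h s t by unfold_locales (rule twisted_data_viable[OF assms[unfolded d]])
 have V: "S.V ~= {}" using assms unfolding d S.twisted_hdata_iff by blast
 have "CR (h, s, t) \<in> s Int t" "\<exists>p. once_occupied_at Z h (CR (h, s, t)) p"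
  using creation_choice assms unfolding creation_choice_def d by blast+
 then obtain q where "CR (h, s, t) \<in> s Int t" "once_occupied_at Z h (CR (h, s, t)) q" by blast
 note p = S.creation_op_props[where CR = CR, OF V this]
 show "x \<in> summand d ==> creation_op Z CR d x \<in> summand d"
  "x \<in> summand d ==> vec_diff x = 0 ==> vec_diff (creation_op Z CR d x) = x"
  "x \<in> summand d ==> y \<in> summand d ==> creation_op Z CR d (x + y) = creation_op Z CR d x + creation_op Z CR d y"
  "x \<in> summand d ==> homog g x ==> homog (g + 1) (creation_op Z CR d x)"
  "x \<in> summand d ==> x \<in> ideal_F Z ==> creation_op Z CR d x \<in> ideal_F Z"
  unfolding d by (rule p; assumption)+
qed

lemma tight_outside_F:
 assumes "tightH d" "x \<in> summand d" "homog g x" "x \<notin> ideal_F Z"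
 shows "vec_diff x = 0"
proof -
 obtain h s t where d: "d = (h, s, t)" by (metis surj_pair)
 interpret S: viable_summand Z h s t by unfold_locales (rule tight_data_viable[OF assms(1)[unfolded d]])
 show ?thesis using S.tight_not_in_F_cycle assms unfolding d S.tight_hdata_iff by blast
qed

lemma F_cycle_boundary:
 assumes "x \<in> summand d" "vec_diff x = 0" "x \<in> ideal_F Z"
 shows "x \<in> bds"
proof (rule ccontr)
 assume n: "x \<notin> bds"
 have t: "tightH d" by (rule nontrivial_cycle(1)[OF assms(1,2) n])
 obtain h s t where d: "d = (h, s, t)" by (metis surj_pair)
 interpret S: viable_summand Z h s t by unfold_locales (rule tight_data_viable[OF t[unfolded d]])
 show False using S.tight_in_F_boundary assms n t unfolding d S.tight_hdata_iff by blast
qed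

text \<open>As soon as a viable summand contains a diagram, its breaks can be completed to a full
  set. The result has no crossings, so it is tight or twisted.\<close>

lemma viable_trichotomy:
 assumes "viable Z (fst d)" "\<not> tightH d" "\<not> twisted_hdata Z d" "x \<in> summand d"
 shows "x = 0"
proof -
 obtain h s t where d: "d = (h, s, t)" by (metis surj_pair)
 interpret S: viable_summand Z h s t by unfold_locales (use assms(1) d in simp)
 have "S.V = {}" using assms(2,3) unfolding d S.tight_hdata_iff S.twisted_hdata_iff by blast
 then have "keys x = {}" using assms(4) unfolding d alg_summand_eq inA_def S.V_def by blast
 then show ?thesis by simp
qed

subsection \<open>Expansion of classes\<close>

text \<open>The coordinates of a class in the basis of generators. By \<open>supp_hclass\<close> all
  representatives in the coset give the same answer.\<close>

definition supp :: "vec set => hdata set" where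
 "supp a = {d. \<exists>x\<in>a. restr (%nu. hdat nu = d) x \<notin> bds}"

lemma restr_boundary: "b \<in> bds ==> restr (%nu. hdat nu = d) b \<in> bds"
proof -
 assume "b \<in> bds"
 then obtain z where z: "inA z" "b = vec_diff z" using in_boundaries by blast
 have "restr (%nu. hdat nu = d) b = vec_diff (restr (%nu. hdat nu = d) z)"
  unfolding z(2) by (rule restr_vec_diff[OF z(1)]) (simp add: reduces_hdat)
 then show ?thesis using alg_summand_inA[OF restr_alg_summand[OF z(1)]] in_boundaries by blast
qed

lemma restr_cycle: "cyc x ==> restr (%nu. hdat nu = d) x \<in> summand d & vec_diff (restr (%nu. hdat nu = d) x) = 0"
 using restr_alg_summand[of x d] restr_vec_diff[of x "%nu. hdat nu = d" "%nu. hdat nu = d"] reduces_hdat by simp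

lemma boundaries_cancel: "a + b \<in> bds ==> a \<in> bds \<longleftrightarrow> b \<in> bds"
 using boundaries_add[of "a + b" a] boundaries_add[of "a + b" b] by (auto simp: add.assoc add.commute add.left_commute)

lemma supp_hclass: "cyc x ==> supp (hclass Z x) = {d. restr (%nu. hdat nu = d) x \<notin> bds}"
proof -
 assume "cyc x"
 have "restr (%nu. hdat nu = d) (b + x) \<in> bds \<longleftrightarrow> restr (%nu. hdat nu = d) x \<in> bds"
  if "b \<in> bds" for b d
  using boundaries_cancel[of "restr (%nu. hdat nu = d) (b + x)" "restr (%nu. hdat nu = d) x"] restr_boundary[OF that]
  by (simp add: restr_add add.assoc)
 then have "restr (%nu. hdat nu = d) y \<notin> bds \<longleftrightarrow> restr (%nu. hdat nu = d) x \<notin> bds"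
  if "y \<in> hclass Z x" for y d using that unfolding hclass_elem by blast
 moreover have "x \<in> hclass Z x" unfolding hclass_elem by (intro bexI[of _ 0]) auto
 ultimately show ?thesis unfolding supp_def by blast
qed

lemma supp_finite: "a \<in> H ==> finite (supp a)"
proof -
 assume "a \<in> H"
 then obtain x where x: "cyc x" "a = hclass Z x" unfolding carrier_homology by blast
 have "supp a \<subseteq> hdat ` keys x"
 proof
  fix d assume "d \<in> supp a"
  then have "restr (%nu. hdat nu = d) x ~= 0" unfolding x(2) supp_hclass[OF x(1)] by auto
  then have "\<exists>nu\<in>keys x. hdat nu = d" using restr_none[of x "%nu. hdat nu = d"] by blast
  then show "d \<in> hdat ` keys x" by blast
 qed
 then show ?thesis by (rule finite_subset) simp
qed

lemma supp_tight: "a \<in> H ==> d \<in> supp a ==> tightH d"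
 unfolding carrier_homology using supp_hclass nontrivial_cycle(1) restr_cycle by blast

text \<open>Two nontrivial cycles of one summand are both homologous to \<open>cd d\<close>, so
  their sum is a boundary and coordinates add modulo 2.\<close>

lemma supp_add:
 assumes "a \<in> H" "b \<in> H"
 shows "supp (addH a b) = (supp a - supp b) Un (supp b - supp a)"
proof -
 obtain x where x: "cyc x" "a = hclass Z x" using assms(1) unfolding carrier_homology by blast
 obtain y where y: "cyc y" "b = hclass Z y" using assms(2) unfolding carrier_homology by blast
 have xy: "cyc (x + y)" using x y by (simp add: inA_add vec_diff_add)
 have "restr (%nu. hdat nu = d) (x + y) \<notin> bds \<longleftrightarrow>
  (restr (%nu. hdat nu = d) x \<notin> bds) ~= (restr (%nu. hdat nu = d) y \<notin> bds)" for d
 proof -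
  let ?x = "restr (%nu. hdat nu = d) x" and ?y = "restr (%nu. hdat nu = d) y"
  have "?x + ?y \<in> bds" if "?x \<notin> bds" "?y \<notin> bds"
  proof -
   have "?x + cd d \<in> bds" "?y + cd d \<in> bds"
    using nontrivial_cycle(2) restr_cycle x y that by blast+
   then have "(?x + cd d) + (?y + cd d) \<in> bds" by (rule boundaries_add)
   then show ?thesis by (simp add: add.assoc add.commute add.left_commute)
  qed
  then show ?thesis unfolding restr_add using boundaries_cancel[of ?x ?y] boundaries_add[of ?x ?y] by blast
 qed
 then show ?thesis
  unfolding x(2) y(2) hclass_hom(1)[OF x(1) y(1)] supp_hclass[OF xy] supp_hclass[OF x(1)] supp_hclass[OF y(1)] by blast
qed

lemma supp_gen: "tightH d ==> supp (gen d) = {d}"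
proof -
 assume t: "tightH d"
 note p = cd_props[OF t]
 have "restr (%nu. hdat nu = d') (cd d) = (if d' = d then cd d else 0)" for d'
  using p(2) by (auto simp: alg_summand_eq intro!: restr_id restr_none)
 then show ?thesis unfolding gen_def using supp_hclass[of "cd d"] p by auto
qed

lemma supp_zero: "supp zeroH = {}"
 unfolding zero_homology using supp_hclass[OF cyc_0] by simp

text \<open>Split off one H-summand of a representative at a time; its class is zero or a
  generator.\<close>

lemma homology_induct [consumes 1]:
 assumes "a \<in> H" "P zeroH"
  "!!d b. tightH d ==> b \<in> H ==> P b ==> P (addH (gen d) b)"
 shows "P a"
proof -
 obtain x where x: "cyc x" "a = hclass Z x" using assms(1) unfolding carrier_homology by blast
 have "P (hclass Z x)" using x(1)
 proof (induction "card (hdat ` keys x)" arbitrary: x rule: less_induct)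
  case less
  show ?case
  proof (cases "x = 0")
   case True
   then show ?thesis using assms(2) by (simp add: zero_homology)
  next
   case False
   then obtain nu where nu: "nu \<in> keys x" by (metis all_not_in_conv keys_eq_empty)
   let ?y = "restr (%mu. hdat mu = hdat nu) x" and ?z = "restr (%mu. hdat mu ~= hdat nu) x"
   have yz: "x = ?y + ?z" by (rule vec_eqI) (auto simp: keys_add_bit)
   have cy: "cyc ?y" using restr_cycle[OF less.prems] alg_summand_inA by blast
   have "cyc ?z"
    using inA_restr[OF _ sim_invariant_hdat[of "%e. e ~= hdat nu"]] less.prems
     restr_vec_diff[of x "%mu. hdat mu ~= hdat nu" "%mu. hdat mu ~= hdat nu"] reduces_hdat by simp
   moreover have "card (hdat ` keys ?z) < card (hdat ` keys x)"
   proof (rule psubset_card_mono)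
    have "hdat nu \<in> hdat ` keys x" "hdat nu \<notin> hdat ` keys ?z" using nu by auto
    moreover have "hdat ` keys ?z \<subseteq> hdat ` keys x" by auto
    ultimately show "hdat ` keys ?z \<subset> hdat ` keys x" by blast
   qed simp
   ultimately have Pz: "P (hclass Z ?z)" using less.hyps by blast
   have e: "hclass Z x = addH (hclass Z ?y) (hclass Z ?z)"
    using hclass_hom(1)[OF cy \<open>cyc ?z\<close>] yz by simp
   have zc: "hclass Z ?z \<in> H" by (rule hclass_carrier[OF \<open>cyc ?z\<close>])
   consider "hclass Z ?y = zeroH" | "tightH (hdat nu)" "hclass Z ?y = gen (hdat nu)"
    using summand_class[of ?y "hdat nu"] restr_cycle[OF less.prems] by blast
   then show ?thesis
   proof cases
    case 1
    interpret H: ring "homology Z" by (rule ring_homology)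
    show ?thesis unfolding e 1 using Pz zc by simp
   next
    case 2
    then show ?thesis unfolding e using assms(3) Pz zc by simp
   qed
  qed
 qed
 then show ?thesis unfolding x(2) .
qed

lemma additive_expand:
 fixes \<phi> :: "vec set => 'b::char2"
 assumes "!!a b. a \<in> H ==> b \<in> H ==> \<phi> (addH a b) = \<phi> a + \<phi> b"
  "a \<in> H"
 shows "\<phi> a = (\<Sum>d\<in>supp a. \<phi> (gen d))"
 using assms(2)
proof (induction rule: homology_induct)
 case 1
 interpret H: ring "homology Z" by (rule ring_homology)
 have "\<phi> zeroH = \<phi> zeroH + \<phi> zeroH"
  using assms(1)[of "zeroH" "zeroH"] by simp
 then show ?case by (simp add: supp_zero)
next
 case (2 d b)
 have "(\<Sum>d\<in>supp (addH (gen d) b). \<phi> (gen d)) = \<phi> (gen d) + (\<Sum>d\<in>supp b. \<phi> (gen d))"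
  unfolding supp_add[OF gen_carrier[OF 2(1)] 2(2)] supp_gen[OF 2(1)]
  using lin_add[of "%d. \<phi> (gen d)" "vecof {d}" "vecof (supp b)"] supp_finite[OF 2(2)]
  by (simp add: lin_def keys_add_bit)
 then show ?case using assms(1)[OF gen_carrier[OF 2(1)] 2(2)] 2(3) by simp
qed

end

subsection \<open>Multilinear extension\<close>

text \<open>Multilinear extension of a function on tuples of basis elements. Each argument is given
  by the set of its coordinates, as \<open>supp\<close> provides.\<close>

fun mext :: "('d list => 'b::comm_monoid_add) => 'd set list => 'b" where
 "mext \<phi> [] = \<phi> []"
| "mext \<phi> (A # As) = (\<Sum>a\<in>A. mext (%ds. \<phi> (a # ds)) As)"

lemma mext_add:
 fixes \<phi> :: "'d list => 'b::char2"
 assumes "finite A" "finite B"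
 shows "mext \<phi> (Xs @ ((A - B) Un (B - A)) # Ys) = mext \<phi> (Xs @ A # Ys) + mext \<phi> (Xs @ B # Ys)"
proof (induction Xs arbitrary: \<phi>)
 case Nil
 show ?case
  using lin_add[of "%a. mext (%ds. \<phi> (a # ds)) Ys" "vecof A" "vecof B"] assms
  by (simp add: lin_def keys_add_bit)
next
 case (Cons C Xs)
 show ?case by (simp add: Cons.IH sum.distrib)
qed

lemma mext_singletons: "mext \<phi> (map (%d. {d}) ds) = \<phi> ds"
 by (induction ds arbitrary: \<phi>) auto

lemma mext_mem:
 fixes \<phi> :: "'d list => 'b::comm_monoid_add"
 assumes "0 \<in> N" "!!x y. x \<in> N ==> y \<in> N ==> x + y \<in> N"
  "!!ds. length ds = length As ==> (\<forall>i<length As. ds ! i \<in> As ! i) ==> \<phi> ds \<in> N"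
 shows "mext \<phi> As \<in> N"
 using assms(3)
proof (induction As arbitrary: \<phi>)
 case (Cons A As)
 have m: "mext (%ds. \<phi> (a # ds)) As \<in> N" if "a \<in> A" for a
 proof (rule Cons.IH)
  fix ds assume "length ds = length As" "\<forall>i<length As. ds ! i \<in> As ! i"
  then show "\<phi> (a # ds) \<in> N" using that by (intro Cons.prems) (auto simp: nth_Cons split: nat.split)
 qed
 have s: "sum g I \<in> N" if "!!i. i \<in> I ==> g i \<in> N" for g and I :: "'d set"
  using that assms(1,2) by (induction I rule: infinite_finite_induct) auto
 show ?case unfolding mext.simps by (rule s) (rule m)
qed simp

context choices
begin

definition slot_additive :: "nat => (vec set list => vec) => bool" where
 "slot_additive n F \<longleftrightarrow> (\<forall>xs a b ys. length xs + 1 + length ys = n --> set xs \<subseteq> H --> set ys \<subseteq> H --> a \<in> H --> b \<in> H -->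
  F (xs @ addH a b # ys) = F (xs @ a # ys) + F (xs @ b # ys))"

lemma slot_additive_expand:
 assumes "slot_additive n F" "length as = n" "set as \<subseteq> H"
 shows "F as = mext (%ds. F (map gen ds)) (map supp as)"
proof -
 have "F (map gen es @ ys) = mext (%ds. F (map gen es @ map gen ds)) (map supp ys)"
  if "length es + length ys = n" "set ys \<subseteq> H" "\<forall>e\<in>set es. tightH e" for es ys
  using that
 proof (induction ys arbitrary: es)
  case (Cons y ys)
  have es: "set (map gen es) \<subseteq> H" using Cons.prems(3) gen_carrier by auto
  have y: "y \<in> H" "set ys \<subseteq> H" using Cons.prems(2) by auto
  have "F (map gen es @ y # ys) = (\<Sum>d\<in>supp y. F (map gen es @ gen d # ys))"
   using assms(1) es y Cons.prems(1) unfolding slot_additive_def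
   by (intro additive_expand[of "%a. F (map gen es @ a # ys)"]) auto
  also have "... = (\<Sum>d\<in>supp y. mext (%ds. F (map gen es @ gen d # map gen ds)) (map supp ys))"
  proof (rule sum.cong[OF refl])
   fix d assume "d \<in> supp y"
   then have "tightH d" using supp_tight y(1) by blast
   then show "F (map gen es @ gen d # ys) = mext (%ds. F (map gen es @ gen d # map gen ds)) (map supp ys)"
    using Cons.IH[of "es @ [d]"] Cons.prems by simp
  qed
  finally show ?case by simp
 qed simp
 from this[of "[]" as] show ?thesis using assms(2,3) by simp
qed

text \<open>With {0} for the set this extends identities from generators to all classes; with the
  boundaries or F it extends congruences.\<close>

lemma slot_additive_mem:
 assumes "slot_additive n F" "0 \<in> N" "!!x y. x \<in> N ==> y \<in> N ==> x + y \<in> N"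
  "!!ds. length ds = n ==> (\<forall>d\<in>set ds. tightH d) ==> F (map gen ds) \<in> N"
  "length as = n" "set as \<subseteq> H"
 shows "F as \<in> N"
 unfolding slot_additive_expand[OF assms(1,5,6)]
proof (rule mext_mem[OF assms(2,3)])
 fix ds assume l: "length ds = length (map supp as)" "\<forall>i<length (map supp as). ds ! i \<in> map supp as ! i"
 have "tightH d" if d: "d \<in> set ds" for d
 proof -
  obtain i where i: "i < length ds" "d = ds ! i" using d by (metis in_set_conv_nth)
  then have "d \<in> supp (as ! i)" "as ! i \<in> H" using l assms(6) by auto
  then show ?thesis using supp_tight by blast
 qed
 then show "F (map gen ds) \<in> N" using l(1) assms(5) by (intro assms(4)) auto
qed

lemma slot_additive_mext: "slot_additive n (%as. mext \<phi> (map supp as))"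
 unfolding slot_additive_def
 by (auto simp: supp_add supp_finite mext_add)

lemma mext_gens: "(\<forall>d\<in>set ds. tightH d) ==> mext \<phi> (map supp (map gen ds)) = \<phi> ds"
proof -
 assume "\<forall>d\<in>set ds. tightH d"
 then have "map supp (map gen ds) = map (%d. {d}) ds" using supp_gen by simp
 then show ?thesis using mext_singletons by metis
qed

end

section \<open>The induction of Kadeishvili\<close>

definition splits2 :: "'a list => ('a list \<times> 'a list) set" where
 "splits2 as = {(a, b). a @ b = as & a ~= [] & b ~= []}"

text \<open>Blocks of length 1 are left out because the unary operation is zero. With lists instead
  of index ranges, nested splittings are reindexed by concatenation.\<close>

definition splits3 :: "'a list => ('a list \<times> 'a list \<times> 'a list) set" where
 "splits3 as = {(a, b, c). a @ b @ c = as & 2 <= length b}"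

definition proper_splits3 :: "'a list => ('a list \<times> 'a list \<times> 'a list) set" where
 "proper_splits3 as = {(a, b, c). a @ b @ c = as & 2 <= length b & (a ~= [] \<or> c ~= [])}"

definition parts :: "'a list => 'a list set" where
 "parts as = {xs. set xs \<subseteq> set as & length xs <= length as}"

lemma finite_parts [simp]: "finite (parts as)"
 unfolding parts_def by (rule finite_lists_length_le) simp

lemma parts_append [simp]:
 "a \<in> parts (a @ b)" "b \<in> parts (a @ b)" "b \<in> parts (a @ b @ c)" "c \<in> parts (a @ b @ c)"
 by (auto simp: parts_def)

lemma finite_splits [simp]:
 "finite (splits2 as)" "finite (splits3 as)" "finite (proper_splits3 as)"
proof -
 show "finite (splits2 as)"
  by (rule finite_subset[of _ "parts as \<times> parts as"]) (auto simp: splits2_def)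
 show "finite (splits3 as)"
  by (rule finite_subset[of _ "parts as \<times> parts as \<times> parts as"]) (auto simp: splits3_def)
 show "finite (proper_splits3 as)"
  by (rule finite_subset[of _ "parts as \<times> parts as \<times> parts as"]) (auto simp: proper_splits3_def)
qed

lemma splits3_proper: "splits3 as = (if 2 <= length as then insert ([], as, []) (proper_splits3 as) else {})"
 "([], as, []) \<notin> proper_splits3 as"
 by (auto simp: splits3_def proper_splits3_def)

lemma sum_splits2_insert:
 "(\<Sum>(a, b)\<in>splits2 (p @ z # q). g a b) =
  (\<Sum>(a, c)\<in>{(a, c). a @ c = p & a ~= []}. g a (c @ z # q)) +
  (\<Sum>(c, d)\<in>{(c, d). c @ d = q & d ~= []}. g (p @ z # c) d)"
proof -
 let ?A = "{(a, c). a @ c = p & a ~= []}" and ?B = "{(c, d). c @ d = q & d ~= []}"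
 have fin: "finite ?A" "finite ?B"
  by (rule finite_subset[of _ "parts p \<times> parts p"], auto)
   (rule finite_subset[of _ "parts q \<times> parts q"], auto)
 have e: "splits2 (p @ z # q) = (%(a, c). (a, c @ z # q)) ` ?A Un (%(c, d). (p @ z # c, d)) ` ?B"
 proof (intro subset_antisym subsetI)
  fix w assume "w \<in> splits2 (p @ z # q)"
  then obtain a b where w: "w = (a, b)" "a @ b = p @ z # q" "a ~= []" "b ~= []" by (auto simp: splits2_def)
  from w(2) consider us where "a @ us = p" "b = us @ z # q" | us where "a = p @ us" "us @ b = z # q"
   by (auto simp: append_eq_append_conv2)
  then show "w \<in> (%(a, c). (a, c @ z # q)) ` ?A Un (%(c, d). (p @ z # c, d)) ` ?B"
  proof cases
   case (1 us)
   then have "(a, us) \<in> ?A" using w(3) by simp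
   then show ?thesis using w(1) 1 by (intro UnI1 image_eqI[of _ _ "(a, us)"]) auto
  next
   case (2 us)
   show ?thesis
   proof (cases us)
    case Nil
    then have "(p, []) \<in> ?A" "b = z # q" "a = p" using w(3) 2 by simp_all
    then show ?thesis using w(1) by (intro UnI1 image_eqI[of _ _ "(p, [])"]) auto
   next
    case (Cons u us')
    then have "(us', b) \<in> ?B" "u = z" using 2 w(4) by simp_all
    then show ?thesis using w(1) 2 Cons by (intro UnI2 image_eqI[of _ _ "(us', b)"]) auto
   qed
  qed
 qed (auto simp: splits2_def)
 have d: "(%(a, c). (a, c @ z # q)) ` ?A Int (%(c, d). (p @ z # c, d)) ` ?B = {}"
  by (auto dest: arg_cong[of _ _ length])
 have i: "inj_on (%(a, c). (a, c @ z # q)) ?A" "inj_on (%(c, d). (p @ z # c, d)) ?B"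
  by (auto simp: inj_on_def)
 show ?thesis
  unfolding e sum.union_disjoint[OF finite_imageI[OF fin(1)] finite_imageI[OF fin(2)] d]
   sum.reindex[OF i(1)] sum.reindex[OF i(2)]
  by (simp add: case_prod_beta)
qed

text \<open>A block lies left of \<open>z\<close>, right of \<open>z\<close>, or contains it. In the
  last case it contains something else too, having length at least 2.\<close>

lemma sum_splits3_insert:
 "(\<Sum>(a, b, c)\<in>splits3 (p @ z # q). g a b c) =
  (\<Sum>(a, b, c)\<in>splits3 p. g a b (c @ z # q)) + (\<Sum>(a, b, c)\<in>splits3 q. g (p @ z # a) b c) +
  (\<Sum>(a, b, b', c)\<in>{(a, b, b', c). a @ b = p & b' @ c = q & (b ~= [] \<or> b' ~= [])}. g a (b @ z # b') c)"
proof -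
 let ?C = "{(a, b, b', c). a @ b = p & b' @ c = q & (b ~= [] \<or> b' ~= [])}"
 let ?f = "%(a, b, c). (a, b, c @ z # q)" and ?g = "%(a, b, c). (p @ z # a, b, c)"
 let ?h = "%(a, b, b', c). (a, b @ z # b', c)"
 have fin: "finite ?C"
  by (rule finite_subset[of _ "parts p \<times> parts p \<times> parts q \<times> parts q"]) auto
 have e: "splits3 (p @ z # q) = (?f ` splits3 p Un ?g ` splits3 q) Un ?h ` ?C"
 proof (intro subset_antisym subsetI)
  fix w assume "w \<in> splits3 (p @ z # q)"
  then obtain a b c where w: "w = (a, b, c)" "a @ b @ c = p @ z # q" "2 <= length b" by (auto simp: splits3_def)
  from w(2) consider us where "a @ us = p" "b @ c = us @ z # q" | us where "a = p @ us" "us @ b @ c = z # q"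
   by (auto simp: append_eq_append_conv2)
  then show "w \<in> (?f ` splits3 p Un ?g ` splits3 q) Un ?h ` ?C"
  proof cases
   case (1 us)
   from 1(2) consider vs where "b @ vs = us" "c = vs @ z # q" | vs where "b = us @ vs" "vs @ c = z # q"
    by (auto simp: append_eq_append_conv2)
   then show ?thesis
   proof cases
    case (1 vs)
    then have "(a, b, vs) \<in> splits3 p" using \<open>a @ us = p\<close> w(3) by (auto simp: splits3_def)
    then show ?thesis using w(1) 1 by (intro UnI1 image_eqI[of _ _ "(a, b, vs)"]) auto
   next
    case (2 vs)
    show ?thesis
    proof (cases vs)
     case Nil
     then have "(a, b, []) \<in> splits3 p" using \<open>a @ us = p\<close> w(3) 2 by (auto simp: splits3_def)
     then show ?thesis using w(1) 2 Nil by (intro UnI1 image_eqI[of _ _ "(a, b, [])"]) auto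
    next
     case (Cons v vs')
     then have "(a, us, vs', c) \<in> ?C" "v = z" using \<open>a @ us = p\<close> w(3) 2 by auto
     then show ?thesis using w(1) 2 Cons by (intro UnI2 image_eqI[of _ _ "(a, us, vs', c)"]) auto
    qed
   qed
  next
   case (2 us)
   show ?thesis
   proof (cases us)
    case Nil
    then obtain b' where b': "b = z # b'" "b' @ c = q" using 2 w(3) by (cases b) auto
    then have "(p, [], b', c) \<in> ?C" using w(3) by (cases b') auto
    then show ?thesis using w(1) 2 Nil b' by (intro UnI2 image_eqI[of _ _ "(p, [], b', c)"]) auto
   next
    case (Cons u us')
    then have "(us', b, c) \<in> splits3 q" "u = z" using 2 w(3) by (auto simp: splits3_def)
    then show ?thesis using w(1) 2 Cons by (intro UnI1 UnI2 image_eqI[of _ _ "(us', b, c)"]) auto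
   qed
  qed
 next
  fix w assume "w \<in> (?f ` splits3 p Un ?g ` splits3 q) Un ?h ` ?C"
  then show "w \<in> splits3 (p @ z # q)" by (auto simp: splits3_def Suc_le_eq)
 qed
 have d1: "?f ` splits3 p Int ?g ` splits3 q = {}"
  by (auto simp: splits3_def dest!: arg_cong[of _ _ length])
 have d2: "(?f ` splits3 p Un ?g ` splits3 q) Int ?h ` ?C = {}"
 proof -
  have "length a + length b <= length p" if "(a, b, c) \<in> ?f ` splits3 p" for a b c
   using that by (auto simp: splits3_def)
  moreover have "length p < length a" if "(a, b, c) \<in> ?g ` splits3 q" for a b c
   using that by auto
  moreover have "length a <= length p & length p < length a + length b" if "(a, b, c) \<in> ?h ` ?C" for a b c
   using that by auto
  ultimately show ?thesis by (fastforce simp: not_less)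
 qed
 have i: "inj_on ?f (splits3 p)" "inj_on ?g (splits3 q)" by (auto simp: inj_on_def)
 have i3: "inj_on ?h ?C"
 proof (rule inj_onI)
  fix w w' assume *: "w \<in> ?C" "w' \<in> ?C" "?h w = ?h w'"
  obtain a b b' c where w: "w = (a, b, b', c)" by (cases w rule: prod_cases4)
  obtain a1 b1 b1' c1 where w': "w' = (a1, b1, b1', c1)" by (cases w' rule: prod_cases4)
  have "a = a1" "c = c1" "b @ z # b' = b1 @ z # b1'" "a @ b = a1 @ b1" using * by (auto simp: w w')
  then show "w = w'" by (simp add: w w')
 qed
 show ?thesis
  unfolding e sum.union_disjoint[OF finite_UnI[OF finite_imageI finite_imageI] finite_imageI d2, OF finite_splits(2) finite_splits(2) fin]
   sum.union_disjoint[OF finite_imageI finite_imageI d1, OF finite_splits(2) finite_splits(2)]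
   sum.reindex[OF i(1)] sum.reindex[OF i(2)] sum.reindex[OF i3]
  by (simp add: case_prod_beta)
qed

context choices
begin

text \<open>The sum of all terms of the morphism relation other than the differential of the value of \<open>F\<close>.\<close>

definition rel :: "(vec set list => vec set) => (vec set list => vec) => vec set list => vec" where
 "rel X F as = (\<Sum>(a, b)\<in>splits2 as. vec_mult (F a) (F b)) + (\<Sum>(a, b, c)\<in>splits3 as. F (a @ X b # c))"

text \<open>The block consisting of the whole list is excluded; its term is \<open>F [X as]\<close>,
  the difference from \<open>rel\<close>.\<close>

definition U :: "(vec set list => vec set) => (vec set list => vec) => vec set list => vec" where
 "U X F as = (\<Sum>(a, b)\<in>splits2 as. vec_mult (F a) (F b)) + (\<Sum>(a, b, c)\<in>proper_splits3 as. F (a @ X b # c))"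

lemma rel_U: "2 <= length as ==> rel X F as = U X F as + F [X as]"
 unfolding rel_def U_def splits3_proper(1) using splits3_proper(2)[of as] by (simp add: add.assoc add.left_commute)

lemma rel_short: "length as = Suc 0 ==> rel X F as = 0"
proof -
 assume "length as = Suc 0"
 then have "splits2 as = {}" "splits3 as = {}"
  by (cases as; auto simp: splits2_def append_eq_Cons_conv)
   (use \<open>length as = Suc 0\<close> in \<open>auto simp: splits3_def dest!: arg_cong[of _ _ length]\<close>)
 then show ?thesis by (simp add: rel_def)
qed

text \<open>The A-infinity relation on one list. Blocks of length 1 and the whole list are absent
  because the unary operation is zero.\<close>

definition stasheff :: "(vec set list => vec set) => vec set list => vec set" where
 "stasheff X as = finsum (homology Z) (%(a, b, c). X (a @ X b # c)) (proper_splits3 as)"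

lemma slot_additive_finsum:
 assumes "slot_additive n F" "length xs + 1 + length ys = n" "set xs \<subseteq> H" "set ys \<subseteq> H"
  "finite S" "!!i. i \<in> S ==> g i \<in> H"
 shows "F (xs @ finsum (homology Z) g S # ys) = (\<Sum>i\<in>S. F (xs @ g i # ys))"
proof -
 interpret Hr: ring "homology Z" by (rule ring_homology)
 note add = assms(1)[unfolded slot_additive_def, rule_format, OF assms(2-4)]
 show ?thesis using assms(5,6)
 proof (induction S rule: finite_induct)
  case empty
  have "F (xs @ zeroH # ys) = F (xs @ zeroH # ys) + F (xs @ zeroH # ys)"
   using add[of "zeroH" "zeroH"] by simp
  then show ?case by simp
 next
  case (insert i S)
  have "finsum (homology Z) g S \<in> H" using insert.prems by (intro Hr.finsum_closed) auto
  then show ?case using insert add[of "g i" "finsum (homology Z) g S"] by (subst Hr.finsum_insert) auto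
 qed
qed

lemma slot_additive_zero:
 assumes "slot_additive n F" "length xs + 1 + length ys = n" "set xs \<subseteq> H" "set ys \<subseteq> H"
 shows "F (xs @ zeroH # ys) = 0"
proof -
 interpret Hr: ring "homology Z" by (rule ring_homology)
 show ?thesis using slot_additive_finsum[OF assms, of "{}" "%_. zeroH"] by simp
qed

lemma rel_insert:
 "rel X F (p @ x # q) =
  (\<Sum>(a, c)\<in>{(a, c). a @ c = p & a ~= []}. vec_mult (F a) (F (c @ x # q))) +
  (\<Sum>(c, d)\<in>{(c, d). c @ d = q & d ~= []}. vec_mult (F (p @ x # c)) (F d)) +
  ((\<Sum>(a, b, c)\<in>splits3 p. F (a @ X b # c @ x # q)) + (\<Sum>(a, b, c)\<in>splits3 q. F (p @ x # a @ X b # c)) +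
  (\<Sum>(a, b, b', c)\<in>{(a, b, b', c). a @ b = p & b' @ c = q & (b ~= [] \<or> b' ~= [])}. F (a @ X (b @ x # b') # c)))"
 unfolding rel_def sum_splits2_insert sum_splits3_insert by simp

lemma slot_additiveD:
 "slot_additive n F ==> length xs + 1 + length ys = n ==> set xs \<subseteq> H ==> set ys \<subseteq> H ==> a \<in> H ==> b \<in> H ==>
  F (xs @ addH a b # ys) = F (xs @ a # ys) + F (xs @ b # ys)"
 by (simp add: slot_additive_def)

lemma slot_additive_U:
 assumes n: "2 <= n" and F_add: "!!k. 1 <= k ==> k < n ==> slot_additive k F"
  and X_H: "!!bs. 2 <= length bs ==> length bs < n ==> set bs \<subseteq> H ==> X bs \<in> H"
  and X_add: "!!xs a b ys. 2 <= length xs + 1 + length ys ==> length xs + 1 + length ys < n ==>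
   set xs \<subseteq> H ==> set ys \<subseteq> H ==> a \<in> H ==> b \<in> H ==>
   X (xs @ addH a b # ys) = addH (X (xs @ a # ys)) (X (xs @ b # ys))"
 shows "slot_additive n (U X F)"
proof -
 interpret Hr: ring "homology Z" by (rule ring_homology)
 \<comment> \<open>Values of \<open>X\<close> on lists of length \<open>n\<close> do not enter
   \<open>U\<close>, and nothing is assumed about them. With 0 in their place \<open>U\<close>
   becomes \<open>rel\<close>, whose sums split at a marked slot.\<close>
 define Y where "Y bs = (if length bs < n then X bs else zeroH)" for bs
 have Y_H: "Y bs \<in> H" if "2 <= length bs" "set bs \<subseteq> H" for bs
  using X_H[OF that(1) _ that(2)] by (simp add: Y_def)
 have Y_add: "Y (xs @ addH a b # ys) = addH (Y (xs @ a # ys)) (Y (xs @ b # ys))"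
  if "2 <= length xs + 1 + length ys" "set xs \<subseteq> H" "set ys \<subseteq> H" "a \<in> H" "b \<in> H" for xs a b ys
  using X_add[OF that(1) _ that(2-5)] by (simp add: Y_def)
 have e: "U X F as = rel Y F as" if "length as = n" for as
 proof -
  have "U X F as = U Y F as"
   unfolding U_def by (intro arg_cong2[of _ _ _ _ "(+)"] sum.cong refl)
    (use that in \<open>auto simp: proper_splits3_def Y_def\<close>)
  moreover have "F [Y as] = 0"
   using slot_additive_zero[OF F_add[of 1], of "[]" "[]"] n that by (simp add: Y_def)
  ultimately show ?thesis using rel_U[of as Y F] n that by simp
 qed
 show ?thesis
  unfolding slot_additive_def
 proof (intro allI impI)
  fix p q :: "vec set list" and x y
  assume *: "length p + 1 + length q = n" "set p \<subseteq> H" "set q \<subseteq> H" "x \<in> H" "y \<in> H"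
  let ?z = "addH x y"
  have add: "F (xs @ ?z # ys) = F (xs @ x # ys) + F (xs @ y # ys)"
   if "length xs + 1 + length ys < n" "set xs \<subseteq> H" "set ys \<subseteq> H" for xs ys
   using slot_additiveD[OF F_add refl that(2,3) *(4,5)] that(1) by simp
  let ?P = "{(a, c). a @ c = p & a ~= []}" and ?Q = "{(c, d). c @ d = q & d ~= []}"
  let ?R = "{(a, b, b', c). a @ b = p & b' @ c = q & (b ~= [] \<or> b' ~= [])}"
  have 1: "(\<Sum>(a, c)\<in>?P. vec_mult (F a) (F (c @ ?z # q))) =
    (\<Sum>(a, c)\<in>?P. vec_mult (F a) (F (c @ x # q))) + (\<Sum>(a, c)\<in>?P. vec_mult (F a) (F (c @ y # q)))"
   unfolding sum.distrib[symmetric]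
  proof (rule sum.cong[OF refl], clarify)
   fix a c assume "p = a @ c" "a ~= []"
   then have "length c + 1 + length q < n" "set c \<subseteq> H" using * by auto
   from add[OF this *(3)] show "vec_mult (F a) (F (c @ ?z # q)) =
     vec_mult (F a) (F (c @ x # q)) + vec_mult (F a) (F (c @ y # q))"
    by (simp add: vec_mult_add_right)
  qed
  have 2: "(\<Sum>(c, d)\<in>?Q. vec_mult (F (p @ ?z # c)) (F d)) =
    (\<Sum>(c, d)\<in>?Q. vec_mult (F (p @ x # c)) (F d)) + (\<Sum>(c, d)\<in>?Q. vec_mult (F (p @ y # c)) (F d))"
   unfolding sum.distrib[symmetric]
  proof (rule sum.cong[OF refl], clarify)
   fix c d assume "q = c @ d" "d ~= []"
   then have "length p + 1 + length c < n" "set c \<subseteq> H" using * by auto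
   from add[OF this(1) *(2) this(2)] show "vec_mult (F (p @ ?z # c)) (F d) =
     vec_mult (F (p @ x # c)) (F d) + vec_mult (F (p @ y # c)) (F d)"
    by (simp add: vec_mult_add_left)
  qed
  have 3: "(\<Sum>(a, b, c)\<in>splits3 p. F (a @ Y b # c @ ?z # q)) =
    (\<Sum>(a, b, c)\<in>splits3 p. F (a @ Y b # c @ x # q)) + (\<Sum>(a, b, c)\<in>splits3 p. F (a @ Y b # c @ y # q))"
   unfolding sum.distrib[symmetric]
  proof (rule sum.cong[OF refl], clarify)
   fix a b c assume "(a, b, c) \<in> splits3 p"
   then have p: "p = a @ b @ c" "2 <= length b" by (auto simp: splits3_def)
   then have "set (a @ Y b # c) \<subseteq> H" "length (a @ Y b # c) + 1 + length q < n" using * Y_H by auto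
   from add[OF this(2,1) *(3)] show "F (a @ Y b # c @ ?z # q) = F (a @ Y b # c @ x # q) + F (a @ Y b # c @ y # q)"
    by simp
  qed
  have 4: "(\<Sum>(a, b, c)\<in>splits3 q. F (p @ ?z # a @ Y b # c)) =
    (\<Sum>(a, b, c)\<in>splits3 q. F (p @ x # a @ Y b # c)) + (\<Sum>(a, b, c)\<in>splits3 q. F (p @ y # a @ Y b # c))"
   unfolding sum.distrib[symmetric]
  proof (rule sum.cong[OF refl], clarify)
   fix a b c assume "(a, b, c) \<in> splits3 q"
   then have q: "q = a @ b @ c" "2 <= length b" by (auto simp: splits3_def)
   then have "set (a @ Y b # c) \<subseteq> H" "length p + 1 + length (a @ Y b # c) < n" using * Y_H by auto
   from add[OF this(2) *(2) this(1)] show "F (p @ ?z # a @ Y b # c) = F (p @ x # a @ Y b # c) + F (p @ y # a @ Y b # c)"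
    by simp
  qed
  have 5: "(\<Sum>(a, b, b', c)\<in>?R. F (a @ Y (b @ ?z # b') # c)) =
    (\<Sum>(a, b, b', c)\<in>?R. F (a @ Y (b @ x # b') # c)) + (\<Sum>(a, b, b', c)\<in>?R. F (a @ Y (b @ y # b') # c))"
   unfolding sum.distrib[symmetric]
  proof (rule sum.cong[OF refl], clarify)
   fix a b b' c assume R: "p = a @ b" "q = b' @ c" "b ~= [] \<or> b' ~= []"
   have s: "set a \<subseteq> H" "set b \<subseteq> H" "set b' \<subseteq> H" "set c \<subseteq> H" using *(2,3) unfolding R(1,2) by auto
   have l: "2 <= length b + 1 + length b'" using R(3) by (cases b; cases b') auto
   have l': "length a + 1 + length c < n" using l *(1) unfolding R(1,2) length_append by linarith
   have "Y (b @ x # b') \<in> H" "Y (b @ y # b') \<in> H" using Y_H[of "b @ x # b'"] Y_H[of "b @ y # b'"] l s *(4,5) by auto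
   then show "F (a @ Y (b @ ?z # b') # c) = F (a @ Y (b @ x # b') # c) + F (a @ Y (b @ y # b') # c)"
    unfolding Y_add[OF l s(2,3) *(4,5)] using slot_additiveD[OF F_add refl s(1,4)] l' by simp
  qed
  have "rel Y F (p @ ?z # q) = rel Y F (p @ x # q) + rel Y F (p @ y # q)"
   unfolding rel_insert 1 2 3 4 5 by (simp only: add.assoc add.left_commute add.commute)
  then show "U X F (p @ ?z # q) = U X F (p @ x # q) + U X F (p @ y # q)" using e *(1) by simp
 qed
qed

section \<open>The differential of U\<close>

context
 fixes X :: "vec set list => vec set" and F :: "vec set list => vec" and as :: "vec set list"
 assumes len: "2 <= length as" and asH: "set as \<subseteq> H"
  and F_inA: "!!bs. bs ~= [] ==> length bs < length as ==> set bs \<subseteq> H ==> inA (F bs)"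
  and X_H: "!!bs. 2 <= length bs ==> length bs < length as ==> set bs \<subseteq> H ==> X bs \<in> H"
  and F_add: "!!n. 1 <= n ==> n < length as ==> slot_additive n F"
  and F_rel: "!!bs. bs ~= [] ==> length bs < length as ==> set bs \<subseteq> H ==> vec_diff (F bs) = rel X F bs"
  and X_rel: "!!bs. bs ~= [] ==> length bs < length as ==> set bs \<subseteq> H ==> stasheff X bs = zeroH"
begin

abbreviation (input) "m x y \<equiv> vec_mult x y"

lemma U_inA: "inA (U X F as)"
 unfolding U_def
proof (intro inA_add inA_sum)
 fix w assume "w \<in> splits2 as"
 then obtain a b where w: "w = (a, b)" "a @ b = as" "a ~= []" "b ~= []" by (auto simp: splits2_def)
 then show "inA (case w of (a, b) => m (F a) (F b))"
  using F_inA[of a] F_inA[of b] inA_vec_mult asH by auto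
next
 fix w assume "w \<in> proper_splits3 as"
 then obtain a b c where w: "w = (a, b, c)" "a @ b @ c = as" "2 <= length b" "a ~= [] \<or> c ~= []"
  by (auto simp: proper_splits3_def)
 then have "length b < length as" "set (a @ X b # c) \<subseteq> H" "length (a @ X b # c) < length as"
  using X_H[of b] asH by (auto simp flip: w(2))
 then show "inA (case w of (a, b, c) => F (a @ X b # c))" using w(1) F_inA by simp
qed

lemma vec_mult_rel_left:
 "m (rel X F a) y = (\<Sum>(c, d)\<in>splits2 a. m (m (F c) (F d)) y) + (\<Sum>(p, z, q)\<in>splits3 a. m (F (p @ X z # q)) y)"
 unfolding rel_def vec_mult_add_left vec_mult_sum_left by (simp add: case_prod_beta)

lemma vec_mult_rel_right:
 "m y (rel X F a) = (\<Sum>(c, d)\<in>splits2 a. m y (m (F c) (F d))) + (\<Sum>(p, z, q)\<in>splits3 a. m y (F (p @ X z # q)))"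
 unfolding rel_def vec_mult_add_right vec_mult_sum_right by (simp add: case_prod_beta)

text \<open>Differentiate term by term and insert the relations for shorter lists. All terms cancel
  in pairs except those with nested blocks, which assemble into values of \<open>F\<close> at lists
  containing the A-infinity relation of a block.\<close>

lemma vec_diff_U: "vec_diff (U X F as) = F [stasheff X as]"
proof -
 interpret Hr: ring "homology Z" by (rule ring_homology)
 let ?S2 = "splits2 as" and ?S3 = "proper_splits3 as"
 have S2: "a ~= [] & b ~= [] & length a < length as & length b < length as & set a \<subseteq> H & set b \<subseteq> H"
  if "(a, b) \<in> ?S2" for a b
  using that asH by (auto simp: splits2_def)
 have S3: "length (p @ X z # q) < length as & set (p @ X z # q) \<subseteq> H" if "(p, z, q) \<in> ?S3" for p z q
 proof -
  have z: "p @ z @ q = as" "2 <= length z" "length z < length as" using that by (auto simp: proper_splits3_def)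
  then show ?thesis using X_H[of z] asH by (auto simp flip: z(1))
 qed
 have "vec_diff (U X F as) = (\<Sum>(a, b)\<in>?S2. m (rel X F a) (F b)) + (\<Sum>(a, b)\<in>?S2. m (F a) (rel X F b)) +
   (\<Sum>(p, z, q)\<in>?S3. rel X F (p @ X z # q))"
 proof -
  have "(\<Sum>(a, b)\<in>?S2. vec_diff (m (F a) (F b))) = (\<Sum>(a, b)\<in>?S2. m (rel X F a) (F b) + m (F a) (rel X F b))"
  proof (rule sum.cong[OF refl], clarify)
   fix a b assume "(a, b) \<in> ?S2"
   then show "vec_diff (m (F a) (F b)) = m (rel X F a) (F b) + m (F a) (rel X F b)"
    using S2 vec_diff_mult F_inA F_rel by metis
  qed
  moreover have "(\<Sum>(p, z, q)\<in>?S3. vec_diff (F (p @ X z # q))) = (\<Sum>(p, z, q)\<in>?S3. rel X F (p @ X z # q))"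
   using S3 F_rel by (intro sum.cong) auto
  ultimately show ?thesis
   unfolding U_def vec_diff_add vec_diff_sum by (simp add: case_prod_beta sum.distrib)
 qed
 also have "(\<Sum>(a, b)\<in>?S2. m (rel X F a) (F b)) =
   (\<Sum>(a, b)\<in>?S2. \<Sum>(c, d)\<in>splits2 a. m (m (F c) (F d)) (F b)) +
   (\<Sum>(a, b)\<in>?S2. \<Sum>(p, z, q)\<in>splits3 a. m (F (p @ X z # q)) (F b))" (is "_ = ?A1 + ?B1")
  unfolding vec_mult_rel_left by (simp add: case_prod_beta sum.distrib)
 also have "(\<Sum>(a, b)\<in>?S2. m (F a) (rel X F b)) =
   (\<Sum>(a, b)\<in>?S2. \<Sum>(c, d)\<in>splits2 b. m (F a) (m (F c) (F d))) +
   (\<Sum>(a, b)\<in>?S2. \<Sum>(p, z, q)\<in>splits3 b. m (F a) (F (p @ X z # q)))" (is "_ = ?A2 + ?B2")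
  unfolding vec_mult_rel_right by (simp add: case_prod_beta sum.distrib)
 also have "(\<Sum>(p, z, q)\<in>?S3. rel X F (p @ X z # q)) =
   (\<Sum>(p, z, q)\<in>?S3. \<Sum>(a, c)\<in>{(a, c). a @ c = p & a ~= []}. m (F a) (F (c @ X z # q))) +
   (\<Sum>(p, z, q)\<in>?S3. \<Sum>(c, d)\<in>{(c, d). c @ d = q & d ~= []}. m (F (p @ X z # c)) (F d)) +
   ((\<Sum>(p, z, q)\<in>?S3. \<Sum>(a, b, c)\<in>splits3 p. F (a @ X b # c @ X z # q)) +
   (\<Sum>(p, z, q)\<in>?S3. \<Sum>(a, b, c)\<in>splits3 q. F (p @ X z # a @ X b # c)) +
   (\<Sum>(p, z, q)\<in>?S3. \<Sum>(a, b, b', c)\<in>{(a, b, b', c). a @ b = p & b' @ c = q & (b ~= [] \<or> b' ~= [])}.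
     F (a @ X (b @ X z # b') # c)))" (is "_ = ?B3 + ?B4 + (?C1 + ?C2 + ?E)")
  unfolding rel_insert by (simp add: case_prod_beta sum.distrib)
 \<comment> \<open>Three factors bracketed in two ways.\<close>
 also have "?A1 = ?A2"
 proof -
  have "?A1 = (\<Sum>w\<in>(SIGMA w:?S2. splits2 (fst w)). m (m (F (fst (snd w))) (F (snd (snd w)))) (F (snd (fst w))))"
   by (simp add: sum.Sigma case_prod_beta)
  also have "... = (\<Sum>w\<in>(SIGMA w:?S2. splits2 (snd w)). m (F (fst (fst w))) (m (F (fst (snd w))) (F (snd (snd w)))))"
  proof (rule sum.reindex_bij_witness[where i = "%((a, b), (c, d)). ((a @ c, d), (a, c))"
     and j = "%((a, b), (c, d)). ((c, d @ b), (d, b))"], goal_cases)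
   case (5 w)
   obtain a b c d where w: "w = ((a, b), (c, d))" by (metis surj_pair)
   have i: "(a, b) \<in> ?S2" "c @ d = a" "c ~= []" "d ~= []" using 5 by (auto simp: w splits2_def)
   then have "inA (F c)" "inA (F d)" "inA (F b)"
    using S2[OF i(1)] F_inA[of c] F_inA[of d] F_inA[of b] by auto
   then show ?case using vec_mult_assoc inA_braids by (simp add: w)
  qed (auto simp: splits2_def)
  also have "... = ?A2" by (simp add: sum.Sigma case_prod_beta)
  finally show ?thesis .
 qed
 \<comment> \<open>A block in the left factor, found either by cutting the list first or by choosing
   the block first. The right factor is treated alike below.\<close>
 also have "?B1 = ?B4"
 proof -
  have fin: "finite {(c, d). c @ d = q & d ~= []}" for q :: "vec set list"
   by (rule finite_subset[of _ "parts q \<times> parts q"]) auto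
  have "?B1 = (\<Sum>w\<in>(SIGMA w:?S2. splits3 (fst w)). m (F (fst (snd w) @ X (fst (snd (snd w))) # snd (snd (snd w)))) (F (snd (fst w))))"
   by (simp add: sum.Sigma case_prod_beta)
  also have "... = (\<Sum>w\<in>(SIGMA w:?S3. {(c, d). c @ d = snd (snd w) & d ~= []}).
    m (F (fst (fst w) @ X (fst (snd (fst w))) # fst (snd w))) (F (snd (snd w))))"
   by (rule sum.reindex_bij_witness[where i = "%((p, z, q), (c, d)). ((p @ z @ c, d), (p, z, c))"
     and j = "%((a, b), (p, z, q)). ((p, z, q @ b), (q, b))"])
    (auto simp: splits2_def splits3_def proper_splits3_def)
  also have "... = ?B4" using fin by (simp add: sum.Sigma case_prod_beta)
  finally show ?thesis .
 qed
 also have "?B2 = ?B3"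
 proof -
  have fin: "finite {(a, c). a @ c = p & a ~= []}" for p :: "vec set list"
   by (rule finite_subset[of _ "parts p \<times> parts p"]) auto
  have "?B2 = (\<Sum>w\<in>(SIGMA w:?S2. splits3 (snd w)). m (F (fst (fst w))) (F (fst (snd w) @ X (fst (snd (snd w))) # snd (snd (snd w)))))"
   by (simp add: sum.Sigma case_prod_beta)
  also have "... = (\<Sum>w\<in>(SIGMA w:?S3. {(a, c). a @ c = fst w & a ~= []}).
    m (F (fst (snd w))) (F (snd (snd w) @ X (fst (snd (fst w))) # snd (snd (fst w)))))"
   by (rule sum.reindex_bij_witness[where i = "%((p, z, q), (a, c)). ((a, c @ z @ q), (c, z, q))"
     and j = "%((a, b), (p, z, q)). ((a @ p, z, q), (a, p))"])
    (auto simp: splits2_def splits3_def proper_splits3_def)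
  also have "... = ?B3" using fin by (simp add: sum.Sigma case_prod_beta)
  finally show ?thesis .
 qed
 \<comment> \<open>Two disjoint blocks, chosen in either order.\<close>
 also have "?C1 = ?C2"
 proof -
  have "?C1 = (\<Sum>w\<in>(SIGMA w:?S3. splits3 (fst w)). F (fst (snd w) @ X (fst (snd (snd w))) # snd (snd (snd w)) @
    X (fst (snd (fst w))) # snd (snd (fst w))))"
   by (simp add: sum.Sigma case_prod_beta)
  also have "... = (\<Sum>w\<in>(SIGMA w:?S3. splits3 (snd (snd w))). F (fst (fst w) @ X (fst (snd (fst w))) # fst (snd w) @
    X (fst (snd (snd w))) # snd (snd (snd w))))"
   by (rule sum.reindex_bij_witness[where i = "%((p, z, q), (a, b, c)). ((p @ z @ a, b, c), (p, z, a))"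
     and j = "%((p, z, q), (a, b, c)). ((a, b, c @ z @ q), (c, z, q))"])
    (auto simp: splits3_def proper_splits3_def)
  also have "... = ?C2" by (simp add: sum.Sigma case_prod_beta)
  finally show ?thesis .
 qed
 finally have "vec_diff (U X F as) = ?E" by (simp add: add.assoc add.left_commute add.commute)
 \<comment> \<open>A block inside a block: summing over the outer one first, it may be the whole
   list, while the inner one is proper in it.\<close>
 also have "?E = (\<Sum>(a, z, c)\<in>splits3 as. \<Sum>(b, y, b')\<in>proper_splits3 z. F (a @ X (b @ X y # b') # c))"
 proof -
  have fin: "finite {(a, b, b', c). a @ b = p & b' @ c = q & (b ~= [] \<or> b' ~= [])}" for p q :: "vec set list"
   by (rule finite_subset[of _ "parts p \<times> parts p \<times> parts q \<times> parts q"]) auto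
  have "?E = (\<Sum>w\<in>(SIGMA w:?S3. {(a, b, b', c). a @ b = fst w & b' @ c = snd (snd w) & (b ~= [] \<or> b' ~= [])}).
    F (fst (snd w) @ X (fst (snd (snd w)) @ X (fst (snd (fst w))) # fst (snd (snd (snd w)))) # snd (snd (snd (snd w)))))"
   using fin by (simp add: sum.Sigma case_prod_beta)
  also have "... = (\<Sum>w\<in>(SIGMA w:splits3 as. proper_splits3 (fst (snd w))).
    F (fst (fst w) @ X (fst (snd w) @ X (fst (snd (snd w))) # snd (snd (snd w))) # snd (snd (fst w))))"
   by (rule sum.reindex_bij_witness[where i = "%((a, z, c), (b, y, b')). ((a @ b, y, b' @ c), (a, b, b', c))"
     and j = "%((p, y, q), (a, b, b', c)). ((a, b @ y @ b', c), (b, y, b'))"])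
    (auto simp: splits3_def proper_splits3_def)
  also have "... = (\<Sum>(a, z, c)\<in>splits3 as. \<Sum>(b, y, b')\<in>proper_splits3 z. F (a @ X (b @ X y # b') # c))"
   by (simp add: sum.Sigma case_prod_beta)
  finally show ?thesis .
 qed
 also have "... = (\<Sum>(a, z, c)\<in>splits3 as. F (a @ stasheff X z # c))"
 proof (rule sum.cong[OF refl], clarify)
  fix a z c assume "(a, z, c) \<in> splits3 as"
  then have azc: "a @ z @ c = as" "2 <= length z" by (auto simp: splits3_def)
  have g: "X (b @ X y # b') \<in> H" if "(b, y, b') \<in> proper_splits3 z" for b y b'
  proof -
   have by': "b @ y @ b' = z" "2 <= length y" "b ~= [] \<or> b' ~= []" using that by (auto simp: proper_splits3_def)
   have l: "length y < length as" using by' azc by (auto simp flip: azc(1) by'(1))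
   have "X y \<in> H" using X_H[OF by'(2) l] asH by (auto simp flip: azc(1) by'(1))
   moreover have "2 <= length (b @ X y # b')" "length (b @ X y # b') < length as"
    using by' azc by (auto simp flip: azc(1) by'(1) simp: Suc_le_eq)
   ultimately show ?thesis using X_H[of "b @ X y # b'"] asH by (auto simp flip: azc(1) by'(1))
  qed
  have ac: "set a \<subseteq> H" "set c \<subseteq> H" using asH unfolding azc(1)[symmetric] by auto
  have l: "length a + length z + length c = length as" unfolding azc(1)[symmetric] by simp
  have "F (a @ stasheff X z # c) = (\<Sum>i\<in>proper_splits3 z. F (a @ (case i of (b, y, b') => X (b @ X y # b')) # c))"
   unfolding stasheff_def
  proof (rule slot_additive_finsum[OF F_add refl ac finite_splits(3)])
   show "(case i of (b, y, b') => X (b @ X y # b')) \<in> H" if "i \<in> proper_splits3 z" for i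
    using g that by (cases i) simp
  qed (use l azc(2) in linarith)+
  then show "(\<Sum>(b, y, b')\<in>proper_splits3 z. F (a @ X (b @ X y # b') # c)) = F (a @ stasheff X z # c)"
   by (simp add: case_prod_beta)
 qed
 also have "... = F [stasheff X as] + (\<Sum>(a, z, c)\<in>proper_splits3 as. F (a @ stasheff X z # c))"
  unfolding splits3_proper(1) using len splits3_proper(2)[of as] by simp
 \<comment> \<open>On a shorter block the A-infinity relation is already known, so only the block
   that is the whole list contributes.\<close>
 also have "(\<Sum>(a, z, c)\<in>proper_splits3 as. F (a @ stasheff X z # c)) = 0"
 proof (rule sum.neutral, clarify)
  fix a z c assume "(a, z, c) \<in> proper_splits3 as"
  then have azc: "a @ z @ c = as" "2 <= length z" "length z < length as" by (auto simp: proper_splits3_def)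
  have sets: "set a \<subseteq> H" "set z \<subseteq> H" "set c \<subseteq> H" using asH unfolding azc(1)[symmetric] by auto
  have l: "length a + length z + length c = length as" unfolding azc(1)[symmetric] by simp
  have "z ~= []" using azc(2) by auto
  have st: "stasheff X z = zeroH" by (rule X_rel[OF \<open>z ~= []\<close> azc(3) sets(2)])
  have "1 <= length a + 1 + length c" "length a + 1 + length c < length as" using l azc(2) by linarith+
  then show "F (a @ stasheff X z # c) = 0"
   unfolding st by (rule slot_additive_zero[OF F_add refl sets(1,3)])
 qed
 finally show ?thesis by simp
qed

end

end

section \<open>Operations indexed by positions\<close>

lemma take_take_drop [simp]: "take k as @ take j (drop k as) @ drop (k + j) as = as"
 by (metis append_take_drop_id drop_drop add.commute)

lemma splits_bij:
 "bij_betw (%j. (take j as, drop j as)) {1..length as - 1} (splits2 as)"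
 "bij_betw (%(j, k). (take k as, take j (drop k as), drop (k + j) as))
  {(j, k). 2 <= j & j <= length as - 1 & k <= length as - j} (proper_splits3 as)"
 "bij_betw (%(i, j, k). (take i as, take j (drop i as), drop (i + j) as))
  {(i, j, k). i + j + k = length as & 2 <= j} (splits3 as)"
proof -
 show "bij_betw (%j. (take j as, drop j as)) {1..length as - 1} (splits2 as)"
  by (rule bij_betw_byWitness[where f' = "%(a, b). length a"])
   (auto simp: splits2_def Suc_le_eq min_def, auto simp: neq_Nil_conv)
 show "bij_betw (%(j, k). (take k as, take j (drop k as), drop (k + j) as))
  {(j, k). 2 <= j & j <= length as - 1 & k <= length as - j} (proper_splits3 as)"
  by (rule bij_betw_byWitness[where f' = "%(a, b, c). (length b, length a)"])
   (auto simp: proper_splits3_def Suc_le_eq min_def, auto simp: neq_Nil_conv)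
 show "bij_betw (%(i, j, k). (take i as, take j (drop i as), drop (i + j) as))
  {(i, j, k). i + j + k = length as & 2 <= j} (splits3 as)"
  by (rule bij_betw_byWitness[where f' = "%(a, b, c). (length a, length b, length c)"])
   (auto simp: splits3_def min_def)
qed

lemma (in abelian_monoid) finsum_index_splits:
 assumes n: "n = length as" and closed: "!!a b c. a @ b @ c = as ==> b ~= [] ==> g a b c \<in> carrier G"
  and one: "!!a x c. a @ [x] @ c = as ==> g a [x] c = \<zero>"
 shows "finsum G (%(i, j, k). g (take i as) (take j (drop i as)) (drop (i + j) as)) {(i, j, k). i + j + k = n & 1 <= j} =
  finsum G (%(a, b, c). g a b c) (splits3 as)"
proof -
 let ?S = "{(i, j, k). i + j + k = n & 1 <= j}" and ?T = "{(i, j, k). i + j + k = length as & 2 <= j}"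
 let ?g = "%(i, j, k :: nat). g (take i as) (take j (drop i as)) (drop (i + j) as)"
 let ?h = "%(i, j, k :: nat). (take i as, take j (drop i as), drop (i + j) as)"
 have cl: "?g w \<in> carrier G" if "w \<in> ?S" for w
  using that n by (auto intro!: closed)
 have "finite ?S"
  by (rule finite_subset[of _ "{..n} \<times> {..n} \<times> {..n}"]) auto
 then have "finsum G ?g ?S = finsum G ?g ?T"
 proof (rule add.finprod_mono_neutral_cong_right)
  fix w assume "w \<in> ?S - ?T"
  then obtain i j k where w: "w = (i, j, k)" "i + j + k = n" "j = 1" using n by (cases w) auto
  then obtain x where x: "take j (drop i as) = [x]" using n by (cases "drop i as") auto
  then show "?g w = \<zero>" using one[of "take i as" x "drop (i + j) as"] take_take_drop[of i as j] w(1) by simp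
 qed (use n cl in auto)
 also have "... = finsum G (%(a, b, c). g a b c) (?h ` ?T)"
 proof (subst finsum_reindex)
  show "inj_on ?h ?T" using splits_bij(3) by (rule bij_betw_imp_inj_on)
  show "finsum G ?g ?T = finsum G (%x. case ?h x of (a, b, c) => g a b c) ?T"
   by (rule arg_cong[of _ _ "%g. finsum G g ?T"]) (auto simp: fun_eq_iff)
  show "(%(a, b, c). g a b c) \<in> ?h ` ?T \<rightarrow> carrier G"
   unfolding bij_betw_imp_surj_on[OF splits_bij(3)] by (auto simp: splits3_def intro!: closed)
 qed
 finally show ?thesis unfolding bij_betw_imp_surj_on[OF splits_bij(3)] .
qed

lemma multilinear_iff:
 "multilinear n G B F \<longleftrightarrow> (\<forall>as. length as = n --> set as \<subseteq> carrier G --> F as \<in> carrier B) &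
  (\<forall>xs a b ys. length xs + 1 + length ys = n --> set xs \<subseteq> carrier G --> set ys \<subseteq> carrier G -->
   a \<in> carrier G --> b \<in> carrier G --> F (xs @ add G a b # ys) = add B (F (xs @ a # ys)) (F (xs @ b # ys)))"
 (is "?L \<longleftrightarrow> ?C & ?R")
proof
 assume L: ?L
 have "F (xs @ add G a b # ys) = add B (F (xs @ a # ys)) (F (xs @ b # ys))"
  if "length xs + 1 + length ys = n" "set xs \<subseteq> carrier G" "set ys \<subseteq> carrier G" "a \<in> carrier G" "b \<in> carrier G" for xs a b ys
  using L[unfolded multilinear_def, rule_format, of "xs @ a # ys", THEN conjunct2, rule_format, of "length xs" b] that
  by simp
 then show "?C & ?R" using L by (simp add: multilinear_def)
next
 assume R: "?C & ?R"
 have "F (as[i := add G (as ! i) b]) = add B (F as) (F (as[i := b]))"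
  if "length as = n" "set as \<subseteq> carrier G" "i < n" "b \<in> carrier G" for as i b
 proof -
  have "set (take i as) \<subseteq> carrier G" "set (drop (Suc i) as) \<subseteq> carrier G" "as ! i \<in> carrier G"
   using that by (auto dest: in_set_takeD in_set_dropD)
  moreover have "as = take i as @ as ! i # drop (Suc i) as" using that by (simp add: id_take_nth_drop)
  ultimately show ?thesis using R that by (simp add: upd_conv_take_nth_drop)
 qed
 then show ?L using R by (auto simp: multilinear_def)
qed

context choices
begin

lemma finsum_strand_alg: "(!!i. i \<in> S ==> inA (g i)) ==> finsum (strand_alg Z) g S = sum g S"
proof (induction S rule: infinite_finite_induct)
 interpret A: ring "strand_alg Z" by (rule ring_strand_alg)
 { case (infinite S) then show ?case by (simp add: A.finsum_infinite) }
 { case empty then show ?case by simp }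
 { case (insert i S) then show ?case by (subst A.finsum_insert) (auto simp: carrier_strand_alg) }
qed

text \<open>A family of operations becomes one function on lists, the arity being the length of the
  argument.\<close>

abbreviation at_length :: "(nat => 'e list => 'c) => 'e list => 'c" ("_\<sharp>" [1000] 1000) where
 "f\<sharp> \<equiv> %as. f (length as) as"

lemma minus_strand_alg: "inA x ==> inA y ==> x \<ominus>\<^bsub>strand_alg Z\<^esub> y = x + y"
proof -
 assume *: "inA x" "inA y"
 interpret A: ring "strand_alg Z" by (rule ring_strand_alg)
 have "\<ominus>\<^bsub>strand_alg Z\<^esub> y = y"
  by (rule A.minus_equality) (use * in \<open>auto simp: carrier_strand_alg add_self\<close>)
 then show ?thesis by (simp add: A.minus_eq)
qed

lemma insert_op_at_length:
 assumes "i + j + k = length as"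
 shows "g (i + 1 + k) (insert_op X i j as) = g\<sharp> (take i as @ X\<sharp> (take j (drop i as)) # drop (i + j) as)"
proof -
 have l: "length (take j (drop i as)) = j" "length (take i as @ x # drop (i + j) as) = i + 1 + k" for x
  using assms by auto
 show ?thesis unfolding insert_op_def l by simp
qed

context
 fixes X :: "nat => vec set list => vec set" and f :: "nat => vec set list => vec" and as :: "vec set list" and n :: nat
 assumes len: "length as = n" and asH: "set as \<subseteq> H"
  and f_inA: "!!bs. bs ~= [] ==> length bs <= n ==> set bs \<subseteq> H ==> inA (f\<sharp> bs)"
  and X_H: "!!bs. bs ~= [] ==> length bs <= n ==> set bs \<subseteq> H ==> X\<sharp> bs \<in> H"
begin

lemma split3_closed:
 assumes "a @ b @ c = as" "b ~= []"
 shows "set (a @ X\<sharp> b # c) \<subseteq> H" "length (a @ X\<sharp> b # c) <= n"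
proof -
 have "X\<sharp> b \<in> H" using X_H[of b] assms len asH by (auto simp flip: assms(1))
 then show "set (a @ X\<sharp> b # c) \<subseteq> H" using asH assms(1) by auto
 show "length (a @ X\<sharp> b # c) <= n" unfolding len[symmetric] assms(1)[symmetric] using assms(2) by (cases b) auto
qed

lemma products_index:
 "finsum (strand_alg Z) (%i. f i (take i as) \<otimes>\<^bsub>strand_alg Z\<^esub> f (n - i) (drop i as)) {1..n - 1} =
  (\<Sum>(a, b)\<in>splits2 as. vec_mult (f\<sharp> a) (f\<sharp> b))"
proof -
 have "(\<Sum>(a, b)\<in>splits2 as. vec_mult (f\<sharp> a) (f\<sharp> b)) = (\<Sum>i\<in>{1..n - 1}. vec_mult (f i (take i as)) (f (n - i) (drop i as)))"
  unfolding sum.reindex_bij_betw[OF splits_bij(1), symmetric] len by (intro sum.cong) (auto simp: len min_def)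
 moreover have "inA (vec_mult (f i (take i as)) (f (n - i) (drop i as)))" if "i \<in> {1..n - 1}" for i
 proof -
  have l: "length (take i as) = i" "length (drop i as) = n - i" using that len by auto
  have "take i as ~= []" "drop i as ~= []" "i <= n" using that len by auto
  moreover have "set (take i as) \<subseteq> H" "set (drop i as) \<subseteq> H"
   using asH by (auto dest: in_set_takeD in_set_dropD)
  ultimately show ?thesis using f_inA[of "take i as"] f_inA[of "drop i as"] unfolding l by (intro inA_vec_mult) auto
 qed
 ultimately show ?thesis by (simp only: strand_alg_simps finsum_strand_alg)
qed

lemma U_op_eq: "U_op (strand_alg Z) X f n as = U X\<sharp> f\<sharp> as"
proof -
 let ?I = "{(j, k). 2 <= j & j <= n - 1 & k <= n - j}"
 have e: "f (n - j + 1) (insert_op X k j as) = f\<sharp> (take k as @ X\<sharp> (take j (drop k as)) # drop (k + j) as)"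
  if "(j, k) \<in> ?I" for j k
  using insert_op_at_length[of k j "n - j - k" as f X] that len by (auto simp: Suc_diff_le)
 have "(\<Sum>(a, b, c)\<in>proper_splits3 as. f\<sharp> (a @ X\<sharp> b # c)) =
   (\<Sum>(j, k)\<in>?I. f\<sharp> (take k as @ X\<sharp> (take j (drop k as)) # drop (k + j) as))"
  unfolding sum.reindex_bij_betw[OF splits_bij(2), symmetric] len by (intro sum.cong) auto
 also have "... = (\<Sum>(j, k)\<in>?I. f (n - j + 1) (insert_op X k j as))"
  by (intro sum.cong refl) (use e in auto)
 also have "... = finsum (strand_alg Z) (%(j, k). f (n - j + 1) (insert_op X k j as)) ?I"
 proof (rule finsum_strand_alg[symmetric], clarify)
  fix j k assume jk: "2 <= j" "j <= n - 1" "k <= n - j"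
  then have "take j (drop k as) ~= []" using len by auto
  have "inA (f\<sharp> (take k as @ X\<sharp> (take j (drop k as)) # drop (k + j) as))"
   by (rule f_inA) (use split3_closed[OF take_take_drop \<open>take j (drop k as) ~= []\<close>] in simp_all)
  then show "inA (f (n - j + 1) (insert_op X k j as))" using e[of j k] jk by simp
 qed
 finally show ?thesis unfolding U_op_def U_def products_index by simp
qed

lemma insertions_index:
 assumes "slot_additive n f\<sharp>" "!!x. x \<in> H ==> X 1 [x] = zeroH"
 shows "finsum (strand_alg Z) (%(i, j, k). f (i + 1 + k) (insert_op X i j as)) {(i, j, k). i + j + k = n & 1 <= j} =
  (\<Sum>(a, b, c)\<in>splits3 as. f\<sharp> (a @ X\<sharp> b # c))"
proof -
 interpret A: ring "strand_alg Z" by (rule ring_strand_alg)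
 have cl: "inA (f\<sharp> (a @ X\<sharp> b # c))" if "a @ b @ c = as" "b ~= []" for a b c
  using f_inA split3_closed[OF that] by blast
 have "finsum (strand_alg Z) (%(i, j, k). f (i + 1 + k) (insert_op X i j as)) {(i, j, k). i + j + k = n & 1 <= j} =
   finsum (strand_alg Z) (%(i, j, k). f\<sharp> (take i as @ X\<sharp> (take j (drop i as)) # drop (i + j) as))
    {(i, j, k). i + j + k = n & 1 <= j}"
 proof (rule A.finsum_cong'[OF refl])
  show "(%(i, j, k). f\<sharp> (take i as @ X\<sharp> (take j (drop i as)) # drop (i + j) as)) \<in>
    {(i, j, k). i + j + k = n & 1 <= j} \<rightarrow> carrier (strand_alg Z)"
  proof clarify
   fix i j k assume "n = i + j + k" "1 <= j"
   then have "take j (drop i as) ~= []" using len by auto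
   from cl[OF take_take_drop this]
   show "f\<sharp> (take i as @ X\<sharp> (take j (drop i as)) # drop (i + j) as) \<in> carrier (strand_alg Z)"
    by (simp add: carrier_strand_alg)
  qed
 qed (simp only: split_paired_all case_prod_conv mem_Collect_eq insert_op_at_length[of _ _ _ as, unfolded len])
 also have "... = finsum (strand_alg Z) (%(a, b, c). f\<sharp> (a @ X\<sharp> b # c)) (splits3 as)"
 proof (rule A.finsum_index_splits[OF len[symmetric]])
  fix a x c assume as: "a @ [x] @ c = as"
  then have "X\<sharp> [x] = zeroH" "set a \<subseteq> H" "set c \<subseteq> H" "length a + 1 + length c = n"
   using assms(2)[of x] asH len by auto
  then show "f\<sharp> (a @ X\<sharp> [x] # c) = zero (strand_alg Z)"
   using slot_additive_zero[OF assms(1), of a c] by simp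
 qed (use cl in \<open>simp add: carrier_strand_alg\<close>)
 also have "... = (\<Sum>(a, b, c)\<in>splits3 as. f\<sharp> (a @ X\<sharp> b # c))"
 proof (rule finsum_strand_alg, clarify)
  fix a b c assume "(a, b, c) \<in> splits3 as"
  then have "a @ b @ c = as" "b ~= []" by (auto simp: splits3_def)
  then show "inA (f\<sharp> (a @ X\<sharp> b # c))" by (rule cl)
 qed
 finally show ?thesis .
qed

lemma stasheff_index:
 assumes "multilinear n (homology Z) (homology Z) (X n)" "!!x. x \<in> H ==> X 1 [x] = zeroH"
 shows "finsum (homology Z) (%(i, j, k). X (i + 1 + k) (insert_op X i j as)) {(i, j, k). i + j + k = n & 1 <= j} =
  stasheff X\<sharp> as"
proof -
 interpret Hr: ring "homology Z" by (rule ring_homology)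
 have cl: "X\<sharp> (a @ X\<sharp> b # c) \<in> H" if "a @ b @ c = as" "b ~= []" for a b c
  using X_H split3_closed[OF that] by blast
 have "finsum (homology Z) (%(i, j, k). X (i + 1 + k) (insert_op X i j as)) {(i, j, k). i + j + k = n & 1 <= j} =
   finsum (homology Z) (%(i, j, k). X\<sharp> (take i as @ X\<sharp> (take j (drop i as)) # drop (i + j) as))
    {(i, j, k). i + j + k = n & 1 <= j}"
 proof (rule Hr.finsum_cong'[OF refl])
  show "(%(i, j, k). X\<sharp> (take i as @ X\<sharp> (take j (drop i as)) # drop (i + j) as)) \<in>
    {(i, j, k). i + j + k = n & 1 <= j} \<rightarrow> H"
  proof clarify
   fix i j k assume "n = i + j + k" "1 <= j"
   then have "take j (drop i as) ~= []" using len by auto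
   from cl[OF take_take_drop this]
   show "X\<sharp> (take i as @ X\<sharp> (take j (drop i as)) # drop (i + j) as) \<in> H" .
  qed
 qed (simp only: split_paired_all case_prod_conv mem_Collect_eq insert_op_at_length[of _ _ _ as, unfolded len])
 also have "... = finsum (homology Z) (%(a, b, c). X\<sharp> (a @ X\<sharp> b # c)) (splits3 as)"
 proof (rule Hr.finsum_index_splits[OF len[symmetric]])
  fix a x c assume as: "a @ [x] @ c = as"
  then have s: "X\<sharp> [x] = zeroH" "set a \<subseteq> H" "set c \<subseteq> H" "length a + 1 + length c = n"
   using assms(2)[of x] asH len by auto
  let ?y = "X n (a @ zeroH # c)"
  have "?y = addH ?y ?y"
   using assms(1)[unfolded multilinear_iff, THEN conjunct2, rule_format, OF s(4,2,3) Hr.zero_closed Hr.zero_closed] by simp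
  moreover have "?y \<in> H" using assms(1)[unfolded multilinear_iff] s by simp
  ultimately have "?y = zeroH" using Hr.add.r_cancel_one'[of ?y ?y] by simp
  then show "X\<sharp> (a @ X\<sharp> [x] # c) = zeroH" using s(1,4) by simp
 qed (use cl in simp)
 also have "... = stasheff X\<sharp> as"
 proof (cases "2 <= length as")
  case True
  then have "X\<sharp> [X\<sharp> as] = zeroH" using assms(2) X_H[of as] len asH by (cases as) auto
  moreover have p: "(%(a, b, c). X\<sharp> (a @ X\<sharp> b # c)) \<in> proper_splits3 as \<rightarrow> H"
  proof (rule Pi_I, clarify)
   fix a b c assume "(a, b, c) \<in> proper_splits3 as"
   then have "a @ b @ c = as" "b ~= []" by (auto simp: proper_splits3_def)
   then show "X\<sharp> (a @ X\<sharp> b # c) \<in> H" by (rule cl)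
  qed
  moreover have "stasheff X\<sharp> as \<in> H" unfolding stasheff_def by (rule Hr.finsum_closed[OF p])
  moreover have "X\<sharp> ([] @ X\<sharp> as # []) \<in> H" using True by (intro cl) auto
  ultimately show ?thesis
   unfolding splits3_proper(1) stasheff_def using True splits3_proper(2)[of as]
   by (simp only: if_True Hr.finsum_insert finite_splits case_prod_conv append_Nil list.size One_nat_def[symmetric] Hr.l_zero
     not_False_eq_True add_0_left flip: Suc_eq_plus1)
 next
  case False
  then have "proper_splits3 as = {}" by (auto simp: proper_splits3_def)
  then show ?thesis using False by (simp add: splits3_proper(1) stasheff_def)
 qed
 finally show ?thesis .
qed

end

end

section \<open>Gradings of tensor products\<close>

context arc
begin

lemma product_summand:
 assumes "x \<in> summand (h, s, t)" "y \<in> summand (h', s', t')"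
 shows "vec_mult x y \<in> summand (%e. h e + h' e, s, t')" "t ~= s' ==> vec_mult x y = 0"
  "homog g x ==> homog g' y ==>
   homog (g + g' + avg_mult Z h' (h_boundary h)) (vec_mult x y)"
proof -
 note xy = assms[unfolded alg_summand_eq]
 have k: "\<exists>al be. good al & good be & hdat al = (h, s, t) & hdat be = (h', s', t') & composes al be gm &
   al \<in> keys x & be \<in> keys y" if gm: "gm \<in> keys (vec_mult x y)" for gm
 proof -
  obtain al be where "al \<in> keys x" "be \<in> keys y" "composes al be gm"
   by (rule keys_vec_mult_ex[OF gm])
  moreover from this have "good al" "good be" "hdat al = (h, s, t)" "hdat be = (h', s', t')"
   using xy by (simp_all add: inA_def)
  ultimately show ?thesis by (intro exI[of _ al] exI[of _ be]) simp
 qed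
 have hd: "hdat gm = (%e. h e + h' e, s, t')" "t = s'" if gm: "gm \<in> keys (vec_mult x y)" for gm
 proof -
  obtain al be where a: "good al" "good be" "hdat al = (h, s, t)" "hdat be = (h', s', t')" "composes al be gm"
   using k[OF gm] by blast
  note cg = composes_good[OF a(1,2,5)]
  have r: "Range al = Domain be" "gm = al O be" using a(5) by (auto simp: composes_def)
  have "h_grading gm = (%e. h e + h' e)"
   using h_grading_comp[OF a(1,2) r(1)] a(3,4) unfolding r(2) by (auto simp: hdat_def fun_eq_iff)
  then show "hdat gm = (%e. h e + h' e, s, t')" "t = s'" using cg a(3,4) by (auto simp: hdat_def)
 qed
 show "vec_mult x y \<in> summand (%e. h e + h' e, s, t')"
  unfolding alg_summand_eq using xy hd(1) inA_vec_mult by blast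
 show "vec_mult x y = 0" if "t ~= s'"
 proof -
  have "keys (vec_mult x y) = {}" using hd(2) that by blast
  then show ?thesis by simp
 qed
 show "homog (g + g' + avg_mult Z h' (h_boundary h)) (vec_mult x y)"
  if g: "homog g x" "homog g' y"
  unfolding maslov_homogeneous_def
 proof
  fix gm assume "gm \<in> keys (vec_mult x y)"
  from k[OF this] obtain al be where a: "good al" "good be" "hdat al = (h, s, t)" "hdat be = (h', s', t')"
   "composes al be gm" "al \<in> keys x" "be \<in> keys y" by blast
  then have "maslov_term Z al = g" "maslov_term Z be = g'" using g by (auto simp: maslov_homogeneous_def)
  then show "maslov_term Z gm = g + g' + avg_mult Z h' (h_boundary h)"
   using composes_maslov[OF a(1,2,5)] a(3,4) by (simp add: hdat_def)
 qed
qed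

lemma maslov_homogeneous_add:
 "homog g x ==> homog g y ==> homog g (x + y)"
 by (auto simp: maslov_homogeneous_def keys_add_bit)

lemma tensor_h_append: "tensor_h Z (as @ bs) = (%e. tensor_h Z as e + tensor_h Z bs e)"
 by (simp add: tensor_h_def)

lemma h_boundary_add: "h_boundary (%e. h e + h' e) = (%p. h_boundary h p + h_boundary h' p)"
 by (auto simp: h_boundary_def)

lemma sum_avg_mult_boundary:
 "(\<Sum>j<length Ms. avg_mult Z h (h_boundary (h_of Z (Ms ! j)))) = avg_mult Z h (h_boundary (tensor_h Z Ms))"
proof (induction Ms rule: rev_induct)
 case Nil
 have "h_boundary (tensor_h Z []) = (%_. 0)" by (auto simp: h_boundary_def tensor_h_def)
 then show ?case by (simp add: avg_mult_def)
next
 case (snoc M Ms)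
 have "tensor_h Z [M] = h_of Z M" by (simp add: tensor_h_def)
 then show ?case
  using snoc by (simp add: nth_append tensor_h_append h_boundary_add avg_mult_add_right)
qed

lemma tensor_maslov_snoc:
 "tmas (Ms @ [M]) =
  tmas Ms + class_maslov Z M + avg_mult Z (h_of Z M) (h_boundary (tensor_h Z Ms))"
proof -
 have "(\<Sum>k<length Ms. \<Sum>j<k. avg_mult Z (h_of Z ((Ms @ [M]) ! k)) (h_boundary (h_of Z ((Ms @ [M]) ! j)))) =
   (\<Sum>k<length Ms. \<Sum>j<k. avg_mult Z (h_of Z (Ms ! k)) (h_boundary (h_of Z (Ms ! j))))"
  by (intro sum.cong refl) (auto simp: nth_append)
 then show ?thesis
  unfolding tensor_maslov_def using sum_avg_mult_boundary[of "h_of Z M" Ms]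
  by (simp add: nth_append)
qed

text \<open>The corrections between a factor of \<open>as\<close> and a factor of \<open>bs\<close>
  collect into one term because \<open>avg_mult\<close> is additive in both arguments.\<close>

lemma tensor_maslov_append:
 "tmas (as @ bs) = tmas as + tmas bs +
  avg_mult Z (tensor_h Z bs) (h_boundary (tensor_h Z as))"
proof (induction bs rule: rev_induct)
 case Nil
 show ?case by (simp add: tensor_maslov_def tensor_h_def avg_mult_def)
next
 case (snoc b bs)
 have "tensor_h Z [b] = h_of Z b" by (simp add: tensor_h_def)
 then show ?case
  using snoc tensor_maslov_snoc[of "as @ bs" b] tensor_maslov_snoc[of bs b]
  by (simp add: tensor_h_append h_boundary_add avg_mult_add_right avg_mult_add_left)
qed

lemma mismatch_iff:
 "mismatch Ms \<longleftrightarrow> \<not> successively (%M N. target_of Z M = source_of Z N) Ms"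
 by (simp add: idempotent_mismatch_def successively_conv_nth)

end

context choices
begin

abbreviation "DC \<equiv> diagram_classes Z"

lemma DC_carrier: "set Ms \<subseteq> DC ==> set Ms \<subseteq> H"
 using gen_carrier by (auto simp: diagram_classes_eq)

lemma DC_gens: "set Ms \<subseteq> DC \<longleftrightarrow> (\<exists>ds. Ms = map gen ds & (\<forall>d\<in>set ds. tightH d))"
proof
 show "set Ms \<subseteq> DC ==> \<exists>ds. Ms = map gen ds & (\<forall>d\<in>set ds. tightH d)"
 proof (induction Ms)
  case (Cons M Ms)
  then obtain ds d where "Ms = map gen ds" "\<forall>d\<in>set ds. tightH d" "M = gen d" "tightH d"
   by (auto simp: diagram_classes_eq)
  then show ?case by (intro exI[of _ "d # ds"]) simp
 qed simp
qed (auto simp: diagram_classes_eq)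

text \<open>Seen from the other factors, a block without mismatch and the generator with its H-data
  are alike; only the degree changes, by the difference of their own degrees.\<close>

lemma replace_class:
 assumes "b ~= []" "tightH (thd b)"
 defines "M \<equiv> gen (thd b)"
 shows "thd (a @ M # c) = thd (a @ b @ c)"
  "\<not> mismatch b ==> mismatch (a @ M # c) = mismatch (a @ b @ c)"
  "tmas (a @ M # c) = tmas (a @ b @ c) - tmas b + class_maslov Z M"
  "M \<in> DC"
proof -
 have "class_hdata Z M = thd b" unfolding M_def by (rule class_hdata_gen[OF assms(2)])
 then have h: "h_of Z M = tensor_h Z b" and s: "source_of Z M = source_of Z (hd b)"
  and t: "target_of Z M = target_of Z (last b)"
  by (simp_all add: h_of_def source_of_def target_of_def tensor_hdata_def)
 have th: "tensor_h Z (M # c) = (%e. tensor_h Z b e + tensor_h Z c e)" for c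
  using h by (simp add: tensor_h_def)
 show "thd (a @ M # c) = thd (a @ b @ c)"
 proof -
  have "tensor_h Z (a @ M # c) = tensor_h Z (a @ b @ c)" by (simp only: tensor_h_append th)
  moreover have "source_of Z (hd (a @ M # c)) = source_of Z (hd (a @ b @ c))"
   "target_of Z (last (a @ M # c)) = target_of Z (last (a @ b @ c))"
   by (cases a; use assms(1) s in simp) (cases c; use assms(1) t in simp)
  ultimately show ?thesis by (simp add: tensor_hdata_def)
 qed
 show "mismatch (a @ M # c) = mismatch (a @ b @ c)" if "\<not> mismatch b"
  using that assms(1) s t by (auto simp: mismatch_iff successively_append_iff successively_Cons)
 have "tmas [M] = class_maslov Z M" "tensor_h Z [M] = tensor_h Z b"
  using h by (simp_all add: tensor_maslov_def tensor_h_def)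
 then show "tmas (a @ M # c) = tmas (a @ b @ c) - tmas b + class_maslov Z M"
  using tensor_maslov_append[of a "[M] @ c"] tensor_maslov_append[of a "b @ c"]
   tensor_maslov_append[of "[M]" c] tensor_maslov_append[of b c] by (simp add: tensor_h_append th)
 show "M \<in> DC" using assms(2) by (auto simp: diagram_classes_eq M_def)
qed

section \<open>Gradings and mismatches of U\<close>

context
 fixes X :: "vec set list => vec set" and F :: "vec set list => vec" and Ms :: "vec set list"
 assumes Ms: "set Ms \<subseteq> DC"
  and F_graded: "!!bs. bs ~= [] ==> length bs < length Ms ==> set bs \<subseteq> DC ==> \<not> mismatch bs ==>
   F bs \<in> summand (thd bs) &
   homog (tmas bs + of_nat (length bs) - 1) (F bs)"
  and X_graded: "!!bs. 2 <= length bs ==> length bs < length Ms ==> set bs \<subseteq> DC ==> \<not> mismatch bs ==>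
   X bs = zeroH \<or> tightH (thd bs) & X bs = gen (thd bs) &
   class_maslov Z (X bs) = tmas bs + of_nat (length bs) - 2"
  and F_zero: "!!a c. length a + 1 + length c < length Ms ==> set a \<subseteq> H ==> set c \<subseteq> H ==> F (a @ zeroH # c) = 0"
begin

text \<open>The degree is n - 2 for both kinds of terms: (j - 1) + (n - j - 1) for a product, and (j
  - 2) + (n - j) for an inserted operation.\<close>

lemma U_graded:
 assumes nm: "\<not> mismatch Ms"
 shows "U X F Ms \<in> summand (thd Ms)"
  "homog (tmas Ms + of_nat (length Ms) - 2) (U X F Ms)"
proof -
 let ?N = "{x \<in> summand (thd Ms). homog (tmas Ms + of_nat (length Ms) - 2) x}"
 have N0: "0 \<in> ?N" by (simp add: maslov_homogeneous_def)
 have Nadd: "x + y \<in> ?N" if "x \<in> ?N" "y \<in> ?N" for x y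
  using that alg_summand_add maslov_homogeneous_add by blast
 have Nsum: "sum g S \<in> ?N" if "!!i. i \<in> S ==> g i \<in> ?N" for S and g :: "'i => vec"
  using that by (induction S rule: infinite_finite_induct) (use N0 Nadd in auto)
 have 1: "vec_mult (F a) (F b) \<in> ?N" if "(a, b) \<in> splits2 Ms" for a b
 proof -
  have ab: "Ms = a @ b" "a ~= []" "b ~= []" using that by (auto simp: splits2_def)
  have "length a < length Ms" "length b < length Ms" "set a \<subseteq> DC" "set b \<subseteq> DC" using Ms ab by auto
  moreover have nm': "\<not> mismatch a" "\<not> mismatch b"
   using nm ab by (auto simp: mismatch_iff successively_append_iff)
  ultimately have "F a \<in> summand (thd a)" "F b \<in> summand (thd b)"
   "homog (tmas a + of_nat (length a) - 1) (F a)"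
   "homog (tmas b + of_nat (length b) - 1) (F b)"
   using F_graded ab(2,3) by blast+
  note p = product_summand[OF this(1,2)[unfolded tensor_hdata_def]] product_summand(3)[OF this(1,2)[unfolded tensor_hdata_def] this(3,4)]
  have "thd Ms = (%e. tensor_h Z a e + tensor_h Z b e, source_of Z (hd a), target_of Z (last b))"
   using ab by (simp add: tensor_hdata_def tensor_h_append)
  moreover have "tmas Ms + of_nat (length Ms) - 2 = tmas a + of_nat (length a) - 1 +
    (tmas b + of_nat (length b) - 1) + avg_mult Z (tensor_h Z b) (h_boundary (tensor_h Z a))"
   unfolding ab(1) tensor_maslov_append by simp
  ultimately show ?thesis using p(1,4) by (simp only: mem_Collect_eq simp_thms)
 qed
 have 2: "F (a @ X b # c) \<in> ?N" if "(a, b, c) \<in> proper_splits3 Ms" for a b c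
 proof -
  have abc: "Ms = a @ b @ c" "2 <= length b" "a ~= [] \<or> c ~= []" using that by (auto simp: proper_splits3_def)
  then have l: "length b < length Ms" "length a + 1 + length c < length Ms" "b ~= []" by auto
  have s: "set a \<subseteq> DC" "set b \<subseteq> DC" "set c \<subseteq> DC" using Ms abc(1) by auto
  have nm': "\<not> mismatch b" using nm abc(1) by (auto simp: mismatch_iff successively_append_iff)
  from X_graded[OF abc(2) l(1) s(2) nm'] show ?thesis
  proof
   assume "X b = zeroH"
   then show ?thesis using F_zero[OF l(2)] DC_carrier s N0 by simp
  next
   assume X: "tightH (thd b) & X b = gen (thd b) &
    class_maslov Z (X b) = tmas b + of_nat (length b) - 2"
   then have t: "tightH (thd b)" and Xb: "gen (thd b) = X b" by auto
   note r = replace_class(1-3)[OF l(3) t, of a c, unfolded Xb] replace_class(4)[OF l(3) t, unfolded Xb]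
   have "\<not> mismatch (a @ X b # c)" using r(2)[OF nm'] nm abc(1) by simp
   moreover have "set (a @ X b # c) \<subseteq> DC" using s r(4) by auto
   ultimately have F: "F (a @ X b # c) \<in> summand (thd (a @ X b # c))"
    "homog (tmas (a @ X b # c) + of_nat (length (a @ X b # c)) - 1) (F (a @ X b # c))"
    using F_graded[of "a @ X b # c"] l(2) by auto
   have cm: "class_maslov Z (X b) = tmas b + of_nat (length b) - 2" using X by blast
   have e: "tmas (a @ X b # c) + of_nat (length (a @ X b # c)) - 1 =
     tmas Ms + of_nat (length Ms) - 2"
    unfolding r(3) abc(1) cm by simp
   have "F (a @ X b # c) \<in> summand (thd Ms)" using F(1) unfolding r(1) abc(1) .
   then show ?thesis using F(2) unfolding e by simp
  qed
 qed
 have "U X F Ms \<in> ?N"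
  unfolding U_def by (intro Nadd Nsum) (use 1 2 in auto)
 then show "U X F Ms \<in> summand (thd Ms)"
  "homog (tmas Ms + of_nat (length Ms) - 2) (U X F Ms)" by auto
qed

text \<open>In a product the mismatch lies inside a factor or at the cut, where incompatible
  idempotents meet. An inserted block either contains it, and is then sent to 0, or leaves it to the
  list with the block replaced.\<close>

lemma U_mismatch:
 assumes mm: "mismatch Ms"
  and F_mismatch: "!!bs. bs ~= [] ==> length bs < length Ms ==> set bs \<subseteq> DC ==> mismatch bs ==> F bs = 0"
  and X_mismatch: "!!bs. 2 <= length bs ==> length bs < length Ms ==> set bs \<subseteq> DC ==> mismatch bs ==>
   X bs = zeroH"
 shows "U X F Ms = 0"
proof -
 have 1: "vec_mult (F a) (F b) = 0" if "(a, b) \<in> splits2 Ms" for a b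
 proof -
  have ab: "Ms = a @ b" "a ~= []" "b ~= []" using that by (auto simp: splits2_def)
  have s: "length a < length Ms" "length b < length Ms" "set a \<subseteq> DC" "set b \<subseteq> DC" using Ms ab by auto
  consider "mismatch a" | "mismatch b" |
   "\<not> mismatch a" "\<not> mismatch b" "target_of Z (last a) ~= source_of Z (hd b)"
   using mm ab by (auto simp: mismatch_iff successively_append_iff)
  then show ?thesis
  proof cases
   case 1
   then show ?thesis using F_mismatch[of a] s ab by simp
  next
   case 2
   then show ?thesis using F_mismatch[of b] s ab by simp
  next
   case 3
   have "F a \<in> summand (thd a)" "F b \<in> summand (thd b)"
    using F_graded ab(2,3) s 3 by blast+
   from product_summand(2)[OF this[unfolded tensor_hdata_def] 3(3)] show ?thesis .
  qed
 qed
 have 2: "F (a @ X b # c) = 0" if "(a, b, c) \<in> proper_splits3 Ms" for a b c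
 proof -
  have abc: "Ms = a @ b @ c" "2 <= length b" "a ~= [] \<or> c ~= []" using that by (auto simp: proper_splits3_def)
  then have l: "length b < length Ms" "length a + 1 + length c < length Ms" "b ~= []" by auto
  have s: "set a \<subseteq> DC" "set b \<subseteq> DC" "set c \<subseteq> DC" using Ms abc(1) by auto
  show ?thesis
  proof (cases "X b = zeroH")
   case True
   then show ?thesis using F_zero[OF l(2)] DC_carrier s by simp
  next
   case False
   then have nm': "\<not> mismatch b" using X_mismatch[OF abc(2) l(1) s(2)] by blast
   then have t: "tightH (thd b)" and Xb: "gen (thd b) = X b"
    using X_graded[OF abc(2) l(1) s(2)] False by auto
   note r = replace_class(1-3)[OF l(3) t, of a c, unfolded Xb] replace_class(4)[OF l(3) t, unfolded Xb]
   have "mismatch (a @ X b # c)" using r(2)[OF nm'] mm abc(1) by simp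
   moreover have "set (a @ X b # c) \<subseteq> DC" using s r(4) by auto
   ultimately show ?thesis using F_mismatch[of "a @ X b # c"] l(2) by simp
  qed
 qed
 show ?thesis
  unfolding U_def using 1 2 by (simp add: sum.neutral case_prod_beta)
qed

end

end

section \<open>Existence\<close>

context choices
begin

text \<open>The cycle selection map, extended linearly through the coordinates of a class.\<close>

definition sel :: "vec set => vec" where "sel a = (\<Sum>d\<in>supp a. cd d)"

lemma sel_gen: "tightH d ==> sel (gen d) = cd d"
 by (simp add: sel_def supp_gen)

lemma sel_zero: "sel zeroH = 0"
 by (simp add: sel_def supp_zero)

lemma sel_add: "a \<in> H ==> b \<in> H ==> sel (addH a b) = sel a + sel b"
 using lin_add[of cd "vecof (supp a)" "vecof (supp b)"]
 by (simp add: sel_def supp_add supp_finite lin_def keys_add_bit)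

lemma sel_cyc: "a \<in> H ==> cyc (sel a)"
proof (induction rule: homology_induct)
 case 1
 show ?case by (simp add: sel_zero inA_0)
next
 case (2 d b)
 then show ?case using tight_props[OF cd_tight[OF 2(1)]]
  by (simp add: sel_add gen_carrier sel_gen inA_add vec_diff_add)
qed

lemma hclass_sel: "a \<in> H ==> hclass Z (sel a) = a"
proof (induction rule: homology_induct)
 case 1
 show ?case unfolding sel_zero by (rule zero_homology[symmetric])
next
 case (2 d b)
 have "cyc (cd d)" using tight_props[OF cd_tight[OF 2(1)]] by simp
 from hclass_hom(1)[OF this sel_cyc[OF 2(2)]] show ?case
  unfolding sel_add[OF gen_carrier[OF 2(1)] 2(2)] sel_gen[OF 2(1)] 2(3) gen_def[symmetric] by simp
qed

lemma sel_boundary: "a \<in> H ==> sel a \<in> bds ==> a = zeroH"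
 using hclass_sel hclass_zero_iff[OF sel_cyc] by simp

text \<open>The difference f_1 X_n - U_n, with X_n replaced by the class of U_n and the sign dropped
  in characteristic 2.\<close>

definition defect :: "(vec set list => vec set) => (vec set list => vec) => vec set list => vec" where
 "defect X F as = sel (hclass Z (U X F as)) + U X F as"

text \<open>The value of f_n on a tuple of generators: the chosen cycle for a single one, then the
  creation condition, then the balanced condition, and otherwise any homogeneous primitive of the
  defect.\<close>

definition filler :: "(vec set list => vec set) => (vec set list => vec) => hdata list => vec" where
 "filler X F ds = (if length ds <= 1 then cd (hd ds) else
  let Ms = map gen ds; d = thd Ms; b = defect X F Ms in
  if tensor_viable Z Ms & twisted_hdata Z d then creation_op Z CR d b
  else if b = 0 then 0
  else SOME c. c \<in> summand d &
   homog (tmas Ms + of_nat (length Ms) - 1) c & vec_diff c = b)"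

lemma U_cong:
 assumes "!!bs. length bs < length as ==> X bs = X' bs & F bs = F' bs"
 shows "U X F as = U X' F' as"
 unfolding U_def
proof (intro arg_cong2[of _ _ _ _ "(+)"] sum.cong refl; clarify)
 fix a b assume "(a, b) \<in> splits2 as"
 then have "length a < length as" "length b < length as" by (auto simp: splits2_def)
 then show "vec_mult (F a) (F b) = vec_mult (F' a) (F' b)" using assms by simp
next
 fix a b c assume "(a, b, c) \<in> proper_splits3 as"
 then have "length b < length as" "length (a @ x # c) < length as" for x by (auto simp: proper_splits3_def)
 then show "F (a @ X b # c) = F' (a @ X' b # c)" using assms by metis
qed

lemma mext_cong: "(!!ds. length ds = length As ==> \<phi> ds = \<psi> ds) ==> mext \<phi> As = mext \<psi> As"
proof (induction As arbitrary: \<phi> \<psi>)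
 case (Cons A As)
 show ?case unfolding mext.simps by (intro sum.cong refl Cons.IH Cons.prems) simp
qed simp

text \<open>Both operations are defined in one recursion on the length, since \<open>U\<close> needs
  both on shorter lists.\<close>

definition XF :: "vec set list => vec set \<times> vec" where
 "XF = wfrec (measure length) (%g as.
  (if length as <= 1 then zeroH else hclass Z (U (fst \<circ> g) (snd \<circ> g) as),
  mext (filler (fst \<circ> g) (snd \<circ> g)) (map supp as)))"

definition "Xo = fst \<circ> XF"
definition "Fo = snd \<circ> XF"

lemma Xo_Fo:
 "Xo as = (if length as <= 1 then zeroH else hclass Z (U Xo Fo as))"
 "Fo as = mext (filler Xo Fo) (map supp as)"
proof -
 let ?G = "%g as. (if length as <= 1 then zeroH else hclass Z (U (fst \<circ> g) (snd \<circ> g) as),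
  mext (filler (fst \<circ> g) (snd \<circ> g)) (map supp as))"
 \<comment> \<open>\<open>U\<close> consults the two functions only on strictly shorter
   lists.\<close>
 have "adm_wf (measure length) ?G"
  unfolding adm_wf_def
 proof (intro allI impI)
  fix g g' :: "vec set list => vec set \<times> vec" and as
  assume eq: "\<forall>z. (z, as) \<in> measure length --> g z = g' z"
  have u: "U (fst \<circ> g) (snd \<circ> g) bs = U (fst \<circ> g') (snd \<circ> g') bs" if "length bs = length as" for bs
   using eq that by (intro U_cong) simp
  have "filler (fst \<circ> g) (snd \<circ> g) ds = filler (fst \<circ> g') (snd \<circ> g') ds" if "length ds = length (map supp as)" for ds
   using u[of "map gen ds"] that by (simp add: filler_def defect_def)
  then have "mext (filler (fst \<circ> g) (snd \<circ> g)) (map supp as) = mext (filler (fst \<circ> g') (snd \<circ> g')) (map supp as)"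
   by (rule mext_cong)
  then show "?G g as = ?G g' as" using u[of as] by simp
 qed
 then have "XF = ?G XF" by (rule wfrec_def_adm[OF eq_reflection[OF XF_def] wf_measure])
 then have "XF as = ?G XF as" by (rule fun_cong)
 then show "Xo as = (if length as <= 1 then zeroH else hclass Z (U Xo Fo as))"
  "Fo as = mext (filler Xo Fo) (map supp as)"
  by (simp_all add: Xo_def Fo_def)
qed

text \<open>Holds for all lengths at once, since \<open>Fo\<close> is a multilinear extension by
  definition. In contrast \<open>Xo\<close> inherits additivity from \<open>U\<close>, by
  induction.\<close>

lemma Fo_additive: "slot_additive n Fo"
 using slot_additive_mext[of n "filler Xo Fo"] unfolding Xo_Fo(2)[symmetric] .

lemma Fo_gens: "\<forall>d\<in>set ds. tightH d ==> Fo (map gen ds) = filler Xo Fo ds"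
 by (subst Xo_Fo(2)) (rule mext_gens)

lemma Fo_single: "Fo [a] = sel a"
 by (subst Xo_Fo(2)) (simp add: filler_def sel_def)

text \<open>Any primitive in the summand may be projected to degree \<open>g + 1\<close>, since the
  differential lowers the degree by one.\<close>

lemma homogeneous_filling:
 assumes "b \<in> bds" "b \<in> summand d" "homog g b"
 shows "\<exists>c. c \<in> summand d & homog (g + 1) c & vec_diff c = b"
proof -
 obtain y where y: "y \<in> summand d" "b = vec_diff y" using boundary_in_summand[OF assms(1,2)] by blast
 let ?Q = "%nu. maslov_term Z nu = g + 1" and ?Q' = "%nu. maslov_term Z nu = g"
 have i: "inA y" using y(1) alg_summand_inA by blast
 have "restr ?Q' (vec_diff y) = vec_diff (restr ?Q y)"
  by (rule restr_vec_diff[OF i]) (auto dest: reduces_maslov)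
 moreover have "restr ?Q' b = b" using assms(3) by (intro restr_id) (simp add: maslov_homogeneous_def)
 moreover have "restr ?Q y \<in> summand d"
  using y(1) inA_restr[OF i sim_invariant_grading[of "%_ m. m = g + 1"]] by (simp add: alg_summand_eq)
 moreover have "homog (g + 1) (restr ?Q y)" by (simp add: maslov_homogeneous_def)
 ultimately show ?thesis using y(2) by (intro exI[of _ "restr ?Q y"]) simp
qed

lemma creation_op_0: "twisted_hdata Z d ==> creation_op Z CR d 0 = 0"
 using creation(3)[of d 0 0] by simp

definition graded_at :: "vec set list => bool" where
 "graded_at Ms \<longleftrightarrow> (if mismatch Ms then Fo Ms = 0 & Xo Ms = zeroH else
  Fo Ms \<in> summand (thd Ms) &
  homog (tmas Ms + of_nat (length Ms) - 1) (Fo Ms) &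
  (Xo Ms = zeroH \<or> tightH (thd Ms) & Xo Ms = gen (thd Ms) &
   class_maslov Z (Xo Ms) = tmas Ms + of_nat (length Ms) - 2))"

text \<open>Collects what the step to longer lists consumes: both relations, additivity of
  \<open>Xo\<close>, and the gradings on generators.\<close>

definition solved :: "nat => bool" where
 "solved n \<longleftrightarrow>
  (\<forall>as. length as = n --> set as \<subseteq> H --> inA (Fo as) & vec_diff (Fo as) = rel Xo Fo as &
   stasheff Xo as = zeroH & Xo as \<in> H) &
  (\<forall>xs a b ys. length xs + 1 + length ys = n --> set xs \<subseteq> H --> set ys \<subseteq> H --> a \<in> H --> b \<in> H -->
   Xo (xs @ addH a b # ys) = addH (Xo (xs @ a # ys)) (Xo (xs @ b # ys))) &
  (\<forall>Ms. length Ms = n --> set Ms \<subseteq> DC --> graded_at Ms)"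

lemma solved_1: "solved 1"
proof -
 interpret Hr: ring "homology Z" by (rule ring_homology)
 have "inA (Fo as) & vec_diff (Fo as) = rel Xo Fo as & stasheff Xo as = zeroH & Xo as \<in> H"
  if as: "length as = 1" "set as \<subseteq> H" for as
 proof -
  have "proper_splits3 as = {}" using as(1) by (auto simp: proper_splits3_def)
  moreover obtain a where "as = [a]" using as(1) by (cases as) auto
  ultimately show ?thesis using as(2) sel_cyc[of a] rel_short[of as] Xo_Fo(1)[of as]
   by (simp add: Fo_single stasheff_def)
 qed
 moreover have "graded_at Ms" if Ms: "length Ms = 1" "set Ms \<subseteq> DC" for Ms
 proof -
  obtain d where d: "Ms = [gen d]" "tightH d"
   using Ms by (cases Ms) (auto simp: diagram_classes_eq)
  have "thd Ms = d" using d class_hdata_gen[OF d(2)]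
   by (cases d) (simp add: tensor_hdata_def tensor_h_def h_of_def source_of_def target_of_def)
  moreover have "tmas Ms = class_maslov Z (gen d)" using d by (simp add: tensor_maslov_def)
  moreover have "\<not> mismatch Ms" using d by (simp add: mismatch_iff)
  ultimately show ?thesis
   using tight_props(2)[OF cd_tight[OF d(2)]] class_maslov_gen(1)[OF d(2)] Xo_Fo(1)[of Ms] Ms(1)
   by (simp add: graded_at_def d(1) Fo_single sel_gen[OF d(2)])
 qed
 ultimately show ?thesis unfolding solved_def using Xo_Fo(1) by simp
qed

section \<open>The inductive step for n factors\<close>

context
 fixes n :: nat
 assumes n: "2 <= n" and IH: "!!k. 1 <= k ==> k < n ==> solved k"
begin

lemma IHD:
 assumes "bs ~= []" "length bs < n" "set bs \<subseteq> H"
 shows "inA (Fo bs)" "vec_diff (Fo bs) = rel Xo Fo bs" "stasheff Xo bs = zeroH" "Xo bs \<in> H"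
proof -
 have "1 <= length bs" using assms(1) by (cases bs) auto
 from IH[OF this assms(2)] show "inA (Fo bs)" "vec_diff (Fo bs) = rel Xo Fo bs"
  "stasheff Xo bs = zeroH" "Xo bs \<in> H"
  using assms(3) by (simp_all add: solved_def)
qed

lemma IH_X: "2 <= length bs ==> length bs < n ==> set bs \<subseteq> H ==> Xo bs \<in> H"
 by (rule IHD(4)) auto

lemma IH_graded: "bs ~= [] ==> length bs < n ==> set bs \<subseteq> DC ==> graded_at bs"
 using IH[of "length bs"] by (cases bs) (auto simp: solved_def)

lemma U_cycle:
 assumes as: "length as = n" "set as \<subseteq> H"
 shows "inA (U Xo Fo as)" "vec_diff (U Xo Fo as) = 0" "stasheff Xo as = zeroH"
proof -
 interpret Hr: ring "homology Z" by (rule ring_homology)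
 have s: "stasheff Xo as \<in> H"
  unfolding stasheff_def
 proof (rule Hr.finsum_closed, rule Pi_I, clarify)
  fix a b c assume "(a, b, c) \<in> proper_splits3 as"
  then have abc: "as = a @ b @ c" "2 <= length b" "a ~= [] \<or> c ~= []" by (auto simp: proper_splits3_def)
  then have "b ~= []" "length b < n" "length (a @ x # c) < n" for x using as(1) by auto
  moreover have "set a \<subseteq> H" "set b \<subseteq> H" "set c \<subseteq> H" using as(2) abc(1) by auto
  ultimately show "Xo (a @ Xo b # c) \<in> H" using IHD(4)[of b] IHD(4)[of "a @ Xo b # c"] by simp
 qed
 show iU: "inA (U Xo Fo as)"
  by (rule U_inA) (use n as IHD IH_X Fo_additive in auto)
 have d: "vec_diff (U Xo Fo as) = sel (stasheff Xo as)"
  unfolding Fo_single[symmetric] by (rule vec_diff_U) (use n as IHD IH_X Fo_additive in auto)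
 \<comment> \<open>Only the zero class is sent to a boundary by \<open>sel\<close>. The relation on
   \<open>as\<close> does not involve \<open>Xo as\<close> itself, so it is available before this
   value is examined.\<close>
 then have "sel (stasheff Xo as) \<in> bds" using iU in_boundaries by metis
 then show "stasheff Xo as = zeroH" using sel_boundary s by blast
 then show "vec_diff (U Xo Fo as) = 0" using d sel_zero by simp
qed

lemma Xo_eq: "length as = n ==> Xo as = hclass Z (U Xo Fo as)"
 using Xo_Fo(1)[of as] n by simp

lemma Xo_H: "length as = n ==> set as \<subseteq> H ==> Xo as \<in> H"
 using Xo_eq hclass_carrier U_cycle by simp

lemma Uo_additive: "slot_additive n (U Xo Fo)"
proof (rule slot_additive_U[OF n Fo_additive])
 fix bs assume "2 <= length bs" "length bs < n" "set bs \<subseteq> H"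
 then show "Xo bs \<in> H" by (rule IH_X)
next
 fix xs a b ys assume *: "length xs + 1 + length ys < n" "set xs \<subseteq> H" "set ys \<subseteq> H" "a \<in> H" "b \<in> H"
 then have "solved (length xs + 1 + length ys)" by (intro IH) auto
 then show "Xo (xs @ addH a b # ys) = addH (Xo (xs @ a # ys)) (Xo (xs @ b # ys))"
  using * unfolding solved_def by blast
qed

lemma Xo_additive:
 assumes "length xs + 1 + length ys = n" "set xs \<subseteq> H" "set ys \<subseteq> H" "a \<in> H" "b \<in> H"
 shows "Xo (xs @ addH a b # ys) = addH (Xo (xs @ a # ys)) (Xo (xs @ b # ys))"
proof -
 have l: "length (xs @ x # ys) = n" for x using assms(1) by simp
 have s: "set (xs @ a # ys) \<subseteq> H" "set (xs @ b # ys) \<subseteq> H" using assms by auto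
 show ?thesis
  unfolding Xo_eq[OF l] slot_additiveD[OF Uo_additive assms]
  using U_cycle[OF l s(1)] U_cycle[OF l s(2)] by (simp add: hclass_hom)
qed

lemma defect_eq: "length as = n ==> defect Xo Fo as = sel (Xo as) + U Xo Fo as"
 by (simp add: defect_def Xo_eq)

lemma defect_boundary:
 assumes "length as = n" "set as \<subseteq> H"
 shows "defect Xo Fo as \<in> bds"
proof -
 have "hclass Z (sel (Xo as)) = hclass Z (U Xo Fo as)" using hclass_sel Xo_H[OF assms] Xo_eq[OF assms(1)] by simp
 then show ?thesis
  unfolding defect_eq[OF assms(1)] using hclass_eq_iff sel_cyc[OF Xo_H[OF assms]] U_cycle[OF assms] by simp
qed

lemma mismatch_step:
 assumes "length Ms = n" "set Ms \<subseteq> DC" "mismatch Ms"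
 shows "U Xo Fo Ms = 0" "Xo Ms = zeroH" "Fo Ms = 0"
proof -
 show U0: "U Xo Fo Ms = 0"
 proof (rule U_mismatch[OF assms(2) _ _ _ assms(3)])
  fix a c :: "vec set list" assume "set a \<subseteq> H" "set c \<subseteq> H"
  then show "Fo (a @ zeroH # c) = 0" using slot_additive_zero[OF Fo_additive refl] by blast
 next
  fix bs assume "2 <= length bs" "length bs < length Ms" "set bs \<subseteq> DC" "\<not> mismatch bs"
  then have "graded_at bs" using IH_graded[of bs] assms(1) by fastforce
  then show "Xo bs = zeroH \<or> tightH (thd bs) & Xo bs = gen (thd bs) &
    class_maslov Z (Xo bs) = tmas bs + of_nat (length bs) - 2"
   using \<open>\<not> mismatch bs\<close> by (simp add: graded_at_def)
 next
  fix bs assume "2 <= length bs" "length bs < length Ms" "set bs \<subseteq> DC" "mismatch bs"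
  then have "graded_at bs" using IH_graded[of bs] assms(1) by fastforce
  then show "Xo bs = zeroH" using \<open>mismatch bs\<close> by (simp add: graded_at_def)
 qed (use IH_graded assms(1) in \<open>auto simp: graded_at_def\<close>)
 then show X0: "Xo Ms = zeroH" using Xo_eq[OF assms(1)] zero_homology by simp
 obtain ds where ds: "Ms = map gen ds" "\<forall>d\<in>set ds. tightH d" using assms(2) DC_gens by blast
 have "defect Xo Fo (map gen ds) = 0" using defect_eq[OF assms(1)] U0 X0 sel_zero ds(1) by simp
 moreover have "\<not> tensor_viable Z (map gen ds)" using assms(3) ds(1) by (simp add: tensor_viable_def)
 ultimately show "Fo Ms = 0"
  using Fo_gens[OF ds(2)] n assms(1) unfolding ds(1) by (simp add: filler_def)
qed

lemma graded_step:
 assumes Ms: "length Ms = n" "set Ms \<subseteq> DC" "\<not> mismatch Ms"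
 defines "d \<equiv> thd Ms" and "g \<equiv> tmas Ms + of_nat n - 2" and "b \<equiv> defect Xo Fo Ms"
 shows "U Xo Fo Ms \<in> summand d" "homog g (U Xo Fo Ms)"
  "Xo Ms = zeroH \<or> tightH d & Xo Ms = gen d & class_maslov Z (Xo Ms) = g"
  "Fo Ms \<in> summand d" "homog (g + 1) (Fo Ms)" "vec_diff (Fo Ms) = b" "b = 0 ==> Fo Ms = 0"
  "tensor_viable Z Ms ==> twisted_hdata Z d ==> Fo Ms = creation_op Z CR d b"
proof -
 have H: "set Ms \<subseteq> H" using DC_carrier Ms(2) by blast
 have F_graded: "Fo bs \<in> summand (thd bs) &
   homog (tmas bs + of_nat (length bs) - 1) (Fo bs)"
  if "bs ~= []" "length bs < length Ms" "set bs \<subseteq> DC" "\<not> mismatch bs" for bs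
  using IH_graded[of bs] that Ms(1) by (simp add: graded_at_def)
 have X_graded: "Xo bs = zeroH \<or> tightH (thd bs) & Xo bs = gen (thd bs) &
   class_maslov Z (Xo bs) = tmas bs + of_nat (length bs) - 2"
  if "2 <= length bs" "length bs < length Ms" "set bs \<subseteq> DC" "\<not> mismatch bs" for bs
 proof -
  have "bs ~= []" using that(1) by auto
  then show ?thesis using IH_graded[of bs] that Ms(1) by (simp add: graded_at_def)
 qed
 have F_zero: "Fo (a @ zeroH # c) = 0" if "set a \<subseteq> H" "set c \<subseteq> H" for a c
  using slot_additive_zero[OF Fo_additive refl that] .
 note Ug = U_graded[OF Ms(2) F_graded X_graded F_zero Ms(3)]
 show U: "U Xo Fo Ms \<in> summand d" "homog g (U Xo Fo Ms)"
  using Ug by (simp_all add: d_def g_def Ms(1))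
 have cyc: "vec_diff (U Xo Fo Ms) = 0" using U_cycle[OF Ms(1) H] by blast
 from summand_class[OF U(1) cyc] have X: "Xo Ms = zeroH \<or>
   tightH d & Xo Ms = gen d & class_maslov Z (Xo Ms) = g"
 proof
  assume "U Xo Fo Ms \<notin> bds & tightH d & hclass Z (U Xo Fo Ms) = gen d"
  then show ?thesis using class_maslov_gen(2)[OF _ U(1) cyc _ U(2)] Xo_eq[OF Ms(1)] by simp
 qed (simp add: Xo_eq[OF Ms(1)])
 then show "Xo Ms = zeroH \<or> tightH d & Xo Ms = gen d & class_maslov Z (Xo Ms) = g" .
 from X have s: "sel (Xo Ms) \<in> summand d & homog g (sel (Xo Ms))"
 proof
  assume "Xo Ms = zeroH"
  then show ?thesis by (simp add: sel_zero maslov_homogeneous_def)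
 next
  assume t: "tightH d & Xo Ms = gen d & class_maslov Z (Xo Ms) = g"
  then have "sel (Xo Ms) = cd d" "class_maslov Z (gen d) = g" using sel_gen by auto
  then show ?thesis using t tight_props(2)[OF cd_tight] class_maslov_gen(1)[of d] by simp
 qed
 have b: "b \<in> summand d" "homog g b"
  unfolding b_def defect_eq[OF Ms(1)] using s U alg_summand_add maslov_homogeneous_add by blast+
 have bd: "b \<in> bds" unfolding b_def by (rule defect_boundary[OF Ms(1) H])
 obtain ds where ds: "Ms = map gen ds" "\<forall>d\<in>set ds. tightH d" using Ms(2) DC_gens by blast
 let ?P = "%c. c \<in> summand d & homog (g + 1) c & vec_diff c = b"
 have F: "Fo Ms = (if tensor_viable Z Ms & twisted_hdata Z d then creation_op Z CR d b
   else if b = 0 then 0 else SOME c. ?P c)"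
 proof -
  have e: "tmas Ms + of_nat (length Ms) - 1 = g + 1" by (simp add: g_def Ms(1))
  have "\<not> length ds <= 1" using n Ms(1) ds(1) by simp
  then show ?thesis
   using Fo_gens[OF ds(2)]
   unfolding filler_def Let_def ds(1)[symmetric] e d_def[symmetric] b_def[symmetric] by simp
 qed
 have "?P (Fo Ms) & (b = 0 --> Fo Ms = 0)"
 proof (cases "tensor_viable Z Ms & twisted_hdata Z d")
  case True
  then show ?thesis using F creation(1,2,4)[of d b] creation_op_0[of d] b boundaries_cycle[OF bd] by simp
 next
  case False
  have "?P (SOME c. ?P c)" by (rule someI_ex) (rule homogeneous_filling[OF bd b])
  then show ?thesis using F False by (cases "b = 0") (auto simp: maslov_homogeneous_def)
 qed
 then show "Fo Ms \<in> summand d" "homog (g + 1) (Fo Ms)" "vec_diff (Fo Ms) = b"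
  "b = 0 ==> Fo Ms = 0" by blast+
 show "tensor_viable Z Ms ==> twisted_hdata Z d ==> Fo Ms = creation_op Z CR d b" using F by simp
qed

text \<open>On generators the relation for \<open>Fo\<close> holds by the choice of the filler. The
  difference of its two sides is additive in each slot, so it vanishes everywhere.\<close>

lemma solved_step: "solved n"
proof -
 have gens: "inA (Fo (map gen ds)) & vec_diff (Fo (map gen ds)) = defect Xo Fo (map gen ds)"
  if ds: "length ds = n" "\<forall>d\<in>set ds. tightH d" for ds
 proof (cases "mismatch (map gen ds)")
  case True
  have "set (map gen ds) \<subseteq> DC" "length (map gen ds) = n" using ds by (auto simp: diagram_classes_eq)
  with mismatch_step[OF this(2,1) True] show ?thesis
   by (simp add: defect_eq sel_zero inA_0)
 next
  case False
  have "set (map gen ds) \<subseteq> DC" "length (map gen ds) = n" using ds by (auto simp: diagram_classes_eq)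
  with graded_step(4,6)[OF this(2,1) False] show ?thesis using alg_summand_inA by blast
 qed
 have all: "inA (Fo as) & vec_diff (Fo as) = rel Xo Fo as" if as: "length as = n" "set as \<subseteq> H" for as
 proof
  have "Fo as \<in> {x. inA x}"
   by (rule slot_additive_mem[OF Fo_additive _ _ _ as]) (use gens inA_0 inA_add in auto)
  then show "inA (Fo as)" by simp
  have "slot_additive n (%as. vec_diff (Fo as) + defect Xo Fo as)"
   unfolding slot_additive_def
  proof (intro allI impI)
   fix xs a b ys assume *: "length xs + 1 + length ys = n" "set xs \<subseteq> H" "set ys \<subseteq> H" "a \<in> H" "b \<in> H"
   have l: "length (xs @ x # ys) = n" for x using *(1) by simp
   have "Xo (xs @ a # ys) \<in> H" "Xo (xs @ b # ys) \<in> H" using * by (auto intro!: Xo_H)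
   then show "vec_diff (Fo (xs @ addH a b # ys)) + defect Xo Fo (xs @ addH a b # ys) =
     vec_diff (Fo (xs @ a # ys)) + defect Xo Fo (xs @ a # ys) + (vec_diff (Fo (xs @ b # ys)) + defect Xo Fo (xs @ b # ys))"
    unfolding defect_eq[OF l] slot_additiveD[OF Uo_additive *] slot_additiveD[OF Fo_additive *] Xo_additive[OF *]
    by (simp add: vec_diff_add sel_add algebra_simps)
  qed
  then have "vec_diff (Fo as) + defect Xo Fo as \<in> {0}"
   by (rule slot_additive_mem[OF _ _ _ _ as]) (use gens add_self in auto)
  then have "vec_diff (Fo as) = defect Xo Fo as"
   using add_self[of "defect Xo Fo as"] add_right_cancel[of "vec_diff (Fo as)" "defect Xo Fo as" "defect Xo Fo as"] by simp
  then show "vec_diff (Fo as) = rel Xo Fo as"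
   using rel_U[of as Xo Fo] n as(1) by (simp add: defect_eq Fo_single add.commute)
 qed
 have "graded_at Ms" if "length Ms = n" "set Ms \<subseteq> DC" for Ms
  using mismatch_step[OF that] graded_step(3-5)[OF that] that(1)
  by (cases "mismatch Ms") (auto simp: graded_at_def algebra_simps)
 then show ?thesis
  unfolding solved_def using all Xo_H U_cycle(3) Xo_additive by blast
qed

end

lemma solved: "1 <= n ==> solved n"
proof (induction n rule: less_induct)
 case (less n)
 show ?case
 proof (cases "n = 1")
  case True
  then show ?thesis using solved_1 by simp
 next
  case False
  then have "2 <= n" using less.prems by simp
  then show ?thesis by (rule solved_step) (rule less.IH)
 qed
qed

end

context choices
begin

lemma solved_less: "1 <= k ==> k < n ==> solved k"
 by (rule solved)

lemma Fo_Xo: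
 assumes "as ~= []" "set as \<subseteq> H"
 shows "inA (Fo as)" "vec_diff (Fo as) = rel Xo Fo as" "stasheff Xo as = zeroH" "Xo as \<in> H"
 using solved[of "length as"] assms by (cases as; simp add: solved_def)+

text \<open>The list determines the arity, so the families of operations are constant in
  \<open>n\<close>.\<close>

lemma existence: "choice_structure Z CY CR (%_. Xo) (%_. Fo)"
proof -
 interpret Hr: ring "homology Z" by (rule ring_homology)
 have inA: "inA (Fo bs)" and XH: "Xo bs \<in> H" if "bs ~= []" "set bs \<subseteq> H" for bs
  using Fo_Xo that by blast+
 have X1: "Xo [x] = zeroH" for x by (simp add: Xo_Fo(1))
 have ne: "as ~= []" if "length as = n" "1 <= n" for as :: "vec set list" and n using that by auto
 have mX: "multilinear n (homology Z) (homology Z) Xo" if n: "1 <= n" for n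
  unfolding multilinear_iff
 proof (intro conjI allI impI)
  show "Xo as \<in> H" if "length as = n" "set as \<subseteq> H" for as using XH[OF ne[OF that(1) n] that(2)] .
 next
  fix xs a b ys assume "length xs + 1 + length ys = n" "set xs \<subseteq> H" "set ys \<subseteq> H" "a \<in> H" "b \<in> H"
  then show "Xo (xs @ addH a b # ys) = addH (Xo (xs @ a # ys)) (Xo (xs @ b # ys))"
   using solved[OF n] unfolding solved_def by blast
 qed
 have mF: "multilinear n (homology Z) (strand_alg Z) Fo" if n: "1 <= n" for n
  unfolding multilinear_iff
 proof (intro conjI allI impI)
  show "Fo as \<in> carrier (strand_alg Z)" if "length as = n" "set as \<subseteq> H" for as
   using inA[OF ne[OF that(1) n] that(2)] by (simp add: carrier_strand_alg)
 qed (simp add: slot_additiveD[OF Fo_additive])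
 have U_op: "U_op (strand_alg Z) (%_. Xo) (%_. Fo) n as = U Xo Fo as" if "length as = n" "set as \<subseteq> H" for n as
  by (rule U_op_eq[OF that]) (use inA XH in auto)
 have graded: "graded_at Ms" if "1 <= length Ms" "set Ms \<subseteq> DC" for Ms
  using solved[OF that(1)] that(2) by (simp add: solved_def)
 have Ucyc: "inA (U Xo Fo as)" "vec_diff (U Xo Fo as) = 0" "Xo as = hclass Z (U Xo Fo as)"
  if n: "2 <= n" and as: "length as = n" "set as \<subseteq> H" for n as
  using U_cycle[OF n solved_less as] Xo_eq[OF n solved_less as(1)] by blast+
 have defect: "Fo [Xo as] \<ominus>\<^bsub>strand_alg Z\<^esub> U_op (strand_alg Z) (%_. Xo) (%_. Fo) n as = defect Xo Fo as"
  if n: "2 <= n" and as: "length as = n" "set as \<subseteq> H" for n as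
 proof -
  have "as ~= []" using n as(1) by auto
  then show ?thesis
   unfolding U_op[OF as] using minus_strand_alg[OF inA[of "[Xo as]"] Ucyc(1)[OF that]] XH as(2)
   by (simp add: defect_eq[OF n solved_less as(1)] Fo_single)
 qed
 have "A_inf_algebra (homology Z) (%_. Xo)"
  unfolding A_inf_algebra_def
 proof (intro allI impI conjI)
  fix n :: nat and as assume n: "1 <= n" and as: "length as = n & set as \<subseteq> H"
  then have as: "length as = n" "set as \<subseteq> H" by auto
  have "finsum (homology Z) (%(i, j, k). Xo (insert_op (%_. Xo) i j as)) {(i, j, k). i + j + k = n & 1 <= j} = stasheff Xo as"
   by (rule stasheff_index[OF as]) (use inA XH mX[OF n] X1 in auto)
  then show "finsum (homology Z) (%(i, j, k). Xo (insert_op (%_. Xo) i j as)) {(i, j, k). i + j + k = n & 1 <= j} = zeroH"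
   using Fo_Xo(3)[OF ne[OF as(1) n] as(2)] by simp
 qed (rule mX)
 moreover have "Xo [a, b] = mult (homology Z) a b" if "a \<in> H" "b \<in> H" for a b
 proof -
  have "splits2 [a, b] = {([a], [b])}" by (auto simp: splits2_def append_eq_Cons_conv)
  moreover have "proper_splits3 [a, b] = {}"
   by (auto simp: proper_splits3_def append_eq_Cons_conv)
  ultimately have "U Xo Fo [a, b] = vec_mult (sel a) (sel b)" by (simp add: U_def Fo_single)
  then show ?thesis using hclass_hom(2)[OF sel_cyc sel_cyc, OF that] that by (simp add: Xo_Fo(1) hclass_sel)
 qed
 moreover have "A_inf_morphism (homology Z) (%_. Xo) (strand_alg Z) vec_diff (%_. Fo)"
  unfolding A_inf_morphism_def
 proof (intro allI impI conjI)
  fix n :: nat and as assume n: "1 <= n" and as: "length as = n & set as \<subseteq> H"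
  then have as: "length as = n" "set as \<subseteq> H" by auto
  have 1: "finsum (strand_alg Z) (%i. Fo (take i as) \<otimes>\<^bsub>strand_alg Z\<^esub> Fo (drop i as)) {1..n - 1} =
    (\<Sum>(a, b)\<in>splits2 as. vec_mult (Fo a) (Fo b))"
   by (rule products_index[OF as]) (use inA XH in auto)
  have 2: "finsum (strand_alg Z) (%(i, j, k). Fo (insert_op (%_. Xo) i j as)) {(i, j, k). i + j + k = n & 1 <= j} =
    (\<Sum>(a, b, c)\<in>splits3 as. Fo (a @ Xo b # c))"
   by (rule insertions_index[OF as]) (use inA XH Fo_additive X1 in auto)
  show "finsum (strand_alg Z) (%(i, j, k). Fo (insert_op (%_. Xo) i j as)) {(i, j, k). i + j + k = n & 1 <= j} =
    vec_diff (Fo as) \<oplus>\<^bsub>strand_alg Z\<^esub>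
     finsum (strand_alg Z) (%i. Fo (take i as) \<otimes>\<^bsub>strand_alg Z\<^esub> Fo (drop i as)) {1..n - 1}"
   unfolding 1 2 Fo_Xo(2)[OF ne[OF as(1) n] as(2)] rel_def
   using add_self[of "\<Sum>(a, b)\<in>splits2 as. vec_mult (Fo a) (Fo b)"] by (simp add: algebra_simps)
 qed (rule mF)
 moreover have "cycle_selection_map Z CY (%a. Fo [a])"
  unfolding cycle_selection_map_def Fo_single
  using sel_cyc sel_add by (auto simp: carrier_strand_alg hom_generator_eq sel_gen cd_def)
 moreover have "vanishing_condition Z (%_. Xo) (%_. Fo)"
  unfolding vanishing_condition_def
 proof (intro allI impI)
  fix n :: nat and Ms assume n: "1 <= n" and Ms: "length Ms = n & set Ms \<subseteq> DC"
  then have g: "graded_at Ms" using graded by simp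
  show "(\<not> tensor_viable Z Ms --> Fo Ms \<in> ideal_F Z & Xo Ms = zeroH) &
    (mismatch Ms --> Fo Ms = zero (strand_alg Z))"
  proof (cases "mismatch Ms")
   case False
   \<comment> \<open>A non-viable summand lies in F, and tight data are viable, so no generator is
     possible as a value of \<open>Xo\<close>.\<close>
   have "Fo Ms \<in> ideal_F Z & Xo Ms = zeroH" if nv: "\<not> viable Z (tensor_h Z Ms)"
    using g False nonviable_in_F[OF nv] tight_data_viable nv by (auto simp: graded_at_def tensor_hdata_def)
   then show ?thesis using False by (auto simp: tensor_viable_def)
  qed (use g in \<open>simp add: graded_at_def\<close>)
 qed
 moreover have "grading_condition Z (%_. Xo) (%_. Fo)"
  unfolding grading_condition_def
 proof (intro allI impI)
  fix n :: nat and Ms assume n: "1 <= n" and Ms: "length Ms = n & set Ms \<subseteq> DC"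
  then have g: "graded_at Ms" using graded by simp
  let ?d = "thd Ms" and ?g = "tmas Ms + of_nat n - 2"
  have X: "\<exists>x. x \<in> summand ?d & vec_diff x = 0 & homog ?g x & Xo Ms = hclass Z x"
  proof (cases "Xo Ms = zeroH")
   case True
   then show ?thesis by (intro exI[of _ 0]) (simp add: maslov_homogeneous_def zero_homology)
  next
   case False
   then have t: "tightH ?d" "Xo Ms = gen ?d" "class_maslov Z (gen ?d) = ?g"
    using g Ms by (auto simp: graded_at_def split: if_splits)
   show ?thesis
    using tight_props[OF cd_tight[OF t(1)]] class_maslov_gen(1)[OF t(1)] t
    by (intro exI[of _ "cd ?d"]) (simp add: gen_def)
  qed
  then obtain x where x: "x \<in> summand ?d" "vec_diff x = 0" "homog ?g x" "Xo Ms = hclass Z x"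
   by blast
  have "Xo Ms \<in> hom_summand Z ?d" using x by (simp add: hom_summand_def)
  moreover have "maslov_homogeneous_class Z ?g (Xo Ms)"
   unfolding maslov_homogeneous_class_def using x alg_summand_inA[OF x(1)] by (auto simp: carrier_cycle_ring)
  moreover have "Fo Ms \<in> summand ?d & homog (tmas Ms + of_nat n - 1) (Fo Ms)"
   using g Ms by (auto simp: graded_at_def maslov_homogeneous_def split: if_splits)
  ultimately show "Xo Ms \<in> hom_summand Z ?d & Fo Ms \<in> summand ?d &
    maslov_homogeneous_class Z ?g (Xo Ms) & homog (tmas Ms + of_nat n - 1) (Fo Ms)"
   by blast
 qed
 moreover have "balanced_condition Z (%_. Xo) (%_. Fo)"
  unfolding balanced_condition_def
 proof (intro allI impI)
  fix n :: nat and Ms assume n: "2 <= n" and "length Ms = n & set Ms \<subseteq> DC"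
   and z: "Fo [Xo Ms] \<ominus>\<^bsub>strand_alg Z\<^esub> U_op (strand_alg Z) (%_. Xo) (%_. Fo) n Ms = zero (strand_alg Z)"
  then have Ms: "length Ms = n" "set Ms \<subseteq> DC" by auto
  have "defect Xo Fo Ms = 0" using z defect[OF n Ms(1) DC_carrier[OF Ms(2)]] by simp
  then show "Fo Ms = zero (strand_alg Z)"
   using mismatch_step(3)[OF n solved_less Ms] graded_step(7)[OF n solved_less Ms] by auto
 qed
 moreover have "creation_condition Z CR (%_. Xo) (%_. Fo)"
  unfolding creation_condition_def
 proof (intro allI impI conjI)
  fix n :: nat and Ms assume n: "2 <= n" and "length Ms = n & set Ms \<subseteq> DC"
   and v: "tensor_viable Z Ms" "twisted_hdata Z (thd Ms)"
  then have Ms: "length Ms = n" "set Ms \<subseteq> DC" "\<not> mismatch Ms" by (auto simp: tensor_viable_def)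
  show "Fo Ms = creation_op Z CR (thd Ms)
    (Fo [Xo Ms] \<ominus>\<^bsub>strand_alg Z\<^esub> U_op (strand_alg Z) (%_. Xo) (%_. Fo) n Ms)"
   unfolding defect[OF n Ms(1) DC_carrier[OF Ms(2)]] by (rule graded_step(8)[OF n solved_less Ms v])
 next
  fix n :: nat and as assume n: "2 <= n" and "length as = n & set as \<subseteq> H"
  then have as: "length as = n" "set as \<subseteq> H" by auto
  show "U_op (strand_alg Z) (%_. Xo) (%_. Fo) n as \<in> carrier (cycle_ring Z)"
   "Xo as = hclass Z (U_op (strand_alg Z) (%_. Xo) (%_. Fo) n as)"
   unfolding U_op[OF as] using Ucyc[OF n as] by (simp_all add: carrier_cycle_ring)
 qed
 ultimately show ?thesis unfolding choice_structure_def using X1 by simp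
qed

section \<open>Uniqueness\<close>

context
 fixes X :: "nat => vec set list => vec set" and f :: "nat => vec set list => vec"
 assumes str: "choice_structure Z CY CR X f"
begin

lemma structureD:
 "A_inf_algebra (homology Z) X" "x \<in> H ==> X 1 [x] = zeroH"
 "A_inf_morphism (homology Z) X (strand_alg Z) vec_diff f"
 "cycle_selection_map Z CY (%a. f 1 [a])" "vanishing_condition Z X f" "grading_condition Z X f"
 "balanced_condition Z X f" "creation_condition Z CR X f"
 using str by (simp_all add: choice_structure_def)

lemma structure_multilinear:
 assumes "1 <= n"
 shows "multilinear n (homology Z) (homology Z) (X n)" "multilinear n (homology Z) (strand_alg Z) (f n)"
 using structureD(1,3) assms unfolding A_inf_algebra_def A_inf_morphism_def by blast+

lemma structure_closed:
 assumes "as ~= []" "set as \<subseteq> H"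
 shows "inA (f\<sharp> as)" "X\<sharp> as \<in> H"
proof -
 have "1 <= length as" using assms(1) by (cases as) auto
 from structure_multilinear[OF this] show "inA (f\<sharp> as)" "X\<sharp> as \<in> H"
  using assms(2) by (auto simp: multilinear_iff carrier_strand_alg)
qed

lemma structure_additive: "1 <= n ==> slot_additive n f\<sharp>"
proof -
 assume "1 <= n"
 from structure_multilinear(2)[OF this] show ?thesis
  unfolding multilinear_iff slot_additive_def by simp
qed

lemma structure_U_op: "length as = n ==> set as \<subseteq> H ==> U_op (strand_alg Z) X f n as = U X\<sharp> f\<sharp> as"
 by (rule U_op_eq) (use structure_closed in auto)

lemma structure_U_additive: "2 <= n ==> slot_additive n (U X\<sharp> f\<sharp>)"
proof (rule slot_additive_U)
 fix bs assume "2 <= length bs" "set bs \<subseteq> H"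
 then show "X\<sharp> bs \<in> H" by (intro structure_closed) auto
next
 fix xs a b ys assume *: "set xs \<subseteq> H" "set ys \<subseteq> H" "a \<in> H" "b \<in> H"
 have "1 <= length xs + 1 + length ys" by simp
 from structure_multilinear(1)[OF this, unfolded multilinear_iff, THEN conjunct2, rule_format, OF refl *]
 show "X\<sharp> (xs @ addH a b # ys) = addH (X\<sharp> (xs @ a # ys)) (X\<sharp> (xs @ b # ys))" by simp
qed (use structure_additive in auto)

lemma structure_f1: "a \<in> H ==> f 1 [a] = sel a"
proof -
 assume a: "a \<in> H"
 have "f 1 [a] = (\<Sum>d\<in>supp a. f 1 [gen d])"
  using structureD(4) by (intro additive_expand[of "%a. f 1 [a]"] a) (auto simp: cycle_selection_map_def)
 also have "... = sel a"
  unfolding sel_def using structureD(4) supp_tight[OF a]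
  by (intro sum.cong refl) (auto simp: cycle_selection_map_def hom_generator_eq cd_def)
 finally show ?thesis .
qed

lemma structure_U:
 assumes "2 <= n" "length as = n" "set as \<subseteq> H"
 shows "cyc (U X\<sharp> f\<sharp> as)" "X n as = hclass Z (U X\<sharp> f\<sharp> as)"
proof -
 have "U_op (strand_alg Z) X f n as \<in> carrier (cycle_ring Z) & X n as = hclass Z (U_op (strand_alg Z) X f n as)"
  using structureD(8) assms unfolding creation_condition_def by blast
 then show "cyc (U X\<sharp> f\<sharp> as)" "X n as = hclass Z (U X\<sharp> f\<sharp> as)"
  unfolding structure_U_op[OF assms(2,3)] by (simp_all add: carrier_cycle_ring)
qed

lemma structure_rel:
 assumes "2 <= n" "length as = n" "set as \<subseteq> H"
 shows "vec_diff (f n as) = sel (X n as) + U X\<sharp> f\<sharp> as"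
  "f 1 [X n as] \<ominus>\<^bsub>strand_alg Z\<^esub> U_op (strand_alg Z) X f n as = sel (X n as) + U X\<sharp> f\<sharp> as"
proof -
 let ?S = "\<Sum>(a, b)\<in>splits2 as. vec_mult (f\<sharp> a) (f\<sharp> b)"
 have n: "1 <= n" "as ~= []" using assms by auto
 have XH: "X n as \<in> H" using structure_closed(2)[OF n(2) assms(3)] assms(2) by simp
 have 1: "finsum (strand_alg Z) (%i. f i (take i as) \<otimes>\<^bsub>strand_alg Z\<^esub> f (n - i) (drop i as)) {1..n - 1} = ?S"
  by (rule products_index[OF assms(2,3)]) (use structure_closed in auto)
 have 2: "finsum (strand_alg Z) (%(i, j, k). f (i + 1 + k) (insert_op X i j as)) {(i, j, k). i + j + k = n & 1 <= j} =
   (\<Sum>(a, b, c)\<in>splits3 as. f\<sharp> (a @ X\<sharp> b # c))"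
  by (rule insertions_index[OF assms(2,3)]) (use structure_closed structure_additive[OF n(1)] structureD(2) in auto)
 have "(\<Sum>(a, b, c)\<in>splits3 as. f\<sharp> (a @ X\<sharp> b # c)) = vec_diff (f n as) + ?S"
  using structureD(3) n(1) assms(2,3) unfolding A_inf_morphism_def 1[symmetric] 2[symmetric] by simp
 then have "vec_diff (f n as) = rel X\<sharp> f\<sharp> as"
  unfolding rel_def using add_self[of ?S] by (simp add: algebra_simps)
 also have "... = U X\<sharp> f\<sharp> as + f 1 [X n as]"
  using rel_U[of as "X\<sharp>" "f\<sharp>"] assms(1,2) by simp
 finally show "vec_diff (f n as) = sel (X n as) + U X\<sharp> f\<sharp> as"
  using structure_f1[OF XH] by (simp add: add.commute)
 show "f 1 [X n as] \<ominus>\<^bsub>strand_alg Z\<^esub> U_op (strand_alg Z) X f n as = sel (X n as) + U X\<sharp> f\<sharp> as"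
  unfolding structure_U_op[OF assms(2,3)] structure_f1[OF XH]
  using minus_strand_alg sel_cyc[OF XH] structure_U(1)[OF assms] by simp
qed

lemma structure_graded:
 assumes "Ms ~= []" "set Ms \<subseteq> DC"
 defines "d \<equiv> thd Ms"
 shows "f\<sharp> Ms \<in> summand d" "homog (tmas Ms + of_nat (length Ms) - 1) (f\<sharp> Ms)"
  "X\<sharp> Ms = zeroH \<or> tightH d & X\<sharp> Ms = gen d &
   class_maslov Z (X\<sharp> Ms) = tmas Ms + of_nat (length Ms) - 2"
proof -
 have l: "1 <= length Ms" using assms(1) by (cases Ms) auto
 have gr: "X\<sharp> Ms \<in> hom_summand Z d" "f\<sharp> Ms \<in> summand d"
  "maslov_homogeneous_class Z (tmas Ms + of_nat (length Ms) - 2) (X\<sharp> Ms)"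
  "homog (tmas Ms + of_nat (length Ms) - 1) (f\<sharp> Ms)"
  using structureD(6) l assms(2) unfolding grading_condition_def d_def by blast+
 show "f\<sharp> Ms \<in> summand d" "homog (tmas Ms + of_nat (length Ms) - 1) (f\<sharp> Ms)"
  by fact+
 obtain x where x: "x \<in> summand d" "vec_diff x = 0" "X\<sharp> Ms = hclass Z x"
  using gr(1) by (auto simp: hom_summand_def)
 from summand_class[OF x(1,2)] show "X\<sharp> Ms = zeroH \<or> tightH d & X\<sharp> Ms = gen d &
   class_maslov Z (X\<sharp> Ms) = tmas Ms + of_nat (length Ms) - 2"
 proof
  assume t: "x \<notin> bds & tightH d & hclass Z x = gen d"
  then have td: "tightH d" by blast
  obtain y where y: "cyc y" "homog (tmas Ms + of_nat (length Ms) - 2) y" "X\<sharp> Ms = hclass Z y"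
   using gr(3) by (auto simp: maslov_homogeneous_class_def carrier_cycle_ring)
  note c = tight_props[OF cd_tight[OF td]]
  \<comment> \<open>The homogeneous representative \<open>y\<close> need not lie in the summand, but
    it is homologous to \<open>cd d\<close>, which forces the degrees to agree.\<close>
  have "hclass Z (cd d) = hclass Z y" using y(3) x(3) t by (simp add: gen_def)
  then have "cd d + y \<in> bds" using hclass_eq_iff[of "cd d" y] c y(1) by simp
  from homogeneous_cycles_same_degree[OF c(3) class_maslov_gen(1)[OF td] c(5) _ y(2) this]
  show ?thesis using t x(3) y(1) by simp
 qed (simp add: x(3))
qed

lemma structure_U_summand:
 assumes "2 <= length Ms" "set Ms \<subseteq> DC" "\<not> mismatch Ms"
 shows "U X\<sharp> f\<sharp> Ms \<in> summand (thd Ms)"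
proof (rule U_graded(1)[OF assms(2) _ _ _ assms(3)])
 fix bs assume "2 <= length bs" "set bs \<subseteq> DC"
 then show "X\<sharp> bs = zeroH \<or> tightH (thd bs) & X\<sharp> bs = gen (thd bs) &
   class_maslov Z (X\<sharp> bs) = tmas bs + of_nat (length bs) - 2"
  by (intro structure_graded(3)) auto
next
 fix a c :: "vec set list" assume "set a \<subseteq> H" "set c \<subseteq> H"
 then show "f\<sharp> (a @ zeroH # c) = 0"
  using slot_additive_zero[OF structure_additive refl] by simp
qed (use structure_graded in auto)

lemma structure_tight_in_F:
 assumes "2 <= length Ms" "set Ms \<subseteq> DC" "tightH (thd Ms)"
 shows "f\<sharp> Ms \<in> ideal_F Z"
proof (rule ccontr)
 assume nF: "f\<sharp> Ms \<notin> ideal_F Z"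
 have "Ms ~= []" using assms(1) by auto
 note r = structure_rel[OF assms(1) refl DC_carrier[OF assms(2)]]
 have "vec_diff (f\<sharp> Ms) = 0"
  by (rule tight_outside_F[OF assms(3) structure_graded(1,2)[OF \<open>Ms ~= []\<close> assms(2)] nF])
 \<comment> \<open>By \<open>structure_rel\<close> the vanishing differential of f_n is f_1 X_n -
   U_n, so the balanced condition applies.\<close>
 then have "f\<sharp> Ms = 0"
  using structureD(7) assms(1,2) r unfolding balanced_condition_def by simp
 then show False using nF by simp
qed

end

text \<open>The induction carries equality of X but only congruence modulo F of f, which suffices
  because F is an ideal.\<close>

lemma uniqueness:
 assumes S: "choice_structure Z CY CR X f" and S': "choice_structure Z CY CR X' f'"
  and "1 <= n" "length as = n" "set as \<subseteq> H"
 shows "X n as = X' n as & f n as + f' n as \<in> ideal_F Z"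
 using assms(3-5)
proof (induction n arbitrary: as rule: less_induct)
 case (less n)
 show ?case
 proof (cases "n = 1")
  case True
  then obtain a where a: "as = [a]" "a \<in> H" using less.prems by (cases as) auto
  then show ?thesis
   using True structureD(2)[OF S a(2)] structureD(2)[OF S' a(2)] structure_f1[OF S a(2)] structure_f1[OF S' a(2)]
   by (simp add: add_self)
 next
  case False
  then have n: "2 <= n" using less.prems by simp
  let ?U = "U X\<sharp> f\<sharp>" and ?U' = "U X'\<sharp> f'\<sharp>"
  have IH: "X\<sharp> bs = X'\<sharp> bs" "f\<sharp> bs + f'\<sharp> bs \<in> ideal_F Z" if "bs ~= []" "length bs < n" "set bs \<subseteq> H" for bs
   using less.IH[of "length bs" bs] that by (cases bs; simp)+
  have UF: "?U as + ?U' as \<in> ideal_F Z" if as: "length as = n" "set as \<subseteq> H" for as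
  proof -
   have Fsum: "sum g S \<in> ideal_F Z" if "!!i. i \<in> S ==> g i \<in> ideal_F Z" for S and g :: "'i => vec"
    using that by (induction S rule: infinite_finite_induct) (auto intro: ideal_F_add)
   have 1: "vec_mult (f\<sharp> a) (f\<sharp> b) + vec_mult (f'\<sharp> a) (f'\<sharp> b) \<in> ideal_F Z" if "(a, b) \<in> splits2 as" for a b
   proof -
    have ab: "a @ b = as" "a ~= []" "b ~= []" using that by (auto simp: splits2_def)
    then have l: "length a < n" "length b < n" "set a \<subseteq> H" "set b \<subseteq> H" using as by auto
    note i = structure_closed(1)[OF S] structure_closed(1)[OF S']
    \<comment> \<open>Telescoping: the mixed product is added twice.\<close>
    have "vec_mult (f\<sharp> a) (f\<sharp> b) + vec_mult (f'\<sharp> a) (f'\<sharp> b) =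
      vec_mult (f\<sharp> a + f'\<sharp> a) (f\<sharp> b) + vec_mult (f'\<sharp> a) (f\<sharp> b + f'\<sharp> b)"
     using add_self[of "vec_mult (f'\<sharp> a) (f\<sharp> b)"]
     by (simp add: vec_mult_add_left vec_mult_add_right algebra_simps)
    moreover have "vec_mult (f\<sharp> a + f'\<sharp> a) (f\<sharp> b) \<in> ideal_F Z"
     using ideal_F_mult[OF inA_add[OF i(1)[OF ab(2) l(3)] i(2)[OF ab(2) l(3)]] i(1)[OF ab(3) l(4)]]
      IH(2)[OF ab(2) l(1,3)] by simp
    moreover have "vec_mult (f'\<sharp> a) (f\<sharp> b + f'\<sharp> b) \<in> ideal_F Z"
     using ideal_F_mult[OF i(2)[OF ab(2) l(3)] inA_add[OF i(1)[OF ab(3) l(4)] i(2)[OF ab(3) l(4)]]]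
      IH(2)[OF ab(3) l(2,4)] by simp
    ultimately show ?thesis using ideal_F_add by simp
   qed
   have 2: "f\<sharp> (a @ X\<sharp> b # c) + f'\<sharp> (a @ X'\<sharp> b # c) \<in> ideal_F Z" if "(a, b, c) \<in> proper_splits3 as" for a b c
   proof -
    have abc: "as = a @ b @ c" "2 <= length b" "a ~= [] \<or> c ~= []" using that by (auto simp: proper_splits3_def)
    then have l: "b ~= []" "length b < n" "length (a @ X\<sharp> b # c) < n" using as(1) by auto
    have s: "set a \<subseteq> H" "set b \<subseteq> H" "set c \<subseteq> H" using as(2) abc(1) by auto
    have "set (a @ X\<sharp> b # c) \<subseteq> H" using s structure_closed(2)[OF S l(1) s(2)] by simp
    then show ?thesis using IH(2)[OF _ l(3)] IH(1)[OF l(1,2) s(2)] by simp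
   qed
   have "?U as + ?U' as = (\<Sum>w\<in>splits2 as. vec_mult (f\<sharp> (fst w)) (f\<sharp> (snd w)) + vec_mult (f'\<sharp> (fst w)) (f'\<sharp> (snd w))) +
     (\<Sum>w\<in>proper_splits3 as. f\<sharp> (fst w @ X\<sharp> (fst (snd w)) # snd (snd w)) + f'\<sharp> (fst w @ X'\<sharp> (fst (snd w)) # snd (snd w)))"
    unfolding U_def split_def sum.distrib by (simp only: add.assoc add.left_commute add.commute)
   also have "... \<in> ideal_F Z"
   proof (rule ideal_F_add; rule Fsum)
    fix w assume "w \<in> splits2 as"
    then show "vec_mult (f\<sharp> (fst w)) (f\<sharp> (snd w)) + vec_mult (f'\<sharp> (fst w)) (f'\<sharp> (snd w)) \<in> ideal_F Z"
     using 1[of "fst w" "snd w"] by simp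
   next
    fix w assume "w \<in> proper_splits3 as"
    then show "f\<sharp> (fst w @ X\<sharp> (fst (snd w)) # snd (snd w)) + f'\<sharp> (fst w @ X'\<sharp> (fst (snd w)) # snd (snd w)) \<in> ideal_F Z"
     using 2[of "fst w" "fst (snd w)" "snd (snd w)"] by simp
   qed
   finally show ?thesis .
  qed
  have main: "?U Ms + ?U' Ms \<in> bds & f\<sharp> Ms + f'\<sharp> Ms \<in> ideal_F Z"
   if Ms: "length Ms = n" "set Ms \<subseteq> DC" for Ms
  proof -
   let ?d = "thd Ms"
   have H: "set Ms \<subseteq> H" "Ms ~= []" "2 <= length Ms" using DC_carrier Ms n by auto
   note u = structure_U[OF S n Ms(1) H(1)] structure_U[OF S' n Ms(1) H(1)]
   have XX: "X n Ms = X' n Ms \<longleftrightarrow> ?U Ms + ?U' Ms \<in> bds"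
    unfolding u(2,4) by (rule hclass_eq_iff[OF u(1,3)])
   show ?thesis
   proof (cases "tensor_viable Z Ms")
    case False
    then have "X n Ms = X' n Ms" "f\<sharp> Ms \<in> ideal_F Z" "f'\<sharp> Ms \<in> ideal_F Z"
     using structureD(5)[OF S] structureD(5)[OF S'] Ms n unfolding vanishing_condition_def by auto
    then show ?thesis using XX ideal_F_add by blast
   next
    case True
    then have nm: "\<not> mismatch Ms" and v: "viable Z (fst ?d)"
     by (auto simp: tensor_viable_def tensor_hdata_def)
    note us = structure_U_summand[OF S H(3) Ms(2) nm] structure_U_summand[OF S' H(3) Ms(2) nm]
    have w: "?U Ms + ?U' Ms \<in> summand ?d" "vec_diff (?U Ms + ?U' Ms) = 0"
     using alg_summand_add[OF us] u(1,3) by (simp_all add: vec_diff_add)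
    have bd: "?U Ms + ?U' Ms \<in> bds" by (rule F_cycle_boundary[OF w UF[OF Ms(1) H(1)]])
    then have X: "X n Ms = X' n Ms" using XX by simp
    note g = structure_graded[OF S H(2) Ms(2)] structure_graded[OF S' H(2) Ms(2)]
    consider "twisted_hdata Z ?d" | "tightH ?d" | "\<not> tightH ?d" "\<not> twisted_hdata Z ?d" by blast
    then have "f\<sharp> Ms + f'\<sharp> Ms \<in> ideal_F Z"
    proof cases
     case 1
     \<comment> \<open>Twisted data are not tight, so X is zero on these factors.\<close>
     have s: "sel (X n Ms) \<in> summand ?d"
      using g(3) Ms(1) 1 twisted_not_tight by (auto simp: sel_zero)
     let ?b = "sel (X n Ms) + ?U Ms" and ?b' = "sel (X n Ms) + ?U' Ms"
     have "f n Ms = creation_op Z CR ?d (f 1 [X n Ms] \<ominus>\<^bsub>strand_alg Z\<^esub> U_op (strand_alg Z) X f n Ms)"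
      "f' n Ms = creation_op Z CR ?d (f' 1 [X' n Ms] \<ominus>\<^bsub>strand_alg Z\<^esub> U_op (strand_alg Z) X' f' n Ms)"
      using structureD(8)[OF S] structureD(8)[OF S'] n Ms True 1 unfolding creation_condition_def by blast+
     then have "f n Ms = creation_op Z CR ?d ?b" "f' n Ms = creation_op Z CR ?d ?b'"
      unfolding structure_rel(2)[OF S n Ms(1) H(1)] structure_rel(2)[OF S' n Ms(1) H(1)] unfolding X .
     \<comment> \<open>The creation operator is additive on the summand and preserves F, so it
       passes the congruence of the two U on to f_n.\<close>
     moreover have "creation_op Z CR ?d ?b + creation_op Z CR ?d ?b' = creation_op Z CR ?d (?b + ?b')"
      using creation(3)[OF 1 alg_summand_add[OF s us(1)] alg_summand_add[OF s us(2)]] by simp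
     moreover have "?b + ?b' = ?U Ms + ?U' Ms"
      using add_self[of "sel (X n Ms)"] by (simp add: algebra_simps)
     ultimately have "f n Ms + f' n Ms = creation_op Z CR ?d (?U Ms + ?U' Ms)" by simp
     then show ?thesis using creation(5)[OF 1 w(1) UF[OF Ms(1) H(1)]] Ms(1) by simp
    next
     case 2
     then show ?thesis
      using structure_tight_in_F[OF S H(3) Ms(2)] structure_tight_in_F[OF S' H(3) Ms(2)] ideal_F_add by blast
    next
     case 3
     then have "f\<sharp> Ms = 0" "f'\<sharp> Ms = 0" using viable_trichotomy[OF v 3] g by blast+
     then show ?thesis by simp
    qed
    then show ?thesis using bd by blast
   qed
  qed
  have gens: "?U (map gen ds) + ?U' (map gen ds) \<in> bds & f\<sharp> (map gen ds) + f'\<sharp> (map gen ds) \<in> ideal_F Z"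
   if "length ds = n" "\<forall>d\<in>set ds. tightH d" for ds
   using that by (intro main) (auto simp: diagram_classes_eq)
  have sum_additive: "slot_additive n (%as. F as + G as)" if "slot_additive n F" "slot_additive n G" for F G
   using that unfolding slot_additive_def by (simp add: algebra_simps)
  have "f\<sharp> as + f'\<sharp> as \<in> ideal_F Z"
   by (rule slot_additive_mem[OF sum_additive[OF structure_additive[OF S less.prems(1)] structure_additive[OF S' less.prems(1)]]
     _ _ _ less.prems(2,3)]) (use gens ideal_F_add in auto)
  \<comment> \<open>Equality of X is stated as a sum being a boundary, so that it extends additively
    from generators.\<close>
  moreover have "?U as + ?U' as \<in> bds"
   by (rule slot_additive_mem[OF sum_additive[OF structure_U_additive[OF S n] structure_U_additive[OF S' n]]
     _ _ _ less.prems(2,3)]) (use gens boundaries_add in auto)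
  ultimately show ?thesis
   using structure_U[OF S n less.prems(2,3)] structure_U[OF S' n less.prems(2,3)] hclass_eq_iff less.prems(2) by simp
 qed
qed

end

theorem theorem5p2:
  fixes Z :: arc_data and CY :: "hdata \<Rightarrow> nat \<Rightarrow> point" and CR :: "hdata \<Rightarrow> nat"
  assumes "arc_diagram Z" and "cycle_choice Z CY" and "creation_choice Z CR"
  shows "(\<exists>X f. choice_structure Z CY CR X f) \<and>
    (\<forall>X f X' f'. choice_structure Z CY CR X f \<and> choice_structure Z CY CR X' f' \<longrightarrow>
      (\<forall>n\<ge>1. \<forall>as. length as = n \<and> set as \<subseteq> carrier (homology Z) \<longrightarrow>
        X n as = X' n as \<and> f n as \<ominus>\<^bsub>strand_alg Z\<^esub> f' n as \<in> ideal_F Z))"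
proof -
  interpret choices Z CY CR
    using assms by (simp add: choices_def choices_axioms_def arc_def)
  show ?thesis
  proof (intro conjI allI impI, goal_cases)
    case 1
    show ?case using existence by blast
  next
    case (2 X f X' f' n as)
    then show ?case using uniqueness by blast
  next
    case (3 X f X' f' n as)
    then have S: "choice_structure Z CY CR X f" "choice_structure Z CY CR X' f'" and
      as: "as \<noteq> []" "set as \<subseteq> carrier (homology Z)" by auto
    have "inA (f n as)" "inA (f' n as)"
      using structure_closed(1)[OF S(1) as] structure_closed(1)[OF S(2) as] 3 by auto
    then show ?case using uniqueness[OF S] 3 minus_strand_alg by simp
  qed
qed

end
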